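(* Let $X=G\backslash\tilde X$ be a regular quotient of a Hadamard space $\tilde X$. Let $\alpha,\beta$ be rays in $X$ with the same origin $o$, with lifts $\tilde\alpha,\tilde\beta$ to $\tilde X$ having the same origin $\tilde o\in\tilde X$, and let $H_{\tilde\alpha}$, $H_{\tilde\beta}$ be the horoballs through $\tilde o$ centered at the points at infinity $\tilde\alpha^+$, $\tilde\beta^+$ respectively. Then $B_\alpha=B_\beta$ if and only if there exist sequences $(g_n),(h_n)$ in $G$ such that $$ g_n\tilde\alpha^+\to\tilde\beta^+,\qquad d(g_n^{-1}\tilde o,H_{\tilde\alpha})\to 0,$$ and $$ h_n\tilde\beta^+\to\tilde\alpha^+,\qquad d(h_n^{-1}\tilde o,H_{\tilde\beta})\to 0 .$$
   Context: A Hadamard space is a complete simply connected Riemannian manifold $\tilde X$ of nonpositive sectional curvature; a regular quotient $X=G\backslash\tilde X$ is its quotient by a discrete, torsion-free group $G$ of isometries. A ray in a complete Riemannian manifold $M$ is a half-geodesic $\alpha:[0,\infty)\to M$ parametrized by arc-length with $d(\alpha(t),\alpha(s))=|t-s|$ for all $s,t\geq 0$; its Busemann function is $B_\alpha(x,y)=\lim_{t\to\infty}\big(d(x,\alpha(t))-d(\alpha(t),y)\big)$, $x,y\in M$. For a ray $\tilde\alpha$ of the Hadamard space $\tilde X$, $\tilde\alpha^+$ denotes its point at infinity in the boundary $\partial\tilde X$ (the visual boundary, which coincides with the horofunction boundary, a point $\xi=\tilde\alpha^+$ being identified with the function $B_\xi=B_{\tilde\alpha}$); isometries of $\tilde X$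 act on $\partial\tilde X$ by homeomorphisms. The horoball centered at $\xi\in\partial\tilde X$ passing through $\tilde x$ is $\{\tilde y\in\tilde X : B_\xi(\tilde x,\tilde y)\ge 0\}$. *)

theory Defs
  imports "HOL-Analysis.Analysis"
begin

section \<open>Smooth manifolds and Riemannian metrics in local coordinates\<close>

text \<open>\<open>k\<close> times continuous differentiability; it is only used on open sets \<open>S\<close>.
  In finite dimension, continuity of each \<open>\<lambda>x. f' x v\<close> is continuity of the differential.\<close>

primrec Ck_on :: "nat \<Rightarrow> ('e::euclidean_space \<Rightarrow> 'f::real_normed_vector) \<Rightarrow> 'e set \<Rightarrow> bool" where
  "Ck_on 0 = (\<lambda>f S. continuous_on S f)"
| "Ck_on (Suc k) = (\<lambda>f S. \<exists>f'. (\<forall>x\<in>S. (f has_derivative f' x) (at x)) \<and>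
                              (\<forall>v. Ck_on k (\<lambda>x. f' x v) S))"

definition smooth_on :: "('e::euclidean_space \<Rightarrow> 'f::real_normed_vector) \<Rightarrow> 'e set \<Rightarrow> bool" where
  "smooth_on f S \<longleftrightarrow> (\<forall>k. Ck_on k f S)"

text \<open>A chart is a domain with a coordinate map; the map is only relevant on the domain.\<close>

type_synonym ('a, 'e) chart = "'a set \<times> ('a \<Rightarrow> 'e)"

abbreviation chart_dom :: "('a, 'e) chart \<Rightarrow> 'a set" where
  "chart_dom c \<equiv> fst c"

abbreviation chart_coord :: "('a, 'e) chart \<Rightarrow> 'a \<Rightarrow> 'e" where
  "chart_coord c \<equiv> snd c"

definition chart_inv :: "('a, 'e) chart \<Rightarrow> 'e \<Rightarrow> 'a" where
  "chart_inv c = inv_into (chart_dom c) (chart_coord c)"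

definition chart_img :: "('a, 'e) chart \<Rightarrow> 'e set" where
  "chart_img c = chart_coord c ` chart_dom c"

definition transition :: "('a, 'e) chart \<Rightarrow> ('a, 'e) chart \<Rightarrow> 'e \<Rightarrow> 'e" where
  "transition c c' = chart_coord c' \<circ> chart_inv c"

locale smooth_atlas =
  fixes A :: "('a::metric_space, 'e::euclidean_space) chart set"
  assumes chart_dom_open: "c \<in> A \<Longrightarrow> open (chart_dom c)"
    and chart_img_open: "c \<in> A \<Longrightarrow> open (chart_img c)"
    and chart_homeo: "c \<in> A \<Longrightarrow>
      homeomorphism (chart_dom c) (chart_img c) (chart_coord c) (chart_inv c)"
    and charts_cover: "(\<Union>c\<in>A. chart_dom c) = UNIV"
    and transition_smooth: "c \<in> A \<Longrightarrow> c' \<in> A \<Longrightarrow>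
      smooth_on (transition c c') (chart_coord c ` (chart_dom c \<inter> chart_dom c'))"

text \<open>\<open>g c x v w\<close> is the value of the metric tensor at the point with coordinates \<open>x\<close> in the
  chart \<open>c\<close>, on the tangent vectors with components \<open>v\<close>, \<open>w\<close>; \<open>metric_tensor\<close> is the
  transformation rule of a covariant 2-tensor.\<close>

locale riemannian_metric = smooth_atlas A
  for A :: "('a::metric_space, 'e::euclidean_space) chart set" +
  fixes g :: "('a, 'e) chart \<Rightarrow> 'e \<Rightarrow> 'e \<Rightarrow> 'e \<Rightarrow> real"
  assumes metric_bilinear: "c \<in> A \<Longrightarrow> x \<in> chart_img c \<Longrightarrow> bilinear (g c x)"
    and metric_sym: "c \<in> A \<Longrightarrow> x \<in> chart_img c \<Longrightarrow> g c x v w = g c x w v"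
    and metric_pos: "c \<in> A \<Longrightarrow> x \<in> chart_img c \<Longrightarrow> v \<noteq> 0 \<Longrightarrow> g c x v v > 0"
    and metric_smooth: "c \<in> A \<Longrightarrow> smooth_on (\<lambda>x. g c x v w) (chart_img c)"
    and metric_tensor: "c \<in> A \<Longrightarrow> c' \<in> A \<Longrightarrow> p \<in> chart_dom c \<inter> chart_dom c' \<Longrightarrow>
      g c (chart_coord c p) v w =
      g c' (chart_coord c' p)
        (frechet_derivative (transition c c') (at (chart_coord c p)) v)
        (frechet_derivative (transition c c') (at (chart_coord c p)) w)"
begin

subsection \<open>Length and Riemannian distance\<close>

definition C1_curve_on :: "real set \<Rightarrow> (real \<Rightarrow> 'a) \<Rightarrow> bool" where
  "C1_curve_on I \<gamma> \<longleftrightarrow> continuous_on I \<gamma> \<and>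
     (\<forall>c\<in>A. \<exists>D. continuous_on {t\<in>I. \<gamma> t \<in> chart_dom c} D \<and>
        (\<forall>t\<in>I. \<gamma> t \<in> chart_dom c \<longrightarrow>
           ((chart_coord c \<circ> \<gamma>) has_vector_derivative D t) (at t within I)))"

definition piecewise_C1_curve :: "(real \<Rightarrow> 'a) \<Rightarrow> bool" where
  "piecewise_C1_curve \<gamma> \<longleftrightarrow> continuous_on {0..1} \<gamma> \<and>
     (\<exists>F. finite F \<and> (\<forall>a b. 0 \<le> a \<and> a < b \<and> b \<le> 1 \<and> {a<..<b} \<inter> F = {} \<longrightarrow> C1_curve_on {a..b} \<gamma>))"

text \<open>By \<open>metric_tensor\<close> the choice of the chart is immaterial.\<close>

definition speed :: "(real \<Rightarrow> 'a) \<Rightarrow> real \<Rightarrow> real" where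
  "speed \<gamma> t = (let c = (SOME c. c \<in> A \<and> \<gamma> t \<in> chart_dom c);
                    v = vector_derivative (chart_coord c \<circ> \<gamma>) (at t)
                in sqrt (g c (chart_coord c (\<gamma> t)) v v))"

definition curve_length :: "(real \<Rightarrow> 'a) \<Rightarrow> real" where
  "curve_length \<gamma> = integral {0..1} (speed \<gamma>)"

definition riemannian_dist :: "'a \<Rightarrow> 'a \<Rightarrow> real" where
  "riemannian_dist p q =
     (INF \<gamma>\<in>{\<gamma>. piecewise_C1_curve \<gamma> \<and> \<gamma> 0 = p \<and> \<gamma> 1 = q}. curve_length \<gamma>)"

subsection \<open>Levi-Civita connection and curvature\<close>

text \<open>Vectors of \<open>'e\<close> are regarded as constant coordinate vector fields, whose brackets vanish;
  so the Koszul formula determines the covariant derivative \<open>christoffel c x u v\<close> of \<open>v\<close> in the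
  direction \<open>u\<close>, and the curvature operator is
  \<open>R(u,v)w = \<nabla>\<^sub>u \<nabla>\<^sub>v w - \<nabla>\<^sub>v \<nabla>\<^sub>u w\<close>.\<close>

definition christoffel :: "('a, 'e) chart \<Rightarrow> 'e \<Rightarrow> 'e \<Rightarrow> 'e \<Rightarrow> 'e" where
  "christoffel c x u v = (THE z. \<forall>w.
     2 * g c x z w =
       frechet_derivative (\<lambda>y. g c y v w) (at x) u
     + frechet_derivative (\<lambda>y. g c y u w) (at x) v
     - frechet_derivative (\<lambda>y. g c y u v) (at x) w)"

definition curvature :: "('a, 'e) chart \<Rightarrow> 'e \<Rightarrow> 'e \<Rightarrow> 'e \<Rightarrow> 'e \<Rightarrow> 'e" where
  "curvature c x u v w =
       frechet_derivative (\<lambda>y. christoffel c y v w) (at x) u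
     - frechet_derivative (\<lambda>y. christoffel c y u w) (at x) v
     + christoffel c x u (christoffel c x v w)
     - christoffel c x v (christoffel c x u w)"

definition sectional_curvature :: "('a, 'e) chart \<Rightarrow> 'e \<Rightarrow> 'e \<Rightarrow> 'e \<Rightarrow> real" where
  "sectional_curvature c x u v =
     g c x (curvature c x u v v) u / (g c x u u * g c x v v - (g c x u v)\<^sup>2)"

end

text \<open>The type \<open>'a\<close> is the manifold and its metric \<open>dist\<close> is the Riemannian distance.\<close>

locale hadamard_space = riemannian_metric A g
  for A :: "('a::metric_space, 'e::euclidean_space) chart set"
    and g :: "('a, 'e) chart \<Rightarrow> 'e \<Rightarrow> 'e \<Rightarrow> 'e \<Rightarrow> real" +
  assumes dist_riemannian: "dist p q = riemannian_dist p q"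
    and complete: "complete (UNIV :: 'a set)"
    and simply_connected: "simply_connected (UNIV :: 'a set)"
    and nonpos_curvature: "c \<in> A \<Longrightarrow> x \<in> chart_img c \<Longrightarrow> u \<noteq> v \<Longrightarrow> independent {u, v} \<Longrightarrow>
      sectional_curvature c x u v \<le> 0"

section \<open>Regular quotients\<close>

definition isometry :: "('a::metric_space \<Rightarrow> 'a) \<Rightarrow> bool" where
  "isometry f \<longleftrightarrow> surj f \<and> (\<forall>x y. dist (f x) (f y) = dist x y)"

definition isometry_group :: "('a::metric_space \<Rightarrow> 'a) set \<Rightarrow> bool" where
  "isometry_group G \<longleftrightarrow> (\<forall>f\<in>G. isometry f) \<and> id \<in> G \<and>
     (\<forall>f\<in>G. \<forall>h\<in>G. f \<circ> h \<in> G) \<and> (\<forall>f\<in>G. inv f \<in> G)"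

definition torsion_free :: "('a \<Rightarrow> 'a) set \<Rightarrow> bool" where
  "torsion_free G \<longleftrightarrow> (\<forall>f\<in>G. \<forall>n>0. f ^^ n = id \<longrightarrow> f = id)"

text \<open>The topology of the function type is that of pointwise convergence; on isometries it
  coincides with the compact-open topology.\<close>

definition regular_group :: "('a::metric_space \<Rightarrow> 'a) set \<Rightarrow> bool" where
  "regular_group G \<longleftrightarrow> isometry_group G \<and> discrete G \<and> torsion_free G"

definition orbit :: "('a \<Rightarrow> 'a) set \<Rightarrow> 'a \<Rightarrow> 'a set" where
  "orbit G x = {f x | f. f \<in> G}"

definition quotient_space :: "('a \<Rightarrow> 'a) set \<Rightarrow> 'a set set" where
  "quotient_space G = range (orbit G)"

text \<open>The points of the quotient are the orbits. A curve of the quotient has the length of its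
  lifts, so the Riemannian distance of two points is the distance \<open>setdist\<close> of the orbits.\<close>

abbreviation quotient_dist :: "'a::metric_space set \<Rightarrow> 'a set \<Rightarrow> real" where
  "quotient_dist \<equiv> setdist"

text \<open>Continuity of a lift is not automatic.\<close>

definition is_lift :: "('a::metric_space \<Rightarrow> 'a) set \<Rightarrow> (real \<Rightarrow> 'a) \<Rightarrow> (real \<Rightarrow> 'a set) \<Rightarrow> bool" where
  "is_lift G \<alpha>' \<alpha> \<longleftrightarrow> continuous_on {0..} \<alpha>' \<and> (\<forall>t\<ge>0. orbit G (\<alpha>' t) = \<alpha> t)"

section \<open>Rays and Busemann functions\<close>

text \<open>These are used both for a Hadamard space (with \<open>UNIV\<close> and \<open>dist\<close>) and for its quotients.
  The values of a ray at negative parameters are irrelevant.\<close>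

definition is_ray :: "'p set \<Rightarrow> ('p \<Rightarrow> 'p \<Rightarrow> real) \<Rightarrow> (real \<Rightarrow> 'p) \<Rightarrow> bool" where
  "is_ray M d \<alpha> \<longleftrightarrow> (\<forall>t\<ge>0. \<alpha> t \<in> M) \<and> (\<forall>s\<ge>0. \<forall>t\<ge>0. d (\<alpha> t) (\<alpha> s) = \<bar>t - s\<bar>)"

definition busemann :: "('p \<Rightarrow> 'p \<Rightarrow> real) \<Rightarrow> (real \<Rightarrow> 'p) \<Rightarrow> 'p \<Rightarrow> 'p \<Rightarrow> real" where
  "busemann d \<alpha> x y = Lim at_top (\<lambda>t. d x (\<alpha> t) - d (\<alpha> t) y)"

section \<open>The visual boundary\<close>

abbreviation ray :: "(real \<Rightarrow> 'a::metric_space) \<Rightarrow> bool" where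
  "ray \<equiv> is_ray UNIV dist"

definition asymptotic :: "(real \<Rightarrow> 'a::metric_space) \<Rightarrow> (real \<Rightarrow> 'a) \<Rightarrow> bool" where
  "asymptotic \<alpha> \<beta> \<longleftrightarrow> (\<exists>C. \<forall>t\<ge>0. dist (\<alpha> t) (\<beta> t) \<le> C)"

definition point_at_infinity :: "(real \<Rightarrow> 'a::metric_space) \<Rightarrow> (real \<Rightarrow> 'a) set" where
  "point_at_infinity \<alpha> = {\<beta>. ray \<beta> \<and> asymptotic \<alpha> \<beta>}"

definition visual_boundary :: "(real \<Rightarrow> 'a::metric_space) set set" where
  "visual_boundary = {point_at_infinity \<alpha> | \<alpha>. ray \<alpha>}"

definition boundary_action ::
    "('a::metric_space \<Rightarrow> 'a) \<Rightarrow> (real \<Rightarrow> 'a) set \<Rightarrow> (real \<Rightarrow> 'a) set" where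
  "boundary_action f \<xi> = (\<lambda>\<alpha>. f \<circ> \<alpha>) ` \<xi>"

text \<open>The cone topology, described by the rays issuing from \<open>x\<close>. In a Hadamard space it does
  not depend on \<open>x\<close>.\<close>

definition cone_topology :: "'a::metric_space \<Rightarrow> (real \<Rightarrow> 'a) set topology" where
  "cone_topology x = topology_generated_by
     {{\<xi> \<in> visual_boundary. \<exists>\<beta>\<in>\<xi>. \<beta> 0 = x \<and> dist (\<beta> r) (\<alpha> r) < \<epsilon>} | \<alpha> r \<epsilon>.
        ray \<alpha> \<and> \<alpha> 0 = x \<and> r > 0 \<and> \<epsilon> > 0}"

text \<open>In a Hadamard space all rays of \<open>\<xi>\<close> have the same Busemann function.\<close>

definition busemann_at :: "(real \<Rightarrow> 'a::metric_space) set \<Rightarrow> 'a \<Rightarrow> 'a \<Rightarrow> real" where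
  "busemann_at \<xi> = busemann dist (SOME \<alpha>. \<alpha> \<in> \<xi>)"

definition horoball :: "(real \<Rightarrow> 'a::metric_space) set \<Rightarrow> 'a \<Rightarrow> 'a set" where
  "horoball \<xi> x = {y. busemann_at \<xi> x y \<ge> 0}"

end

theory Submission
  imports Defs
begin

text \<open>The distance of the quotient is the infimum of distances to the points of an orbit, hence the
  Busemann function of \<open>\<alpha>\<close>, normalized at its origin, is the supremum of \<open>B\<close> over an orbit, where \<open>B\<close> is the
  Busemann function of the lift. If \<open>g\<^sub>n \<alpha>'\<^sup>+\<close> tends to \<open>\<beta>'\<^sup>+\<close> and \<open>g\<^sub>n\<close> changes the normalization at \<open>o'\<close> by
  an amount tending to \<open>0\<close>, lower semicontinuity in the boundary point shows that the Busemann function of \<open>\<alpha>\<close>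
  is at least that of \<open>\<beta>\<close>. Conversely, if it is, choose \<open>g\<^sub>n\<close> almost realizing the supremum at \<open>\<beta>'(n)\<close>, where
  it is \<open>n\<close>: the ray from \<open>o'\<close> to \<open>g\<^sub>n \<alpha>'\<^sup>+\<close> then passes within bounded distance of \<open>\<beta>'(n)\<close>.

  This uses that the universal cover is proper and \<open>CAT(0)\<close>. By nonpositive curvature the length of a
  Jacobi field vanishing at \<open>0\<close> is convex, so the exponential map does not decrease lengths. Hence it has local
  sections of uniform size and is a covering, and by simple connectedness a diffeomorphism whose inverse is
  nonexpanding; applied at a point of a geodesic, this is the Bruhat--Tits inequality.\<close>

section \<open>Flows of ordinary differential equations\<close>

text \<open>Curve lengths are bounded below without a Gauss lemma: the image of a curve under the
  inverse exponential map is paired with the difference of its end points, and Cauchy-Schwarz leaves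
  only the pointwise inequality for the differential. That differential is obtained by following the
  geodesic flow from chart to chart along one geodesic, which metric completeness allows up to time
  \<open>1\<close>. For the covering property uniformity is decisive: the expansion constant in a
  coordinate ball is the same for every preimage, so one neighbourhood carries a section through
  each of them. After the Bruhat-Tits inequality the manifold is forgotten. In the quotient the
  obstacle is that a continuous lift of a ray has to be a ray: discreteness, properness and absence
  of torsion bound from below the displacement of a point by the nontrivial elements, so that near
  each time the orbit distance is the distance along the lift. Each of the two sequences of the
  theorem accounts for one inequality between the normalized Busemann functions; these agree at the
  common origin, which is why no additive constant appears.\<close>

lemma onorm_scaleR_le: "norm v \<le> M \<Longrightarrow> onorm (\<lambda>h::real. h *\<^sub>R v) \<le> M"
  by (rule onorm_le) (simp add: mult.commute[of M] mult_left_mono)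

lemma ode_bound:
  fixes e :: "real \<Rightarrow> 'z::real_normed_vector"
  assumes "a \<le> c" "c \<le> b" and L: "0 \<le> L" "L * (b - a) \<le> 1/2" and \<rho>: "0 \<le> \<rho>"
    and der: "\<And>t. t \<in> {a..b} \<Longrightarrow> (e has_vector_derivative e' t) (at t within {a..b})"
    and bd: "\<And>t. t \<in> {a..b} \<Longrightarrow> norm (e' t) \<le> L * norm (e t) + \<rho>"
    and t: "t \<in> {a..b}"
  shows "norm (e t) \<le> 2 * norm (e c) + 2 * (b - a) * \<rho>"
proof -
  have cont: "continuous_on {a..b} e"
    using der by (meson continuous_on_eq_continuous_within has_vector_derivative_continuous)
  obtain s where s: "s \<in> {a..b}" and smax: "\<And>u. u \<in> {a..b} \<Longrightarrow> norm (e u) \<le> norm (e s)"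
    using continuous_attains_sup[of "{a..b}" "\<lambda>u. norm (e u)"] continuous_on_norm[OF cont] t
    by (metis compact_Icc empty_iff)
  have "norm (e s - e c) \<le> (L * norm (e s) + \<rho>) * norm (s - c)"
  proof (rule differentiable_bound[of "{a..b}" e "\<lambda>t h. h *\<^sub>R e' t"])
    show "(e has_derivative (\<lambda>h. h *\<^sub>R e' x)) (at x within {a..b})" if "x \<in> {a..b}" for x
      using der[OF that] by (simp add: has_vector_derivative_def)
    show "onorm (\<lambda>h. h *\<^sub>R e' x) \<le> L * norm (e s) + \<rho>" if "x \<in> {a..b}" for x
      using bd[OF that] smax[OF that] L(1) by (intro onorm_scaleR_le) (smt (verit) mult_left_mono)
  qed (use s assms in auto)
  also have "\<dots> \<le> (L * norm (e s) + \<rho>) * (b - a)"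
    using s assms by (intro mult_left_mono) auto
  also have "\<dots> = L * (b - a) * norm (e s) + (b - a) * \<rho>" by (simp add: algebra_simps)
  also have "\<dots> \<le> 1/2 * norm (e s) + (b - a) * \<rho>"
    using mult_right_mono[OF L(2), of "norm (e s)"] by simp
  finally have "norm (e s) \<le> 2 * norm (e c) + 2 * (b - a) * \<rho>"
    using norm_triangle_sub[of "e s" "e c"] by (simp add: algebra_simps)
  then show ?thesis using smax[OF t] by simp
qed

text \<open>Banach's fixed point theorem is applied in the type of bounded continuous functions on
  the whole line; functions on \<open>{a..b}\<close> enter it by composition with the retraction
  \<open>p\<close>.\<close>

lemma picard:
  fixes f :: "real \<Rightarrow> 'z::banach \<Rightarrow> 'z"
  assumes abc: "a \<le> c" "c \<le> b" and L: "0 \<le> L" "L * (b - a) \<le> 1/2"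
    and cont: "continuous_on ({a..b} \<times> UNIV) (\<lambda>(t, x). f t x)"
    and lip: "\<And>t x y. t \<in> {a..b} \<Longrightarrow> norm (f t x - f t y) \<le> L * norm (x - y)"
  obtains x where "x c = x0"
    "\<And>t. t \<in> {a..b} \<Longrightarrow> (x has_vector_derivative f t (x t)) (at t within {a..b})"
proof -
  define p where "p = (\<lambda>t. max a (min b t))"
  have p: "p t \<in> {a..b}" "t \<in> {a..b} \<Longrightarrow> p t = t" for t
    using abc by (auto simp: p_def)
  have contp: "continuous_on UNIV p" unfolding p_def by (intro continuous_intros)
  \<comment> \<open>The difference of two integrals from \<open>a\<close> is the oriented integral
    from \<open>c\<close> to \<open>t\<close>, for \<open>t\<close> on either side of
    \<open>c\<close>.\<close>
  define I where "I = (\<lambda>(x::real \<Rightarrow>\<^sub>C 'z) t. x0 + integral {a..t} (\<lambda>s. f s (x s)) - integral {a..c} (\<lambda>s. f s (x s)))"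
  have contx: "continuous_on {a..b} (\<lambda>s. f s (apply_bcontfun x s))" for x
    using continuous_on_compose2[OF cont, of "{a..b}" "\<lambda>s. (s, apply_bcontfun x s)"]
    by (simp add: image_subset_iff continuous_on_Pair)
  have der: "(I x has_vector_derivative f t (x t)) (at t within {a..b})" if "t \<in> {a..b}" for x t
    unfolding I_def using integral_has_vector_derivative[OF contx that]
    by (auto intro!: derivative_eq_intros)
  have contI: "continuous_on {a..b} (I x)" for x
    using der by (meson continuous_on_eq_continuous_within has_vector_derivative_continuous)
  have bc: "(\<lambda>t. I x (p t)) \<in> bcontfun" for x
  proof -
    have "compact (I x ` {a..b})" using contI compact_continuous_image by blast
    then obtain B where "\<And>t. t \<in> {a..b} \<Longrightarrow> norm (I x t) \<le> B"
      by (meson bounded_iff compact_imp_bounded imageI)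
    then show ?thesis
      using p contp contI[of x] by (intro bcontfun_normI[of _ B]) (auto intro: continuous_on_compose2)
  qed
  define T where "T = (\<lambda>x. Bcontfun (\<lambda>t. I x (p t)))"
  have T: "apply_bcontfun (T x) t = I x (p t)" for x t
    unfolding T_def using bc[of x] by (simp add: Bcontfun_inverse)
  have "\<exists>!x. T x = x"
  proof (rule banach_fix_type[of "1/2"])
    show "\<forall>x y. dist (T x) (T y) \<le> 1/2 * dist x y"
    proof (intro allI, rule dist_bound)
      fix x y :: "real \<Rightarrow>\<^sub>C 'z" and t
      have "norm ((I x (p t) - I y (p t)) - (I x c - I y c)) \<le> (L * dist x y) * norm (p t - c)"
      proof (rule differentiable_bound[of "{a..b}" _ "\<lambda>t h. h *\<^sub>R (f t (x t) - f t (y t))"])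
        fix s assume s: "s \<in> {a..b}"
        show "((\<lambda>t. I x t - I y t) has_derivative (\<lambda>h. h *\<^sub>R (f s (x s) - f s (y s)))) (at s within {a..b})"
          using has_vector_derivative_diff[OF der[OF s] der[OF s]] by (simp add: has_vector_derivative_def)
        show "onorm (\<lambda>h. h *\<^sub>R (f s (x s) - f s (y s))) \<le> L * dist x y"
        proof (rule onorm_scaleR_le)
          have "norm (f s (x s) - f s (y s)) \<le> L * norm (x s - y s)" using lip s by auto
          also have "\<dots> \<le> L * dist x y"
            using dist_bounded[of x s y] L by (intro mult_left_mono) (auto simp: dist_norm)
          finally show "norm (f s (x s) - f s (y s)) \<le> L * dist x y" .
        qed
      qed (use p abc in auto)
      also have "I x c - I y c = 0" by (simp add: I_def)
      also have "(L * dist x y) * norm (p t - c) \<le> (L * dist x y) * (b - a)"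
        using p(1)[of t] abc L by (intro mult_left_mono) auto
      also have "\<dots> = (L * (b - a)) * dist x y" by simp
      also have "\<dots> \<le> 1/2 * dist x y" using L by (intro mult_right_mono) auto
      finally show "dist (T x t) (T y t) \<le> 1/2 * dist x y" by (simp add: T dist_norm)
    qed
  qed auto
  then obtain x where x: "T x = x" by auto
  have xI: "apply_bcontfun x t = I x t" if "t \<in> {a..b}" for t
    using T[of x t] x p(2)[OF that] by simp
  show thesis
  proof
    show "x c = x0" using xI[of c] abc by (simp add: I_def)
    show "(x has_vector_derivative f t (x t)) (at t within {a..b})" if "t \<in> {a..b}" for t
      using has_vector_derivative_transform[OF that _ der[OF that, of x]] xI that by auto
  qed
qed

lemma lipschitz_C1_convex:
  fixes F :: "'z::real_normed_vector \<Rightarrow> 'w::real_normed_vector"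
  assumes "convex S" "\<And>z. z \<in> S \<Longrightarrow> (F has_derivative blinfun_apply (F' z)) (at z)"
    "\<And>z. z \<in> S \<Longrightarrow> norm (F' z) \<le> L" "x \<in> S" "y \<in> S"
  shows "norm (F x - F y) \<le> L * norm (x - y)"
  using assms
  by (intro differentiable_bound[of S F "\<lambda>z. blinfun_apply (F' z)"])
     (auto simp: norm_blinfun.rep_eq intro: has_derivative_at_withinI)

text \<open>\<open>D t z\<close> is the differential of the flow \<open>X t\<close> at \<open>z\<close>; it solves the variational equation.\<close>

definition C1_flow :: "'z::euclidean_space set \<Rightarrow> ('z \<Rightarrow> 'z) \<Rightarrow> ('z \<Rightarrow> 'z \<Rightarrow>\<^sub>L 'z) \<Rightarrow> 'z \<Rightarrow> real \<Rightarrow> real \<Rightarrow>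
    (real \<Rightarrow> 'z \<Rightarrow> 'z) \<Rightarrow> (real \<Rightarrow> 'z \<Rightarrow> 'z \<Rightarrow>\<^sub>L 'z) \<Rightarrow> bool" where
  "C1_flow W F F' z0 \<epsilon> \<delta> X D \<longleftrightarrow> \<epsilon> > 0 \<and> \<delta> > 0 \<and>
    (\<forall>z\<in>ball z0 \<delta>. X 0 z = z \<and> D 0 z = id_blinfun \<and>
      (\<forall>t\<in>{-\<epsilon><..<\<epsilon>}. X t z \<in> W \<and>
         ((\<lambda>t. X t z) has_vector_derivative F (X t z)) (at t) \<and>
         (X t has_derivative blinfun_apply (D t z)) (at z) \<and>
         ((\<lambda>t. D t z) has_vector_derivative F' (X t z) o\<^sub>L D t z) (at t))) \<and>
    (\<forall>t\<in>{-\<epsilon><..<\<epsilon>}. continuous_on (ball z0 \<delta>) (D t))"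

lemma C1_flowD:
  assumes "C1_flow W F F' z0 \<epsilon> \<delta> X D"
  shows "\<epsilon> > 0" "\<delta> > 0"
    "\<And>z. z \<in> ball z0 \<delta> \<Longrightarrow> X 0 z = z"
    "\<And>z. z \<in> ball z0 \<delta> \<Longrightarrow> D 0 z = id_blinfun"
    "\<And>z t. z \<in> ball z0 \<delta> \<Longrightarrow> t \<in> {-\<epsilon><..<\<epsilon>} \<Longrightarrow> X t z \<in> W"
    "\<And>z t. z \<in> ball z0 \<delta> \<Longrightarrow> t \<in> {-\<epsilon><..<\<epsilon>} \<Longrightarrow> ((\<lambda>t. X t z) has_vector_derivative F (X t z)) (at t)"
    "\<And>z t. z \<in> ball z0 \<delta> \<Longrightarrow> t \<in> {-\<epsilon><..<\<epsilon>} \<Longrightarrow> (X t has_derivative blinfun_apply (D t z)) (at z)"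
    "\<And>z t. z \<in> ball z0 \<delta> \<Longrightarrow> t \<in> {-\<epsilon><..<\<epsilon>} \<Longrightarrow> ((\<lambda>t. D t z) has_vector_derivative F' (X t z) o\<^sub>L D t z) (at t)"
    "\<And>t. t \<in> {-\<epsilon><..<\<epsilon>} \<Longrightarrow> continuous_on (ball z0 \<delta>) (D t)"
  using assms unfolding C1_flow_def by blast+

text \<open>The field is Lipschitz only near \<open>z0\<close>. Composing it with the projection
  \<open>P\<close> onto a closed ball makes it globally Lipschitz, and for short times solutions
  starting in the half ball stay where \<open>P\<close> is the identity. The family \<open>D\<close>
  is first obtained from the variational equation and then shown to be the derivative of
  \<open>X\<close>.\<close>

proposition local_flow:
  fixes F :: "'z::euclidean_space \<Rightarrow> 'z" and F' :: "'z \<Rightarrow> 'z \<Rightarrow>\<^sub>L 'z"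
  assumes W: "open W" "z0 \<in> W"
    and derF: "\<And>z. z \<in> W \<Longrightarrow> (F has_derivative blinfun_apply (F' z)) (at z)"
    and contF': "continuous_on W F'"
  obtains \<epsilon> \<delta> X D where "C1_flow W F F' z0 \<epsilon> \<delta> X D"
proof -
  obtain R where R: "R > 0" "cball z0 R \<subseteq> W" using W open_contains_cball by blast
  let ?K = "cball z0 R"
  have contF: "continuous_on ?K F"
    using derF R by (meson continuous_at_imp_continuous_on has_derivative_continuous subsetD)
  have contF'K: "continuous_on ?K F'" using contF' R continuous_on_subset by blast
  obtain M where M: "M \<ge> 0" "\<And>z. z \<in> ?K \<Longrightarrow> norm (F z) \<le> M"
    using compact_continuous_image[OF contF] compact_imp_bounded bounded_pos
    by (metis compact_cball imageI less_eq_real_def)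
  obtain L where L: "L > 0" "\<And>z. z \<in> ?K \<Longrightarrow> norm (F' z) \<le> L"
    using compact_continuous_image[OF contF'K] compact_imp_bounded bounded_pos
    by (metis compact_cball imageI)
  have lipF: "norm (F x - F y) \<le> L * norm (x - y)" if "x \<in> ?K" "y \<in> ?K" for x y
    using that R L derF by (intro lipschitz_C1_convex[of ?K F F']) auto
  define P where "P = closest_point ?K"
  have P: "P x \<in> ?K" "x \<in> ?K \<Longrightarrow> P x = x" "dist (P x) (P y) \<le> dist x y" for x y
    using R unfolding P_def by (auto intro: closest_point_lipschitz closest_point_self closest_point_in_set simp del: mem_cball)
  \<comment> \<open>The first bound gives the contraction factor \<open>1/2\<close>, the second
    keeps a path of speed at most \<open>M\<close> within \<open>R / 4\<close> of its start;
    \<open>M + 1\<close> excludes division by zero.\<close>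
  define \<epsilon> where "\<epsilon> = min (1 / (4 * L)) (R / (4 * (M + 1)))"
  have \<epsilon>: "\<epsilon> > 0" "L * (\<epsilon> - - \<epsilon>) \<le> 1/2" "M * \<epsilon> \<le> R / 4"
  proof -
    show "\<epsilon> > 0" using L M R by (simp add: \<epsilon>_def)
    have "L * \<epsilon> \<le> L * (1 / (4 * L))" using L by (intro mult_left_mono) (auto simp: \<epsilon>_def)
    then show "L * (\<epsilon> - - \<epsilon>) \<le> 1/2" using L by simp
    have "M * \<epsilon> \<le> (M + 1) * (R / (4 * (M + 1)))"
      using M R L by (intro mult_mono) (auto simp: \<epsilon>_def)
    also have "\<dots> = R / 4" using M(1) by (simp add: divide_simps)
    finally show "M * \<epsilon> \<le> R / 4" .
  qed
  let ?I = "{-\<epsilon>..\<epsilon>}"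
  have "\<exists>x. x 0 = z \<and> (\<forall>t\<in>?I. (x has_vector_derivative F (P (x t))) (at t within ?I))" for z
  proof (rule picard[of "-\<epsilon>" 0 \<epsilon> L "\<lambda>t x. F (P x)" z])
    have "continuous_on UNIV P"
      using R unfolding P_def by (intro continuous_on_closest_point) auto
    then have "continuous_on UNIV (\<lambda>x. F (P x))"
      using P(1) contF by (auto intro: continuous_on_compose2)
    then show "continuous_on (?I \<times> UNIV) (\<lambda>(t, x). F (P x))"
      by (auto simp: case_prod_unfold intro!: continuous_on_compose2[of UNIV "\<lambda>x. F (P x)"] continuous_intros)
    show "norm (F (P x) - F (P y)) \<le> L * norm (x - y)" for x y
    proof -
      have "norm (F (P x) - F (P y)) \<le> L * norm (P x - P y)" using lipF P by blast
      also have "\<dots> \<le> L * norm (x - y)" using P(3) L by (simp add: dist_norm)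
      finally show ?thesis .
    qed
  qed (use \<epsilon> L in auto)
  then obtain x where x0: "\<And>z. x z 0 = z"
    and xder: "\<And>z t. t \<in> ?I \<Longrightarrow> (x z has_vector_derivative F (P (x z t))) (at t within ?I)"
    by metis
  define X where "X = (\<lambda>t z. x z t)"
  define \<delta> where "\<delta> = R / 2"
  have \<delta>: "\<delta> > 0" using R by (simp add: \<delta>_def)
  have XK: "X t z \<in> ?K" if "z \<in> ball z0 \<delta>" "t \<in> ?I" for z t
  proof -
    have "norm (x z t - x z 0) \<le> M * norm (t - 0)"
    proof (rule differentiable_bound[of ?I _ "\<lambda>t h. h *\<^sub>R F (P (x z t))"])
      fix s assume s: "s \<in> ?I"
      show "(x z has_derivative (\<lambda>h. h *\<^sub>R F (P (x z s)))) (at s within ?I)"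
        using xder[OF s] by (simp add: has_vector_derivative_def)
      show "onorm (\<lambda>h. h *\<^sub>R F (P (x z s))) \<le> M"
        by (intro onorm_scaleR_le M(2) P(1))
    qed (use that \<epsilon> in auto)
    also have "\<dots> \<le> M * \<epsilon>" using that M by (intro mult_left_mono) auto
    also have "\<dots> \<le> R / 4" by (rule \<epsilon>)
    finally have "dist z (x z t) \<le> R / 4" by (simp add: x0 dist_norm norm_minus_commute)
    then show ?thesis using that R dist_triangle[of z0 "x z t" z] by (simp add: X_def \<delta>_def)
  qed
  have Xder: "((\<lambda>t. X t z) has_vector_derivative F (X t z)) (at t within ?I)"
    if "z \<in> ball z0 \<delta>" "t \<in> ?I" for z t
    using xder[OF that(2), of z] P(2)[OF XK[OF that]] by (simp add: X_def)
  have X0: "X 0 z = z" for z by (simp add: X_def x0)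
  have Xcont: "continuous_on ?I (\<lambda>t. X t z)" if "z \<in> ball z0 \<delta>" for z
    using Xder[OF that] by (meson continuous_on_eq_continuous_within has_vector_derivative_continuous)
  have "\<exists>d. d 0 = id_blinfun \<and> (\<forall>t\<in>?I. (d has_vector_derivative F' (X t z) o\<^sub>L d t) (at t within ?I))"
    if "z \<in> ball z0 \<delta>" for z
  proof (rule picard[of "-\<epsilon>" 0 \<epsilon> L "\<lambda>t d. F' (X t z) o\<^sub>L d" id_blinfun])
    have "continuous_on ?I (\<lambda>t. F' (X t z))"
      using continuous_on_compose2[OF contF'K Xcont[OF that]] XK[OF that] by blast
    then have c1: "continuous_on (?I \<times> UNIV) (\<lambda>p. F' (X (fst p) z))" for U :: "('z \<Rightarrow>\<^sub>L 'z) set"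
      by (rule continuous_on_compose2) (auto intro!: continuous_intros)
    have "continuous_on (?I \<times> (UNIV :: ('z \<Rightarrow>\<^sub>L 'z) set)) (\<lambda>p. F' (X (fst p) z) o\<^sub>L snd p)"
      by (rule bounded_bilinear.continuous_on[OF bounded_bilinear_blinfun_compose])
         (auto intro!: continuous_intros c1)
    then show "continuous_on (?I \<times> (UNIV :: ('z \<Rightarrow>\<^sub>L 'z) set)) (\<lambda>(t, d). F' (X t z) o\<^sub>L d)"
      by (simp add: case_prod_unfold)
    show "norm ((F' (X t z) o\<^sub>L d) - (F' (X t z) o\<^sub>L d')) \<le> L * norm (d - d')" if t: "t \<in> ?I" for t d d'
    proof -
      have "norm ((F' (X t z) o\<^sub>L d) - (F' (X t z) o\<^sub>L d')) = norm (F' (X t z) o\<^sub>L (d - d'))"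
        by (simp add: bounded_bilinear.diff_right[OF bounded_bilinear_blinfun_compose])
      also have "\<dots> \<le> norm (F' (X t z)) * norm (d - d')" by (rule norm_blinfun_compose)
      also have "\<dots> \<le> L * norm (d - d')"
        using L(2)[OF XK[OF \<open>z \<in> ball z0 \<delta>\<close> t]] by (intro mult_right_mono) auto
      finally show ?thesis .
    qed
  qed (use \<epsilon> L in auto)
  then obtain D' where D0': "\<And>z. z \<in> ball z0 \<delta> \<Longrightarrow> D' z 0 = id_blinfun"
    and Dder': "\<And>z t. z \<in> ball z0 \<delta> \<Longrightarrow> t \<in> ?I \<Longrightarrow> (D' z has_vector_derivative F' (X t z) o\<^sub>L D' z t) (at t within ?I)"
    by metis
  define D where "D = (\<lambda>t z. D' z t)"
  have D0: "D 0 z = id_blinfun" if "z \<in> ball z0 \<delta>" for z using D0'[OF that] by (simp add: D_def)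
  have Dder: "((\<lambda>t. D t z) has_vector_derivative F' (X t z) o\<^sub>L D t z) (at t within ?I)"
    if "z \<in> ball z0 \<delta>" "t \<in> ?I" for z t
    using Dder'[OF that] by (simp add: D_def)
  have Dbd: "norm (D t z) \<le> 2" if z: "z \<in> ball z0 \<delta>" and t: "t \<in> ?I" for z t
  proof -
    have "norm (D t z) \<le> 2 * norm (D 0 z) + 2 * (\<epsilon> - - \<epsilon>) * 0"
    proof (rule ode_bound[where e'="\<lambda>t. F' (X t z) o\<^sub>L D t z" and a = "-\<epsilon>" and b=\<epsilon> and L=L])
      show "norm (F' (X s z) o\<^sub>L D s z) \<le> L * norm (D s z) + 0" if s: "s \<in> ?I" for s
        using norm_blinfun_compose[of "F' (X s z)" "D s z"] L(2)[OF XK[OF z s]]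
        by (smt (verit) mult_right_mono norm_ge_zero)
    qed (use \<epsilon> L t z Dder in auto)
    then show ?thesis using D0[OF z] norm_blinfun_id_le[where 'a='z] by auto
  qed
  have Xlip: "norm (X t z' - X t z) \<le> 2 * norm (z' - z)"
    if z: "z \<in> ball z0 \<delta>" "z' \<in> ball z0 \<delta>" and t: "t \<in> ?I" for z z' t
  proof -
    have "norm (X t z' - X t z) \<le> 2 * norm (X 0 z' - X 0 z) + 2 * (\<epsilon> - - \<epsilon>) * 0"
    proof (rule ode_bound[where e="\<lambda>t. X t z' - X t z" and e'="\<lambda>t. F (X t z') - F (X t z)" and a = "-\<epsilon>" and b=\<epsilon> and L=L])
      show "norm (F (X s z') - F (X s z)) \<le> L * norm (X s z' - X s z) + 0" if s: "s \<in> ?I" for s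
        using lipF XK z s by auto
      show "((\<lambda>t. X t z' - X t z) has_vector_derivative F (X s z') - F (X s z)) (at s within ?I)"
        if s: "s \<in> ?I" for s
        using Xder z s by (intro has_vector_derivative_diff) auto
    qed (use \<epsilon> L t in auto)
    then show ?thesis by (simp add: X0)
  qed
  have unif: "\<exists>d>0. \<forall>y\<in>?K. \<forall>y'\<in>?K. norm (y' - y) < d \<longrightarrow> norm (F' y' - F' y) \<le> \<eta>" if "\<eta> > 0" for \<eta>
    using compact_uniformly_continuous[OF contF'K compact_cball] that
    unfolding uniformly_continuous_on_def dist_norm by (meson less_imp_le)
  have Xderz: "(X t has_derivative blinfun_apply (D t z)) (at z)" if z: "z \<in> ball z0 \<delta>" and t: "t \<in> ?I" for z t
    unfolding has_derivative_at_alt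
  proof (intro conjI allI impI blinfun.bounded_linear_right)
    fix r :: real assume "r > 0"
    \<comment> \<open>Chosen so that the factor \<open>8 * \<epsilon> * \<eta>\<close> produced
      below equals \<open>r / 2\<close>.\<close>
    define \<eta> where "\<eta> = r / (16 * \<epsilon>)"
    have "\<eta> > 0" using \<open>r > 0\<close> \<epsilon> by (simp add: \<eta>_def)
    then obtain d where d: "d > 0" "\<And>y y'. y \<in> ?K \<Longrightarrow> y' \<in> ?K \<Longrightarrow> norm (y' - y) < d \<Longrightarrow> norm (F' y' - F' y) \<le> \<eta>"
      using unif by meson
    obtain d' where d': "d' > 0" "ball z d' \<subseteq> ball z0 \<delta>" using z openE[OF open_ball] by blast
    have est: "norm (X t z' - X t z - D t z (z' - z)) \<le> 8 * \<epsilon> * \<eta> * norm (z' - z)"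
      if z': "norm (z' - z) < d / 2" "norm (z' - z) < d'" for z'
    proof -
      have z'b: "z' \<in> ball z0 \<delta>" using d'(2) z'(2) by (metis dist_commute dist_norm mem_ball subsetD)
      let ?e = "\<lambda>s. X s z' - X s z - D s z (z' - z)"
      let ?e' = "\<lambda>s. F (X s z') - F (X s z) - F' (X s z) (D s z (z' - z))"
      have "norm (?e t) \<le> 2 * norm (?e 0) + 2 * (\<epsilon> - - \<epsilon>) * (2 * \<eta> * norm (z' - z))"
      proof (rule ode_bound[where e'="?e'" and a = "-\<epsilon>" and b=\<epsilon> and L=L])
        fix s assume s: "s \<in> ?I"
        have "((\<lambda>s. D s z (z' - z)) has_vector_derivative (F' (X s z) o\<^sub>L D s z) (z' - z)) (at s within ?I)"
          using Dder[OF z s]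
          by (rule bounded_linear.has_vector_derivative[OF blinfun.bounded_linear_left])
        then show "(?e has_vector_derivative ?e' s) (at s within ?I)"
          using Xder[OF z s] Xder[OF z'b s] by (auto intro!: derivative_intros)
        have xl: "norm (X s z' - X s z) \<le> 2 * norm (z' - z)" using Xlip[OF z z'b s] .
        have lin: "norm (F (X s z') - F (X s z) - F' (X s z) (X s z' - X s z)) \<le> norm (X s z' - X s z) * \<eta>"
        proof (rule differentiable_bound_linearization[where S="closed_segment (X s z) (X s z')" and f'="\<lambda>x. blinfun_apply (F' x)"])
          have seg: "closed_segment (X s z) (X s z') \<subseteq> ?K"
            using XK z z'b s by (intro closed_segment_subset) auto
          show "X s z + u *\<^sub>R (X s z' - X s z) \<in> closed_segment (X s z) (X s z')" if "u \<in> {0..1}" for u :: real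
            using that by (auto simp: in_segment algebra_simps intro!: exI[of _ u])
          show "(F has_derivative blinfun_apply (F' y)) (at y within closed_segment (X s z) (X s z'))"
            if "y \<in> closed_segment (X s z) (X s z')" for y
            using that seg R derF by (blast intro: has_derivative_at_withinI)
          show "onorm (blinfun_apply (F' y) - blinfun_apply (F' (X s z))) \<le> \<eta>"
            if y: "y \<in> closed_segment (X s z) (X s z')" for y
          proof -
            have "norm (y - X s z) \<le> norm (X s z' - X s z)"
              using y segment_bound(1) by blast
            also have "\<dots> < d" using xl z' by linarith
            finally have "norm (F' y - F' (X s z)) \<le> \<eta>"
              using d(2)[of "X s z" y] y seg XK[OF z s] by blast
            moreover have "blinfun_apply (F' y) - blinfun_apply (F' (X s z)) = blinfun_apply (F' y - F' (X s z))"
              by (auto simp: blinfun.diff_left)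
            ultimately show ?thesis by (simp add: norm_blinfun.rep_eq)
          qed
        qed auto
        \<comment> \<open>The deviation solves the variational equation up to the linearization
          error of \<open>F\<close>, which uniform continuity of \<open>F'\<close> makes small
          relative to \<open>z' - z\<close>.\<close>
        have "?e' s = (F (X s z') - F (X s z) - F' (X s z) (X s z' - X s z)) + F' (X s z) (?e s)"
          by (simp add: blinfun.diff_right)
        then have "norm (?e' s) \<le> norm (X s z' - X s z) * \<eta> + norm (F' (X s z) (?e s))"
          using lin norm_triangle_le[OF add_right_mono[OF lin]] by (metis (no_types))
        also have "norm (F' (X s z) (?e s)) \<le> L * norm (?e s)"
          using norm_blinfun[of "F' (X s z)" "?e s"] L(2)[OF XK[OF z s]]
          by (meson mult_right_mono norm_ge_zero order_trans)
        also have "norm (X s z' - X s z) * \<eta> \<le> 2 * norm (z' - z) * \<eta>"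
          using xl \<open>\<eta> > 0\<close> by (intro mult_right_mono) auto
        finally show "norm (?e' s) \<le> L * norm (?e s) + 2 * \<eta> * norm (z' - z)"
          by (simp add: algebra_simps)
      qed (use \<epsilon> L t \<open>\<eta> > 0\<close> in auto)
      then show ?thesis using D0[OF z] by (simp add: X0)
    qed
    have "8 * \<epsilon> * \<eta> \<le> r" using \<open>r > 0\<close> \<epsilon> by (simp add: \<eta>_def field_simps)
    then have "norm (X t y - X t z - D t z (y - z)) \<le> r * norm (y - z)"
      if "norm (y - z) < min (d/2) d'" for y
      using est[of y] that by (smt (verit) mult_right_mono norm_ge_zero)
    then show "\<exists>s>0. \<forall>y. norm (y - z) < s \<longrightarrow> norm (X t y - X t z - D t z (y - z)) \<le> r * norm (y - z)"
      using d(1) d'(1) by (intro exI[of _ "min (d/2) d'"]) auto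
  qed
  have Dcont: "continuous_on (ball z0 \<delta>) (D t)" if t: "t \<in> ?I" for t
    unfolding continuous_on_iff
  proof (intro ballI allI impI)
    fix z and r :: real assume z: "z \<in> ball z0 \<delta>" and "r > 0"
    define \<eta> where "\<eta> = r / (16 * \<epsilon>)"
    have "\<eta> > 0" using \<open>r > 0\<close> \<epsilon> by (simp add: \<eta>_def)
    then obtain d where d: "d > 0" "\<And>y y'. y \<in> ?K \<Longrightarrow> y' \<in> ?K \<Longrightarrow> norm (y' - y) < d \<Longrightarrow> norm (F' y' - F' y) \<le> \<eta>"
      using unif by meson
    have "dist (D t z') (D t z) < r" if z': "z' \<in> ball z0 \<delta>" "dist z' z < d / 2" for z'
    proof -
      have "norm (D t z' - D t z) \<le> 2 * norm (D 0 z' - D 0 z) + 2 * (\<epsilon> - - \<epsilon>) * (\<eta> * 2)"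
      proof (rule ode_bound[where e'="\<lambda>s. (F' (X s z') o\<^sub>L D s z') - (F' (X s z) o\<^sub>L D s z)" and a = "-\<epsilon>" and b=\<epsilon> and L=L])
        fix s assume s: "s \<in> ?I"
        show "((\<lambda>t. D t z' - D t z) has_vector_derivative (F' (X s z') o\<^sub>L D s z') - (F' (X s z) o\<^sub>L D s z)) (at s within ?I)"
          using Dder z z' s by (intro has_vector_derivative_diff) auto
        have "(F' (X s z') o\<^sub>L D s z') - (F' (X s z) o\<^sub>L D s z) =
            (F' (X s z') o\<^sub>L (D s z' - D s z)) + ((F' (X s z') - F' (X s z)) o\<^sub>L D s z)"
          by (simp add: bounded_bilinear.diff_right[OF bounded_bilinear_blinfun_compose]
              bounded_bilinear.diff_left[OF bounded_bilinear_blinfun_compose])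
        also have "norm \<dots> \<le> norm (F' (X s z')) * norm (D s z' - D s z) + norm (F' (X s z') - F' (X s z)) * norm (D s z)"
          by (intro norm_triangle_mono norm_blinfun_compose)
        also have "\<dots> \<le> L * norm (D s z' - D s z) + \<eta> * 2"
        proof (intro add_mono mult_mono)
          show "norm (F' (X s z')) \<le> L" using L(2) XK z' s by blast
          have "norm (X s z' - X s z) < d" using Xlip[OF z z'(1) s] z'(2) by (simp add: dist_norm)
          then show "norm (F' (X s z') - F' (X s z)) \<le> \<eta>" using d(2) XK z z' s by blast
          show "norm (D s z) \<le> 2" using Dbd z s by blast
        qed (use L \<open>\<eta> > 0\<close> in auto)
        finally show "norm ((F' (X s z') o\<^sub>L D s z') - (F' (X s z) o\<^sub>L D s z)) \<le> L * norm (D s z' - D s z) + \<eta> * 2" .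
      qed (use \<epsilon> L t \<open>\<eta> > 0\<close> in auto)
      then have "norm (D t z' - D t z) \<le> 8 * \<epsilon> * \<eta>" using D0 z z' by simp
      also have "\<dots> < r" using \<open>r > 0\<close> \<epsilon> by (simp add: \<eta>_def field_simps)
      finally show ?thesis by (simp add: dist_norm)
    qed
    then show "\<exists>d>0. \<forall>x'\<in>ball z0 \<delta>. dist x' z < d \<longrightarrow> dist (D t x') (D t z) < r"
      using d(1) by (intro exI[of _ "d/2"]) auto
  qed
  have at: "at t within ?I = at t" "t \<in> ?I" if "t \<in> {-\<epsilon><..<\<epsilon>}" for t
    using at_within_Icc_at[of "-\<epsilon>" t \<epsilon>] that by auto
  have "C1_flow W F F' z0 \<epsilon> \<delta> X D"
    unfolding C1_flow_def
  proof (intro conjI ballI)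
    fix z t assume zt: "z \<in> ball z0 \<delta>" "t \<in> {-\<epsilon><..<\<epsilon>}"
    show "X t z \<in> W" using XK[OF zt(1) at(2)[OF zt(2)]] R by blast
    show "((\<lambda>t. X t z) has_vector_derivative F (X t z)) (at t)"
      using Xder[OF zt(1) at(2)[OF zt(2)]] at(1)[OF zt(2)] by simp
    show "((\<lambda>t. D t z) has_vector_derivative F' (X t z) o\<^sub>L D t z) (at t)"
      using Dder[OF zt(1) at(2)[OF zt(2)]] at(1)[OF zt(2)] by simp
    show "(X t has_derivative blinfun_apply (D t z)) (at z)" by (rule Xderz[OF zt(1) at(2)[OF zt(2)]])
  qed (use \<epsilon>(1) \<delta> X0 D0 Dcont at(2) in blast)+
  then show thesis by (rule that)
qed

section \<open>Smooth families of bilinear forms\<close>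

lemma Ck_on_cong:
  assumes "open S" "\<And>x. x \<in> S \<Longrightarrow> f x = h x" "Ck_on k f S"
  shows "Ck_on k h S"
  using assms
proof (cases k)
  case 0
  then show ?thesis using assms by (simp cong: continuous_on_cong)
next
  case (Suc j)
  then obtain f' where f': "\<forall>x\<in>S. (f has_derivative f' x) (at x)" "\<forall>v. Ck_on j (\<lambda>x. f' x v) S"
    using assms(3) by auto
  have "\<forall>x\<in>S. (h has_derivative f' x) (at x)"
    using f'(1) assms(1,2) has_derivative_transform_within_open by blast
  then show ?thesis using f'(2) Suc by auto
qed

lemma Ck_on_SucD:
  assumes "open S" "Ck_on (Suc k) f S"
  shows "\<And>x. x \<in> S \<Longrightarrow> f differentiable at x"
    and "Ck_on k (\<lambda>x. frechet_derivative f (at x) v) S"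
proof -
  obtain f' where f': "\<forall>x\<in>S. (f has_derivative f' x) (at x)" "\<forall>v. Ck_on k (\<lambda>x. f' x v) S"
    using assms(2) by auto
  show "f differentiable at x" if "x \<in> S" for x
    using f'(1) that by (auto simp: differentiable_def)
  show "Ck_on k (\<lambda>x. frechet_derivative f (at x) v) S"
    by (rule Ck_on_cong[OF assms(1) _ f'(2)[rule_format, of v]])
       (use f'(1) frechet_derivative_at in metis)
qed

definition C1_on :: "('e::euclidean_space \<Rightarrow> 'f::real_normed_vector) \<Rightarrow> 'e set \<Rightarrow> bool" where
  "C1_on f S \<longleftrightarrow> (\<forall>x\<in>S. f differentiable at x) \<and>
     (\<forall>v. continuous_on S (\<lambda>x. frechet_derivative f (at x) v))"

lemma smooth_on_C1: "open S \<Longrightarrow> smooth_on f S \<Longrightarrow> C1_on f S"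
  unfolding smooth_on_def C1_on_def
  using Ck_on_SucD[of S 0 f] Ck_on_SucD(1)[of S 0 f] by (metis Ck_on.simps(1))

lemma smooth_on_derivative:
  "open S \<Longrightarrow> smooth_on f S \<Longrightarrow> smooth_on (\<lambda>x. frechet_derivative f (at x) v) S"
  unfolding smooth_on_def using Ck_on_SucD(2) by blast

lemma C1_on_has_derivative:
  "C1_on f S \<Longrightarrow> x \<in> S \<Longrightarrow> (f has_derivative frechet_derivative f (at x)) (at x)"
  by (simp add: C1_on_def frechet_derivative_works)

lemma C1_on_continuous: "C1_on f S \<Longrightarrow> continuous_on S f"
  by (meson C1_on_def continuous_at_imp_continuous_on differentiable_imp_continuous_within)

lemma C1_onI:
  assumes "\<And>x. x \<in> S \<Longrightarrow> (f has_derivative f' x) (at x)" "\<And>v. continuous_on S (\<lambda>x. f' x v)"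
  shows "C1_on f S"
proof -
  have eq: "frechet_derivative f (at x) = f' x" if "x \<in> S" for x
    using assms(1)[OF that] frechet_derivative_at by metis
  show ?thesis
    unfolding C1_on_def
    using assms eq by (auto simp: differentiable_def cong: continuous_on_cong)
qed

lemma C1_on_cong:
  assumes "open S" "\<And>x. x \<in> S \<Longrightarrow> f x = h x" "C1_on f S"
  shows "C1_on h S"
proof (rule C1_onI)
  show "(h has_derivative frechet_derivative f (at x)) (at x)" if "x \<in> S" for x
    using has_derivative_transform_within_open[OF C1_on_has_derivative[OF assms(3) that] assms(1) that]
      assms(2) by auto
qed (use assms in \<open>auto simp: C1_on_def\<close>)

text \<open>Questions about a family of bilinear maps reduce through this to its finitely many
  coefficients on basis vectors.\<close>

lemma bilinear_basis_expand:
  fixes B :: "'e::euclidean_space \<Rightarrow> 'e \<Rightarrow> 'f::real_vector"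
  assumes "bilinear B"
  shows "B v w = (\<Sum>i\<in>Basis. \<Sum>j\<in>Basis. ((v \<bullet> i) * (w \<bullet> j)) *\<^sub>R B i j)"
proof -
  have "B v w = B (\<Sum>i\<in>Basis. (v \<bullet> i) *\<^sub>R i) (\<Sum>j\<in>Basis. (w \<bullet> j) *\<^sub>R j)"
    by (simp add: euclidean_representation)
  also have "\<dots> = (\<Sum>(i,j)\<in>Basis\<times>Basis. B ((v \<bullet> i) *\<^sub>R i) ((w \<bullet> j) *\<^sub>R j))"
    by (rule bilinear_sum[OF assms])
  also have "\<dots> = (\<Sum>i\<in>Basis. \<Sum>j\<in>Basis. ((v \<bullet> i) * (w \<bullet> j)) *\<^sub>R B i j)"
    by (simp add: sum.cartesian_product bilinear_lmul[OF assms] bilinear_rmul[OF assms] mult.commute)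
  finally show ?thesis .
qed

text \<open>The smoothness of the metric is given for fixed vectors only. This locale passes to
  joint differentiability in the point and both vectors; it is instantiated with the metric and with
  the Christoffel symbols.\<close>

locale C1_bilinear =
  fixes U :: "'e::euclidean_space set" and B :: "'e \<Rightarrow> 'e \<Rightarrow> 'e \<Rightarrow> 'f::real_normed_vector"
  assumes U: "open U"
    and bil: "x \<in> U \<Longrightarrow> bilinear (B x)"
    and C1: "C1_on (\<lambda>x. B x v w) U"
begin

definition d :: "'e \<Rightarrow> 'e \<Rightarrow> 'e \<Rightarrow> 'e \<Rightarrow> 'f" where
  "d x a v w = frechet_derivative (\<lambda>y. B y v w) (at x) a"

lemma has_derivative_d: "x \<in> U \<Longrightarrow> ((\<lambda>y. B y v w) has_derivative (\<lambda>a. d x a v w)) (at x)"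
  using C1_on_has_derivative[OF C1] by (simp add: d_def[abs_def])

lemma d_unique: "x \<in> U \<Longrightarrow> ((\<lambda>y. B y v w) has_derivative f') (at x) \<Longrightarrow> d x a v w = f' a"
  using has_derivative_unique[OF has_derivative_d] by metis

lemma linear_d: "x \<in> U \<Longrightarrow> linear (\<lambda>a. d x a v w)"
  using has_derivative_d has_derivative_linear by blast

lemma bilinear_d:
  assumes x: "x \<in> U"
  shows "bilinear (d x a)"
proof -
  note bl = bilinear_ladd[OF bil] bilinear_radd[OF bil] bilinear_lmul[OF bil] bilinear_rmul[OF bil]
  note tr = d_unique[OF x has_derivative_transform_within_open[OF _ U x]]
  have "d x a (v + v') w = d x a v w + d x a v' w" for v v' w
    by (rule tr[OF has_derivative_add[OF has_derivative_d[OF x] has_derivative_d[OF x]]]) (simp add: bl)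
  moreover have "d x a v (w + w') = d x a v w + d x a v w'" for v w w'
    by (rule tr[OF has_derivative_add[OF has_derivative_d[OF x] has_derivative_d[OF x]]]) (simp add: bl)
  moreover have "d x a (r *\<^sub>R v) w = r *\<^sub>R d x a v w" for v w r
    by (rule tr[OF has_derivative_scaleR_right[OF has_derivative_d[OF x]]]) (simp add: bl)
  moreover have "d x a v (r *\<^sub>R w) = r *\<^sub>R d x a v w" for v w r
    by (rule tr[OF has_derivative_scaleR_right[OF has_derivative_d[OF x]]]) (simp add: bl)
  ultimately show ?thesis by (auto simp: bilinear_def linear_iff)
qed

lemma joint_derivative:
  assumes x: "x \<in> U"
  shows "((\<lambda>(x, v, w). B x v w) has_derivative (\<lambda>(a, b, c). d x a v w + B x b w + B x v c)) (at (x, v, w))"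
proof -
  let ?h = "\<lambda>p. \<Sum>i\<in>Basis. \<Sum>j\<in>Basis. ((fst (snd p) \<bullet> i) * (snd (snd p) \<bullet> j)) *\<^sub>R B (fst p) i j"
  let ?h' = "\<lambda>q. \<Sum>i\<in>Basis. \<Sum>j\<in>Basis. ((v \<bullet> i) * (w \<bullet> j)) *\<^sub>R d x (fst q) i j
     + ((v \<bullet> i) * (snd (snd q) \<bullet> j) + (fst (snd q) \<bullet> i) * (w \<bullet> j)) *\<^sub>R B x i j"
  have f1: "((\<lambda>p. B (fst p) i j) has_derivative (\<lambda>q. d x (fst q) i j)) (at (x, v, w))" for i j
  proof -
    have "(fst has_derivative fst) (at (x, v, w))"
      by (rule bounded_linear.has_derivative[OF bounded_linear_fst has_derivative_ident])
    from has_derivative_compose[OF this, of "\<lambda>y. B y i j" "\<lambda>a. d x a i j"]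
    show ?thesis using has_derivative_d[OF x] by simp
  qed
  have f2: "((\<lambda>p. fst (snd p) \<bullet> i) has_derivative (\<lambda>q. fst (snd q) \<bullet> i)) (at (x, v, w))"
    and f3: "((\<lambda>p. snd (snd p) \<bullet> i) has_derivative (\<lambda>q. snd (snd q) \<bullet> i)) (at (x, v, w))" for i
    by (rule has_derivative_inner_left[OF has_derivative_fst[OF has_derivative_snd[OF has_derivative_ident]]]
        has_derivative_inner_left[OF has_derivative_snd[OF has_derivative_snd[OF has_derivative_ident]]])+
  have "((\<lambda>p. ((fst (snd p) \<bullet> i) * (snd (snd p) \<bullet> j)) *\<^sub>R B (fst p) i j) has_derivative
     (\<lambda>q. ((v \<bullet> i) * (w \<bullet> j)) *\<^sub>R d x (fst q) i j
     + ((v \<bullet> i) * (snd (snd q) \<bullet> j) + (fst (snd q) \<bullet> i) * (w \<bullet> j)) *\<^sub>R B x i j)) (at (x, v, w))" for i j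
    by (rule has_derivative_eq_rhs[OF has_derivative_scaleR[OF has_derivative_mult[OF f2 f3] f1]]) simp
  then have "(?h has_derivative ?h') (at (x, v, w))"
    by (intro has_derivative_sum)
  moreover have "?h' = (\<lambda>(a, b, c). d x a v w + B x b w + B x v c)"
  proof
    fix q
    have "?h' q = d x (fst q) v w + B x (fst (snd q)) w + B x v (snd (snd q))"
      unfolding bilinear_basis_expand[OF bilinear_d[OF x], of "fst q" v w]
        bilinear_basis_expand[OF bil[OF x], of "fst (snd q)" w]
        bilinear_basis_expand[OF bil[OF x], of v "snd (snd q)"] sum.distrib[symmetric]
      by (intro sum.cong refl) (simp add: scaleR_left_distrib)
    then show "?h' q = (case q of (a, b, c) \<Rightarrow> d x a v w + B x b w + B x v c)"
      by (simp add: case_prod_unfold)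
  qed
  ultimately have "(?h has_derivative (\<lambda>(a, b, c). d x a v w + B x b w + B x v c)) (at (x, v, w))"
    by simp
  then show ?thesis
  proof (rule has_derivative_transform_within_open)
    show "open (U \<times> (UNIV :: ('e \<times> 'e) set))" using U by (simp add: open_Times)
    fix p :: "'e \<times> 'e \<times> 'e" assume "p \<in> U \<times> UNIV"
    then show "?h p = (\<lambda>(x, v, w). B x v w) p"
      using bilinear_basis_expand[OF bil, of "fst p" "fst (snd p)" "snd (snd p)"]
      by (simp add: case_prod_unfold mem_Times_iff)
  qed (use x in auto)
qed

lemma curve_derivative:
  assumes "x t \<in> U" and "(x has_vector_derivative x') (at t within S)"
    "(v has_vector_derivative v') (at t within S)" "(w has_vector_derivative w') (at t within S)"
  shows "((\<lambda>t. B (x t) (v t) (w t)) has_vector_derivative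
     d (x t) x' (v t) (w t) + B (x t) v' (w t) + B (x t) (v t) w') (at t within S)"
proof -
  have "((\<lambda>t. (x t, v t, w t)) has_derivative (\<lambda>h. (h *\<^sub>R x', h *\<^sub>R v', h *\<^sub>R w'))) (at t within S)"
    using assms(2-4) unfolding has_vector_derivative_def by (intro has_derivative_Pair)
  from has_derivative_compose[OF this joint_derivative[OF assms(1)]]
  show ?thesis
    using linear_cmul[OF linear_d[OF assms(1)]] bilinear_lmul[OF bil[OF assms(1)]] bilinear_rmul[OF bil[OF assms(1)]]
    by (simp add: has_vector_derivative_def scaleR_add_right)
qed

lemma continuous_joint:
  assumes "continuous_on T x" "continuous_on T v" "continuous_on T w" "x ` T \<subseteq> U"
  shows "continuous_on T (\<lambda>t. B (x t) (v t) (w t))"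
proof -
  have "continuous_on T (\<lambda>t. \<Sum>i\<in>Basis. \<Sum>j\<in>Basis. ((v t \<bullet> i) * (w t \<bullet> j)) *\<^sub>R B (x t) i j)"
    using assms by (intro continuous_intros continuous_on_compose2[OF C1_on_continuous[OF C1]]) auto
  then show ?thesis
    by (rule continuous_on_eq) (rule bilinear_basis_expand[symmetric], use assms(4) bil in blast)
qed

lemma continuous_d:
  assumes "continuous_on T x" "continuous_on T v" "continuous_on T w" "x ` T \<subseteq> U"
  shows "continuous_on T (\<lambda>t. d (x t) a (v t) (w t))"
proof -
  have "continuous_on U (\<lambda>x. d x a i j)" for i j
    using C1[of i j] by (simp add: C1_on_def d_def)
  then have "continuous_on T (\<lambda>t. d (x t) a i j)" for i j
    by (rule continuous_on_compose2[OF _ assms(1,4)])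
  then have "continuous_on T (\<lambda>t. \<Sum>i\<in>Basis. \<Sum>j\<in>Basis. ((v t \<bullet> i) * (w t \<bullet> j)) *\<^sub>R d (x t) a i j)"
    using assms(2,3) by (intro continuous_on_sum continuous_on_scaleR continuous_on_mult continuous_on_inner continuous_on_const)
  then show ?thesis
    by (rule continuous_on_eq) (rule bilinear_basis_expand[symmetric], use assms(4) bilinear_d in blast)
qed

end

text \<open>Riesz representation with respect to \<open>B\<close>: positivity makes
  \<open>z \<mapsto> B z\<close> injective, hence surjective by dimension. Existence and uniqueness
  together justify the \<open>THE\<close> in \<open>christoffel\<close>.\<close>

lemma linear_functional_represent:
  fixes B :: "'e::euclidean_space \<Rightarrow> 'e \<Rightarrow> real"
  assumes "bilinear B" "\<And>v. v \<noteq> 0 \<Longrightarrow> B v v > 0" "linear \<beta>"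
  shows "\<exists>!z. \<forall>w. B z w = \<beta> w"
proof -
  let ?T = "\<lambda>z. \<Sum>i\<in>Basis. B z i *\<^sub>R i"
  have lin: "linear ?T"
    by (auto simp: linear_iff bilinear_ladd[OF assms(1)] bilinear_lmul[OF assms(1)] sum.distrib
        scaleR_left_distrib scaleR_sum_right)
  have Tin: "?T z \<bullet> w = B z w" for z w
  proof -
    have "B z w = B z (\<Sum>i\<in>Basis. (w \<bullet> i) *\<^sub>R i)" by (simp add: euclidean_representation)
    also have "\<dots> = (\<Sum>i\<in>Basis. (w \<bullet> i) * B z i)"
      using assms(1) by (simp add: bilinear_def linear_sum linear_cmul)
    finally show ?thesis by (simp add: inner_sum_left inner_commute[of w] mult.commute)
  qed
  have inj: "inj ?T"
  proof (rule linear_injective_0[OF lin, THEN iffD2], intro allI impI)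
    fix v assume "?T v = 0"
    then have "B v v = 0" using Tin[of v v] by simp
    then show "v = 0" using assms(2)[of v] by fastforce
  qed
  have \<beta>: "\<beta> w = (\<Sum>i\<in>Basis. \<beta> i *\<^sub>R i) \<bullet> w" for w
  proof -
    have "\<beta> w = \<beta> (\<Sum>i\<in>Basis. (w \<bullet> i) *\<^sub>R i)" by (simp add: euclidean_representation)
    also have "\<dots> = (\<Sum>i\<in>Basis. (w \<bullet> i) * \<beta> i)" using assms(3) by (simp add: linear_sum linear_cmul)
    finally show ?thesis by (simp add: inner_sum_left inner_commute[of w] mult.commute)
  qed
  have "surj ?T" by (rule linear_injective_imp_surjective[OF lin inj refl])
  from surjD[OF this, of "\<Sum>i\<in>Basis. \<beta> i *\<^sub>R i"]
  obtain z where z0: "?T z = (\<Sum>i\<in>Basis. \<beta> i *\<^sub>R i)" by fastforce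
  have z: "B z w = \<beta> w" for w
    by (rule trans[OF Tin[symmetric] trans[OF arg_cong[OF z0, of "\<lambda>u. u \<bullet> w"] \<beta>[symmetric]]])
  show ?thesis
  proof (rule ex1I[of _ z])
    fix y assume y: "\<forall>w. B y w = \<beta> w"
    then have "?T y \<bullet> w = ?T z \<bullet> w" for w using Tin z by simp
    then have "?T y = ?T z" by (meson vector_eq_rdot)
    then show "y = z" using injD[OF inj, of y z] by blast
  qed (use z in auto)
qed

text \<open>A product rule in which the second factor is merely continuous: the vanishing of the
  first factor at \<open>x\<close> absorbs the variation of the second.\<close>

lemma has_derivative_scaleR_vanishing:
  fixes r :: "'e::real_normed_vector \<Rightarrow> real" and q :: "'e \<Rightarrow> 'f::real_normed_vector"
  assumes r: "(r has_derivative r') (at x)" "r x = 0" and q: "isCont q x"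
  shows "((\<lambda>y. r y *\<^sub>R q y) has_derivative (\<lambda>a. r' a *\<^sub>R q x)) (at x)"
proof -
  have bl: "bounded_linear r'" using r(1) has_derivative_bounded_linear by blast
  obtain K where K: "K > 0" "\<And>a. norm (r' a) \<le> norm a * K"
    using bounded_linear.pos_bounded[OF bl] by blast
  have "((\<lambda>y. r y *\<^sub>R (q y - q x)) has_derivative (\<lambda>a. 0)) (at x)"
    unfolding has_derivative_at_alt
  proof (intro conjI allI impI)
    fix e :: real assume "e > 0"
    obtain d1 where d1: "d1 > 0" "\<And>y. norm (y - x) < d1 \<Longrightarrow> norm (r y - r x - r' (y - x)) \<le> 1 * norm (y - x)"
      using r(1) unfolding has_derivative_at_alt using zero_less_one by blast
    obtain d2 where d2: "d2 > 0" "\<And>y. norm (y - x) < d2 \<Longrightarrow> norm (q y - q x) < e / (K + 1)"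
      using q \<open>e > 0\<close> K unfolding continuous_at_eps_delta dist_norm
      by (metis add_pos_pos divide_pos_pos zero_less_one)
    have "norm (r y *\<^sub>R (q y - q x)) \<le> e * norm (y - x)" if "norm (y - x) < min d1 d2" for y
    proof -
      have "norm (r y) \<le> norm (r y - r x - r' (y - x)) + norm (r' (y - x))"
        using r(2) norm_triangle_ineq[of "r y - r' (y - x)" "r' (y - x)"] by simp
      also have "\<dots> \<le> (K + 1) * norm (y - x)"
        using d1(2)[of y] K(2)[of "y - x"] that by (simp add: algebra_simps)
      finally have "norm (r y *\<^sub>R (q y - q x)) \<le> ((K + 1) * norm (y - x)) * (e / (K + 1))"
        unfolding norm_scaleR using d2(2)[of y] that K(1) by (intro mult_mono) auto
      also have "\<dots> = e * norm (y - x)" using K by simp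
      finally show ?thesis .
    qed
    then show "\<exists>d>0. \<forall>y. norm (y - x) < d \<longrightarrow>
        norm (r y *\<^sub>R (q y - q x) - r x *\<^sub>R (q x - q x) - 0) \<le> e * norm (y - x)"
      using d1 d2 by (intro exI[of _ "min d1 d2"]) auto
  qed auto
  moreover have "((\<lambda>y. r y *\<^sub>R q x) has_derivative (\<lambda>a. r' a *\<^sub>R q x)) (at x)"
    using r(1) by (rule has_derivative_scaleR_left)
  ultimately have "((\<lambda>y. r y *\<^sub>R (q y - q x) + r y *\<^sub>R q x) has_derivative (\<lambda>a. 0 + r' a *\<^sub>R q x)) (at x)"
    by (rule has_derivative_add)
  then show ?thesis by (simp add: algebra_simps)
qed

locale C1_inner = C1_bilinear U B for U :: "'e::euclidean_space set" and B :: "'e \<Rightarrow> 'e \<Rightarrow> 'e \<Rightarrow> real" +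
  assumes pos: "x \<in> U \<Longrightarrow> v \<noteq> 0 \<Longrightarrow> B x v v > 0"
begin

text \<open>Extrema on the compact set \<open>K \<times> sphere 0 1\<close>, extended to all vectors
  by homogeneity.\<close>

lemma norm_equiv:
  assumes "compact K" "K \<subseteq> U"
  obtains m M where "m > 0" "M > 0" "\<And>x v. x \<in> K \<Longrightarrow> m * (norm v)\<^sup>2 \<le> B x v v \<and> B x v v \<le> M * (norm v)\<^sup>2"
proof (cases "K = {}")
  case True
  then show thesis using that[of 1 1] by auto
next
  case False
  let ?S = "K \<times> sphere (0::'e) 1"
  have "compact ?S" using assms by (simp add: compact_Times)
  moreover have "?S \<noteq> {}" using False by (simp add: sphere_empty)
  moreover have cont: "continuous_on ?S (\<lambda>p. B (fst p) (snd p) (snd p))"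
    using assms by (intro continuous_joint continuous_intros) auto
  ultimately obtain p q where p: "p \<in> ?S" "\<And>y. y \<in> ?S \<Longrightarrow> B (fst p) (snd p) (snd p) \<le> B (fst y) (snd y) (snd y)"
    and q: "q \<in> ?S" "\<And>y. y \<in> ?S \<Longrightarrow> B (fst q) (snd q) (snd q) \<ge> B (fst y) (snd y) (snd y)"
    using continuous_attains_inf[OF _ _ cont] continuous_attains_sup[OF _ _ cont] by blast
  have pp: "B (fst r) (snd r) (snd r) > 0" if "r \<in> ?S" for r
    using that assms pos[of "fst r" "snd r"] by force
  show thesis
  proof (rule that[OF pp[OF p(1)] pp[OF q(1)]])
    fix x v assume x: "x \<in> K"
    show "B (fst p) (snd p) (snd p) * (norm v)\<^sup>2 \<le> B x v v \<and> B x v v \<le> B (fst q) (snd q) (snd q) * (norm v)\<^sup>2"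
    proof (cases "v = 0")
      case True
      then show ?thesis using bilinear_lzero[OF bil] x assms by auto
    next
      case False
      define u where "u = v /\<^sub>R norm v"
      have v: "v = norm v *\<^sub>R u" "norm u = 1" using False by (auto simp: u_def)
      have bx: "bilinear (B x)" using bil x assms by blast
      have "B x v v = (norm v)\<^sup>2 * B x u u"
        by (subst (1 2) v(1), subst bilinear_lmul[OF bx], subst bilinear_rmul[OF bx]) (simp add: power2_eq_square)
      moreover have "B (fst p) (snd p) (snd p) \<le> B x u u" "B x u u \<le> B (fst q) (snd q) (snd q)"
        using p(2)[of "(x, u)"] q(2)[of "(x, u)"] x v(2) by auto
      ultimately show ?thesis by (simp add: mult.commute[of "(norm v)\<^sup>2"] mult_right_mono)
    qed
  qed
qed

text \<open>Positivity replaces the inversion of a matrix: for \<open>e = q y - q x\<close> the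
  quantity \<open>m * norm e * norm e\<close> is at most \<open>B y e e\<close>, and by the defining
  equations this is the difference of \<open>B x\<close> and \<open>B y\<close> at
  \<open>(q x, e)\<close>.\<close>

lemma continuous_dual:
  assumes q: "\<And>x w. x \<in> U \<Longrightarrow> B x (q x) w = w \<bullet> b"
  shows "continuous_on U q"
  unfolding continuous_on_eq_continuous_at[OF U]
proof
  fix x assume x: "x \<in> U"
  obtain r where r: "r > 0" "cball x r \<subseteq> U" using U x open_contains_cball by blast
  obtain m M where m: "m > 0" "\<And>y v. y \<in> cball x r \<Longrightarrow> m * (norm v)\<^sup>2 \<le> B y v v"
    using norm_equiv[OF compact_cball r(2)] by metis
  have est: "norm (q y - q x) \<le> (\<Sum>j\<in>Basis. \<bar>B x (q x) j - B y (q x) j\<bar>) / m" if y: "y \<in> cball x r" for y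
  proof (cases "q y = q x")
    case True
    then show ?thesis using m by (simp add: sum_nonneg)
  next
    case False
    define e where "e = q y - q x"
    have yU: "y \<in> U" using y r by blast
    have "m * (norm e)\<^sup>2 \<le> B y e e" using m y by blast
    also have "B y e e = B x (q x) e - B y (q x) e"
      using q[OF yU, of e] q[OF x, of e] by (simp add: e_def bilinear_lsub[OF bil[OF yU]])
    also have "\<dots> = (\<Sum>j\<in>Basis. (e \<bullet> j) * (B x (q x) j - B y (q x) j))"
    proof -
      have lx: "linear (\<lambda>w. B x (q x) w - B y (q x) w)"
        using bil[OF x] bil[OF yU] by (auto simp: bilinear_def intro!: linear_compose_sub)
      have "B x (q x) e - B y (q x) e = (\<lambda>w. B x (q x) w - B y (q x) w) (\<Sum>j\<in>Basis. (e \<bullet> j) *\<^sub>R j)"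
        by (simp add: euclidean_representation)
      also have "\<dots> = (\<Sum>j\<in>Basis. (e \<bullet> j) * (B x (q x) j - B y (q x) j))"
        by (simp only: linear_sum[OF lx] linear_cmul[OF lx] real_scaleR_def)
      finally show ?thesis .
    qed
    also have "\<dots> \<le> (\<Sum>j\<in>Basis. norm e * \<bar>B x (q x) j - B y (q x) j\<bar>)"
    proof (rule sum_mono)
      fix j :: 'e assume j: "j \<in> Basis"
      have "(e \<bullet> j) * (B x (q x) j - B y (q x) j) \<le> \<bar>e \<bullet> j\<bar> * \<bar>B x (q x) j - B y (q x) j\<bar>"
        by (metis abs_ge_self abs_mult)
      also have "\<dots> \<le> norm e * \<bar>B x (q x) j - B y (q x) j\<bar>"
        using Basis_le_norm[OF j] by (intro mult_right_mono) auto
      finally show "(e \<bullet> j) * (B x (q x) j - B y (q x) j) \<le> norm e * \<bar>B x (q x) j - B y (q x) j\<bar>" .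
    qed
    finally have "(m * norm e) * norm e \<le> (\<Sum>j\<in>Basis. \<bar>B x (q x) j - B y (q x) j\<bar>) * norm e"
      by (simp add: sum_distrib_left sum_distrib_right power2_eq_square mult.commute mult.left_commute)
    then have "m * norm e \<le> (\<Sum>j\<in>Basis. \<bar>B x (q x) j - B y (q x) j\<bar>)"
      using False by (simp add: e_def)
    then show ?thesis using m(1) by (simp add: e_def field_simps)
  qed
  have "((\<lambda>y. (\<Sum>j\<in>Basis. \<bar>B x (q x) j - B y (q x) j\<bar>) / m) \<longlongrightarrow> (\<Sum>j\<in>Basis. \<bar>B x (q x) j - B x (q x) j\<bar>) / m) (at x)"
  proof (intro tendsto_intros)
    show "((\<lambda>y. B y (q x) j) \<longlongrightarrow> B x (q x) j) (at x)" for j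
      using C1_on_continuous[OF C1] x U continuous_on_eq_continuous_at isContD by fastforce
  qed (use m in auto)
  then have "((\<lambda>y. (\<Sum>j\<in>Basis. \<bar>B x (q x) j - B y (q x) j\<bar>) / m) \<longlongrightarrow> 0) (at x)" by simp
  moreover have "eventually (\<lambda>y. norm (q y - q x) \<le> (\<Sum>j\<in>Basis. \<bar>B x (q x) j - B y (q x) j\<bar>) / m) (at x)"
    using r(1) est by (intro eventually_at_ball'[THEN eventually_mono, of r]) auto
  ultimately have "((\<lambda>y. q y - q x) \<longlongrightarrow> 0) (at x)"
    by (rule Lim_null_comparison[rotated])
  then show "isCont q x" by (simp add: isCont_def LIM_zero_iff)
qed

text \<open>No inverse matrix is differentiated: \<open>z y - z x\<close> is expanded in the dual
  vectors \<open>q j y\<close> with coefficients that vanish at \<open>y = x\<close>, so continuity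
  of \<open>q\<close> suffices. Its use is the regularity of the Christoffel symbols.\<close>

lemma C1_solution:
  assumes \<beta>: "\<And>w. C1_on (\<lambda>x. \<beta> x w) U" "\<And>x. x \<in> U \<Longrightarrow> linear (\<beta> x)"
    and z: "\<And>x w. x \<in> U \<Longrightarrow> B x (z x) w = \<beta> x w"
  shows "C1_on z U"
proof -
  have "\<exists>q. \<forall>w. B x q w = w \<bullet> b" if "x \<in> U" for x b
  proof -
    have "linear (\<lambda>w. w \<bullet> b)" by (simp add: linear_iff inner_add_left)
    then show ?thesis using linear_functional_represent[OF bil[OF that] pos[OF that]] by blast
  qed
  then have "\<forall>b x. \<exists>q. x \<in> U \<longrightarrow> (\<forall>w. B x q w = w \<bullet> b)" by blast
  then obtain q where q: "\<And>x b w. x \<in> U \<Longrightarrow> B x (q b x) w = w \<bullet> b" by metis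
  have contq: "continuous_on U (q b)" for b using continuous_dual q by blast
  have diff: "z y - z x = (\<Sum>j\<in>Basis. (\<beta> y j - B y (z x) j) *\<^sub>R q j y)" if x: "x \<in> U" and y: "y \<in> U" for x y
  proof -
    have l: "linear (\<lambda>w. \<beta> y w - B y (z x) w)"
      using bil[OF y] \<beta>(2)[OF y] by (auto simp: bilinear_def intro!: linear_compose_sub)
    have 1: "B y (\<Sum>j\<in>Basis. (\<beta> y j - B y (z x) j) *\<^sub>R q j y) w = \<beta> y w - B y (z x) w" for w
    proof -
      have ly: "linear (\<lambda>v. B y v w)" using bil[OF y] by (simp add: bilinear_def)
      have "B y (\<Sum>j\<in>Basis. (\<beta> y j - B y (z x) j) *\<^sub>R q j y) w = (\<Sum>j\<in>Basis. (\<beta> y j - B y (z x) j) * (w \<bullet> j))"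
        by (simp only: linear_sum[OF ly] linear_cmul[OF ly] q[OF y] real_scaleR_def)
      also have "\<dots> = (\<lambda>w. \<beta> y w - B y (z x) w) (\<Sum>j\<in>Basis. (w \<bullet> j) *\<^sub>R j)"
        by (simp only: linear_sum[OF l] linear_cmul[OF l] real_scaleR_def) (simp add: mult.commute)
      finally show ?thesis by (simp add: euclidean_representation)
    qed
    have 2: "B y (z y - z x) w = \<beta> y w - B y (z x) w" for w
      using z[OF y] by (simp add: bilinear_lsub[OF bil[OF y]])
    note ex = linear_functional_represent[OF bil[OF y] pos[OF y] l]
    show ?thesis
      by (rule trans[OF the1_equality[OF ex, symmetric] the1_equality[OF ex]]) (use 1 2 in auto)
  qed
  let ?z' = "\<lambda>x a. \<Sum>j\<in>Basis. (frechet_derivative (\<lambda>y. \<beta> y j) (at x) a - d x a (z x) j) *\<^sub>R q j x"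
  have der: "(z has_derivative ?z' x) (at x)" if x: "x \<in> U" for x
  proof -
    have "((\<lambda>y. (\<beta> y j - B y (z x) j) *\<^sub>R q j y) has_derivative
        (\<lambda>a. (frechet_derivative (\<lambda>y. \<beta> y j) (at x) a - d x a (z x) j) *\<^sub>R q j x)) (at x)" for j
    proof (rule has_derivative_scaleR_vanishing)
      show "((\<lambda>y. \<beta> y j - B y (z x) j) has_derivative (\<lambda>a. frechet_derivative (\<lambda>y. \<beta> y j) (at x) a - d x a (z x) j)) (at x)"
        using has_derivative_diff[OF C1_on_has_derivative[OF \<beta>(1) x] has_derivative_d[OF x]] .
    qed (use z[OF x] contq x continuous_on_eq_continuous_at[OF U] in auto)
    then have "((\<lambda>y. \<Sum>j\<in>Basis. (\<beta> y j - B y (z x) j) *\<^sub>R q j y) has_derivative ?z' x) (at x)"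
      by (rule has_derivative_sum)
    then have "((\<lambda>y. z x + (\<Sum>j\<in>Basis. (\<beta> y j - B y (z x) j) *\<^sub>R q j y)) has_derivative (\<lambda>a. 0 + ?z' x a)) (at x)"
      by (intro has_derivative_add has_derivative_const)
    moreover have "z x + (\<Sum>j\<in>Basis. (\<beta> y j - B y (z x) j) *\<^sub>R q j y) = z y" if "y \<in> U" for y
      using diff[OF x that] by (metis add.commute diff_add_cancel)
    ultimately show ?thesis
      using has_derivative_transform_within_open[OF _ U x, of "\<lambda>y. z x + (\<Sum>j\<in>Basis. (\<beta> y j - B y (z x) j) *\<^sub>R q j y)"] by simp
  qed
  have contz: "continuous_on U z"
    using der by (meson continuous_at_imp_continuous_on has_derivative_continuous)
  show ?thesis
  proof (rule C1_onI[OF der])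
    fix a
    show "continuous_on U (\<lambda>x. ?z' x a)"
    proof (intro continuous_on_sum continuous_on_scaleR continuous_on_diff contq)
      show "continuous_on U (\<lambda>x. frechet_derivative (\<lambda>y. \<beta> y j) (at x) a)" for j
        using \<beta>(1) by (simp add: C1_on_def)
      show "continuous_on U (\<lambda>x. d x a (z x) j)" for j
        using continuous_d[OF continuous_on_id contz continuous_on_const] by simp
    qed
  qed
qed

end

section \<open>Christoffel symbols and the Jacobi inequality\<close>

lemma bilinear_Cauchy_Schwarz:
  fixes B :: "'e::real_vector \<Rightarrow> 'e \<Rightarrow> real"
  assumes B: "bilinear B" and sym: "\<And>u v. B u v = B v u" and pos: "\<And>v. v \<noteq> 0 \<Longrightarrow> B v v > 0"
  shows "(B u v)\<^sup>2 \<le> B u u * B v v"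
proof (cases "v = 0")
  case True
  then show ?thesis by (simp add: bilinear_rzero[OF B])
next
  case False
  then have v: "B v v > 0" by (rule pos)
  define s where "s = B u v / B v v"
  have "0 \<le> B (u - s *\<^sub>R v) (u - s *\<^sub>R v)"
    using pos[of "u - s *\<^sub>R v"] bilinear_lzero[OF B] by (cases "u - s *\<^sub>R v = 0") auto
  also have "\<dots> = B u u - 2 * s * B u v + s\<^sup>2 * B v v"
    by (simp add: bilinear_lsub[OF B] bilinear_rsub[OF B] bilinear_lmul[OF B] bilinear_rmul[OF B]
        sym[of v u] power2_eq_square algebra_simps)
  also have "\<dots> = B u u - (B u v)\<^sup>2 / B v v"
    using v by (simp add: s_def power2_eq_square)
  finally show ?thesis using v by (simp add: field_simps)
qed

text \<open>The assumption \<open>key\<close> says that the second derivative of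
  \<open>sqrt f\<close> is nonnegative where \<open>f\<close> is positive. With
  \<open>f 0 = 0\<close>, convexity puts \<open>sqrt f\<close> below the chord over
  \<open>{0..1}\<close>.\<close>

lemma sqrt_convex_bound:
  fixes f f1 f2 :: "real \<Rightarrow> real"
  assumes cont: "continuous_on {0..1} f" and nonneg: "\<And>t. t \<in> {0..1} \<Longrightarrow> f t \<ge> 0" and f0: "f 0 = 0"
    and d1: "\<And>t. t \<in> {0<..<1} \<Longrightarrow> (f has_real_derivative f1 t) (at t)"
    and d2: "\<And>t. t \<in> {0<..<1} \<Longrightarrow> (f1 has_real_derivative f2 t) (at t)"
    and f2: "\<And>t. t \<in> {0<..<1} \<Longrightarrow> f2 t \<ge> 0"
    and key: "\<And>t. t \<in> {0<..<1} \<Longrightarrow> (f1 t)\<^sup>2 \<le> 2 * f t * f2 t"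
    and s: "s \<in> {0..1}"
  shows "sqrt (f s) \<le> s * sqrt (f 1)"
proof -
  \<comment> \<open>\<open>sqrt f\<close> need not be differentiable where \<open>f\<close> vanishes, hence the shift by \<open>e\<close>.\<close>
  have conv: "sqrt (f s + e) \<le> (1 - s) * sqrt e + s * sqrt (f 1 + e)" if e: "e > 0" for e
  proof -
    define h where "h = (\<lambda>t. sqrt (f t + e))"
    have pos: "f t + e > 0" if "t \<in> {0..1}" for t using nonneg[OF that] e by simp
    have hpos: "h t > 0" "(h t)\<^sup>2 = f t + e" if "t \<in> {0..1}" for t
      using pos[OF that] by (auto simp: h_def)
    have dh: "(h has_real_derivative f1 t / (2 * h t)) (at t)" if t: "t \<in> {0<..<1}" for t
    proof -
      have "(h has_real_derivative f1 t * (inverse (sqrt (f t + e)) / 2)) (at t)"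
        unfolding h_def using pos[of t] d1[OF t] t by (auto intro!: derivative_eq_intros)
      then show ?thesis by (simp add: h_def field_simps)
    qed
    have dh2: "((\<lambda>t. f1 t / (2 * h t)) has_real_derivative
        (f2 t * (2 * h t) - f1 t * (f1 t / h t)) / (2 * h t)\<^sup>2) (at t)" if t: "t \<in> {0<..<1}" for t
      using hpos[of t] t d2[OF t] dh[OF t]
      by (auto intro!: derivative_eq_intros simp: power2_eq_square)
    have nn: "(f2 t * (2 * h t) - f1 t * (f1 t / h t)) / (2 * h t)\<^sup>2 \<ge> 0" if t: "t \<in> {0<..<1}" for t
    proof -
      have "(f1 t)\<^sup>2 \<le> 2 * (f t + e) * f2 t"
        using key[OF t] mult_nonneg_nonneg[OF less_imp_le[OF e] f2[OF t]] by (simp add: algebra_simps)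
      then have "(f1 t)\<^sup>2 \<le> 2 * (h t)\<^sup>2 * f2 t" using hpos[of t] t by simp
      then have "(f1 t)\<^sup>2 / h t \<le> 2 * (h t)\<^sup>2 * f2 t / h t"
        using hpos(1)[of t] t by (intro divide_right_mono) auto
      also have "\<dots> = f2 t * (2 * h t)" using hpos(1)[of t] t by (simp add: power2_eq_square)
      finally have "f1 t * (f1 t / h t) \<le> f2 t * (2 * h t)" by (simp add: power2_eq_square)
      then show ?thesis by simp
    qed
    have conv: "convex_on {0<..<1} h"
      by (rule f''_ge0_imp_convex[OF _ dh dh2 nn]) auto
    have hc: "continuous_on {0..1} h" unfolding h_def using cont by (intro continuous_intros)
    \<comment> \<open>Derivatives are available in the open interval only, so convexity is carried
      to the end points \<open>0\<close> and \<open>1\<close> by a limit.\<close>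
    define a where "a = (\<lambda>n. inverse (real (n + 2)))"
    define b where "b = (\<lambda>n. 1 - inverse (real (n + 2)))"
    have ab: "a n \<in> {0<..<1}" "b n \<in> {0<..<1}" for n by (auto simp: a_def b_def field_simps)
    have a0: "a \<longlonglongrightarrow> 0"
      unfolding a_def by (rule LIMSEQ_ignore_initial_segment[OF lim_inverse_n, of 2])
    have b1: "b \<longlonglongrightarrow> 1"
      using tendsto_diff[OF tendsto_const a0, of 1] by (simp add: b_def a_def)
    have lh: "(\<lambda>n. h (u n)) \<longlonglongrightarrow> h t" if "u \<longlonglongrightarrow> t" "\<And>n. u n \<in> {0..1}" "t \<in> {0..1}" for u t
      using continuous_on_tendsto_compose[OF hc that(1,3)] that(2) by simp
    have ineq: "h ((1 - s) * a n + s * b n) \<le> (1 - s) * h (a n) + s * h (b n)" for n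
      using convex_onD[OF conv, of s "a n" "b n"] ab s by simp
    have in01: "(1 - s) * a n + s * b n \<in> {0..1}" for n
    proof -
      have "(1 - s) * a n + s * b n \<le> (1 - s) * 1 + s * 1"
        using ab[of n] s by (intro add_mono mult_left_mono) auto
      then show ?thesis using ab[of n] s by simp
    qed
    have "h ((1 - s) * 0 + s * 1) \<le> (1 - s) * h 0 + s * h 1"
    proof (rule LIMSEQ_le)
      show "(\<lambda>n. h ((1 - s) * a n + s * b n)) \<longlonglongrightarrow> h ((1 - s) * 0 + s * 1)"
        using in01 s by (intro lh tendsto_intros a0 b1) auto
      show "(\<lambda>n. (1 - s) * h (a n) + s * h (b n)) \<longlonglongrightarrow> (1 - s) * h 0 + s * h 1"
        using ab by (intro tendsto_intros lh a0 b1) (auto simp: less_imp_le)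
    qed (use ineq in auto)
    then show ?thesis using f0 by (simp add: h_def)
  qed
  have "((\<lambda>e. sqrt (f s + e)) \<longlongrightarrow> sqrt (f s + 0)) (at_right 0)"
    by (intro tendsto_intros)
  moreover have "((\<lambda>e. (1 - s) * sqrt e + s * sqrt (f 1 + e)) \<longlongrightarrow> (1 - s) * sqrt 0 + s * sqrt (f 1 + 0)) (at_right 0)"
    by (intro tendsto_intros)
  ultimately have "sqrt (f s + 0) \<le> (1 - s) * sqrt 0 + s * sqrt (f 1 + 0)"
    by (intro tendsto_le[where f="\<lambda>e. (1 - s) * sqrt e + s * sqrt (f 1 + e)" and g="\<lambda>e. sqrt (f s + e)" and F="at_right 0"])
       (use conv in \<open>auto intro!: eventually_at_rightI[of 0 1]\<close>)
  then show ?thesis by simp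
qed

context riemannian_metric begin

lemma C1_metric: "c \<in> A \<Longrightarrow> C1_inner (chart_img c) (g c)"
  by unfold_locales
     (use chart_img_open metric_bilinear metric_pos smooth_on_C1[OF chart_img_open metric_smooth] in blast)+

abbreviation dg :: "('a, 'e) chart \<Rightarrow> 'e \<Rightarrow> 'e \<Rightarrow> 'e \<Rightarrow> 'e \<Rightarrow> real" where
  "dg c \<equiv> C1_bilinear.d (g c)"

abbreviation d\<Gamma> :: "('a, 'e) chart \<Rightarrow> 'e \<Rightarrow> 'e \<Rightarrow> 'e \<Rightarrow> 'e \<Rightarrow> 'e" where
  "d\<Gamma> c \<equiv> C1_bilinear.d (christoffel c)"

lemma d_metric_def: "c \<in> A \<Longrightarrow> dg c x a v w = frechet_derivative (\<lambda>y. g c y v w) (at x) a"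
proof -
  assume c: "c \<in> A"
  interpret M: C1_inner "chart_img c" "g c" using C1_metric[OF c] .
  show ?thesis by (rule M.d_def)
qed

lemma dg_sym:
  assumes c: "c \<in> A" and x: "x \<in> chart_img c"
  shows "dg c x a v w = dg c x a w v"
proof -
  interpret M: C1_inner "chart_img c" "g c" using C1_metric[OF c] .
  have "((\<lambda>y. g c y v w) has_derivative (\<lambda>a. dg c x a w v)) (at x)"
    by (rule has_derivative_transform_within_open[OF M.has_derivative_d[OF x] M.U x])
       (rule metric_sym[OF c])
  then show ?thesis by (rule M.d_unique[OF x])
qed

lemma koszul_linear:
  assumes c: "c \<in> A" and x: "x \<in> chart_img c"
  shows "linear (\<lambda>w. (dg c x u v w + dg c x v u w - dg c x w u v) / 2)"
proof -
  interpret M: C1_inner "chart_img c" "g c" using C1_metric[OF c] .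
  have "linear (\<lambda>w. dg c x u v w)" "linear (\<lambda>w. dg c x v u w)" "linear (\<lambda>w. dg c x w u v)"
    using M.bilinear_d[OF x] M.linear_d[OF x] by (auto simp: bilinear_def)
  then show ?thesis by (auto simp: linear_iff field_simps)
qed

text \<open>Two faces of the definition by \<open>THE\<close>: the Koszul identity, and uniqueness,
  by which the algebraic rules for the symbols are verified.\<close>

lemma christoffel_works:
  assumes c: "c \<in> A" and x: "x \<in> chart_img c"
  shows christoffel_eq: "g c x (christoffel c x u v) w = (dg c x u v w + dg c x v u w - dg c x w u v) / 2"
    and christoffel_unique: "(\<And>w. g c x z w = (dg c x u v w + dg c x v u w - dg c x w u v) / 2) \<Longrightarrow>
      christoffel c x u v = z"
proof -
  interpret M: C1_inner "chart_img c" "g c" using C1_metric[OF c] .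
  have *: "christoffel c x u v = (THE z. \<forall>w. g c x z w = (dg c x u v w + dg c x v u w - dg c x w u v) / 2)"
    unfolding christoffel_def d_metric_def[OF c]
    by (intro arg_cong[where f=The] ext iff_allI) (auto simp: field_simps)
  note ex = linear_functional_represent[OF M.bil[OF x] M.pos[OF x] koszul_linear[OF c x]]
  show "g c x (christoffel c x u v) w = (dg c x u v w + dg c x v u w - dg c x w u v) / 2"
    using theI'[OF ex] unfolding * by blast
  show "christoffel c x u v = z" if "\<And>w. g c x z w = (dg c x u v w + dg c x v u w - dg c x w u v) / 2"
    unfolding * using that by (intro the1_equality[OF ex]) auto
qed

lemma christoffel_sym:
  assumes c: "c \<in> A" and x: "x \<in> chart_img c"
  shows "christoffel c x u v = christoffel c x v u"
  by (rule christoffel_unique[OF c x]) (simp add: christoffel_eq[OF c x] dg_sym[OF c x, of _ u v])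

lemma bilinear_christoffel:
  assumes c: "c \<in> A" and x: "x \<in> chart_img c"
  shows "bilinear (christoffel c x)"
proof -
  interpret M: C1_inner "chart_img c" "g c" using C1_metric[OF c] .
  note b = M.bil[OF x] and bd = M.bilinear_d[OF x]
  have add: "christoffel c x (u + u') v = christoffel c x u v + christoffel c x u' v" for u u' v
    by (rule christoffel_unique[OF c x])
       (simp add: bilinear_ladd[OF b] christoffel_eq[OF c x] bilinear_ladd[OF bd] bilinear_radd[OF bd]
          linear_add[OF M.linear_d[OF x]] field_simps)
  have scale: "christoffel c x (r *\<^sub>R u) v = r *\<^sub>R christoffel c x u v" for r u v
    by (rule christoffel_unique[OF c x])
       (simp add: bilinear_lmul[OF b] christoffel_eq[OF c x] bilinear_lmul[OF bd] bilinear_rmul[OF bd]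
          linear_cmul[OF M.linear_d[OF x]] field_simps)
  show ?thesis
    unfolding bilinear_def linear_iff
    using add scale christoffel_sym[OF c x] by metis
qed

text \<open>The symbols solve a linear system whose matrix is the metric and whose right side
  consists of first derivatives of the metric, which are still C1.\<close>

lemma C1_christoffel:
  assumes c: "c \<in> A"
  shows "C1_bilinear (chart_img c) (christoffel c)"
proof
  interpret M: C1_inner "chart_img c" "g c" using C1_metric[OF c] .
  show "open (chart_img c)" using chart_img_open c .
  show "bilinear (christoffel c x)" if "x \<in> chart_img c" for x using bilinear_christoffel[OF c that] .
  fix u v
  have sm: "smooth_on (\<lambda>x. dg c x a v w) (chart_img c)" for a v w
    unfolding d_metric_def[OF c] by (rule smooth_on_derivative[OF M.U metric_smooth[OF c]])
  have C: "C1_on (\<lambda>x. dg c x a v w) (chart_img c)" for a v w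
    by (rule smooth_on_C1[OF M.U sm])
  show "C1_on (\<lambda>x. christoffel c x u v) (chart_img c)"
  proof (rule M.C1_solution[where \<beta> = "\<lambda>x w. (dg c x u v w + dg c x v u w - dg c x w u v) / 2"])
    fix w
    let ?D = "\<lambda>a v w x. frechet_derivative (\<lambda>x. dg c x a v w) (at x)"
    show "C1_on (\<lambda>x. (dg c x u v w + dg c x v u w - dg c x w u v) / 2) (chart_img c)"
    proof (rule C1_onI)
      fix x assume x: "x \<in> chart_img c"
      have "((\<lambda>x. (dg c x u v w + dg c x v u w - dg c x w u v) * (1/2)) has_derivative
        (\<lambda>b. (?D u v w x b + ?D v u w x b - ?D w u v x b) * (1/2))) (at x)"
        by (intro has_derivative_mult_left has_derivative_add has_derivative_diff C1_on_has_derivative[OF C x])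
      then show "((\<lambda>x. (dg c x u v w + dg c x v u w - dg c x w u v) / 2) has_derivative
        (\<lambda>b. (?D u v w x b + ?D v u w x b - ?D w u v x b) * (1/2))) (at x)"
        by simp
    next
      fix b
      show "continuous_on (chart_img c) (\<lambda>x. (?D u v w x b + ?D v u w x b - ?D w u v x b) * (1/2))"
        using C by (intro continuous_on_mult continuous_on_add continuous_on_diff continuous_on_const) (auto simp: C1_on_def)
    qed
  qed (use koszul_linear christoffel_eq c in auto)
qed

lemma metric_compatible:
  assumes c: "c \<in> A" and x: "x \<in> chart_img c"
  shows "dg c x a v w = g c x (christoffel c x a v) w + g c x v (christoffel c x a w)"
  using christoffel_eq[OF c x, of a v w] christoffel_eq[OF c x, of a w v]
    metric_sym[OF c x, of v "christoffel c x a w"] dg_sym[OF c x, of a v w]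
    dg_sym[OF c x, of v a w] dg_sym[OF c x, of w a v]
  by simp

lemma curvature_eq:
  assumes c: "c \<in> A"
  shows "curvature c x u v w = d\<Gamma> c x u v w - d\<Gamma> c x v u w
     + christoffel c x u (christoffel c x v w) - christoffel c x v (christoffel c x u w)"
proof -
  interpret G: C1_bilinear "chart_img c" "christoffel c" using C1_christoffel[OF c] .
  show ?thesis by (simp add: curvature_def G.d_def)
qed

text \<open>The equation for \<open>K\<close> is the linearized geodesic equation, so \<open>J\<close> is a Jacobi field; the covariant
  derivative of \<open>J\<close> is \<open>P\<close>, and \<open>f'' = 2 |P|\<^sup>2 - 2 g(R(J,v)v, J)\<close>. The last inequality makes \<open>sqrt f\<close> convex.\<close>

lemma jacobi_inequality:
  assumes c: "c \<in> A" and T: "open T" "t \<in> T"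
    and x: "\<And>t. t \<in> T \<Longrightarrow> x t \<in> chart_img c"
    and dx: "\<And>t. t \<in> T \<Longrightarrow> (x has_vector_derivative v t) (at t)"
    and dv: "\<And>t. t \<in> T \<Longrightarrow> (v has_vector_derivative - christoffel c (x t) (v t) (v t)) (at t)"
    and dJ: "\<And>t. t \<in> T \<Longrightarrow> (J has_vector_derivative K t) (at t)"
    and dK: "\<And>t. t \<in> T \<Longrightarrow> (K has_vector_derivative
       - (d\<Gamma> c (x t) (J t) (v t) (v t) + christoffel c (x t) (K t) (v t) + christoffel c (x t) (v t) (K t))) (at t)"
    and curv: "\<And>t. t \<in> T \<Longrightarrow> g c (x t) (curvature c (x t) (J t) (v t) (v t)) (J t) \<le> 0"
  defines "f \<equiv> \<lambda>t. g c (x t) (J t) (J t)"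
  obtains f2 where "(f has_real_derivative deriv f t) (at t)" "(deriv f has_real_derivative f2) (at t)"
    "f2 \<ge> 0" "(deriv f t)\<^sup>2 \<le> 2 * f t * f2"
proof -
  interpret M: C1_inner "chart_img c" "g c" using C1_metric[OF c] .
  interpret G: C1_bilinear "chart_img c" "christoffel c" using C1_christoffel[OF c] .
  define P where "P = (\<lambda>t. K t + christoffel c (x t) (v t) (J t))"
  define f1 where "f1 = (\<lambda>t. 2 * g c (x t) (P t) (J t))"
  have df: "(f has_real_derivative f1 t) (at t)" if t: "t \<in> T" for t
  proof -
    note b = M.bil[OF x[OF t]]
    have "(f has_vector_derivative dg c (x t) (v t) (J t) (J t) + g c (x t) (K t) (J t) + g c (x t) (J t) (K t)) (at t)"
      unfolding f_def by (rule M.curve_derivative[OF x[OF t] dx[OF t] dJ[OF t] dJ[OF t]])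
    moreover have "dg c (x t) (v t) (J t) (J t) + g c (x t) (K t) (J t) + g c (x t) (J t) (K t) = f1 t"
      using metric_sym[OF c x[OF t], of "J t"]
      by (simp add: metric_compatible[OF c x[OF t]] f1_def P_def bilinear_ladd[OF b])
    ultimately show ?thesis by (simp add: has_real_derivative_iff_has_vector_derivative)
  qed
  have deriv: "deriv f t = f1 t" if "t \<in> T" for t using DERIV_imp_deriv[OF df[OF that]] .
  define f2 where "f2 = 2 * g c (x t) (P t) (P t) - 2 * g c (x t) (curvature c (x t) (J t) (v t) (v t)) (J t)"
  note xt = x[OF T(2)]
  note b = M.bil[OF xt] and gb = G.bil[OF xt]
  define P' where "P' = - (d\<Gamma> c (x t) (J t) (v t) (v t) + christoffel c (x t) (K t) (v t) + christoffel c (x t) (v t) (K t))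
    + (d\<Gamma> c (x t) (v t) (v t) (J t) + christoffel c (x t) (- christoffel c (x t) (v t) (v t)) (J t) + christoffel c (x t) (v t) (K t))"
  have dP: "(P has_vector_derivative P') (at t)"
    unfolding P_def P'_def
    by (intro has_vector_derivative_add dK G.curve_derivative dx dv dJ x T)
  \<comment> \<open>The Jacobi equation: the covariant derivative of \<open>P\<close> along
    \<open>x\<close> is minus the curvature term. The derivative of the symbols in direction
    \<open>v t\<close> takes the required form by the symmetry of the connection.\<close>
  have S: "P' + christoffel c (x t) (v t) (P t) = - curvature c (x t) (J t) (v t) (v t)"
  proof -
    have "d\<Gamma> c (x t) (v t) (v t) (J t) = d\<Gamma> c (x t) (v t) (J t) (v t)"
    proof (rule G.d_unique[OF xt, where f'="\<lambda>a. d\<Gamma> c (x t) a (J t) (v t)"])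
      show "((\<lambda>y. christoffel c y (v t) (J t)) has_derivative (\<lambda>a. d\<Gamma> c (x t) a (J t) (v t))) (at (x t))"
        by (rule has_derivative_transform_within_open[OF G.has_derivative_d[OF xt] G.U xt])
           (rule christoffel_sym[OF c])
    qed
    then show ?thesis
      by (simp add: P'_def P_def curvature_eq[OF c] bilinear_radd[OF gb] bilinear_lneg[OF gb]
          christoffel_sym[OF c xt, of "K t" "v t"] christoffel_sym[OF c xt, of "christoffel c (x t) (v t) (v t)" "J t"]
          christoffel_sym[OF c xt, of "J t" "v t"])
  qed
  have "(f1 has_vector_derivative 2 * (dg c (x t) (v t) (P t) (J t) + g c (x t) P' (J t) + g c (x t) (P t) (K t))) (at t)"
    unfolding f1_def
    by (rule has_vector_derivative_mult_right[OF M.curve_derivative[OF xt dx[OF T(2)] dP dJ[OF T(2)]]])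
  moreover
  have "dg c (x t) (v t) (P t) (J t) + g c (x t) P' (J t) + g c (x t) (P t) (K t)
     = g c (x t) (P' + christoffel c (x t) (v t) (P t)) (J t) + g c (x t) (P t) (P t)"
    by (simp add: metric_compatible[OF c xt] bilinear_ladd[OF b] bilinear_radd[OF b] P_def)
  then have "2 * (dg c (x t) (v t) (P t) (J t) + g c (x t) P' (J t) + g c (x t) (P t) (K t)) = f2"
    by (simp add: S f2_def bilinear_lneg[OF b])
  ultimately have d2: "(f1 has_real_derivative f2) (at t)"
    by (simp add: has_real_derivative_iff_has_vector_derivative)
  show thesis
  proof (rule that[of f2])
    show "(f has_real_derivative deriv f t) (at t)" using df[OF T(2)] deriv[OF T(2)] by simp
    show "(deriv f has_real_derivative f2) (at t)"
      using has_field_derivative_transform_within_open[OF d2 T] deriv by simp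
    have nn: "g c (x t) w w \<ge> 0" for w
      using M.pos[OF xt, of w] bilinear_lzero[OF b] by (cases "w = 0") auto
    show "f2 \<ge> 0" using nn[of "P t"] curv[OF T(2)] by (simp add: f2_def)
    have "(g c (x t) (P t) (J t))\<^sup>2 \<le> g c (x t) (P t) (P t) * f t"
      unfolding f_def by (rule bilinear_Cauchy_Schwarz[OF b metric_sym[OF c xt] M.pos[OF xt]])
    also have "\<dots> \<le> (f2 / 2) * f t"
      using curv[OF T(2)] nn[of "J t"] by (intro mult_right_mono) (auto simp: f2_def f_def)
    finally show "(deriv f t)\<^sup>2 \<le> 2 * f t * f2" by (simp add: deriv[OF T(2)] f1_def power_mult_distrib)
  qed
qed

end

context hadamard_space begin

text \<open>The hypothesis on sectional curvature concerns independent pairs, for which the Gram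
  determinant is positive. For dependent vectors the curvature term itself vanishes by
  multilinearity.\<close>

lemma curvature_nonpos:
  assumes c: "c \<in> A" and x: "x \<in> chart_img c"
  shows "g c x (curvature c x u v v) u \<le> 0"
proof (cases "u \<noteq> v \<and> independent {u, v}")
  case True
  interpret M: C1_inner "chart_img c" "g c" using C1_metric[OF c] .
  note b = M.bil[OF x]
  have v: "v \<noteq> 0" using True dependent_zero by blast
  define w where "w = u - (g c x u v / g c x v v) *\<^sub>R v"
  have "w \<noteq> 0"
  proof
    assume "w = 0"
    then have "u \<in> span {v}" by (simp add: w_def span_breakdown_eq) (metis span_zero)
    then show False using True by (simp add: independent_insert)
  qed
  then have "0 < g c x w w" by (rule M.pos[OF x])
  also have "\<dots> = g c x u u - (g c x u v)\<^sup>2 / g c x v v"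
    using M.pos[OF x v]
    by (simp add: w_def bilinear_lsub[OF b] bilinear_rsub[OF b] bilinear_lmul[OF b] bilinear_rmul[OF b]
        metric_sym[OF c x, of v u] power2_eq_square field_simps)
  finally have "g c x u u * g c x v v - (g c x u v)\<^sup>2 > 0"
    using M.pos[OF x v] by (simp add: field_simps)
  then show ?thesis
    using nonpos_curvature[OF c x, of u v] True
    by (auto simp: sectional_curvature_def divide_le_0_iff)
next
  case False
  interpret M: C1_inner "chart_img c" "g c" using C1_metric[OF c] .
  interpret G: C1_bilinear "chart_img c" "christoffel c" using C1_christoffel[OF c] .
  note b = M.bil[OF x] and gb = G.bil[OF x] and gd = G.bilinear_d[OF x] and gl = G.linear_d[OF x]
  show ?thesis
  proof (cases "v = 0")
    case True
    then show ?thesis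
      by (simp add: curvature_eq[OF c] bilinear_rzero[OF gb] bilinear_lzero[OF gb] bilinear_rzero[OF gd]
        bilinear_lzero[OF gd] linear_0[OF gl] bilinear_lzero[OF b])
  next
    case v: False
    have "u \<in> span {v}"
      using False v by (auto simp: independent_insert span_base dependent_single split: if_splits)
    then obtain a where "u = a *\<^sub>R v" by (auto simp: span_singleton)
    then show ?thesis
      by (simp add: curvature_eq[OF c] linear_cmul[OF gl] bilinear_lmul[OF gd] bilinear_lmul[OF gb] bilinear_rmul[OF gb]
        bilinear_lzero[OF b])
  qed
qed

end

section \<open>Change of coordinates\<close>

lemma line_has_real_derivative:
  fixes f :: "'e::euclidean_space \<Rightarrow> real"
  assumes "C1_on f S" "x + t *\<^sub>R a + y \<in> S"
  shows "((\<lambda>t. f (x + t *\<^sub>R a + y)) has_real_derivative frechet_derivative f (at (x + t *\<^sub>R a + y)) a) (at t)"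
proof -
  have "((\<lambda>t. x + t *\<^sub>R a + y) has_derivative (\<lambda>h. h *\<^sub>R a)) (at t)"
    by (auto intro!: derivative_eq_intros)
  note has_derivative_compose[OF this C1_on_has_derivative[OF assms]]
  then show ?thesis
    using linear_cmul[OF has_derivative_linear[OF C1_on_has_derivative[OF assms]]]
    by (simp add: has_field_derivative_def mult.commute[of _ "frechet_derivative f _ _"])
qed

text \<open>The mean value theorem twice: in direction \<open>a\<close> for the increment of
  \<open>f\<close> along \<open>s *\<^sub>R b\<close>, then in direction \<open>b\<close> for the
  derivative obtained.\<close>

lemma second_difference_mvt:
  fixes f :: "'e::euclidean_space \<Rightarrow> real"
  assumes C1: "C1_on f S" and C2: "C1_on (\<lambda>x. frechet_derivative f (at x) a) S"
    and s: "s > 0" and in_S: "\<And>t u. t \<in> {0..s} \<Longrightarrow> u \<in> {0..s} \<Longrightarrow> x + t *\<^sub>R a + u *\<^sub>R b \<in> S"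
  obtains t u where "t \<in> {0..s}" "u \<in> {0..s}"
    "f (x + s *\<^sub>R a + s *\<^sub>R b) - f (x + s *\<^sub>R a) - (f (x + s *\<^sub>R b) - f x)
      = s * (s * frechet_derivative (\<lambda>y. frechet_derivative f (at y) a) (at (x + t *\<^sub>R a + u *\<^sub>R b)) b)"
proof -
  define \<phi> where "\<phi> = (\<lambda>t. f (x + t *\<^sub>R a + s *\<^sub>R b) - f (x + t *\<^sub>R a))"
  have d\<phi>: "(\<phi> has_real_derivative frechet_derivative f (at (x + t *\<^sub>R a + s *\<^sub>R b)) a
      - frechet_derivative f (at (x + t *\<^sub>R a)) a) (at t)" if "0 \<le> t" "t \<le> s" for t
    unfolding \<phi>_def
    using line_has_real_derivative[OF C1, of x t a "s *\<^sub>R b"] line_has_real_derivative[OF C1, of x t a 0]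
      in_S[of t s] in_S[of t 0] that s
    by (intro DERIV_diff) auto
  obtain t where t: "0 < t" "t < s" "\<phi> s - \<phi> 0 = (s - 0) * (frechet_derivative f (at (x + t *\<^sub>R a + s *\<^sub>R b)) a
      - frechet_derivative f (at (x + t *\<^sub>R a)) a)"
    using MVT2[OF s d\<phi>] by auto
  define \<psi> where "\<psi> = (\<lambda>u. frechet_derivative f (at (x + t *\<^sub>R a + u *\<^sub>R b)) a)"
  have d\<psi>: "(\<psi> has_real_derivative frechet_derivative (\<lambda>y. frechet_derivative f (at y) a) (at (x + t *\<^sub>R a + u *\<^sub>R b)) b) (at u)"
    if "0 \<le> u" "u \<le> s" for u
    unfolding \<psi>_def
    using line_has_real_derivative[OF C2, of "x + t *\<^sub>R a" u b 0] in_S[of t u] that t by simp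
  obtain u where u: "0 < u" "u < s" "\<psi> s - \<psi> 0 = (s - 0) * frechet_derivative (\<lambda>y. frechet_derivative f (at y) a) (at (x + t *\<^sub>R a + u *\<^sub>R b)) b"
    using MVT2[OF s d\<psi>] by auto
  show thesis
    using t u by (intro that[of t u]) (auto simp: \<phi>_def \<psi>_def)
qed

text \<open>The second difference is symmetric in \<open>a\<close> and \<open>b\<close>; hence the
  two mixed derivatives take equal values at points arbitrarily close to \<open>x\<close>, and
  continuity does the rest.\<close>

lemma second_derivative_symmetric_real:
  fixes f :: "'e::euclidean_space \<Rightarrow> real"
  assumes S: "open S" "x \<in> S" and C1: "C1_on f S" and C2: "\<And>a. C1_on (\<lambda>x. frechet_derivative f (at x) a) S"
  shows "frechet_derivative (\<lambda>y. frechet_derivative f (at y) a) (at x) b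
    = frechet_derivative (\<lambda>y. frechet_derivative f (at y) b) (at x) a"
proof (rule ccontr)
  define P where "P = (\<lambda>y. frechet_derivative (\<lambda>y. frechet_derivative f (at y) a) (at y) b)"
  define Q where "Q = (\<lambda>y. frechet_derivative (\<lambda>y. frechet_derivative f (at y) b) (at y) a)"
  assume "\<not> ?thesis"
  then have ne: "\<bar>P x - Q x\<bar> / 2 > 0" by (simp add: P_def Q_def)
  have "isCont P x" "isCont Q x"
    using C2 S unfolding P_def Q_def C1_on_def by (simp_all add: continuous_on_eq_continuous_at)
  then obtain d1 d2 where d: "d1 > 0" "\<And>y. dist y x < d1 \<Longrightarrow> dist (P y) (P x) < \<bar>P x - Q x\<bar> / 2"
    "d2 > 0" "\<And>y. dist y x < d2 \<Longrightarrow> dist (Q y) (Q x) < \<bar>P x - Q x\<bar> / 2"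
    unfolding continuous_at_eps_delta using ne by blast
  obtain r where r: "r > 0" "ball x r \<subseteq> S" using S openE by blast
  define \<delta> where "\<delta> = min r (min d1 d2)"
  define N where "N = norm a + norm b + 1"
  \<comment> \<open>Keeps the parallelogram spanned by \<open>s *\<^sub>R a\<close> and
    \<open>s *\<^sub>R b\<close> within \<open>\<delta> / 2\<close> of \<open>x\<close>; the
    \<open>1\<close> in \<open>N\<close> covers the case \<open>a = b = 0\<close>.\<close>
  define s where "s = \<delta> / (2 * N)"
  have \<delta>: "\<delta> > 0" using r d by (simp add: \<delta>_def)
  have nab: "N > 0" unfolding N_def by (smt (verit) norm_ge_zero)
  have s: "s > 0" using \<delta> nab by (simp add: s_def)
  have near: "dist (x + t *\<^sub>R a + u *\<^sub>R b) x < \<delta>" if "t \<in> {0..s}" "u \<in> {0..s}" for t u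
  proof -
    have "dist (x + t *\<^sub>R a + u *\<^sub>R b) x = norm (t *\<^sub>R a + u *\<^sub>R b)" by (simp add: dist_norm add.assoc)
    also have "\<dots> \<le> t * norm a + u * norm b" using that norm_triangle_ineq[of "t *\<^sub>R a" "u *\<^sub>R b"] by simp
    also have "\<dots> \<le> s * norm a + s * norm b" using that by (intro add_mono mult_right_mono) auto
    also have "\<dots> \<le> s * N" using s by (simp add: N_def algebra_simps)
    also have "\<dots> = \<delta> / 2" using nab by (simp add: s_def)
    finally show ?thesis using \<delta> by simp
  qed
  have inS: "x + t *\<^sub>R a + u *\<^sub>R b \<in> S" if "t \<in> {0..s}" "u \<in> {0..s}" for t u
    using near[OF that] r by (auto simp: \<delta>_def dist_commute subset_iff)
  have inS': "x + t *\<^sub>R b + u *\<^sub>R a \<in> S" if "t \<in> {0..s}" "u \<in> {0..s}" for t u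
    using inS[OF that(2,1)] by (simp add: algebra_simps)
  obtain t u where tu: "t \<in> {0..s}" "u \<in> {0..s}"
    "f (x + s *\<^sub>R a + s *\<^sub>R b) - f (x + s *\<^sub>R a) - (f (x + s *\<^sub>R b) - f x) = s * (s * P (x + t *\<^sub>R a + u *\<^sub>R b))"
    unfolding P_def by (rule second_difference_mvt[OF C1 C2[of a] s inS])
  obtain t' u' where tu': "t' \<in> {0..s}" "u' \<in> {0..s}"
    "f (x + s *\<^sub>R b + s *\<^sub>R a) - f (x + s *\<^sub>R b) - (f (x + s *\<^sub>R a) - f x) = s * (s * Q (x + t' *\<^sub>R b + u' *\<^sub>R a))"
    unfolding Q_def by (rule second_difference_mvt[OF C1 C2[of b] s inS'])
  have "s * (s * P (x + t *\<^sub>R a + u *\<^sub>R b)) = s * (s * Q (x + t' *\<^sub>R b + u' *\<^sub>R a))"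
    using tu(3) tu'(3)[unfolded add.assoc add.commute[of "s *\<^sub>R b" "s *\<^sub>R a"]] unfolding add.assoc by linarith
  then have eq: "P (x + t *\<^sub>R a + u *\<^sub>R b) = Q (x + t' *\<^sub>R b + u' *\<^sub>R a)" using s by simp
  have "dist (P (x + t *\<^sub>R a + u *\<^sub>R b)) (P x) < \<bar>P x - Q x\<bar> / 2"
    using near[OF tu(1,2)] by (intro d) (simp add: \<delta>_def)
  moreover have "dist (Q (x + t' *\<^sub>R b + u' *\<^sub>R a)) (Q x) < \<bar>P x - Q x\<bar> / 2"
    using near[OF tu'(2,1)] by (intro d) (simp add: \<delta>_def algebra_simps)
  moreover have "\<bar>P x - Q x\<bar> \<le> \<bar>Q (x + t' *\<^sub>R b + u' *\<^sub>R a) - P x\<bar> + \<bar>Q (x + t' *\<^sub>R b + u' *\<^sub>R a) - Q x\<bar>"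
    by arith
  ultimately show False using eq by (simp add: dist_real_def)
qed

lemma second_derivative_symmetric:
  fixes f :: "'e::euclidean_space \<Rightarrow> 'f::euclidean_space"
  assumes S: "open S" "x \<in> S" and C1: "C1_on f S" and C2: "\<And>a. C1_on (\<lambda>x. frechet_derivative f (at x) a) S"
  shows "frechet_derivative (\<lambda>y. frechet_derivative f (at y) a) (at x) b
    = frechet_derivative (\<lambda>y. frechet_derivative f (at y) b) (at x) a"
proof (rule euclidean_eqI)
  fix i :: 'f
  have comp: "((\<lambda>x. h x \<bullet> i) has_derivative (\<lambda>a. frechet_derivative h (at x) a \<bullet> i)) (at x)"
    if "C1_on h S" "x \<in> S" for h :: "'e \<Rightarrow> 'f" and x
    by (rule has_derivative_inner_left[OF C1_on_has_derivative[OF that]])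
  have C: "C1_on (\<lambda>x. h x \<bullet> i) S" if "C1_on h S" for h :: "'e \<Rightarrow> 'f"
    using that by (intro C1_onI[OF comp]) (auto simp: C1_on_def intro!: continuous_intros)
  have e1: "frechet_derivative (\<lambda>x. h x \<bullet> i) (at y) a = frechet_derivative h (at y) a \<bullet> i"
    if "C1_on h S" "y \<in> S" for h :: "'e \<Rightarrow> 'f" and y a
    using comp[OF that] frechet_derivative_at by metis
  have C2': "C1_on (\<lambda>x. frechet_derivative (\<lambda>x. f x \<bullet> i) (at x) a) S" for a
    by (rule C1_on_cong[OF S(1) _ C[OF C2[of a]]]) (simp add: e1[OF C1])
  have e2: "frechet_derivative (\<lambda>y. frechet_derivative (\<lambda>x. f x \<bullet> i) (at y) a) (at x) b
     = frechet_derivative (\<lambda>y. frechet_derivative f (at y) a) (at x) b \<bullet> i" for a b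
  proof -
    have "((\<lambda>y. frechet_derivative (\<lambda>x. f x \<bullet> i) (at y) a) has_derivative
        (\<lambda>b. frechet_derivative (\<lambda>y. frechet_derivative f (at y) a) (at x) b \<bullet> i)) (at x)"
      by (rule has_derivative_transform_within_open[OF comp[OF C2 S(2)] S]) (simp add: e1[OF C1])
    then show ?thesis using frechet_derivative_at by metis
  qed
  show "frechet_derivative (\<lambda>y. frechet_derivative f (at y) a) (at x) b \<bullet> i
    = frechet_derivative (\<lambda>y. frechet_derivative f (at y) b) (at x) a \<bullet> i"
    using second_derivative_symmetric_real[OF S C[OF C1] C2', of a b] by (simp add: e2)
qed

locale C1_linear =
  fixes U :: "'e::euclidean_space set" and L :: "'e \<Rightarrow> 'e \<Rightarrow> 'f::real_normed_vector"
  assumes U: "open U"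
    and lin: "x \<in> U \<Longrightarrow> linear (L x)"
    and C1: "C1_on (\<lambda>x. L x v) U"
begin

text \<open>A linear family becomes a bilinear one through a dummy argument; inserting a unit vector
  \<open>k\<close> there recovers \<open>L\<close> and transfers the calculus of
  \<open>C1_bilinear\<close>.\<close>

lemma bilinear_extension: "C1_bilinear U (\<lambda>x v w. (w \<bullet> k) *\<^sub>R L x v)"
proof
  show "bilinear (\<lambda>v w. (w \<bullet> k) *\<^sub>R L x v)" if "x \<in> U" for x
    using lin[OF that] by (auto simp: bilinear_def linear_iff inner_add_left scaleR_left_distrib scaleR_right_distrib)
  fix v w
  show "C1_on (\<lambda>x. (w \<bullet> k) *\<^sub>R L x v) U"
    using C1_on_has_derivative[OF C1] C1
    by (intro C1_onI[where f'="\<lambda>x a. (w \<bullet> k) *\<^sub>R frechet_derivative (\<lambda>x. L x v) (at x) a"]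
        has_derivative_scaleR_right continuous_on_scaleR continuous_on_const) (auto simp: C1_on_def)
qed (rule U)

lemma curve_derivative:
  assumes "x t \<in> U" and "(x has_vector_derivative x') (at t within S)" "(v has_vector_derivative v') (at t within S)"
  shows "((\<lambda>t. L (x t) (v t)) has_vector_derivative
     frechet_derivative (\<lambda>y. L y (v t)) (at (x t)) x' + L (x t) v') (at t within S)"
proof -
  obtain k :: 'e where k: "k \<in> Basis" by fastforce
  interpret B: C1_bilinear U "\<lambda>x v w. (w \<bullet> k) *\<^sub>R L x v" by (rule bilinear_extension)
  have "((\<lambda>t. (k \<bullet> k) *\<^sub>R L (x t) (v t)) has_vector_derivative
     B.d (x t) x' (v t) k + (k \<bullet> k) *\<^sub>R L (x t) v' + (0 \<bullet> k) *\<^sub>R L (x t) (v t)) (at t within S)"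
    by (rule B.curve_derivative[where w="\<lambda>_. k"]) (use assms in \<open>auto intro: has_vector_derivative_const\<close>)
  then show ?thesis using k by (simp add: B.d_def)
qed

lemma continuous_joint:
  assumes "continuous_on T x" "continuous_on T v" "x ` T \<subseteq> U"
  shows "continuous_on T (\<lambda>t. L (x t) (v t))"
proof -
  obtain k :: 'e where k: "k \<in> Basis" by fastforce
  interpret B: C1_bilinear U "\<lambda>x v w. (w \<bullet> k) *\<^sub>R L x v" by (rule bilinear_extension)
  show ?thesis
    using B.continuous_joint[OF assms(1,2) continuous_on_const[of _ k] assms(3)] k by simp
qed

lemma joint_derivative:
  assumes "x \<in> U"
  shows "((\<lambda>p. L (fst p) (snd p)) has_derivative
     (\<lambda>q. frechet_derivative (\<lambda>y. L y v) (at x) (fst q) + L x (snd q))) (at (x, v))"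
proof -
  obtain k :: 'e where k: "k \<in> Basis" by fastforce
  interpret B: C1_bilinear U "\<lambda>x v w. (w \<bullet> k) *\<^sub>R L x v" by (rule bilinear_extension)
  have "((\<lambda>p. (fst p, snd p, k)) has_derivative (\<lambda>q. (fst q, snd q, 0))) (at (x, v))"
    by (auto intro!: derivative_eq_intros)
  moreover have "((\<lambda>(x, v, w). (w \<bullet> k) *\<^sub>R L x v) has_derivative
      (\<lambda>(a, b, c). B.d x a v k + (k \<bullet> k) *\<^sub>R L x b + (c \<bullet> k) *\<^sub>R L x v)) (at (fst (x, v), snd (x, v), k))"
    using B.joint_derivative[OF assms, of v k] by simp
  ultimately show ?thesis
    using k by (auto dest: has_derivative_compose simp: B.d_def)
qed

end

section \<open>Transition maps and their differentials\<close>

context smooth_atlas begin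

lemma chart_inv_coord: "c \<in> A \<Longrightarrow> p \<in> chart_dom c \<Longrightarrow> chart_inv c (chart_coord c p) = p"
  using chart_homeo homeomorphism_apply1 by blast

lemma chart_coord_inv: "c \<in> A \<Longrightarrow> x \<in> chart_img c \<Longrightarrow> chart_coord c (chart_inv c x) = x"
  using chart_homeo homeomorphism_apply2 by blast

lemma chart_coord_in: "p \<in> chart_dom c \<Longrightarrow> chart_coord c p \<in> chart_img c"
  by (simp add: chart_img_def)

lemma chart_inv_in: "c \<in> A \<Longrightarrow> x \<in> chart_img c \<Longrightarrow> chart_inv c x \<in> chart_dom c"
  using chart_homeo homeomorphism_image2 by blast

lemma chart_exists: obtains c where "c \<in> A" "p \<in> chart_dom c"
  using charts_cover by blast

lemma continuous_chart_coord: "c \<in> A \<Longrightarrow> continuous_on (chart_dom c) (chart_coord c)"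
  using chart_homeo by (auto simp: homeomorphism_def)

lemma continuous_chart_inv: "c \<in> A \<Longrightarrow> continuous_on (chart_img c) (chart_inv c)"
  using chart_homeo by (auto simp: homeomorphism_def)

definition overlap :: "('a, 'e) chart \<Rightarrow> ('a, 'e) chart \<Rightarrow> 'e set" where
  "overlap c c' = chart_coord c ` (chart_dom c \<inter> chart_dom c')"

abbreviation Dtrans :: "('a, 'e) chart \<Rightarrow> ('a, 'e) chart \<Rightarrow> 'e \<Rightarrow> 'e \<Rightarrow> 'e" where
  "Dtrans c c' x \<equiv> frechet_derivative (transition c c') (at x)"

lemma overlap_alt: "c \<in> A \<Longrightarrow> overlap c c' = chart_img c \<inter> chart_inv c -` chart_dom c'"
  unfolding overlap_def chart_img_def by (auto simp: chart_inv_coord)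

lemma open_overlap: "c \<in> A \<Longrightarrow> c' \<in> A \<Longrightarrow> open (overlap c c')"
  unfolding overlap_alt
  using continuous_open_preimage[OF continuous_chart_inv chart_img_open chart_dom_open] by auto

lemma transition_coord: "c \<in> A \<Longrightarrow> p \<in> chart_dom c \<Longrightarrow> transition c c' (chart_coord c p) = chart_coord c' p"
  by (simp add: transition_def chart_inv_coord)

lemma C1_transition:
  assumes "c \<in> A" "c' \<in> A"
  shows "C1_on (transition c c') (overlap c c')" "C1_on (\<lambda>x. Dtrans c c' x v) (overlap c c')"
  using smooth_on_C1 smooth_on_derivative transition_smooth[OF assms] open_overlap[OF assms]
  unfolding overlap_def by blast+

lemma Dtrans_linear:
  assumes "c \<in> A" "c' \<in> A"
  shows "C1_linear (overlap c c') (Dtrans c c')"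
proof (rule C1_linear.intro)
  show "linear (Dtrans c c' x)" if "x \<in> overlap c c'" for x
    by (rule has_derivative_linear[OF C1_on_has_derivative[OF C1_transition(1)[OF assms] that]])
qed (use open_overlap[OF assms] C1_transition[OF assms] in auto)

text \<open>The chain rule for the two mutually inverse transitions gives a right inverse of the
  differential.\<close>

lemma Dtrans_surj:
  assumes c: "c \<in> A" "c' \<in> A" and x: "x \<in> overlap c c'"
  obtains v where "Dtrans c c' x v = w"
proof -
  obtain p where p: "p \<in> chart_dom c" "p \<in> chart_dom c'" "x = chart_coord c p" using x by (auto simp: overlap_def)
  define y where "y = chart_coord c' p"
  have y: "y \<in> overlap c' c" using p by (auto simp: overlap_def y_def)
  have ty: "transition c' c y = x" using p c by (simp add: y_def transition_coord)
  have "((\<lambda>y. transition c c' (transition c' c y)) has_derivative (\<lambda>w. Dtrans c c' x (Dtrans c' c y w))) (at y)"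
    using has_derivative_compose[OF C1_on_has_derivative[OF C1_transition(1)[OF c(2,1)] y], of "transition c c'" "Dtrans c c' x"]
      C1_on_has_derivative[OF C1_transition(1)[OF c] x] by (simp add: ty)
  then have "((\<lambda>y. y) has_derivative (\<lambda>w. Dtrans c c' x (Dtrans c' c y w))) (at y)"
    by (rule has_derivative_transform_within_open[OF _ open_overlap[OF c(2,1)] y])
       (auto simp: overlap_def transition_coord c)
  then have "(\<lambda>w. Dtrans c c' x (Dtrans c' c y w)) = (\<lambda>w. w)"
    using has_derivative_unique has_derivative_ident by blast
  then show thesis using that by metis
qed

text \<open>The curve stays in the first chart only for parameters near \<open>t\<close>, so the
  identity with the transition map is used eventually. The filter \<open>at t within S\<close> also
  covers end points of intervals.\<close>

lemma curve_change_chart: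
  assumes c: "c \<in> A" "c' \<in> A" and \<gamma>: "\<gamma> t \<in> chart_dom c" "\<gamma> t \<in> chart_dom c'"
    and cont: "continuous (at t within S) \<gamma>" and t: "t \<in> S"
    and d: "((chart_coord c \<circ> \<gamma>) has_vector_derivative v) (at t within S)"
  shows "((chart_coord c' \<circ> \<gamma>) has_vector_derivative Dtrans c c' (chart_coord c (\<gamma> t)) v) (at t within S)"
proof -
  have x: "chart_coord c (\<gamma> t) \<in> overlap c c'" using \<gamma> by (auto simp: overlap_def)
  have "((\<lambda>s. transition c c' ((chart_coord c \<circ> \<gamma>) s)) has_derivative (\<lambda>h. Dtrans c c' (chart_coord c (\<gamma> t)) (h *\<^sub>R v))) (at t within S)"
    using has_derivative_compose[OF d[unfolded has_vector_derivative_def], of "transition c c'"]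
      C1_on_has_derivative[OF C1_transition(1)[OF c] x] by simp
  then have d': "((\<lambda>s. transition c c' ((chart_coord c \<circ> \<gamma>) s)) has_vector_derivative Dtrans c c' (chart_coord c (\<gamma> t)) v) (at t within S)"
    using linear_cmul[OF C1_linear.lin[OF Dtrans_linear[OF c] x]] by (simp add: has_vector_derivative_def)
  have "eventually (\<lambda>s. \<gamma> s \<in> chart_dom c) (at t within S)"
    using cont topological_tendstoD[OF _ chart_dom_open[OF c(1)] \<gamma>(1)] by (simp add: continuous_within)
  then have "eventually (\<lambda>s. transition c c' ((chart_coord c \<circ> \<gamma>) s) = (chart_coord c' \<circ> \<gamma>) s) (at t within S)"
    by eventually_elim (simp add: transition_coord c)
  then show ?thesis
    using d' \<gamma> c t unfolding has_vector_derivative_def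
    by (elim has_derivative_transform_eventually) (auto simp: transition_coord)
qed

end

section \<open>Geodesics\<close>

context riemannian_metric begin

lemma metric_eqI:
  assumes "c \<in> A" "x \<in> chart_img c" "\<And>w. g c x z w = g c x z' w"
  shows "z = z'"
proof (rule ccontr)
  assume "z \<noteq> z'"
  then have "g c x (z - z') (z - z') > 0" using metric_pos[OF assms(1,2), of "z - z'"] by simp
  then show False by (simp add: bilinear_lsub[OF metric_bilinear[OF assms(1,2)]] assms(3))
qed

lemma metric_nonneg: "c \<in> A \<Longrightarrow> x \<in> chart_img c \<Longrightarrow> g c x v v \<ge> 0"
  using metric_pos[of c x v] bilinear_lzero[OF metric_bilinear] by (cases "v = 0") auto

lemma overlapE:
  assumes "x \<in> overlap c c'"
  obtains p where "p \<in> chart_dom c" "p \<in> chart_dom c'" "x = chart_coord c p"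
  using assms by (auto simp: overlap_def)

lemma overlap_img: "x \<in> overlap c c' \<Longrightarrow> x \<in> chart_img c"
  "c \<in> A \<Longrightarrow> x \<in> overlap c c' \<Longrightarrow> transition c c' x \<in> chart_img c'"
  by (auto simp: overlap_def transition_coord chart_coord_in)

lemma metric_transition:
  assumes "c \<in> A" "c' \<in> A" "x \<in> overlap c c'"
  shows "g c x v w = g c' (transition c c' x) (Dtrans c c' x v) (Dtrans c c' x w)"
  using assms metric_tensor[of c c'] by (auto elim!: overlapE simp: transition_coord)

abbreviation D2trans :: "('a, 'e) chart \<Rightarrow> ('a, 'e) chart \<Rightarrow> 'e \<Rightarrow> 'e \<Rightarrow> 'e \<Rightarrow> 'e" where
  "D2trans c c' x a v \<equiv> frechet_derivative (\<lambda>y. Dtrans c c' y v) (at x) a"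

lemma dg_transition:
  assumes c: "c \<in> A" "c' \<in> A" and x: "x \<in> overlap c c'"
  shows "dg c x a v w = dg c' (transition c c' x) (Dtrans c c' x a) (Dtrans c c' x v) (Dtrans c c' x w)
     + g c' (transition c c' x) (D2trans c c' x a v) (Dtrans c c' x w)
     + g c' (transition c c' x) (Dtrans c c' x v) (D2trans c c' x a w)"
proof -
  interpret M: C1_inner "chart_img c" "g c" using C1_metric[OF c(1)] .
  interpret M': C1_inner "chart_img c'" "g c'" using C1_metric[OF c(2)] .
  note T = C1_on_has_derivative[OF C1_transition(1)[OF c] x]
    and T2 = C1_on_has_derivative[OF C1_transition(2)[OF c] x]
  have "((\<lambda>y. (transition c c' y, Dtrans c c' y v, Dtrans c c' y w)) has_derivative
      (\<lambda>a. (Dtrans c c' x a, D2trans c c' x a v, D2trans c c' x a w))) (at x)"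
    by (intro has_derivative_Pair T T2)
  from has_derivative_compose[OF this M'.joint_derivative[OF overlap_img(2)[OF c(1) x]]]
  have d: "((\<lambda>y. g c' (transition c c' y) (Dtrans c c' y v) (Dtrans c c' y w)) has_derivative
    (\<lambda>a. dg c' (transition c c' x) (Dtrans c c' x a) (Dtrans c c' x v) (Dtrans c c' x w)
     + g c' (transition c c' x) (D2trans c c' x a v) (Dtrans c c' x w)
     + g c' (transition c c' x) (Dtrans c c' x v) (D2trans c c' x a w))) (at x)" by simp
  show ?thesis
    by (rule M.d_unique[OF overlap_img(1)[OF x] has_derivative_transform_within_open[OF d open_overlap[OF c] x]])
       (rule metric_transition[OF c, symmetric])
qed

text \<open>The inhomogeneous transformation law, tested with the metric of the second chart. In the
  Koszul expression the second derivatives of the transition combine to one term because they are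
  symmetric. The diagonal case is the one that occurs in the geodesic equation.\<close>

lemma christoffel_transition:
  assumes c: "c \<in> A" "c' \<in> A" and x: "x \<in> overlap c c'"
  shows "Dtrans c c' x (christoffel c x u u) =
    christoffel c' (transition c c' x) (Dtrans c c' x u) (Dtrans c c' x u) + D2trans c c' x u u"
proof (rule metric_eqI[OF c(2) overlap_img(2)[OF c(1) x]])
  let ?y = "transition c c' x" and ?D = "Dtrans c c' x"
  note xi = overlap_img(1)[OF x] and yi = overlap_img(2)[OF c(1) x]
  fix w'
  obtain w where w: "?D w = w'" using Dtrans_surj[OF c x] by blast
  have sym: "D2trans c c' x w u = D2trans c c' x u w"
    by (rule second_derivative_symmetric[OF open_overlap[OF c] x C1_transition[OF c]])
  have "g c' ?y (?D (christoffel c x u u)) w' = g c x (christoffel c x u u) w"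
    using metric_transition[OF c x] w by simp
  also have "\<dots> = (dg c' ?y (?D u) (?D u) w' + dg c' ?y (?D u) (?D u) w' - dg c' ?y w' (?D u) (?D u)) / 2
      + g c' ?y (D2trans c c' x u u) w'"
    unfolding christoffel_eq[OF c(1) xi] dg_transition[OF c x] sym w
    by (simp add: metric_sym[OF c(2) yi, of "?D u"] field_simps)
  also have "\<dots> = g c' ?y (christoffel c' ?y (?D u) (?D u) + D2trans c c' x u u) w'"
    unfolding christoffel_eq[OF c(2) yi, symmetric] bilinear_ladd[OF metric_bilinear[OF c(2) yi]] ..
  finally show "g c' ?y (?D (christoffel c x u u)) w' = g c' ?y (christoffel c' ?y (?D u) (?D u) + D2trans c c' x u u) w'" .
qed

section \<open>The geodesic equation in charts\<close>

definition vel :: "('a, 'e) chart \<Rightarrow> (real \<Rightarrow> 'a) \<Rightarrow> real \<Rightarrow> 'e" where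
  "vel c \<gamma> t = vector_derivative (chart_coord c \<circ> \<gamma>) (at t)"

definition geod_in :: "('a, 'e) chart \<Rightarrow> (real \<Rightarrow> 'a) \<Rightarrow> real set \<Rightarrow> bool" where
  "geod_in c \<gamma> S \<longleftrightarrow> (\<forall>t\<in>S. \<gamma> t \<in> chart_dom c \<and>
     ((chart_coord c \<circ> \<gamma>) has_vector_derivative vel c \<gamma> t) (at t) \<and>
     (vel c \<gamma> has_vector_derivative - christoffel c (chart_coord c (\<gamma> t)) (vel c \<gamma> t) (vel c \<gamma> t)) (at t))"

text \<open>A geodesic may leave any single chart, so the equation is required locally in some
  chart. The neighbourhood \<open>S\<close> may exceed \<open>I\<close>, hence derivatives are
  two-sided even at end points of \<open>I\<close>.\<close>

definition geod_on :: "(real \<Rightarrow> 'a) \<Rightarrow> real set \<Rightarrow> bool" where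
  "geod_on \<gamma> I \<longleftrightarrow> (\<forall>t\<in>I. \<exists>c\<in>A. \<exists>S. open S \<and> t \<in> S \<and> geod_in c \<gamma> S)"

lemma velI: "((chart_coord c \<circ> \<gamma>) has_vector_derivative v) (at t) \<Longrightarrow> vel c \<gamma> t = v"
  by (simp add: vel_def vector_derivative_at)

lemma geod_inD:
  assumes "geod_in c \<gamma> S" "t \<in> S"
  shows "\<gamma> t \<in> chart_dom c" "((chart_coord c \<circ> \<gamma>) has_vector_derivative vel c \<gamma> t) (at t)"
    "(vel c \<gamma> has_vector_derivative - christoffel c (chart_coord c (\<gamma> t)) (vel c \<gamma> t) (vel c \<gamma> t)) (at t)"
  using assms by (auto simp: geod_in_def)

lemma geod_in_subset: "geod_in c \<gamma> S \<Longrightarrow> S' \<subseteq> S \<Longrightarrow> geod_in c \<gamma> S'"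
  by (auto simp: geod_in_def)

lemma geod_on_subset: "geod_on \<gamma> S \<Longrightarrow> S' \<subseteq> S \<Longrightarrow> geod_on \<gamma> S'"
  by (auto simp: geod_on_def)

lemma geod_in_on: "c \<in> A \<Longrightarrow> open S \<Longrightarrow> geod_in c \<gamma> S \<Longrightarrow> geod_on \<gamma> S"
  by (auto simp: geod_on_def)

lemma geod_on_Un: "geod_on \<gamma> S \<Longrightarrow> geod_on \<gamma> S' \<Longrightarrow> geod_on \<gamma> (S \<union> S')"
  by (auto simp: geod_on_def)

lemma geod_in_continuous:
  assumes c: "c \<in> A" and S: "open S" and \<gamma>: "geod_in c \<gamma> S" and t: "t \<in> S"
  shows "isCont \<gamma> t" "isCont (vel c \<gamma>) t"
proof -
  show "isCont (vel c \<gamma>) t" using geod_inD(3)[OF \<gamma> t] has_vector_derivative_continuous by blast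
  have "isCont (chart_coord c \<circ> \<gamma>) t" using geod_inD(2)[OF \<gamma> t] has_vector_derivative_continuous by blast
  moreover have "isCont (chart_inv c) ((chart_coord c \<circ> \<gamma>) t)"
    using continuous_on_eq_continuous_at[OF chart_img_open[OF c]] continuous_chart_inv[OF c]
      chart_coord_in[OF geod_inD(1)[OF \<gamma> t]] unfolding comp_apply by blast
  ultimately have "isCont (chart_inv c \<circ> (chart_coord c \<circ> \<gamma>)) t" by (rule continuous_at_compose)
  moreover have "eventually (\<lambda>s. (chart_inv c \<circ> (chart_coord c \<circ> \<gamma>)) s = \<gamma> s) (nhds t)"
    using geod_inD(1)[OF \<gamma>] chart_inv_coord[OF c] by (auto simp: eventually_nhds intro!: exI[of _ S] S t)
  ultimately show "isCont \<gamma> t" using isCont_cong by blast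
qed

lemma geod_on_isCont: "geod_on \<gamma> I \<Longrightarrow> t \<in> I \<Longrightarrow> isCont \<gamma> t"
  unfolding geod_on_def using geod_in_continuous(1) by blast

lemma geod_inI:
  assumes S: "open S" and c: "c \<in> A"
    and x: "\<And>t. t \<in> S \<Longrightarrow> x t \<in> chart_img c" "\<And>t. t \<in> S \<Longrightarrow> (x has_vector_derivative v t) (at t)"
    and v: "\<And>t. t \<in> S \<Longrightarrow> (v has_vector_derivative - christoffel c (x t) (v t) (v t)) (at t)"
    and \<gamma>: "\<And>t. t \<in> S \<Longrightarrow> \<gamma> t = chart_inv c (x t)"
  shows "geod_in c \<gamma> S" "\<And>t. t \<in> S \<Longrightarrow> vel c \<gamma> t = v t"
proof -
  have eq: "x t = (chart_coord c \<circ> \<gamma>) t" if "t \<in> S" for t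
    using \<gamma> x(1) chart_coord_inv c that by simp
  have d: "((chart_coord c \<circ> \<gamma>) has_vector_derivative v t) (at t)" if "t \<in> S" for t
    by (rule has_vector_derivative_transform_within_open[OF x(2)[OF that] S that eq])
  show vel: "vel c \<gamma> t = v t" if "t \<in> S" for t by (rule velI[OF d[OF that]])
  have "(vel c \<gamma> has_vector_derivative - christoffel c (x t) (v t) (v t)) (at t)" if "t \<in> S" for t
    by (rule has_vector_derivative_transform_within_open[OF v[OF that] S that]) (simp add: vel)
  moreover have "\<gamma> t \<in> chart_dom c" "chart_coord c (\<gamma> t) = x t" if "t \<in> S" for t
    using \<gamma>[OF that] x(1)[OF that] chart_inv_in[OF c] chart_coord_inv[OF c] by simp_all
  ultimately show "geod_in c \<gamma> S"
    unfolding geod_in_def using d by (simp add: vel)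
qed

lemma geod_in_cong:
  assumes S: "open S" and c: "c \<in> A" and \<gamma>: "geod_in c \<gamma> S" and eq: "\<And>t. t \<in> S \<Longrightarrow> \<sigma> t = \<gamma> t"
  shows "geod_in c \<sigma> S" "\<And>t. t \<in> S \<Longrightarrow> vel c \<sigma> t = vel c \<gamma> t"
proof -
  have 1: "(chart_coord c \<circ> \<gamma>) t \<in> chart_img c" "\<sigma> t = chart_inv c ((chart_coord c \<circ> \<gamma>) t)" if "t \<in> S" for t
    using geod_inD(1)[OF \<gamma> that] eq[OF that] chart_inv_coord[OF c] by (simp_all add: chart_coord_in)
  have 2: "(vel c \<gamma> has_vector_derivative - christoffel c ((chart_coord c \<circ> \<gamma>) t) (vel c \<gamma> t) (vel c \<gamma> t)) (at t)"
    if "t \<in> S" for t using geod_inD(3)[OF \<gamma> that] by simp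
  show "geod_in c \<sigma> S" "\<And>t. t \<in> S \<Longrightarrow> vel c \<sigma> t = vel c \<gamma> t"
    by (rule geod_inI[OF S c 1(1) geod_inD(2)[OF \<gamma>] 2 1(2)]; assumption)+
qed

lemma geod_on_cong:
  assumes I: "open I" and \<gamma>: "geod_on \<gamma> I" and eq: "\<And>t. t \<in> I \<Longrightarrow> \<sigma> t = \<gamma> t"
  shows "geod_on \<sigma> I"
  unfolding geod_on_def
proof
  fix t assume t: "t \<in> I"
  obtain c S where c: "c \<in> A" "open S" "t \<in> S" "geod_in c \<gamma> S" using \<gamma> t by (auto simp: geod_on_def)
  then have "geod_in c \<sigma> (S \<inter> I)"
    using geod_in_cong(1)[of "S \<inter> I" c \<gamma> \<sigma>] geod_in_subset I eq by auto
  then show "\<exists>c\<in>A. \<exists>S. open S \<and> t \<in> S \<and> geod_in c \<sigma> S" using c t I by blast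
qed

lemma vel_change:
  assumes c: "c \<in> A" "c' \<in> A" and S: "open S" "t \<in> S" and \<gamma>: "geod_in c \<gamma> S" "\<gamma> t \<in> chart_dom c'"
  shows "((chart_coord c' \<circ> \<gamma>) has_vector_derivative Dtrans c c' (chart_coord c (\<gamma> t)) (vel c \<gamma> t)) (at t)"
    "vel c' \<gamma> t = Dtrans c c' (chart_coord c (\<gamma> t)) (vel c \<gamma> t)"
proof -
  show *: "((chart_coord c' \<circ> \<gamma>) has_vector_derivative Dtrans c c' (chart_coord c (\<gamma> t)) (vel c \<gamma> t)) (at t)"
    using curve_change_chart[OF c, of \<gamma> t UNIV "vel c \<gamma> t"] geod_inD(1,2)[OF \<gamma>(1) S(2)] \<gamma>(2)
      geod_in_continuous(1)[OF c(1) S(1) \<gamma>(1) S(2)] by simp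
  show "vel c' \<gamma> t = Dtrans c c' (chart_coord c (\<gamma> t)) (vel c \<gamma> t)" by (rule velI[OF *])
qed

text \<open>The derivative of the differential of the transition along the curve is exactly the
  inhomogeneous term of \<open>christoffel_transition\<close>.\<close>

lemma geod_in_change:
  assumes c: "c \<in> A" "c' \<in> A" and S: "open S" and \<gamma>: "geod_in c \<gamma> S" "\<And>t. t \<in> S \<Longrightarrow> \<gamma> t \<in> chart_dom c'"
  shows "geod_in c' \<gamma> S"
  unfolding geod_in_def
proof (intro ballI conjI)
  fix t assume t: "t \<in> S"
  show "\<gamma> t \<in> chart_dom c'" using \<gamma>(2) t .
  show "((chart_coord c' \<circ> \<gamma>) has_vector_derivative vel c' \<gamma> t) (at t)"
    using vel_change[OF c S t \<gamma>(1) \<gamma>(2)[OF t]] by simp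
  let ?x = "chart_coord c \<circ> \<gamma>" and ?v = "vel c \<gamma>"
  have x: "?x t \<in> overlap c c'" using t \<gamma> geod_inD(1) by (auto simp: overlap_def)
  interpret L: C1_linear "overlap c c'" "Dtrans c c'" by (rule Dtrans_linear[OF c])
  have "((\<lambda>t. Dtrans c c' (?x t) (?v t)) has_vector_derivative
     D2trans c c' (?x t) (?v t) (?v t) + Dtrans c c' (?x t) (- christoffel c (?x t) (?v t) (?v t))) (at t)"
    using L.curve_derivative[OF x geod_inD(2)[OF \<gamma>(1) t] geod_inD(3)[OF \<gamma>(1) t]] by simp
  also have "D2trans c c' (?x t) (?v t) (?v t) + Dtrans c c' (?x t) (- christoffel c (?x t) (?v t) (?v t))
      = - christoffel c' (chart_coord c' (\<gamma> t)) (vel c' \<gamma> t) (vel c' \<gamma> t)"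
    using christoffel_transition[OF c x, of "?v t"] vel_change(2)[OF c S t \<gamma>(1) \<gamma>(2)[OF t]]
      linear_neg[OF L.lin[OF x]] transition_coord[OF c(1) geod_inD(1)[OF \<gamma>(1) t], of c'] by simp
  finally show "(vel c' \<gamma> has_vector_derivative - christoffel c' (chart_coord c' (\<gamma> t)) (vel c' \<gamma> t) (vel c' \<gamma> t)) (at t)"
    by (rule has_vector_derivative_transform_within_open[OF _ S t])
       (simp add: vel_change(2)[OF c S _ \<gamma>(1) \<gamma>(2)])
qed

lemma geod_on_chart:
  assumes \<gamma>: "geod_on \<gamma> I" and c: "c \<in> A" and S: "open S" "S \<subseteq> I" "\<And>t. t \<in> S \<Longrightarrow> \<gamma> t \<in> chart_dom c"
  shows "geod_in c \<gamma> S"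
proof -
  have "geod_in c \<gamma> {t}" if t: "t \<in> S" for t
  proof -
    obtain c' S' where c': "c' \<in> A" "open S'" "t \<in> S'" "geod_in c' \<gamma> S'" using \<gamma> t S unfolding geod_on_def by (meson subsetD)
    have "geod_in c \<gamma> (S \<inter> S')"
      by (rule geod_in_change[OF c'(1) c]) (use S c' geod_in_subset in auto)
    then show ?thesis using geod_in_subset t c' by blast
  qed
  then show ?thesis by (auto simp: geod_in_def)
qed

lemma geod_on_chart_at:
  assumes \<gamma>: "geod_on \<gamma> I" and I: "open I" "t \<in> I" and c: "c \<in> A" "\<gamma> t \<in> chart_dom c"
  obtains S where "open S" "t \<in> S" "S \<subseteq> I" "geod_in c \<gamma> S"
proof -
  have "continuous_on I \<gamma>" using geod_on_isCont[OF \<gamma>] by (simp add: continuous_at_imp_continuous_on)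
  then have "open (I \<inter> \<gamma> -` chart_dom c)" using I chart_dom_open[OF c(1)] continuous_open_preimage by blast
  then show thesis using that[of "I \<inter> \<gamma> -` chart_dom c"] geod_on_chart[OF \<gamma> c(1)] I c by auto
qed

text \<open>Both the acceleration and the quadratic Christoffel term scale by
  \<open>a * a\<close>.\<close>

lemma geod_on_affine:
  assumes \<gamma>: "geod_on \<gamma> I" and J: "open J" "\<And>s. s \<in> J \<Longrightarrow> a * s + b \<in> I"
  shows "geod_on (\<lambda>s. \<gamma> (a * s + b)) J"
  unfolding geod_on_def
proof
  fix s assume s: "s \<in> J"
  let ?h = "\<lambda>s. a * s + b"
  obtain c S where c: "c \<in> A" "open S" "?h s \<in> S" "geod_in c \<gamma> S" using \<gamma> J(2)[OF s] by (auto simp: geod_on_def)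
  have o: "open (?h -` S)" by (intro open_vimage c continuous_intros)
  have dh: "(?h has_real_derivative a) (at u)" for u by (auto intro!: derivative_eq_intros)
  have "geod_in c (\<lambda>s. \<gamma> (?h s)) (?h -` S)"
  proof (rule geod_inI(1)[OF o c(1), where x="(chart_coord c \<circ> \<gamma>) \<circ> ?h" and v="\<lambda>u. a *\<^sub>R vel c \<gamma> (?h u)"])
    fix u assume u: "u \<in> ?h -` S"
    then have hu: "?h u \<in> S" by simp
    note D = geod_inD[OF c(4) hu]
    show "((chart_coord c \<circ> \<gamma>) \<circ> ?h) u \<in> chart_img c" using D(1) by (simp add: chart_coord_in)
    show "(((chart_coord c \<circ> \<gamma>) \<circ> ?h) has_vector_derivative a *\<^sub>R vel c \<gamma> (?h u)) (at u)"
      by (rule vector_diff_chain_at[OF dh[unfolded has_real_derivative_iff_has_vector_derivative] D(2)])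
    have "((\<lambda>u. vel c \<gamma> (?h u)) has_vector_derivative a *\<^sub>R (- christoffel c (chart_coord c (\<gamma> (?h u))) (vel c \<gamma> (?h u)) (vel c \<gamma> (?h u)))) (at u)"
      using vector_diff_chain_at[OF dh[unfolded has_real_derivative_iff_has_vector_derivative] D(3)] by (simp add: comp_def)
    then have "((\<lambda>u. a *\<^sub>R vel c \<gamma> (?h u)) has_vector_derivative a *\<^sub>R a *\<^sub>R (- christoffel c (chart_coord c (\<gamma> (?h u))) (vel c \<gamma> (?h u)) (vel c \<gamma> (?h u)))) (at u)"
      by (rule bounded_linear.has_vector_derivative[OF bounded_linear_scaleR_right])
    then show "((\<lambda>u. a *\<^sub>R vel c \<gamma> (?h u)) has_vector_derivative
      - christoffel c (((chart_coord c \<circ> \<gamma>) \<circ> ?h) u) (a *\<^sub>R vel c \<gamma> (?h u)) (a *\<^sub>R vel c \<gamma> (?h u))) (at u)"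
      using bilinear_christoffel[OF c(1) chart_coord_in[OF D(1)]] by (simp add: bilinear_lmul bilinear_rmul)
    show "\<gamma> (?h u) = chart_inv c (((chart_coord c \<circ> \<gamma>) \<circ> ?h) u)" using chart_inv_coord[OF c(1) D(1)] by simp
  qed
  then show "\<exists>c\<in>A. \<exists>S. open S \<and> s \<in> S \<and> geod_in c (\<lambda>s. \<gamma> (?h s)) S" using o c by blast
qed

lemma vel_affine:
  assumes "((chart_coord c \<circ> \<gamma>) has_vector_derivative vel c \<gamma> (a * s + b)) (at (a * s + b))"
  shows "vel c (\<lambda>s. \<gamma> (a * s + b)) s = a *\<^sub>R vel c \<gamma> (a * s + b)"
proof (rule velI)
  have dh: "((\<lambda>s. a * s + b) has_vector_derivative a) (at s)"
    unfolding has_real_derivative_iff_has_vector_derivative[symmetric] by (auto intro!: derivative_eq_intros)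
  show "((chart_coord c \<circ> (\<lambda>s. \<gamma> (a * s + b))) has_vector_derivative a *\<^sub>R vel c \<gamma> (a * s + b)) (at s)"
    using vector_diff_chain_at[OF dh assms] by (simp add: comp_def)
qed

section \<open>The geodesic spray and uniqueness of geodesics\<close>

definition gF :: "('a, 'e) chart \<Rightarrow> 'e \<times> 'e \<Rightarrow> 'e \<times> 'e" where
  "gF c z = (snd z, - christoffel c (fst z) (snd z) (snd z))"

definition gF' :: "('a, 'e) chart \<Rightarrow> 'e \<times> 'e \<Rightarrow> ('e \<times> 'e) \<Rightarrow>\<^sub>L ('e \<times> 'e)" where
  "gF' c z = Blinfun (\<lambda>q. (snd q, - (d\<Gamma> c (fst z) (fst q) (snd z) (snd z)
     + christoffel c (fst z) (snd q) (snd z) + christoffel c (fst z) (snd z) (snd q))))"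

lemma gF_derivative:
  assumes c: "c \<in> A" and z: "fst z \<in> chart_img c"
  shows "(gF c has_derivative blinfun_apply (gF' c z)) (at z)"
    and gF'_apply: "blinfun_apply (gF' c z) q = (snd q, - (d\<Gamma> c (fst z) (fst q) (snd z) (snd z)
     + christoffel c (fst z) (snd q) (snd z) + christoffel c (fst z) (snd z) (snd q)))"
proof -
  interpret G: C1_bilinear "chart_img c" "christoffel c" using C1_christoffel[OF c] .
  let ?f = "\<lambda>q. (snd q, - (d\<Gamma> c (fst z) (fst q) (snd z) (snd z)
     + christoffel c (fst z) (snd q) (snd z) + christoffel c (fst z) (snd z) (snd q)))"
  have p: "((\<lambda>z. (fst z, snd z, snd z)) has_derivative (\<lambda>q. (fst q, snd q, snd q))) (at z)"
    by (auto intro!: derivative_eq_intros)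
  have "((\<lambda>z. christoffel c (fst z) (snd z) (snd z)) has_derivative
    (\<lambda>q. d\<Gamma> c (fst z) (fst q) (snd z) (snd z) + christoffel c (fst z) (snd q) (snd z) + christoffel c (fst z) (snd z) (snd q))) (at z)"
    using has_derivative_compose[OF p G.joint_derivative[OF z]] by simp
  then have d: "(gF c has_derivative ?f) (at z)"
    unfolding gF_def[abs_def]
    by (intro has_derivative_Pair has_derivative_minus has_derivative_snd has_derivative_ident)
  then have "blinfun_apply (gF' c z) = ?f"
    unfolding gF'_def by (intro bounded_linear_Blinfun_apply) (rule has_derivative_bounded_linear)
  then show "(gF c has_derivative blinfun_apply (gF' c z)) (at z)" "blinfun_apply (gF' c z) q = ?f q" using d by auto
qed

lemma continuous_gF':
  assumes c: "c \<in> A"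
  shows "continuous_on (chart_img c \<times> UNIV) (gF' c)"
proof (rule continuous_on_blinfun_componentwise)
  fix i :: "'e \<times> 'e"
  interpret G: C1_bilinear "chart_img c" "christoffel c" using C1_christoffel[OF c] .
  have "continuous_on (chart_img c \<times> UNIV) (\<lambda>z. (snd i, - (d\<Gamma> c (fst z) (fst i) (snd z) (snd z)
     + christoffel c (fst z) (snd i) (snd z) + christoffel c (fst z) (snd z) (snd i))))"
    by (intro continuous_on_Pair continuous_on_minus continuous_on_add continuous_on_const G.continuous_d G.continuous_joint
       continuous_on_fst continuous_on_snd continuous_on_id) auto
  then show "continuous_on (chart_img c \<times> UNIV) (\<lambda>z. gF' c z i)"
    by (rule continuous_on_eq) (auto simp: gF'_apply[OF c])
qed

lemma geod_in_iff_ode: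
  assumes "geod_in c \<gamma> S" "t \<in> S"
  shows "((\<lambda>t. (chart_coord c (\<gamma> t), vel c \<gamma> t)) has_vector_derivative gF c (chart_coord c (\<gamma> t), vel c \<gamma> t)) (at t)"
  using has_vector_derivative_Pair[OF geod_inD(2,3)[OF assms]] by (simp add: gF_def)

text \<open>The spray is Lipschitz on a ball around the common state, so \<open>ode_bound\<close>
  with zero initial difference and \<open>\<rho> = 0\<close> applies.\<close>

lemma geod_local_unique:
  assumes c: "c \<in> A" and S: "open S" "t0 \<in> S" and \<gamma>: "geod_in c \<gamma> S" and \<sigma>: "geod_in c \<sigma> S"
    and eq: "\<gamma> t0 = \<sigma> t0" "vel c \<gamma> t0 = vel c \<sigma> t0"
  obtains h where "h > 0" "\<And>t. dist t t0 < h \<Longrightarrow> \<gamma> t = \<sigma> t"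
proof -
  define y where "y = (\<lambda>t. (chart_coord c (\<gamma> t), vel c \<gamma> t))"
  define z where "z = (\<lambda>t. (chart_coord c (\<sigma> t), vel c \<sigma> t))"
  have yz: "y t0 = z t0" using eq by (simp add: y_def z_def)
  let ?W = "chart_img c \<times> (UNIV :: 'e set)"
  have W: "open ?W" using chart_img_open[OF c] by (simp add: open_Times)
  have "y t0 \<in> ?W" using geod_inD(1)[OF \<gamma> S(2)] chart_coord_in by (simp add: y_def)
  from open_contains_cball[THEN iffD1, OF W, rule_format, OF this]
  obtain r where r: "r > 0" "cball (y t0) r \<subseteq> ?W" by (elim exE conjE)
  have "compact (gF' c ` cball (y t0) r)"
    by (rule compact_continuous_image[OF continuous_on_subset[OF continuous_gF'[OF c] r(2)] compact_cball])
  then obtain L where L: "L > 0" "\<And>w. w \<in> cball (y t0) r \<Longrightarrow> norm (gF' c w) \<le> L"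
    using compact_imp_bounded bounded_pos by (metis imageI)
  have lip: "norm (gF c p - gF c q) \<le> L * norm (p - q)" if "p \<in> cball (y t0) r" "q \<in> cball (y t0) r" for p q
    by (rule lipschitz_C1_convex[of "cball (y t0) r" _ "gF' c"])
       (use that r L gF_derivative[OF c] in \<open>auto simp: mem_Times_iff\<close>)
  have dy: "(y has_vector_derivative gF c (y t)) (at t)" if "t \<in> S" for t
    using geod_in_iff_ode[OF \<gamma> that] by (simp add: y_def)
  have dz: "(z has_vector_derivative gF c (z t)) (at t)" if "t \<in> S" for t
    using geod_in_iff_ode[OF \<sigma> that] by (simp add: z_def)
  have "isCont y t0" "isCont z t0" using dy dz S has_vector_derivative_continuous by blast+
  then obtain d1 d2 where d: "d1 > 0" "d2 > 0" "\<And>t. dist t t0 < d1 \<Longrightarrow> dist (y t) (y t0) < r"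
    "\<And>t. dist t t0 < d2 \<Longrightarrow> dist (z t) (z t0) < r"
    unfolding continuous_at_eps_delta using r(1) by blast
  obtain d3 where d3: "d3 > 0" "ball t0 d3 \<subseteq> S" using S openE by blast
  define h where "h = min (min d1 d2) (min d3 (1 / (4 * L))) / 2"
  have h: "h > 0" "h < d1" "h < d2" "h < d3" "L * (2 * h) \<le> 1 / 2"
  proof -
    have "h \<le> 1 / (4 * L) / 2" by (simp add: h_def)
    then have "L * (2 * h) \<le> L * (2 * (1 / (4 * L) / 2))" using L by (intro mult_left_mono) auto
    then show "L * (2 * h) \<le> 1 / 2" using L by simp
  qed (use d d3 L in \<open>auto simp: h_def\<close>)
  have "y t - z t = 0" if "dist t t0 < h" for t
  proof -
    have "norm (y t - z t) \<le> 2 * norm (y t0 - z t0) + 2 * ((t0 + h) - (t0 - h)) * 0"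
    proof (rule ode_bound[where e="\<lambda>t. y t - z t" and e'="\<lambda>t. gF c (y t) - gF c (z t)" and L=L])
      fix s assume "s \<in> {t0 - h..t0 + h}"
      then have s: "dist s t0 \<le> h" by (auto simp: dist_real_def)
      then have sS: "s \<in> S" using d3 h by (auto simp: dist_commute subset_iff)
      show "((\<lambda>t. y t - z t) has_vector_derivative gF c (y s) - gF c (z s)) (at s within {t0 - h..t0 + h})"
        by (intro has_vector_derivative_diff has_vector_derivative_at_within[OF dy] has_vector_derivative_at_within[OF dz] sS)
      have "y s \<in> cball (y t0) r" "z s \<in> cball (y t0) r"
        using d(3)[of s] d(4)[of s] s h yz by (auto simp: dist_commute intro: less_imp_le)
      then show "norm (gF c (y s) - gF c (z s)) \<le> L * norm (y s - z s) + 0" using lip by simp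
    qed (use h L that in \<open>auto simp: dist_real_def\<close>)
    then show ?thesis by (simp add: yz)
  qed
  then have "chart_coord c (\<gamma> t) = chart_coord c (\<sigma> t)" if "dist t t0 < h" for t
    using that by (simp add: y_def z_def zero_prod_def)
  moreover have "t \<in> S" if "dist t t0 < h" for t
    using that d3 h(4) by (simp add: dist_commute subset_iff)
  ultimately have "\<gamma> t = \<sigma> t" if "dist t t0 < h" for t
    using that geod_inD(1)[OF \<gamma>, of t] geod_inD(1)[OF \<sigma>, of t] chart_inv_coord[OF c] by metis
  then show thesis using that h(1) by blast
qed

text \<open>The set where position and velocity agree is open and closed in \<open>I\<close>.
  Velocities are compared in some chart; by \<open>vel_change\<close> agreement in one chart is
  agreement in every chart.\<close>

lemma geod_unique:
  assumes I: "open I" "connected I" "t0 \<in> I" and \<gamma>: "geod_on \<gamma> I" and \<sigma>: "geod_on \<sigma> I"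
    and c: "c \<in> A" "\<gamma> t0 \<in> chart_dom c" and eq: "\<gamma> t0 = \<sigma> t0" "vel c \<gamma> t0 = vel c \<sigma> t0" and t: "t \<in> I"
  shows "\<gamma> t = \<sigma> t"
proof -
  define E where "E = {t\<in>I. \<gamma> t = \<sigma> t \<and> (\<exists>c\<in>A. \<gamma> t \<in> chart_dom c \<and> vel c \<gamma> t = vel c \<sigma> t)}"
  have chart: "\<exists>S. open S \<and> s \<in> S \<and> S \<subseteq> I \<and> geod_in c \<gamma> S \<and> geod_in c \<sigma> S"
    if s: "s \<in> I" "c \<in> A" "\<gamma> s \<in> chart_dom c" "\<gamma> s = \<sigma> s" for s c
  proof -
    obtain S where "open S" "s \<in> S" "S \<subseteq> I" "geod_in c \<gamma> S" using geod_on_chart_at[OF \<gamma> I(1) s(1-3)] by blast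
    moreover obtain S' where "open S'" "s \<in> S'" "S' \<subseteq> I" "geod_in c \<sigma> S'"
      using geod_on_chart_at[OF \<sigma> I(1) s(1,2)] s(3,4) by metis
    ultimately show ?thesis by (intro exI[of _ "S \<inter> S'"]) (auto intro: geod_in_subset)
  qed
  have E_open: "\<exists>h>0. \<forall>u. dist u s < h \<longrightarrow> u \<in> E" if s: "s \<in> E" for s
  proof -
    obtain c where c: "c \<in> A" "\<gamma> s \<in> chart_dom c" "vel c \<gamma> s = vel c \<sigma> s" and eq: "s \<in> I" "\<gamma> s = \<sigma> s"
      using s by (auto simp: E_def)
    obtain S where S: "open S" "s \<in> S" "S \<subseteq> I" "geod_in c \<gamma> S" "geod_in c \<sigma> S" using chart[OF eq(1) c(1,2) eq(2)] by blast
    obtain h where h: "h > 0" "\<And>t. dist t s < h \<Longrightarrow> \<gamma> t = \<sigma> t"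
      using geod_local_unique[OF c(1) S(1,2,4,5) eq(2) c(3)] by blast
    obtain h' where h': "h' > 0" "ball s h' \<subseteq> S" using S openE by blast
    have o: "open (S \<inter> ball s h)" using S by auto
    have v: "vel c \<gamma> t = vel c \<sigma> t" if "t \<in> S \<inter> ball s h" for t
      by (rule geod_in_cong(2)[OF o c(1) geod_in_subset[OF S(5)] _ that]) (use h in \<open>auto simp: dist_commute\<close>)
    have "u \<in> E" if "dist u s < min h h'" for u
    proof -
      have u: "u \<in> S \<inter> ball s h" using that h' by (auto simp: dist_commute subset_iff)
      then show ?thesis using v[OF u] h(2)[of u] S(3) c(1) geod_inD(1)[OF S(4), of u] by (auto simp: E_def dist_commute)
    qed
    then show ?thesis using h h' by (intro exI[of _ "min h h'"]) auto
  qed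
  have "open E" unfolding open_dist using E_open by blast
  have NE_open: "\<exists>T. open T \<and> s \<in> T \<and> T \<subseteq> I - E" if s: "s \<in> I - E" for s
  proof (cases "\<gamma> s = \<sigma> s")
    case False
    have "open {u\<in>I. \<gamma> u \<noteq> \<sigma> u}"
    proof -
      have "continuous_on I (\<lambda>u. dist (\<gamma> u) (\<sigma> u))"
        using geod_on_isCont[OF \<gamma>] geod_on_isCont[OF \<sigma>]
        by (intro continuous_on_dist) (auto simp: continuous_at_imp_continuous_on)
      then have "open (I \<inter> (\<lambda>u. dist (\<gamma> u) (\<sigma> u)) -` {0<..})"
        using I(1) by (simp add: continuous_open_preimage)
      moreover have "I \<inter> (\<lambda>u. dist (\<gamma> u) (\<sigma> u)) -` {0<..} = {u\<in>I. \<gamma> u \<noteq> \<sigma> u}" by auto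
      ultimately show ?thesis by simp
    qed
    then show ?thesis using False s by (intro exI[of _ "{u\<in>I. \<gamma> u \<noteq> \<sigma> u}"]) (auto simp: E_def)
  next
    case True
    obtain c where c: "c \<in> A" "\<gamma> s \<in> chart_dom c" using chart_exists by blast
    obtain S where S: "open S" "s \<in> S" "S \<subseteq> I" "geod_in c \<gamma> S" "geod_in c \<sigma> S" using chart[of s c] s True c by auto
    have ne: "vel c \<gamma> s \<noteq> vel c \<sigma> s" using s True c by (auto simp: E_def)
    have "continuous_on S (\<lambda>u. vel c \<gamma> u - vel c \<sigma> u)"
      using geod_in_continuous(2)[OF c(1) S(1)] S
      by (intro continuous_on_diff) (auto simp: continuous_at_imp_continuous_on)
    then have "open (S \<inter> (\<lambda>u. vel c \<gamma> u - vel c \<sigma> u) -` (- {0}))"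
      using S(1) by (intro continuous_open_preimage) auto
    moreover have "S \<inter> (\<lambda>u. vel c \<gamma> u - vel c \<sigma> u) -` (- {0}) \<subseteq> I - E"
    proof
      fix u assume u: "u \<in> S \<inter> (\<lambda>u. vel c \<gamma> u - vel c \<sigma> u) -` (- {0})"
      have "u \<notin> E"
      proof
        assume "u \<in> E"
        then obtain c' where c': "c' \<in> A" "\<gamma> u \<in> chart_dom c'" "vel c' \<gamma> u = vel c' \<sigma> u" "\<gamma> u = \<sigma> u" "u \<in> I" by (auto simp: E_def)
        obtain S' where S': "open S'" "u \<in> S'" "geod_in c' \<gamma> S'" "geod_in c' \<sigma> S'"
          using chart[OF c'(5,1,2,4)] by blast
        have "vel c \<gamma> u = vel c \<sigma> u"
          using vel_change(2)[OF c'(1) c(1) S'(1,2,3)] vel_change(2)[OF c'(1) c(1) S'(1,2,4)] c'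
            geod_inD(1)[OF S(4)] geod_inD(1)[OF S(5)] u by auto
        then show False using u by auto
      qed
      then show "u \<in> I - E" using u S(3) by auto
    qed
    ultimately show ?thesis
      using S(2) ne by (intro exI[of _ "S \<inter> (\<lambda>u. vel c \<gamma> u - vel c \<sigma> u) -` (- {0})"]) simp
  qed
  have "open (I - E)" by (subst open_subopen) (use NE_open in blast)
  have "I \<subseteq> E"
  proof (rule ccontr)
    assume "\<not> I \<subseteq> E"
    moreover have "t0 \<in> E" using I c eq by (auto simp: E_def)
    ultimately show False
      using connectedD[OF I(2) \<open>open E\<close> \<open>open (I - E)\<close>] I(3) by blast
  qed
  then show ?thesis using t by (auto simp: E_def)
qed

end

section \<open>Lengths of geodesics and completeness\<close>

context riemannian_metric begin

abbreviation chart_flow :: "('a, 'e) chart \<Rightarrow> 'e \<times> 'e \<Rightarrow> real \<Rightarrow> real \<Rightarrow> (real \<Rightarrow> 'e \<times> 'e \<Rightarrow> 'e \<times> 'e)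
    \<Rightarrow> (real \<Rightarrow> 'e \<times> 'e \<Rightarrow> ('e \<times> 'e) \<Rightarrow>\<^sub>L ('e \<times> 'e)) \<Rightarrow> bool" where
  "chart_flow c \<equiv> C1_flow (chart_img c \<times> UNIV) (gF c) (gF' c)"

lemma chart_flow_exists:
  assumes c: "c \<in> A" and z0: "fst z0 \<in> chart_img c"
  obtains \<epsilon> \<delta> X D where "chart_flow c z0 \<epsilon> \<delta> X D"
proof -
  have W: "open (chart_img c \<times> (UNIV :: 'e set))" "z0 \<in> chart_img c \<times> UNIV"
    using chart_img_open[OF c] z0 by (simp_all add: open_Times mem_Times_iff)
  have der: "(gF c has_derivative blinfun_apply (gF' c z)) (at z)" if "z \<in> chart_img c \<times> UNIV" for z
    using gF_derivative[OF c] that by (simp add: mem_Times_iff)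
  show thesis by (rule local_flow[OF W der continuous_gF'[OF c] that])
qed

lemma flow_geodesic:
  assumes c: "c \<in> A" and in_W: "\<And>t. t \<in> {-\<epsilon><..<\<epsilon>} \<Longrightarrow> X t \<in> chart_img c \<times> UNIV"
    and "\<And>t. t \<in> {-\<epsilon><..<\<epsilon>} \<Longrightarrow> (X has_vector_derivative gF c (X t)) (at t)"
  shows "geod_in c (\<lambda>t. chart_inv c (fst (X t))) {-\<epsilon><..<\<epsilon>}"
    "\<And>t. t \<in> {-\<epsilon><..<\<epsilon>} \<Longrightarrow> vel c (\<lambda>t. chart_inv c (fst (X t))) t = snd (X t)"
proof -
  have 0: "fst (X t) \<in> chart_img c" if "t \<in> {-\<epsilon><..<\<epsilon>}" for t
    using in_W[OF that] by (simp add: mem_Times_iff)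
  have 1: "((\<lambda>t. fst (X t)) has_vector_derivative snd (X t)) (at t)"
    and 2: "((\<lambda>t. snd (X t)) has_vector_derivative - christoffel c (fst (X t)) (snd (X t)) (snd (X t))) (at t)"
    if "t \<in> {-\<epsilon><..<\<epsilon>}" for t
    using bounded_linear.has_vector_derivative[OF bounded_linear_fst assms(3)[OF that]]
      bounded_linear.has_vector_derivative[OF bounded_linear_snd assms(3)[OF that]] by (simp_all add: gF_def)
  show "geod_in c (\<lambda>t. chart_inv c (fst (X t))) {-\<epsilon><..<\<epsilon>}"
    "\<And>t. t \<in> {-\<epsilon><..<\<epsilon>} \<Longrightarrow> vel c (\<lambda>t. chart_inv c (fst (X t))) t = snd (X t)"
    by (rule geod_inI[OF open_greaterThanLessThan c 0 1 2 refl]; assumption)+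
qed

lemma local_geodesics:
  assumes c: "c \<in> A" and z0: "fst z0 \<in> chart_img c"
  obtains \<epsilon> \<delta> where "\<epsilon> > 0" "\<delta> > 0"
    "\<And>z. z \<in> ball z0 \<delta> \<Longrightarrow> \<exists>\<gamma>. geod_in c \<gamma> {-\<epsilon><..<\<epsilon>} \<and> chart_coord c (\<gamma> 0) = fst z \<and> vel c \<gamma> 0 = snd z"
proof -
  obtain \<epsilon> \<delta> X D where *: "chart_flow c z0 \<epsilon> \<delta> X D" by (rule chart_flow_exists[OF c z0])
  show thesis
  proof (rule that[OF C1_flowD(1,2)[OF *]])
    fix z assume z: "z \<in> ball z0 \<delta>"
    let ?\<gamma> = "\<lambda>t. chart_inv c (fst (X t z))"
    have 0: "0 \<in> {-\<epsilon><..<\<epsilon>}" using C1_flowD(1)[OF *] by simp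
    have "geod_in c ?\<gamma> {-\<epsilon><..<\<epsilon>}"
      by (rule flow_geodesic(1)[OF c C1_flowD(5,6)[OF * z]])
    moreover have "vel c ?\<gamma> 0 = snd (X 0 z)"
      by (rule flow_geodesic(2)[OF c C1_flowD(5,6)[OF * z] 0])
    ultimately show "\<exists>\<gamma>. geod_in c \<gamma> {-\<epsilon><..<\<epsilon>} \<and> chart_coord c (\<gamma> 0) = fst z \<and> vel c \<gamma> 0 = snd z"
      using C1_flowD(3)[OF * z] C1_flowD(5)[OF * z 0] chart_coord_inv[OF c] by (auto simp: mem_Times_iff)
  qed
qed

lemma speed_chart:
  assumes c: "c \<in> A" "\<gamma> t \<in> chart_dom c" and cont: "isCont \<gamma> t"
    and d: "((chart_coord c \<circ> \<gamma>) has_vector_derivative v) (at t)"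
  shows "speed \<gamma> t = sqrt (g c (chart_coord c (\<gamma> t)) v v)"
proof -
  define c0 where "c0 = (SOME c. c \<in> A \<and> \<gamma> t \<in> chart_dom c)"
  have c0: "c0 \<in> A" "\<gamma> t \<in> chart_dom c0"
    using someI[of "\<lambda>c. c \<in> A \<and> \<gamma> t \<in> chart_dom c" c] c by (auto simp: c0_def)
  let ?x = "chart_coord c (\<gamma> t)"
  have x: "?x \<in> overlap c c0" using c c0 by (auto simp: overlap_def)
  have "((chart_coord c0 \<circ> \<gamma>) has_vector_derivative Dtrans c c0 ?x v) (at t)"
    using curve_change_chart[OF c(1) c0(1), of \<gamma> t UNIV v] c c0 cont d by simp
  then have "vector_derivative (chart_coord c0 \<circ> \<gamma>) (at t) = Dtrans c c0 ?x v"
    by (rule vector_derivative_at)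
  then show ?thesis
    unfolding speed_def Let_def c0_def[symmetric]
    by (simp add: metric_transition[OF c(1) c0(1) x] transition_coord[OF c])
qed

lemma speed_geod_in:
  assumes "c \<in> A" "open S" "geod_in c \<gamma> S" "t \<in> S"
  shows "speed \<gamma> t = sqrt (g c (chart_coord c (\<gamma> t)) (vel c \<gamma> t) (vel c \<gamma> t))"
  by (rule speed_chart[where \<gamma>=\<gamma>, OF assms(1) geod_inD(1)[OF assms(3,4)] geod_in_continuous(1)[OF assms] geod_inD(2)[OF assms(3,4)]])

lemma speed_nonneg: "speed \<gamma> t \<ge> 0"
proof -
  define c0 where "c0 = (SOME c. c \<in> A \<and> \<gamma> t \<in> chart_dom c)"
  obtain c where c: "c \<in> A" "\<gamma> t \<in> chart_dom c" by (rule chart_exists)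
  have c0: "c0 \<in> A" "\<gamma> t \<in> chart_dom c0"
    using someI[of "\<lambda>c. c \<in> A \<and> \<gamma> t \<in> chart_dom c" c] c by (auto simp: c0_def)
  show ?thesis
    unfolding speed_def Let_def c0_def[symmetric]
    using metric_nonneg[OF c0(1) chart_coord_in[OF c0(2)]] by simp
qed

text \<open>Compatibility of the connection with the metric makes the derivative of the squared
  speed vanish.\<close>

lemma speed_constant:
  assumes I: "open I" "convex I" and \<gamma>: "geod_on \<gamma> I" and st: "s \<in> I" "t \<in> I"
  shows "speed \<gamma> s = speed \<gamma> t"
proof -
  have "((\<lambda>t. (speed \<gamma> t)\<^sup>2) has_real_derivative 0) (at t)" if t: "t \<in> I" for t
  proof -
    obtain c S where c: "c \<in> A" "open S" "t \<in> S" "geod_in c \<gamma> S" using \<gamma> t unfolding geod_on_def by blast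
    interpret M: C1_inner "chart_img c" "g c" using C1_metric[OF c(1)] .
    let ?x = "chart_coord c \<circ> \<gamma>" and ?v = "vel c \<gamma>"
    have xi: "?x s \<in> chart_img c" if "s \<in> S" for s using geod_inD(1)[OF c(4) that] by (simp add: chart_coord_in)
    have "((\<lambda>t. g c (?x t) (?v t) (?v t)) has_vector_derivative
       dg c (?x t) (?v t) (?v t) (?v t) + g c (?x t) (- christoffel c (?x t) (?v t) (?v t)) (?v t)
       + g c (?x t) (?v t) (- christoffel c (?x t) (?v t) (?v t))) (at t)"
      using M.curve_derivative[OF xi[OF c(3)] geod_inD(2,3,3)[OF c(4,3)]] by simp
    also have "dg c (?x t) (?v t) (?v t) (?v t) + g c (?x t) (- christoffel c (?x t) (?v t) (?v t)) (?v t)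
       + g c (?x t) (?v t) (- christoffel c (?x t) (?v t) (?v t)) = 0"
      using metric_compatible[OF c(1) xi[OF c(3)], of "?v t" "?v t" "?v t"] M.bil[OF xi[OF c(3)]]
      by (simp add: bilinear_lneg bilinear_rneg)
    finally have d: "((\<lambda>t. g c (?x t) (?v t) (?v t)) has_real_derivative 0) (at t)"
      by (simp add: has_real_derivative_iff_has_vector_derivative)
    show ?thesis
      by (rule has_field_derivative_transform_within_open[OF d c(2,3)])
         (use speed_geod_in[OF c(1,2,4)] metric_nonneg[OF c(1) xi] in simp)
  qed
  then have "(speed \<gamma> s)\<^sup>2 = (speed \<gamma> t)\<^sup>2"
    using has_field_derivative_zero_constant[OF I(2), of "\<lambda>t. (speed \<gamma> t)\<^sup>2"] st
    by (metis has_field_derivative_at_within)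
  then show ?thesis using speed_nonneg by (simp add: power2_eq_iff_nonneg)
qed

lemma speed_affine:
  assumes \<gamma>: "geod_on \<gamma> I" and J: "open J" "s \<in> J" "\<And>s. s \<in> J \<Longrightarrow> a * s + b \<in> I" and I: "open I"
  shows "speed (\<lambda>s. \<gamma> (a * s + b)) s = \<bar>a\<bar> * speed \<gamma> (a * s + b)"
proof -
  obtain c where c: "c \<in> A" "\<gamma> (a * s + b) \<in> chart_dom c" using chart_exists by blast
  obtain S where S: "open S" "a * s + b \<in> S" "S \<subseteq> I" "geod_in c \<gamma> S"
    using geod_on_chart_at[OF \<gamma> I J(3)[OF J(2)] c] by blast
  note D = geod_inD[OF S(4,2)]
  have \<sigma>: "geod_on (\<lambda>s. \<gamma> (a * s + b)) J" by (rule geod_on_affine[OF \<gamma> J(1,3)])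
  obtain S' where S': "open S'" "s \<in> S'" "S' \<subseteq> J" "geod_in c (\<lambda>s. \<gamma> (a * s + b)) S'"
    using geod_on_chart_at[OF \<sigma> J(1,2) c] by blast
  show ?thesis
    using bilinear_christoffel metric_bilinear[OF c(1) chart_coord_in[OF D(1)]]
    unfolding speed_geod_in[OF c(1) S(1,4,2)] speed_geod_in[OF c(1) S'(1,4,2)] vel_affine[OF D(2)]
    by (simp add: bilinear_lmul bilinear_rmul real_sqrt_mult mult.assoc[symmetric])
qed

lemma curve_length_nonneg: "curve_length \<gamma> \<ge> 0"
  unfolding curve_length_def using speed_nonneg
  by (cases "speed \<gamma> integrable_on {0..1}") (auto simp: integral_nonneg not_integrable_integral)

lemma geod_piecewise_C1:
  assumes J: "open J" "{0..1} \<subseteq> J" and \<sigma>: "geod_on \<sigma> J"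
  shows "piecewise_C1_curve \<sigma>"
proof -
  have cont: "continuous_on S \<sigma>" if "S \<subseteq> J" for S
    using geod_on_isCont[OF \<sigma>] that by (meson continuous_at_imp_continuous_on subsetD)
  have "C1_curve_on {a..b} \<sigma>" if ab: "0 \<le> a" "a < b" "b \<le> 1" for a b
    unfolding C1_curve_on_def
  proof (intro conjI ballI)
    have sub: "{a..b} \<subseteq> J" using ab J by (meson atLeastatMost_subset_iff order_trans)
    show "continuous_on {a..b} \<sigma>" by (rule cont[OF sub])
    fix c assume c: "c \<in> A"
    have at: "\<exists>S. open S \<and> t \<in> S \<and> geod_in c \<sigma> S" if t: "t \<in> {a..b}" "\<sigma> t \<in> chart_dom c" for t
      by (rule geod_on_chart_at[OF \<sigma> J(1) subsetD[OF sub t(1)] c t(2)]) blast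
    show "\<exists>D. continuous_on {t \<in> {a..b}. \<sigma> t \<in> chart_dom c} D \<and>
         (\<forall>t\<in>{a..b}. \<sigma> t \<in> chart_dom c \<longrightarrow> (chart_coord c \<circ> \<sigma> has_vector_derivative D t) (at t within {a..b}))"
    proof (intro exI[of _ "vel c \<sigma>"] conjI ballI impI)
      show "continuous_on {t \<in> {a..b}. \<sigma> t \<in> chart_dom c} (vel c \<sigma>)"
      proof (rule continuous_at_imp_continuous_on, rule ballI)
        fix t assume "t \<in> {t \<in> {a..b}. \<sigma> t \<in> chart_dom c}"
        then obtain S where "open S" "t \<in> S" "geod_in c \<sigma> S" using at by blast
        then show "isCont (vel c \<sigma>) t" using geod_in_continuous(2)[OF c] by blast
      qed
      fix t assume "t \<in> {a..b}" "\<sigma> t \<in> chart_dom c"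
      then obtain S where "open S" "t \<in> S" "geod_in c \<sigma> S" using at by blast
      then show "(chart_coord c \<circ> \<sigma> has_vector_derivative vel c \<sigma> t) (at t within {a..b})"
        using geod_inD(2) has_vector_derivative_at_within by blast
    qed
  qed
  then show ?thesis
    unfolding piecewise_C1_curve_def using cont[OF J(2)] by blast
qed

lemma riemannian_dist_le: "piecewise_C1_curve \<gamma> \<Longrightarrow> riemannian_dist (\<gamma> 0) (\<gamma> 1) \<le> curve_length \<gamma>"
  unfolding riemannian_dist_def
  by (rule cINF_lower) (use curve_length_nonneg in \<open>auto simp: bdd_below_def\<close>)

lemma geod_riemannian_dist_le:
  assumes J: "open J" "convex J" "{0..1} \<subseteq> J" and \<sigma>: "geod_on \<sigma> J"
  shows "riemannian_dist (\<sigma> 0) (\<sigma> 1) \<le> speed \<sigma> 0"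
proof -
  have "speed \<sigma> t = speed \<sigma> 0" if "t \<in> {0..1}" for t
    by (rule speed_constant[OF J(1,2) \<sigma>]) (use that J(3) in auto)
  then have "curve_length \<sigma> = integral {0..1} (\<lambda>t::real. speed \<sigma> 0)"
    unfolding curve_length_def by (rule integral_cong)
  also have "\<dots> = speed \<sigma> 0" by simp
  finally show ?thesis using riemannian_dist_le[OF geod_piecewise_C1[OF J(1,3) \<sigma>]] by linarith
qed

text \<open>A local geodesic \<open>\<sigma>\<close>, started at time \<open>t1\<close> shortly
  before \<open>T\<close> with the state of \<open>\<gamma>\<close>, is attached. Uniqueness on the
  overlap makes the union a geodesic.\<close>

lemma geod_extend:
  assumes \<gamma>: "geod_on \<gamma> {a<..<T}" and t1: "a < t1" "t1 < T" and c: "c \<in> A" "\<gamma> t1 \<in> chart_dom c"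
    and \<sigma>: "geod_in c \<sigma> {-\<epsilon><..<\<epsilon>}" "chart_coord c (\<sigma> 0) = chart_coord c (\<gamma> t1)" "vel c \<sigma> 0 = vel c \<gamma> t1"
    and \<epsilon>: "\<epsilon> > 0" "T - t1 < \<epsilon>"
  obtains \<gamma>' where "geod_on \<gamma>' {a<..<t1 + \<epsilon>}" "\<And>t. t < T \<Longrightarrow> \<gamma>' t = \<gamma> t"
proof -
  define \<tau> where "\<tau> = (\<lambda>t. \<sigma> (1 * t + (- t1)))"
  have \<sigma>0: "0 \<in> {-\<epsilon><..<\<epsilon>}" using \<epsilon> by simp
  have "geod_on \<sigma> {-\<epsilon><..<\<epsilon>}" by (rule geod_in_on[OF c(1) open_greaterThanLessThan \<sigma>(1)])
  then have \<tau>: "geod_on \<tau> {t1 - \<epsilon><..<t1 + \<epsilon>}"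
    unfolding \<tau>_def by (rule geod_on_affine) auto
  have \<sigma>\<gamma>: "\<sigma> 0 = \<gamma> t1"
    using \<sigma>(2) chart_inv_coord[OF c] chart_inv_coord[OF c(1) geod_inD(1)[OF \<sigma>(1) \<sigma>0]] by simp
  define b where "b = max a (t1 - \<epsilon>)"
  have eq: "\<gamma> t = \<tau> t" if t: "t \<in> {b<..<T}" for t
  proof (rule geod_unique[of "{b<..<T}" t1 \<gamma> \<tau> c])
    show "geod_on \<gamma> {b<..<T}" by (rule geod_on_subset[OF \<gamma>]) (auto simp: b_def)
    show "geod_on \<tau> {b<..<T}" by (rule geod_on_subset[OF \<tau>]) (use \<epsilon> in \<open>auto simp: b_def\<close>)
    show "t1 \<in> {b<..<T}" using t1 \<epsilon> by (auto simp: b_def)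
    show "\<gamma> t1 = \<tau> t1" using \<sigma>\<gamma> by (simp add: \<tau>_def)
    have "vel c \<tau> t1 = 1 *\<^sub>R vel c \<sigma> (1 * t1 + - t1)"
      unfolding \<tau>_def by (rule vel_affine) (use geod_inD(2)[OF \<sigma>(1) \<sigma>0] in simp)
    then show "vel c \<gamma> t1 = vel c \<tau> t1" using \<sigma>(3) by simp
  qed (use c t in auto)
  define \<gamma>' where "\<gamma>' = (\<lambda>t. if t < T then \<gamma> t else \<tau> t)"
  have "geod_on \<gamma>' {a<..<T}" by (rule geod_on_cong[OF _ \<gamma>]) (auto simp: \<gamma>'_def)
  moreover have "geod_on \<gamma>' {b<..<t1 + \<epsilon>}"
    by (rule geod_on_cong[OF _ geod_on_subset[OF \<tau>]]) (use eq in \<open>auto simp: \<gamma>'_def b_def\<close>)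
  ultimately have "geod_on \<gamma>' ({a<..<T} \<union> {b<..<t1 + \<epsilon>})" by (rule geod_on_Un)
  moreover have "{a<..<t1 + \<epsilon>} \<subseteq> {a<..<T} \<union> {b<..<t1 + \<epsilon>}" using t1 \<epsilon> by (auto simp: b_def)
  ultimately have "geod_on \<gamma>' {a<..<t1 + \<epsilon>}" by (rule geod_on_subset)
  then show thesis by (rule that) (simp add: \<gamma>'_def)
qed

end

section \<open>Metric completeness implies geodesic completeness\<close>

context hadamard_space begin

lemma geod_dist_le:
  assumes I: "open I" "convex I" "s \<in> I" "t \<in> I" and \<gamma>: "geod_on \<gamma> I"
  shows "dist (\<gamma> s) (\<gamma> t) \<le> \<bar>t - s\<bar> * speed \<gamma> s"
proof -
  let ?\<sigma> = "\<lambda>u. \<gamma> ((t - s) * u + s)" and ?J = "(\<lambda>u. (t - s) * u + s) -` I"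
  have oJ: "open ?J" by (intro open_vimage I continuous_intros)
  have cJ: "convex ?J"
  proof (rule convexI)
    fix x y u v :: real assume xy: "x \<in> ?J" "y \<in> ?J" "0 \<le> u" "0 \<le> v" "u + v = 1"
    have "(t - s) * (u *\<^sub>R x + v *\<^sub>R y) + s = u *\<^sub>R ((t - s) * x + s) + v *\<^sub>R ((t - s) * y + s)"
      using xy(5) by (simp add: algebra_simps) (metis distrib_right mult.commute mult_1)
    then show "u *\<^sub>R x + v *\<^sub>R y \<in> ?J" using convexD[OF I(2)] xy by auto
  qed
  have "0 \<in> ?J" "1 \<in> ?J" using I by auto
  then have J01: "{0..1} \<subseteq> ?J" using cJ closed_segment_subset[of 0 ?J 1] by (simp add: closed_segment_eq_real_ivl)
  have \<sigma>: "geod_on ?\<sigma> ?J" by (rule geod_on_affine[OF \<gamma> oJ]) auto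
  have "dist (?\<sigma> 0) (?\<sigma> 1) \<le> speed ?\<sigma> 0"
    using geod_riemannian_dist_le[OF oJ cJ J01 \<sigma>] by (simp add: dist_riemannian)
  also have "speed ?\<sigma> 0 = \<bar>t - s\<bar> * speed \<gamma> ((t - s) * 0 + s)"
    by (rule speed_affine[OF \<gamma> oJ \<open>0 \<in> ?J\<close> _ I(1)]) auto
  finally show ?thesis by simp
qed

text \<open>If no extension beyond time \<open>1\<close> existed, the geodesic up to the supremum
  \<open>T\<close> of the existence times would be Lipschitz and so converge at \<open>T\<close>.
  Constancy of the speed keeps its late states in a compact set of one chart, and near a limit state
  the existence time of geodesics is bounded below, which carries the geodesic past
  \<open>T\<close>.\<close>

proposition geodesically_complete:
  assumes c: "c \<in> A" and x: "x \<in> chart_img c"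
  obtains \<epsilon> \<gamma> where "\<epsilon> > 0" "geod_on \<gamma> {-\<epsilon><..<1 + \<epsilon>}" "\<gamma> 0 = chart_inv c x" "vel c \<gamma> 0 = v"
proof -
  obtain \<epsilon>0 \<gamma>0 where \<gamma>0: "\<epsilon>0 > 0" "geod_in c \<gamma>0 {-\<epsilon>0<..<\<epsilon>0}" "chart_coord c (\<gamma>0 0) = x" "vel c \<gamma>0 0 = v"
    using local_geodesics[OF c, of "(x, v)"] x by (metis centre_in_ball fst_conv snd_conv)
  have \<gamma>00: "\<gamma>0 0 = chart_inv c x"
    using chart_inv_coord[OF c geod_inD(1)[OF \<gamma>0(2), of 0]] \<gamma>0(1,3) by simp
  define P where "P = (\<lambda>T \<gamma>. geod_on \<gamma> {-\<epsilon>0<..<T} \<and> \<gamma> 0 = chart_inv c x \<and> vel c \<gamma> 0 = v)"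
  define Q where "Q = {T. T \<ge> \<epsilon>0 \<and> (\<exists>\<gamma>. P T \<gamma>)}"
  have Q0: "\<epsilon>0 \<in> Q" using \<gamma>0 \<gamma>00 geod_in_on[OF c _ \<gamma>0(2)] by (auto simp: Q_def P_def)
  have uniq: "\<gamma> t = \<sigma> t" if "P T \<gamma>" "P T' \<sigma>" "T > 0" "T' > 0" "- \<epsilon>0 < t" "t < T" "t < T'" for T T' \<gamma> \<sigma> t
  proof (rule geod_unique[of "{-\<epsilon>0<..<min T T'}" 0 \<gamma> \<sigma> c])
    show "geod_on \<gamma> {- \<epsilon>0<..<min T T'}" "geod_on \<sigma> {- \<epsilon>0<..<min T T'}"
      using that(1,2) unfolding P_def by (auto elim: geod_on_subset)
  qed (use that \<gamma>0(1) c chart_inv_in[OF c x] in \<open>auto simp: P_def\<close>)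
  have "\<exists>T\<in>Q. T > 1"
  proof (rule ccontr)
    assume "\<not> ?thesis"
    then have bdd: "bdd_above Q" by (auto simp: bdd_above_def not_less)
    define T where "T = Sup Q"
    have T\<epsilon>: "T \<ge> \<epsilon>0" unfolding T_def by (rule cSup_upper[OF Q0 bdd])
    have ex: "\<exists>T'\<in>Q. t < T'" if "t < T" for t
      using that less_cSupD[of Q t] Q0 unfolding T_def by blast
    \<comment> \<open>The geodesics with different existence times are glued by choice;
      \<open>uniq\<close> makes the value independent of the one chosen.\<close>
    define G where "G = (\<lambda>t. (SOME y. \<exists>T' \<sigma>. T' \<in> Q \<and> t < T' \<and> P T' \<sigma> \<and> y = \<sigma> t))"
    have G: "G t = \<sigma> t" if "P T' \<sigma>" "T' \<in> Q" "- \<epsilon>0 < t" "t < T'" for t T' \<sigma>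
      unfolding G_def
    proof (rule some_equality)
      show "\<exists>T' \<sigma>'. T' \<in> Q \<and> t < T' \<and> P T' \<sigma>' \<and> \<sigma> t = \<sigma>' t" using that by blast
      show "y = \<sigma> t" if "\<exists>T' \<sigma>'. T' \<in> Q \<and> t < T' \<and> P T' \<sigma>' \<and> y = \<sigma>' t" for y
        using that \<open>P T' \<sigma>\<close> \<open>T' \<in> Q\<close> \<open>- \<epsilon>0 < t\<close> \<open>t < T'\<close> uniq \<gamma>0(1) by (force simp: Q_def)
    qed
    have Gloc: "geod_on G {-\<epsilon>0<..<T'}" "\<exists>\<sigma>. P T' \<sigma> \<and> (\<forall>t\<in>{-\<epsilon>0<..<T'}. G t = \<sigma> t)" if T': "T' \<in> Q" for T'
    proof -
      obtain \<sigma> where \<sigma>: "P T' \<sigma>" using T' by (auto simp: Q_def)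
      show "geod_on G {-\<epsilon>0<..<T'}"
        by (rule geod_on_cong[of _ \<sigma>]) (use \<sigma> G[OF \<sigma> T'] in \<open>auto simp: P_def\<close>)
      show "\<exists>\<sigma>. P T' \<sigma> \<and> (\<forall>t\<in>{-\<epsilon>0<..<T'}. G t = \<sigma> t)" using \<sigma> G[OF \<sigma> T'] by auto
    qed
    have Gg: "geod_on G {-\<epsilon>0<..<T}"
      unfolding geod_on_def
    proof
      fix t assume "t \<in> {-\<epsilon>0<..<T}"
      then obtain T' where "T' \<in> Q" "t \<in> {-\<epsilon>0<..<T'}" using ex by auto
      then show "\<exists>c\<in>A. \<exists>S. open S \<and> t \<in> S \<and> geod_in c G S" using Gloc(1) unfolding geod_on_def by blast
    qed
    define \<kappa> where "\<kappa> = speed G 0"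
    have T0: "T > 0" using T\<epsilon> \<gamma>0(1) by simp
    have sp: "speed G t = \<kappa>" if "t \<in> {-\<epsilon>0<..<T}" for t
      unfolding \<kappa>_def by (rule speed_constant[OF _ _ Gg that]) (use \<gamma>0(1) T0 in auto)
    define u where "u = (\<lambda>n. T - T * inverse (real (Suc n)))"
    have u: "u n \<in> {-\<epsilon>0<..<T}" for n
    proof -
      have "T * inverse (real (Suc n)) \<le> T"
        using T0 mult_left_le[of "inverse (real (Suc n))" T] by (simp add: field_simps del: of_nat_Suc)
      moreover have "T * inverse (real (Suc n)) > 0" using T0 by simp
      ultimately show ?thesis using T0 \<gamma>0(1) unfolding u_def greaterThanLessThan_iff by linarith
    qed
    have uT: "u \<longlonglongrightarrow> T"
      using tendsto_diff[OF tendsto_const tendsto_mult_right_zero[OF LIMSEQ_inverse_real_of_nat], of T T] by (simp add: u_def)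
    have lip: "dist (G (u m)) (G (u n)) \<le> dist (u m) (u n) * \<kappa>" for m n
      using geod_dist_le[OF _ _ u[of m] u[of n] Gg] sp[OF u[of m]] by (simp add: dist_real_def abs_minus_commute)
    have \<kappa>: "\<kappa> \<ge> 0" by (simp add: \<kappa>_def speed_nonneg)
    have "Cauchy (\<lambda>n. G (u n))"
    proof (rule metric_CauchyI)
      fix e :: real assume e: "e > 0"
      obtain M where M: "\<And>m n. m \<ge> M \<Longrightarrow> n \<ge> M \<Longrightarrow> dist (u m) (u n) < e / (\<kappa> + 1)"
        using metric_CauchyD[OF LIMSEQ_imp_Cauchy[OF uT], of "e / (\<kappa> + 1)"] e \<kappa> by auto
      have "dist (G (u m)) (G (u n)) < e" if "m \<ge> M" "n \<ge> M" for m n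
      proof -
        have "dist (G (u m)) (G (u n)) \<le> dist (u m) (u n) * (\<kappa> + 1)"
          using lip[of m n] by (simp add: algebra_simps) (smt (verit) zero_le_dist)
        also have "\<dots> < e" using M[OF that] \<kappa> by (simp add: field_simps)
        finally show ?thesis .
      qed
      then show "\<exists>M. \<forall>m\<ge>M. \<forall>n\<ge>M. dist (G (u m)) (G (u n)) < e" by blast
    qed
    then obtain p where p: "(\<lambda>n. G (u n)) \<longlonglongrightarrow> p"
      using complete unfolding complete_def by blast
    obtain c1 where c1: "c1 \<in> A" "p \<in> chart_dom c1" using chart_exists by blast
    interpret M: C1_inner "chart_img c1" "g c1" using C1_metric[OF c1(1)] .
    define xs where "xs = (\<lambda>n. chart_coord c1 (G (u n)))"
    define vs where "vs = (\<lambda>n. vel c1 G (u n))"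
    have evd: "eventually (\<lambda>n. G (u n) \<in> chart_dom c1) sequentially"
      by (rule topological_tendstoD[OF p chart_dom_open[OF c1(1)] c1(2)])
    have xs: "xs \<longlonglongrightarrow> chart_coord c1 p"
      unfolding xs_def
      by (rule continuous_on_tendsto_compose[OF continuous_chart_coord[OF c1(1)] p c1(2) evd])
    from open_contains_cball[THEN iffD1, OF M.U, rule_format, OF chart_coord_in[OF c1(2)]]
    obtain r where r: "r > 0" "cball (chart_coord c1 p) r \<subseteq> chart_img c1" by (elim exE conjE)
    obtain m N where m: "m > 0" "\<And>y w. y \<in> cball (chart_coord c1 p) r \<Longrightarrow> m * (norm w)\<^sup>2 \<le> g c1 y w w"
      using M.norm_equiv[OF compact_cball r(2)] by metis
    have evr: "eventually (\<lambda>n. dist (xs n) (chart_coord c1 p) < r) sequentially"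
      using tendstoD[OF xs r(1)] .
    \<comment> \<open>The bound for coordinate velocities that follows from \<open>\<kappa>\<close>
      being the constant speed and \<open>m\<close> the lower constant of the metric on the
      ball.\<close>
    define R where "R = sqrt (\<kappa>\<^sup>2 / m)"
    let ?K = "cball (chart_coord c1 p) r \<times> cball (0::'e) R"
    have evK: "eventually (\<lambda>n. G (u n) \<in> chart_dom c1 \<and> (xs n, vs n) \<in> ?K) sequentially"
      using evd evr
    proof eventually_elim
      case (elim n)
      obtain S where S: "open S" "u n \<in> S" "S \<subseteq> {-\<epsilon>0<..<T}" "geod_in c1 G S"
        by (rule geod_on_chart_at[OF Gg open_greaterThanLessThan u[of n] c1(1) elim(1)])
      have "\<kappa> = sqrt (g c1 (xs n) (vs n) (vs n))"
        using speed_geod_in[OF c1(1) S(1,4,2)] sp[OF u[of n]] by (simp add: xs_def vs_def)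
      then have "\<kappa>\<^sup>2 = g c1 (xs n) (vs n) (vs n)"
        using metric_nonneg[OF c1(1) chart_coord_in[OF elim(1)]] by (simp add: xs_def)
      moreover have "xs n \<in> cball (chart_coord c1 p) r" using elim(2) by (simp add: dist_commute)
      ultimately have "(norm (vs n))\<^sup>2 \<le> \<kappa>\<^sup>2 / m" using m by (simp add: pos_le_divide_eq mult.commute)
      then have "norm (vs n) \<le> R" by (simp add: R_def real_le_rsqrt)
      then show ?case using elim by (simp add: dist_commute)
    qed
    then obtain n0 where n0: "\<And>n. n \<ge> n0 \<Longrightarrow> G (u n) \<in> chart_dom c1 \<and> (xs n, vs n) \<in> ?K"
      by (auto simp: eventually_sequentially)
    have "compact ?K" by (intro compact_Times compact_cball)
    then obtain z f where z: "z \<in> ?K" and f: "strict_mono f" "((\<lambda>n. (xs (n + n0), vs (n + n0))) \<circ> f) \<longlonglongrightarrow> z"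
      using n0 unfolding compact_def by (metis (no_types, lifting) le_add2)
    have "fst z \<in> chart_img c1" using z r(2) by (auto simp: mem_Times_iff)
    then obtain \<epsilon> \<delta> where \<epsilon>: "\<epsilon> > 0" "\<delta> > 0"
      and loc: "\<And>y. y \<in> ball z \<delta> \<Longrightarrow> \<exists>\<gamma>. geod_in c1 \<gamma> {-\<epsilon><..<\<epsilon>} \<and> chart_coord c1 (\<gamma> 0) = fst y \<and> vel c1 \<gamma> 0 = snd y"
      using local_geodesics[OF c1(1)] by blast
    have "eventually (\<lambda>n. dist (((\<lambda>n. (xs (n + n0), vs (n + n0))) \<circ> f) n) z < \<delta>) sequentially"
      by (rule tendstoD[OF f(2) \<epsilon>(2)])
    moreover have "eventually (\<lambda>n. dist (u (f n + n0)) T < min \<epsilon> T) sequentially"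
    proof -
      have "(\<lambda>n. u (n + n0)) \<longlonglongrightarrow> T" by (rule LIMSEQ_ignore_initial_segment[OF uT])
      then have "((\<lambda>n. u (n + n0)) \<circ> f) \<longlonglongrightarrow> T" using f(1) by (rule LIMSEQ_subseq_LIMSEQ)
      then show ?thesis using tendstoD[of _ T sequentially "min \<epsilon> T"] \<epsilon> T0 by (simp add: comp_def)
    qed
    ultimately have "eventually (\<lambda>n. dist (xs (f n + n0), vs (f n + n0)) z < \<delta> \<and> dist (u (f n + n0)) T < min \<epsilon> T) sequentially"
      by eventually_elim simp
    then obtain k where k: "dist (xs (f k + n0), vs (f k + n0)) z < \<delta>" "dist (u (f k + n0)) T < min \<epsilon> T"
      using eventually_happens'[OF sequentially_bot] by blast
    \<comment> \<open>At time \<open>u n\<close> the state is close enough to \<open>z\<close> for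
      existence during \<open>\<epsilon>\<close>, and less than \<open>\<epsilon>\<close> remains
      until \<open>T\<close>.\<close>
    define n where "n = f k + n0"
    obtain \<sigma> where \<sigma>: "geod_in c1 \<sigma> {-\<epsilon><..<\<epsilon>}" "chart_coord c1 (\<sigma> 0) = xs n" "vel c1 \<sigma> 0 = vs n"
      using loc[of "(xs n, vs n)"] k(1) by (auto simp: dist_commute n_def)
    have un: "0 < u n" "u n < T" "T - u n < \<epsilon>"
      using k(2) u[of n] by (auto simp: dist_real_def n_def)
    obtain \<gamma>' where \<gamma>': "geod_on \<gamma>' {-\<epsilon>0<..<u n + \<epsilon>}" "\<And>t. t < T \<Longrightarrow> \<gamma>' t = G t"
      by (rule geod_extend[OF Gg, of "u n" c1 \<sigma> \<epsilon>])
         (use u[of n] n0[of n] \<sigma> un \<epsilon> c1 in \<open>auto simp: xs_def vs_def n_def\<close>)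
    have "P (u n + \<epsilon>) \<gamma>'"
    proof -
      obtain \<tau> where \<tau>: "P \<epsilon>0 \<tau>" "\<forall>t\<in>{-\<epsilon>0<..<\<epsilon>0}. G t = \<tau> t" using Gloc(2)[OF Q0] by blast
      have eq: "\<gamma>' t = \<tau> t" if "t \<in> {-\<epsilon>0<..<\<epsilon>0}" for t using \<gamma>'(2)[of t] \<tau>(2) that T\<epsilon> by simp
      have z0: "0 \<in> {-\<epsilon>0<..<\<epsilon>0}" using \<gamma>0(1) by simp
      have d: "\<tau> 0 \<in> chart_dom c" using \<tau>(1) chart_inv_in[OF c x] by (simp add: P_def)
      obtain S where S: "open S" "0 \<in> S" "S \<subseteq> {-\<epsilon>0<..<\<epsilon>0}" "geod_in c \<tau> S"
        by (rule geod_on_chart_at[where \<gamma>=\<tau>, OF _ open_greaterThanLessThan z0 c d]) (use \<tau>(1) in \<open>auto simp: P_def\<close>)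
      have "vel c \<gamma>' 0 = vel c \<tau> 0" by (rule geod_in_cong(2)[OF S(1) c S(4) _ S(2)]) (use eq S(3) in blast)
      then show ?thesis using \<gamma>'(1) eq[OF z0] \<tau>(1) by (simp add: P_def)
    qed
    then have "u n + \<epsilon> \<in> Q" using T\<epsilon> un by (auto simp: Q_def)
    then have "u n + \<epsilon> \<le> T" unfolding T_def by (rule cSup_upper[OF _ bdd])
    then show False using un by simp
  qed
  then obtain T \<gamma> where T: "T > 1" "P T \<gamma>" by (auto simp: Q_def)
  show thesis
    by (rule that[of "min \<epsilon>0 (T - 1)" \<gamma>]) (use T \<gamma>0(1) in \<open>auto simp: P_def elim!: geod_on_subset\<close>)
qed

end

section \<open>Jacobi fields and the exponential map\<close>

lemma C1_on_subset: "C1_on f S \<Longrightarrow> T \<subseteq> S \<Longrightarrow> C1_on f T"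
  unfolding C1_on_def by (meson continuous_on_subset subsetD)

lemma continuous_linear_family:
  fixes L :: "'a::topological_space \<Rightarrow> 'e::euclidean_space \<Rightarrow> 'f::real_normed_vector"
  assumes "\<And>t. t \<in> T \<Longrightarrow> linear (L t)" "\<And>v. continuous_on T (\<lambda>t. L t v)" "continuous_on T v"
  shows "continuous_on T (\<lambda>t. L t (v t))"
proof -
  have "continuous_on T (\<lambda>t. \<Sum>i\<in>Basis. (v t \<bullet> i) *\<^sub>R L t i)"
    using assms(2,3) by (intro continuous_on_sum continuous_on_scaleR continuous_on_inner continuous_on_const)
  moreover have "(\<Sum>i\<in>Basis. (v t \<bullet> i) *\<^sub>R L t i) = L t (v t)" if "t \<in> T" for t
  proof -
    have "L t (v t) = L t (\<Sum>i\<in>Basis. (v t \<bullet> i) *\<^sub>R i)" by (simp add: euclidean_representation)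
    then show ?thesis by (simp add: linear_sum[OF assms(1)[OF that]] linear_cmul[OF assms(1)[OF that]])
  qed
  ultimately show ?thesis by (simp cong: continuous_on_cong)
qed

lemma C1_on_linear: "C1_on f S \<Longrightarrow> x \<in> S \<Longrightarrow> linear (frechet_derivative f (at x))"
  using C1_on_has_derivative has_derivative_linear by blast

lemma C1_on_compose:
  fixes f :: "'d::euclidean_space \<Rightarrow> 'e::euclidean_space" and h :: "'e \<Rightarrow> 'f::real_normed_vector"
  assumes f: "C1_on f S" and h: "C1_on h T" and sub: "\<And>x. x \<in> S \<Longrightarrow> f x \<in> T"
  shows "C1_on (\<lambda>x. h (f x)) S"
    "\<And>x w. x \<in> S \<Longrightarrow> frechet_derivative (\<lambda>x. h (f x)) (at x) w = frechet_derivative h (at (f x)) (frechet_derivative f (at x) w)"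
proof -
  have d: "((\<lambda>x. h (f x)) has_derivative (\<lambda>w. frechet_derivative h (at (f x)) (frechet_derivative f (at x) w))) (at x)"
    if "x \<in> S" for x
    using has_derivative_compose[OF C1_on_has_derivative[OF f that] C1_on_has_derivative[OF h sub[OF that]]] .
  show "C1_on (\<lambda>x. h (f x)) S"
  proof (rule C1_onI[OF d])
    fix w
    show "continuous_on S (\<lambda>x. frechet_derivative h (at (f x)) (frechet_derivative f (at x) w))"
    proof (rule continuous_linear_family)
      show "continuous_on S (\<lambda>t. frechet_derivative h (at (f t)) v)" for v
        by (rule continuous_on_compose2[of T "\<lambda>y. frechet_derivative h (at y) v", OF _ C1_on_continuous[OF f]])
           (use h sub in \<open>auto simp: C1_on_def\<close>)
    qed (use f C1_on_linear[OF h sub] in \<open>auto simp: C1_on_def\<close>)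
  qed
  show "frechet_derivative (\<lambda>x. h (f x)) (at x) w = frechet_derivative h (at (f x)) (frechet_derivative f (at x) w)"
    if "x \<in> S" for x w
    using frechet_derivative_at[OF d[OF that]] by metis
qed

lemma (in C1_linear) continuous_derivative:
  assumes "continuous_on T x" "continuous_on T v" "x ` T \<subseteq> U"
  shows "continuous_on T (\<lambda>t. frechet_derivative (\<lambda>y. L y (v t)) (at (x t)) a)"
proof -
  obtain k :: 'e where k: "k \<in> Basis" by fastforce
  interpret B: C1_bilinear U "\<lambda>x v w. (w \<bullet> k) *\<^sub>R L x v" by (rule bilinear_extension)
  show ?thesis
    using B.continuous_d[OF assms(1,2) continuous_on_const[of _ k] assms(3), of a] k by (simp add: B.d_def)
qed

lemma C1_flow_C1:
  assumes "C1_flow W F F' z0 \<epsilon> \<delta> X D" "t \<in> {-\<epsilon><..<\<epsilon>}"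
  shows "C1_on (X t) (ball z0 \<delta>)"
    "\<And>z. z \<in> ball z0 \<delta> \<Longrightarrow> frechet_derivative (X t) (at z) = blinfun_apply (D t z)"
proof -
  show "C1_on (X t) (ball z0 \<delta>)"
  proof (rule C1_onI)
    show "(X t has_derivative blinfun_apply (D t z)) (at z)" if "z \<in> ball z0 \<delta>" for z
      by (rule C1_flowD(7)[OF assms(1) that assms(2)])
    show "continuous_on (ball z0 \<delta>) (\<lambda>z. blinfun_apply (D t z) v)" for v
      using C1_flowD(9)[OF assms] by (intro blinfun.continuous_on continuous_on_const)
  qed
  show "frechet_derivative (X t) (at z) = blinfun_apply (D t z)" if "z \<in> ball z0 \<delta>" for z
    using frechet_derivative_at[OF C1_flowD(7)[OF assms(1) that assms(2)]] by simp
qed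

section \<open>Chart changes of states and the pulled back metric\<close>

context riemannian_metric begin

text \<open>The change of charts on the tangent bundle, in coordinates of position and
  velocity.\<close>

definition state_trans :: "('a, 'e) chart \<Rightarrow> ('a, 'e) chart \<Rightarrow> 'e \<times> 'e \<Rightarrow> 'e \<times> 'e" where
  "state_trans c c' z = (transition c c' (fst z), Dtrans c c' (fst z) (snd z))"

lemma C1_state_trans:
  assumes c: "c \<in> A" "c' \<in> A"
  shows "C1_on (state_trans c c') (overlap c c' \<times> UNIV)"
proof -
  interpret L: C1_linear "overlap c c'" "Dtrans c c'" by (rule Dtrans_linear[OF c])
  note cf = continuous_on_fst[OF continuous_on_id] continuous_on_snd[OF continuous_on_id]
  show ?thesis
  proof (rule C1_onI)
    fix z :: "'e \<times> 'e" assume "z \<in> overlap c c' \<times> UNIV"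
    then have z: "fst z \<in> overlap c c'" by auto
    have "((\<lambda>z. transition c c' (fst z)) has_derivative (\<lambda>q. Dtrans c c' (fst z) (fst q))) (at z)"
      using has_derivative_compose[OF has_derivative_fst[OF has_derivative_ident] C1_on_has_derivative[OF C1_transition(1)[OF c] z]] .
    moreover have "((\<lambda>z. Dtrans c c' (fst z) (snd z)) has_derivative
        (\<lambda>q. D2trans c c' (fst z) (fst q) (snd z) + Dtrans c c' (fst z) (snd q))) (at z)"
      using L.joint_derivative[OF z, of "snd z"] by simp
    ultimately show "(state_trans c c' has_derivative
       (\<lambda>q. (Dtrans c c' (fst z) (fst q), D2trans c c' (fst z) (fst q) (snd z) + Dtrans c c' (fst z) (snd q)))) (at z)"
      unfolding state_trans_def[abs_def] by (rule has_derivative_Pair)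
  next
    fix q :: "'e \<times> 'e"
    show "continuous_on (overlap c c' \<times> UNIV) (\<lambda>z::'e \<times> 'e. (Dtrans c c' (fst z) (fst q),
        D2trans c c' (fst z) (fst q) (snd z) + Dtrans c c' (fst z) (snd q)))"
      by (intro continuous_on_Pair continuous_on_add L.continuous_joint L.continuous_derivative cf continuous_on_const) auto
  qed
qed

text \<open>The squared length of the image of \<open>w\<close> under the differential of
  \<open>h\<close> at \<open>u\<close>, that is, the pulled back metric on the diagonal.\<close>

definition dnorm :: "('e \<Rightarrow> 'a) \<Rightarrow> 'e \<Rightarrow> 'e \<Rightarrow> real" where
  "dnorm h u w = (let c = (SOME c. c \<in> A \<and> h u \<in> chart_dom c); v = frechet_derivative (chart_coord c \<circ> h) (at u) w
     in g c (chart_coord c (h u)) v v)"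

lemma dnorm_chart:
  assumes c: "c \<in> A" and N: "open N" "u \<in> N" "\<And>u. u \<in> N \<Longrightarrow> h u \<in> chart_dom c"
    and d: "((chart_coord c \<circ> h) has_derivative h') (at u)"
  shows "dnorm h u w = g c (chart_coord c (h u)) (h' w) (h' w)"
proof -
  define c0 where "c0 = (SOME c. c \<in> A \<and> h u \<in> chart_dom c)"
  have c0: "c0 \<in> A" "h u \<in> chart_dom c0"
    using someI[of "\<lambda>c. c \<in> A \<and> h u \<in> chart_dom c" c] c N by (auto simp: c0_def)
  let ?x = "chart_coord c (h u)"
  have x: "?x \<in> overlap c c0" using N c0 by (auto simp: overlap_def)
  have "((\<lambda>u. transition c c0 ((chart_coord c \<circ> h) u)) has_derivative (\<lambda>w. Dtrans c c0 ?x (h' w))) (at u)"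
    using has_derivative_compose[OF d] C1_on_has_derivative[OF C1_transition(1)[OF c c0(1)] x] by simp
  then have "((chart_coord c0 \<circ> h) has_derivative (\<lambda>w. Dtrans c c0 ?x (h' w))) (at u)"
    by (rule has_derivative_transform_within_open[OF _ N(1,2)]) (simp add: transition_coord[OF c N(3)])
  then have "frechet_derivative (chart_coord c0 \<circ> h) (at u) w = Dtrans c c0 ?x (h' w)"
    by (metis frechet_derivative_at)
  then show ?thesis
    unfolding dnorm_def Let_def c0_def[symmetric]
    by (simp add: metric_transition[OF c c0(1) x] transition_coord[OF c N(3)[OF N(2)]])
qed

end

text \<open>\<open>\<gamma> u\<close> is the geodesic from \<open>p\<close> with initial velocity \<open>u\<close>, so \<open>\<gamma> u 1\<close> is the exponential map at \<open>p\<close>.\<close>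

locale exp_family = hadamard_space A g
  for A :: "('a::metric_space, 'e::euclidean_space) chart set" and g +
  fixes c0 :: "('a, 'e) chart" and p :: 'a and \<gamma> :: "'e \<Rightarrow> real \<Rightarrow> 'a"
  assumes c0: "c0 \<in> A" "p \<in> chart_dom c0"
    and family: "\<exists>\<epsilon>>0. geod_on (\<gamma> u) {-\<epsilon><..<1 + \<epsilon>}"
    and init: "\<gamma> u 0 = p" "vel c0 (\<gamma> u) 0 = u"
begin

definition st :: "('a, 'e) chart \<Rightarrow> 'e \<Rightarrow> real \<Rightarrow> 'e \<times> 'e" where
  "st c u t = (chart_coord c (\<gamma> u t), vel c (\<gamma> u) t)"

text \<open>C1 dependence on the initial velocity near \<open>u0\<close>, in a form that can be
  passed from one time to another and from one chart to another.\<close>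

definition good :: "('a, 'e) chart \<Rightarrow> 'e \<Rightarrow> real \<Rightarrow> bool" where
  "good c u0 t \<longleftrightarrow> (\<exists>N. open N \<and> u0 \<in> N \<and> (\<forall>u\<in>N. \<gamma> u t \<in> chart_dom c) \<and> C1_on (\<lambda>u. st c u t) N)"

lemma geod_near:
  assumes "t \<in> {0..1}" "c \<in> A" "\<gamma> u t \<in> chart_dom c"
  obtains S where "open S" "t \<in> S" "geod_in c (\<gamma> u) S"
proof -
  obtain \<epsilon> where \<epsilon>: "\<epsilon> > 0" "geod_on (\<gamma> u) {-\<epsilon><..<1 + \<epsilon>}" using family by blast
  have t: "t \<in> {-\<epsilon><..<1 + \<epsilon>}" using assms(1) \<epsilon>(1) by auto
  show thesis
    by (rule geod_on_chart_at[where \<gamma>="\<gamma> u" and t=t, OF \<epsilon>(2) open_greaterThanLessThan t assms(2,3)]) (rule that)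
qed

lemma geodesic_determined:
  assumes J: "open J" "convex J" "{0..1} \<subseteq> J" and \<sigma>: "geod_on \<sigma> J" and "\<sigma> 0 = p" "vel c0 \<sigma> 0 = u" and t: "t \<in> {0..1}"
  shows "\<sigma> t = \<gamma> u t"
proof -
  obtain \<epsilon> where \<epsilon>: "\<epsilon> > 0" "geod_on (\<gamma> u) {-\<epsilon><..<1 + \<epsilon>}" using family by blast
  show ?thesis
  proof (rule geod_unique[of "{-\<epsilon><..<1 + \<epsilon>} \<inter> J" 0 \<sigma> "\<gamma> u" c0])
    show "connected ({-\<epsilon><..<1 + \<epsilon>} \<inter> J)" using J by (intro convex_connected convex_Int) auto
    show "geod_on \<sigma> ({-\<epsilon><..<1 + \<epsilon>} \<inter> J)" by (rule geod_on_subset[OF \<sigma>]) auto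
    show "geod_on (\<gamma> u) ({-\<epsilon><..<1 + \<epsilon>} \<inter> J)" by (rule geod_on_subset[OF \<epsilon>(2)]) auto
    show "0 \<in> {-\<epsilon><..<1 + \<epsilon>} \<inter> J" "t \<in> {-\<epsilon><..<1 + \<epsilon>} \<inter> J" using J(3) \<epsilon>(1) t by auto
  qed (use J assms c0 init in auto)
qed

lemma st_change:
  assumes "t \<in> {0..1}" and c: "c \<in> A" "c' \<in> A" and dom: "\<gamma> u t \<in> chart_dom c" "\<gamma> u t \<in> chart_dom c'"
  shows "st c' u t = state_trans c c' (st c u t)"
proof -
  obtain S where S: "open S" "t \<in> S" "geod_in c (\<gamma> u) S" by (rule geod_near[OF assms(1) c(1) dom(1)])
  show ?thesis
    using vel_change(2)[OF c S dom(2)] by (simp add: st_def state_trans_def transition_coord[OF c(1) dom(1)])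
qed

lemma good_change:
  assumes t: "t \<in> {0..1}" and c: "c \<in> A" "c' \<in> A" and dom: "\<gamma> u0 t \<in> chart_dom c'" and good: "good c u0 t"
  shows "good c' u0 t"
proof -
  obtain N where N: "open N" "u0 \<in> N" "\<forall>u\<in>N. \<gamma> u t \<in> chart_dom c" "C1_on (\<lambda>u. st c u t) N"
    using good by (auto simp: good_def)
  define N' where "N' = N \<inter> (\<lambda>u. st c u t) -` (overlap c c' \<times> UNIV)"
  have o: "open N'"
    unfolding N'_def using N(1) C1_on_continuous[OF N(4)] open_overlap[OF c]
    by (intro continuous_open_preimage) (auto simp: open_Times)
  have dom': "\<gamma> u t \<in> chart_dom c'" if "u \<in> N'" for u
  proof -
    have "u \<in> N" "chart_coord c (\<gamma> u t) \<in> overlap c c'" using that by (auto simp: N'_def st_def)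
    then show ?thesis using N(3) c(1) chart_inv_coord by (metis IntD2 overlap_alt vimageE)
  qed
  have "u0 \<in> N'" using N(2,3) dom by (auto simp: N'_def st_def overlap_def)
  moreover have "C1_on (\<lambda>u. st c' u t) N'"
  proof (rule C1_on_cong[OF o])
    show "C1_on (\<lambda>u. state_trans c c' (st c u t)) N'"
      by (rule C1_on_compose(1)[OF C1_on_subset[OF N(4)] C1_state_trans[OF c]]) (auto simp: N'_def)
    show "state_trans c c' (st c u t) = st c' u t" if "u \<in> N'" for u
      using st_change[OF t c _ dom'[OF that]] N(3) that by (auto simp: N'_def)
  qed
  ultimately show ?thesis unfolding good_def using o dom' by blast
qed

text \<open>Uniqueness identifies \<open>\<gamma> u\<close> with the trajectory of the chart flow
  through its state at time \<open>t\<close>. The flow box is centred at a fixed \<open>z1\<close>,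
  so one box serves all \<open>u\<close> whose state lies in it.\<close>

lemma flow_follow:
  assumes c: "c \<in> A" and fl: "chart_flow c z1 \<epsilon> \<delta> X D" and t: "t \<in> {0..1}" and dom: "\<gamma> u t \<in> chart_dom c"
    and z: "st c u t \<in> ball z1 \<delta>" and s: "s \<in> {0..1}" "\<bar>s - t\<bar> < \<epsilon>"
  shows "\<gamma> u s \<in> chart_dom c" "st c u s = X (s - t) (st c u t)"
proof -
  define z where "z = st c u t"
  define \<tau> where "\<tau> = (\<lambda>r. chart_inv c (fst (X r z)))"
  note F = C1_flowD[OF fl]
  have zb: "z \<in> ball z1 \<delta>" using z by (simp add: z_def)
  have \<tau>: "geod_in c \<tau> {-\<epsilon><..<\<epsilon>}" and v\<tau>: "\<And>r. r \<in> {-\<epsilon><..<\<epsilon>} \<Longrightarrow> vel c \<tau> r = snd (X r z)"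
    unfolding \<tau>_def by (rule flow_geodesic[OF c F(5,6)[OF zb]]; assumption)+
  have c\<tau>: "chart_coord c (\<tau> r) = fst (X r z)" if "r \<in> {-\<epsilon><..<\<epsilon>}" for r
    using F(5)[OF zb that] chart_coord_inv[OF c] by (simp add: \<tau>_def mem_Times_iff)
  have z0: "0 \<in> {-\<epsilon><..<\<epsilon>}" using F(1) by simp
  let ?\<sigma> = "\<lambda>r. \<tau> (1 * r + (- t))"
  have sg: "geod_on ?\<sigma> {t - \<epsilon><..<t + \<epsilon>}"
    by (rule geod_on_affine[OF geod_in_on[OF c open_greaterThanLessThan \<tau>]]) auto
  have v\<sigma>: "vel c ?\<sigma> r = snd (X (r - t) z)" if "r \<in> {t - \<epsilon><..<t + \<epsilon>}" for r
  proof -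
    have r: "1 * r + - t \<in> {-\<epsilon><..<\<epsilon>}" using that by auto
    have "vel c ?\<sigma> r = 1 *\<^sub>R vel c \<tau> (1 * r + - t)" by (rule vel_affine[OF geod_inD(2)[OF \<tau> r]])
    then show ?thesis using v\<tau>[OF r] by simp
  qed
  have \<sigma>t: "?\<sigma> t = \<gamma> u t" using F(3)[OF zb] chart_inv_coord[OF c dom] by (simp add: \<tau>_def z_def st_def)
  obtain e where e: "e > 0" "geod_on (\<gamma> u) {-e<..<1 + e}" using family by blast
  let ?I = "{t - \<epsilon><..<t + \<epsilon>} \<inter> {-e<..<1 + e}"
  have oI: "open ?I" by auto
  have eq: "?\<sigma> r = \<gamma> u r" if r: "r \<in> ?I" for r
  proof (rule geod_unique[of ?I t ?\<sigma> "\<gamma> u" c])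
    show "connected ?I" by (intro convex_connected convex_Int) auto
    show "geod_on ?\<sigma> ?I" by (rule geod_on_subset[OF sg]) auto
    show "geod_on (\<gamma> u) ?I" by (rule geod_on_subset[OF e(2)]) auto
    show "t \<in> ?I" using t e F(1) by auto
    have "t \<in> {t - \<epsilon><..<t + \<epsilon>}" using F(1) by auto
    from v\<sigma>[OF this] show "vel c ?\<sigma> t = vel c (\<gamma> u) t" using F(3)[OF zb] by (simp add: z_def st_def)
    show "?\<sigma> t \<in> chart_dom c" unfolding \<sigma>t by (rule dom)
  qed (use c r \<sigma>t in auto)
  have s1: "s \<in> {t - \<epsilon><..<t + \<epsilon>}" "s \<in> ?I" "1 * s + - t \<in> {-\<epsilon><..<\<epsilon>}" using s e by auto
  show doms: "\<gamma> u s \<in> chart_dom c"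
    using geod_inD(1)[OF \<tau> s1(3)] eq[OF s1(2)] by simp
  have \<sigma>c: "geod_in c ?\<sigma> {t - \<epsilon><..<t + \<epsilon>}"
    by (rule geod_on_chart[OF sg c open_greaterThanLessThan order_refl]) (use geod_inD(1)[OF \<tau>] in auto)
  have "vel c (\<gamma> u) s = vel c ?\<sigma> s"
    by (rule geod_in_cong(2)[OF oI c geod_in_subset[OF \<sigma>c] _ s1(2)]) (use eq in auto)
  then show "st c u s = X (s - t) (st c u t)"
    using v\<sigma>[OF s1(1)] c\<tau>[OF s1(3)] eq[OF s1(2)] by (simp add: st_def z_def[symmetric, unfolded st_def] prod_eq_iff)
qed

text \<open>The state at time \<open>s\<close> is the state at time \<open>t\<close> followed by the
  flow map for the time difference; the chain rule then transports the differential by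
  \<open>D\<close>.\<close>

lemma good_follow:
  assumes c: "c \<in> A" and fl: "chart_flow c z1 \<epsilon> \<delta> X D" and t: "t \<in> {0..1}" and good: "good c u0 t"
    and z: "st c u0 t \<in> ball z1 \<delta>" and s: "s \<in> {0..1}" "\<bar>s - t\<bar> < \<epsilon>"
  shows "good c u0 s"
    "frechet_derivative (\<lambda>u. st c u s) (at u0) w = D (s - t) (st c u0 t) (frechet_derivative (\<lambda>u. st c u t) (at u0) w)"
proof -
  obtain N where N: "open N" "u0 \<in> N" "\<forall>u\<in>N. \<gamma> u t \<in> chart_dom c" "C1_on (\<lambda>u. st c u t) N"
    using good by (auto simp: good_def)
  define N' where "N' = N \<inter> (\<lambda>u. st c u t) -` ball z1 \<delta>"
  have o: "open N'"
    unfolding N'_def using N(1) C1_on_continuous[OF N(4)] by (intro continuous_open_preimage) auto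
  have u0: "u0 \<in> N'" using N(2) z by (simp add: N'_def)
  have r: "s - t \<in> {-\<epsilon><..<\<epsilon>}" using s by auto
  have ff: "\<gamma> u s \<in> chart_dom c" "st c u s = X (s - t) (st c u t)" if "u \<in> N'" for u
    using flow_follow[OF c fl t _ _ s, of u] N(3) that by (auto simp: N'_def)
  note comp = C1_on_compose[OF C1_on_subset[OF N(4), of N'] C1_flow_C1(1)[OF fl r]]
  have C: "C1_on (\<lambda>u. X (s - t) (st c u t)) N'" by (rule comp(1)) (auto simp: N'_def)
  have "C1_on (\<lambda>u. st c u s) N'"
    by (rule C1_on_cong[OF o _ C]) (simp add: ff(2))
  then show "good c u0 s" unfolding good_def using o u0 ff(1) by blast
  have "((\<lambda>u. st c u s) has_derivative frechet_derivative (\<lambda>u. X (s - t) (st c u t)) (at u0)) (at u0)"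
    by (rule has_derivative_transform_within_open[OF C1_on_has_derivative[OF C u0] o u0]) (simp add: ff(2))
  then have "frechet_derivative (\<lambda>u. st c u s) (at u0) w = frechet_derivative (\<lambda>u. X (s - t) (st c u t)) (at u0) w"
    by (metis frechet_derivative_at)
  also have "\<dots> = frechet_derivative (X (s - t)) (at (st c u0 t)) (frechet_derivative (\<lambda>u. st c u t) (at u0) w)"
    by (rule comp(2)) (use u0 in \<open>auto simp: N'_def\<close>)
  also have "\<dots> = D (s - t) (st c u0 t) (frechet_derivative (\<lambda>u. st c u t) (at u0) w)"
    by (simp add: C1_flow_C1(2)[OF fl r z])
  finally show "frechet_derivative (\<lambda>u. st c u s) (at u0) w = D (s - t) (st c u0 t) (frechet_derivative (\<lambda>u. st c u t) (at u0) w)" .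
qed

text \<open>At time \<open>0\<close> the state is the coordinate point of \<open>p\<close> together
  with \<open>u\<close>, so the variation starts as a Jacobi field with value \<open>0\<close> and
  derivative \<open>w\<close>.\<close>

lemma good_initial: "good c0 u0 0"
  and initial_derivative: "frechet_derivative (\<lambda>u. st c0 u 0) (at u0) w = (0, w)"
proof -
  have eq: "(\<lambda>u. st c0 u 0) = (\<lambda>u. (chart_coord c0 p, u))" by (auto simp: st_def init)
  have d: "((\<lambda>u. st c0 u 0) has_derivative (\<lambda>w. (0, w))) (at u)" for u
    unfolding eq by (auto intro!: derivative_eq_intros)
  then show "frechet_derivative (\<lambda>u. st c0 u 0) (at u0) w = (0, w)" by (metis frechet_derivative_at)
  have "C1_on (\<lambda>u. st c0 u 0) UNIV" by (rule C1_onI[OF d]) (auto intro!: continuous_intros)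
  then show "good c0 u0 0" unfolding good_def using c0 init by (intro exI[of _ UNIV]) auto
qed

text \<open>Connectedness of \<open>{0..1}\<close>: around each time one flow box transports the
  property between any two nearby times, in either direction.\<close>

lemma good_all:
  assumes t: "t \<in> {0..1}" and c: "c \<in> A" "\<gamma> u0 t \<in> chart_dom c"
  shows "good c u0 t"
proof -
  have "\<exists>c\<in>A. good c u0 t"
  proof (rule connected_induction_simple[of "{0..1::real}" 0 t "\<lambda>t. \<exists>c\<in>A. good c u0 t"])
    fix t1 :: real assume t1: "t1 \<in> {0..1}"
    obtain c where c: "c \<in> A" "\<gamma> u0 t1 \<in> chart_dom c" by (rule chart_exists)
    obtain \<epsilon> \<delta> X D where fl: "chart_flow c (st c u0 t1) \<epsilon> \<delta> X D"
      by (rule chart_flow_exists[OF c(1), of "st c u0 t1"]) (simp add: st_def chart_coord_in[OF c(2)])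
    note F = C1_flowD[OF fl]
    obtain S where S: "open S" "t1 \<in> S" "geod_in c (\<gamma> u0) S" by (rule geod_near[OF t1 c])
    have "isCont (st c u0) t1"
      unfolding st_def[abs_def]
      using geod_inD(2)[OF S(3,2), THEN has_vector_derivative_continuous] geod_in_continuous(2)[OF c(1) S(1,3,2)]
      by (intro isCont_Pair) (simp_all add: comp_def)
    then obtain \<eta> where \<eta>: "\<eta> > 0" "\<And>t. dist t t1 < \<eta> \<Longrightarrow> dist (st c u0 t) (st c u0 t1) < \<delta>"
      using F(2) unfolding continuous_at_eps_delta by blast
    obtain \<eta>' where \<eta>': "\<eta>' > 0" "ball t1 \<eta>' \<subseteq> S" using S openE by blast
    \<comment> \<open>Half of \<open>\<epsilon>\<close>, so that any two times of \<open>T\<close>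
      differ by less than the lifetime \<open>\<epsilon>\<close> of the flow.\<close>
    define T where "T = {0..1} \<inter> ball t1 (min (\<epsilon> / 2) (min \<eta> \<eta>'))"
    have "\<exists>c\<in>A. good c u0 s" if t: "t \<in> T" "\<exists>c\<in>A. good c u0 t" and s: "s \<in> T" for t s
    proof -
      have "t \<in> S" using t(1) \<eta>' by (auto simp: T_def)
      then have "good c u0 t"
        using t good_change[OF _ _ c(1) geod_inD(1)[OF S(3)]] by (auto simp: T_def)
      moreover have "st c u0 t \<in> ball (st c u0 t1) \<delta>" using t(1) \<eta>(2)[of t] by (auto simp: T_def dist_commute)
      moreover have "\<bar>t1 - s\<bar> < \<epsilon> / 2" "\<bar>t1 - t\<bar> < \<epsilon> / 2" using s t(1) by (auto simp: T_def dist_real_def)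
      then have "\<bar>s - t\<bar> < \<epsilon>" by arith
      ultimately show ?thesis using good_follow(1)[OF c(1) fl, of t u0 s] s t(1) c(1) by (auto simp: T_def)
    qed
    moreover have "openin (top_of_set {0..1}) T" "t1 \<in> T"
      using t1 \<eta> \<eta>' F(1) by (auto simp: T_def openin_open_Int)
    ultimately show "\<exists>T. openin (top_of_set {0..1}) T \<and> t1 \<in> T \<and> (\<forall>x\<in>T. \<forall>y\<in>T. (\<exists>c\<in>A. good c u0 x) \<longrightarrow> (\<exists>c\<in>A. good c u0 y))"
      by blast
  qed (use t good_initial c0 in auto)
  then show ?thesis using good_change[OF t _ c] by blast
qed

text \<open>The curves \<open>Z\<close> and \<open>Y\<close> come from the flow and are defined
  around \<open>t\<close> on both sides, so two-sided derivatives exist also at \<open>t = 0\<close>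
  and \<open>t = 1\<close>; agreement with the family is claimed inside \<open>{0..1}\<close>
  only.\<close>

lemma variation:
  assumes t: "t \<in> {0..1}" and c: "c \<in> A" "\<gamma> u0 t \<in> chart_dom c"
  obtains S Z Y where "open S" "t \<in> S"
    "\<And>s. s \<in> S \<Longrightarrow> fst (Z s) \<in> chart_img c"
    "\<And>s. s \<in> S \<Longrightarrow> (Z has_vector_derivative gF c (Z s)) (at s)"
    "\<And>s. s \<in> S \<Longrightarrow> (Y has_vector_derivative gF' c (Z s) (Y s)) (at s)"
    "\<And>s. s \<in> S \<Longrightarrow> s \<in> {0..1} \<Longrightarrow> good c u0 s \<and> st c u0 s = Z s \<and> frechet_derivative (\<lambda>u. st c u s) (at u0) w = Y s"
proof -
  obtain \<epsilon> \<delta> X D where fl: "chart_flow c (st c u0 t) \<epsilon> \<delta> X D"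
    by (rule chart_flow_exists[OF c(1), of "st c u0 t"]) (simp add: st_def chart_coord_in[OF c(2)])
  note F = C1_flowD[OF fl]
  have z: "st c u0 t \<in> ball (st c u0 t) \<delta>" using F(2) by simp
  define S where "S = {t - \<epsilon><..<t + \<epsilon>}"
  have sh: "((\<lambda>s. s - t) has_vector_derivative 1) (at s)" for s
    unfolding has_real_derivative_iff_has_vector_derivative[symmetric] by (auto intro!: derivative_eq_intros)
  have sub: "s - t \<in> {-\<epsilon><..<\<epsilon>}" if "s \<in> S" for s using that by (auto simp: S_def)
  define Z where "Z = (\<lambda>s. X (s - t) (st c u0 t))"
  define Y where "Y = (\<lambda>s. D (s - t) (st c u0 t) (frechet_derivative (\<lambda>u. st c u t) (at u0) w))"
  show thesis
  proof (rule that[of S Z Y])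
    show "open S" "t \<in> S" using F(1) by (auto simp: S_def)
    fix s assume s: "s \<in> S"
    show "fst (Z s) \<in> chart_img c" using F(5)[OF z sub[OF s]] by (simp add: Z_def mem_Times_iff)
    show "(Z has_vector_derivative gF c (Z s)) (at s)"
      using vector_diff_chain_at[OF sh F(6)[OF z sub[OF s]]] by (simp add: Z_def comp_def)
    have "((\<lambda>s. D (s - t) (st c u0 t)) has_vector_derivative gF' c (Z s) o\<^sub>L D (s - t) (st c u0 t)) (at s)"
      using vector_diff_chain_at[OF sh F(8)[OF z sub[OF s]]] by (simp add: Z_def comp_def)
    from bounded_linear.has_vector_derivative[OF blinfun.bounded_linear_left this]
    show "(Y has_vector_derivative gF' c (Z s) (Y s)) (at s)" by (simp add: Y_def)
    assume s01: "s \<in> {0..1}"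
    have "\<bar>s - t\<bar> < \<epsilon>" using s by (auto simp: S_def)
    note * = c(1) fl t
    show "good c u0 s \<and> st c u0 s = Z s \<and> frechet_derivative (\<lambda>u. st c u s) (at u0) w = Y s"
      using good_follow[OF * good_all[OF t c] z s01 \<open>\<bar>s - t\<bar> < \<epsilon>\<close>] flow_follow(2)[OF * c(2) z s01 \<open>\<bar>s - t\<bar> < \<epsilon>\<close>]
      by (simp add: Z_def Y_def)
  qed
qed

lemma dnorm_good:
  assumes "good c u0 s" "c \<in> A"
  shows "dnorm (\<lambda>u. \<gamma> u s) u0 w = g c (chart_coord c (\<gamma> u0 s))
    (fst (frechet_derivative (\<lambda>u. st c u s) (at u0) w)) (fst (frechet_derivative (\<lambda>u. st c u s) (at u0) w))"
proof -
  obtain N where N: "open N" "u0 \<in> N" "\<forall>u\<in>N. \<gamma> u s \<in> chart_dom c" "C1_on (\<lambda>u. st c u s) N"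
    using assms(1) by (auto simp: good_def)
  have "((\<lambda>u. fst (st c u s)) has_derivative (\<lambda>w. fst (frechet_derivative (\<lambda>u. st c u s) (at u0) w))) (at u0)"
    by (rule has_derivative_fst[OF C1_on_has_derivative[OF N(4,2)]])
  then have "((chart_coord c \<circ> (\<lambda>u. \<gamma> u s)) has_derivative (\<lambda>w. fst (frechet_derivative (\<lambda>u. st c u s) (at u0) w))) (at u0)"
    by (simp add: st_def comp_def)
  from dnorm_chart[OF assms(2) N(1,2) _ this] N(3) show ?thesis by simp
qed

text \<open>The length \<open>sqrt f\<close> of the Jacobi field \<open>d (\<gamma> u s) w\<close> is convex in \<open>s\<close>, vanishes at \<open>0\<close> and has there the
  slope \<open>|w|\<close>; hence it is at least \<open>|w|\<close> at \<open>1\<close>.\<close>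

proposition exp_expanding: "g c0 (chart_coord c0 p) w w \<le> dnorm (\<lambda>u. \<gamma> u 1) u0 w"
proof -
  define f where "f = (\<lambda>s. dnorm (\<lambda>u. \<gamma> u s) u0 w)"
  have local: "\<exists>S x v J K. open S \<and> t \<in> S \<and>
      (\<forall>s\<in>S. x s \<in> chart_img c \<and> (x has_vector_derivative v s) (at s) \<and>
         (v has_vector_derivative - christoffel c (x s) (v s) (v s)) (at s) \<and>
         (J has_vector_derivative K s) (at s) \<and>
         (K has_vector_derivative - (d\<Gamma> c (x s) (J s) (v s) (v s) + christoffel c (x s) (K s) (v s) + christoffel c (x s) (v s) (K s))) (at s) \<and>
         (s \<in> {0..1} \<longrightarrow> f s = g c (x s) (J s) (J s) \<and> x s = chart_coord c (\<gamma> u0 s) \<and> frechet_derivative (\<lambda>u. st c u s) (at u0) w = (J s, K s)))"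
    if t: "t \<in> {0..1}" and c: "c \<in> A" "\<gamma> u0 t \<in> chart_dom c" for t c
  proof -
    obtain S Z Y where V: "open S" "t \<in> S"
      "\<And>s. s \<in> S \<Longrightarrow> fst (Z s) \<in> chart_img c"
      "\<And>s. s \<in> S \<Longrightarrow> (Z has_vector_derivative gF c (Z s)) (at s)"
      "\<And>s. s \<in> S \<Longrightarrow> (Y has_vector_derivative gF' c (Z s) (Y s)) (at s)"
      "\<And>s. s \<in> S \<Longrightarrow> s \<in> {0..1} \<Longrightarrow> good c u0 s \<and> st c u0 s = Z s \<and> frechet_derivative (\<lambda>u. st c u s) (at u0) w = Y s"
      by (rule variation[OF t c, where w=w]) (rule that)
    have "fst (Z s) \<in> chart_img c \<and> ((\<lambda>s. fst (Z s)) has_vector_derivative snd (Z s)) (at s) \<and>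
         ((\<lambda>s. snd (Z s)) has_vector_derivative - christoffel c (fst (Z s)) (snd (Z s)) (snd (Z s))) (at s) \<and>
         ((\<lambda>s. fst (Y s)) has_vector_derivative snd (Y s)) (at s) \<and>
         ((\<lambda>s. snd (Y s)) has_vector_derivative - (d\<Gamma> c (fst (Z s)) (fst (Y s)) (snd (Z s)) (snd (Z s))
            + christoffel c (fst (Z s)) (snd (Y s)) (snd (Z s)) + christoffel c (fst (Z s)) (snd (Z s)) (snd (Y s)))) (at s) \<and>
         (s \<in> {0..1} \<longrightarrow> f s = g c (fst (Z s)) (fst (Y s)) (fst (Y s)) \<and> fst (Z s) = chart_coord c (\<gamma> u0 s)
           \<and> frechet_derivative (\<lambda>u. st c u s) (at u0) w = (fst (Y s), snd (Y s)))" if s: "s \<in> S" for s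
      using V(3)[OF s] V(6)[OF s] dnorm_good[OF _ c(1), of u0 s w]
        bounded_linear.has_vector_derivative[OF bounded_linear_fst V(4)[OF s]]
        bounded_linear.has_vector_derivative[OF bounded_linear_snd V(4)[OF s]]
        bounded_linear.has_vector_derivative[OF bounded_linear_fst V(5)[OF s]]
        bounded_linear.has_vector_derivative[OF bounded_linear_snd V(5)[OF s]]
      by (auto simp: gF_def gF'_apply[OF c(1) V(3)[OF s]] f_def st_def prod_eq_iff)
    then show ?thesis
      by (intro exI[of _ S] exI[of _ "\<lambda>s. fst (Z s)"] exI[of _ "\<lambda>s. snd (Z s)"] exI[of _ "\<lambda>s. fst (Y s)"]
          exI[of _ "\<lambda>s. snd (Y s)"] conjI[OF V(1)] conjI[OF V(2)] ballI)
  qed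
  have floc: "\<exists>S F F'. open S \<and> t \<in> S \<and> (F has_vector_derivative F') (at t) \<and> (\<forall>s\<in>S. s \<in> {0..1} \<longrightarrow> f s = F s)"
    if t: "t \<in> {0..1}" for t
  proof -
    obtain c where c: "c \<in> A" "\<gamma> u0 t \<in> chart_dom c" by (rule chart_exists)
    interpret M: C1_inner "chart_img c" "g c" using C1_metric[OF c(1)] .
    obtain S x v J K where S: "open S" "t \<in> S" and x: "\<And>s. s \<in> S \<Longrightarrow> x s \<in> chart_img c"
      and d: "\<And>s. s \<in> S \<Longrightarrow> (x has_vector_derivative v s) (at s)" "\<And>s. s \<in> S \<Longrightarrow> (J has_vector_derivative K s) (at s)"
      and f: "\<And>s. s \<in> S \<Longrightarrow> s \<in> {0..1} \<Longrightarrow> f s = g c (x s) (J s) (J s)"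
      using local[OF t c] by blast
    show ?thesis
      by (rule exI[of _ S], rule exI[of _ "\<lambda>s. g c (x s) (J s) (J s)"], rule exI,
          intro conjI S ballI impI, rule M.curve_derivative[OF x d(1) d(2) d(2)]; (rule S f; assumption?)?)
  qed
  have contf: "continuous_on {0..1} f"
    unfolding continuous_on_eq_continuous_within
  proof
    fix t :: real assume t: "t \<in> {0..1}"
    obtain S F F' where F: "open S" "t \<in> S" "(F has_vector_derivative F') (at t)" "\<forall>s\<in>S. s \<in> {0..1} \<longrightarrow> f s = F s"
      using floc[OF t] by blast
    have "continuous (at t within {0..1}) F"
      using has_vector_derivative_continuous[OF F(3)] continuous_at_imp_continuous_at_within by blast
    moreover obtain d where d: "d > 0" "ball t d \<subseteq> S" using F(1,2) openE by blast
    ultimately show "continuous (at t within {0..1}) f"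
      by (rule_tac continuous_transform_within[OF _ d(1) t]) (use F(4) d in \<open>auto simp: dist_commute subset_iff\<close>)
  qed
  have nonneg: "f t \<ge> 0" if t: "t \<in> {0..1}" for t
  proof -
    obtain c where c: "c \<in> A" "\<gamma> u0 t \<in> chart_dom c" by (rule chart_exists)
    show ?thesis
      unfolding f_def dnorm_good[OF good_all[OF t c] c(1)] by (rule metric_nonneg[OF c(1) chart_coord_in[OF c(2)]])
  qed
  have "0 \<in> {0..1::real}" by simp
  from local[OF this c0(1), unfolded init(1), OF c0(2)]
  obtain S x v J K where S: "open S" "0 \<in> S"
    and x: "\<And>s. s \<in> S \<Longrightarrow> x s \<in> chart_img c0" "\<And>s. s \<in> S \<Longrightarrow> (x has_vector_derivative v s) (at s)"
    and J: "\<And>s. s \<in> S \<Longrightarrow> (J has_vector_derivative K s) (at s)"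
    and f: "\<And>s. s \<in> S \<Longrightarrow> s \<in> {0..1} \<Longrightarrow> f s = g c0 (x s) (J s) (J s) \<and> x s = chart_coord c0 (\<gamma> u0 s) \<and> frechet_derivative (\<lambda>u. st c0 u s) (at u0) w = (J s, K s)"
    by blast
  interpret M: C1_inner "chart_img c0" "g c0" using C1_metric[OF c0(1)] .
  have J0: "J 0 = 0" "K 0 = w" "x 0 = chart_coord c0 p"
    using f[OF S(2)] initial_derivative by (auto simp: init)
  have f0: "f 0 = 0" using f[OF S(2)] J0 bilinear_lzero[OF M.bil[OF x(1)[OF S(2)]]] by simp
  have jac: "\<exists>f2. (f has_real_derivative deriv f t) (at t) \<and> (deriv f has_real_derivative f2) (at t) \<and> f2 \<ge> 0 \<and> (deriv f t)\<^sup>2 \<le> 2 * f t * f2"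
    if t: "t \<in> {0<..<1}" for t
  proof -
    have t01: "t \<in> {0..1}" using t by auto
    obtain c where c: "c \<in> A" "\<gamma> u0 t \<in> chart_dom c" by (rule chart_exists)
    obtain S x v J K where S: "open S" "t \<in> S" and L: "\<forall>s\<in>S. x s \<in> chart_img c \<and> (x has_vector_derivative v s) (at s) \<and>
         (v has_vector_derivative - christoffel c (x s) (v s) (v s)) (at s) \<and>
         (J has_vector_derivative K s) (at s) \<and>
         (K has_vector_derivative - (d\<Gamma> c (x s) (J s) (v s) (v s) + christoffel c (x s) (K s) (v s) + christoffel c (x s) (v s) (K s))) (at s) \<and>
         (s \<in> {0..1} \<longrightarrow> f s = g c (x s) (J s) (J s) \<and> x s = chart_coord c (\<gamma> u0 s) \<and> frechet_derivative (\<lambda>u. st c u s) (at u0) w = (J s, K s))"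
      using local[OF t01 c] by blast
    let ?F = "\<lambda>s. g c (x s) (J s) (J s)"
    obtain f2 where f2: "(?F has_real_derivative deriv ?F t) (at t)" "(deriv ?F has_real_derivative f2) (at t)"
      "f2 \<ge> 0" "(deriv ?F t)\<^sup>2 \<le> 2 * ?F t * f2"
      by (rule jacobi_inequality[OF c(1) S, of x v J K]) (use L curvature_nonpos[OF c(1)] in auto)
    let ?S = "S \<inter> {0<..<1}"
    have S': "open ?S" "t \<in> ?S" using S t by auto
    have eq: "?F s = f s" if "s \<in> ?S" for s using L that by auto
    have deq: "deriv ?F s = deriv f s" if "s \<in> ?S" for s
      by (rule deriv_cong_ev) (use eq S'(1) that in \<open>auto simp: eventually_nhds\<close>)
    have "(f has_real_derivative deriv f t) (at t)"
      using has_field_derivative_transform_within_open[OF f2(1) S' eq] deq[OF S'(2)] by simp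
    moreover have "(deriv f has_real_derivative f2) (at t)"
      by (rule has_field_derivative_transform_within_open[OF f2(2) S' deq])
    ultimately show ?thesis using f2(3,4) eq[OF S'(2)] deq[OF S'(2)] by (intro exI[of _ f2]) simp
  qed
  then obtain f2 where f2: "\<And>t. t \<in> {0<..<1} \<Longrightarrow> (f has_real_derivative deriv f t) (at t) \<and>
      (deriv f has_real_derivative f2 t) (at t) \<and> f2 t \<ge> 0 \<and> (deriv f t)\<^sup>2 \<le> 2 * f t * f2 t"
    by metis
  have bound: "sqrt (f s) \<le> s * sqrt (f 1)" if "s \<in> {0..1}" for s
    by (rule sqrt_convex_bound[OF contf nonneg f0 _ _ _ _ that, where ?f1.0="deriv f" and ?f2.0=f2]) (use f2 in auto)
  have bound': "g c0 (x s) (J s /\<^sub>R s) (J s /\<^sub>R s) \<le> f 1" if s: "s \<in> S" "0 < s" "s < 1" for s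
  proof -
    have s01: "s \<in> {0..1}" using s by simp
    have "f s = (sqrt (f s))\<^sup>2" using nonneg[OF s01] by simp
    also have "\<dots> \<le> (s * sqrt (f 1))\<^sup>2" using bound[OF s01] nonneg[OF s01] by (intro power_mono) auto
    also have "\<dots> = s\<^sup>2 * f 1" using nonneg[of 1] by (simp add: power_mult_distrib)
    finally have "g c0 (x s) (J s) (J s) \<le> s\<^sup>2 * f 1" using f[OF s(1) s01] by simp
    then show ?thesis
      using s(2) by (simp add: bilinear_lmul[OF M.bil[OF x(1)[OF s(1)]]] bilinear_rmul[OF M.bil[OF x(1)[OF s(1)]]]
         power2_eq_square field_simps)
  qed
  \<comment> \<open>Times tending to \<open>0\<close> for use in \<open>bound'\<close>: there
    \<open>J s /\<^sub>R s\<close> tends to \<open>K 0 = w\<close> because \<open>J 0 = 0\<close>,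
    which gives the inequality at the base point.\<close>
  define s where "s = (\<lambda>n. inverse (real (n + 2)))"
  have sl: "s \<longlonglongrightarrow> 0" unfolding s_def by (rule LIMSEQ_ignore_initial_segment[OF lim_inverse_n, of 2])
  have s01: "0 < s n" "s n < 1" for n by (auto simp: s_def field_simps)
  have sl': "filterlim s (at 0) sequentially"
    using sl s01 by (auto simp: filterlim_at less_imp_neq[symmetric])
  have Jl: "(\<lambda>n. J (s n) /\<^sub>R s n) \<longlonglongrightarrow> w"
  proof -
    have "((\<lambda>h. (1 / norm (h - 0)) *\<^sub>R (J h - (J 0 + (h - 0) *\<^sub>R w))) \<longlongrightarrow> 0) (at 0)"
      using J[OF S(2)] unfolding has_vector_derivative_def has_derivative_within J0(2) by blast
    from filterlim_compose[OF this sl']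
    have "(\<lambda>n. (1 / s n) *\<^sub>R (J (s n) - s n *\<^sub>R w)) \<longlonglongrightarrow> 0"
      using s01 by (simp add: J0 abs_of_pos)
    moreover have "(1 / s n) *\<^sub>R (J (s n) - s n *\<^sub>R w) = J (s n) /\<^sub>R s n - w" for n
      using s01(1)[of n] by (simp add: scaleR_diff_right inverse_eq_divide)
    ultimately show ?thesis by (simp add: LIM_zero_iff)
  qed
  have xl: "(\<lambda>n. x (s n)) \<longlonglongrightarrow> x 0"
    using x(2)[OF S(2)] has_vector_derivative_continuous isCont_tendsto_compose[OF _ sl] by blast
  have "(\<lambda>n. g c0 (x (s n)) (J (s n) /\<^sub>R s n) (J (s n) /\<^sub>R s n)) \<longlonglongrightarrow> g c0 (x 0) w w"
  proof -
    have "continuous_on (chart_img c0 \<times> UNIV) (\<lambda>p. g c0 (fst p) (snd p) (snd p))"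
      by (rule M.continuous_joint) (auto intro!: continuous_intros)
    then have "isCont (\<lambda>p. g c0 (fst p) (snd p) (snd p)) (x 0, w)"
      using x(1)[OF S(2)] M.U by (simp add: continuous_on_eq_continuous_at open_Times)
    from isCont_tendsto_compose[OF this tendsto_Pair[OF xl Jl]] show ?thesis by simp
  qed
  moreover have "eventually (\<lambda>n. g c0 (x (s n)) (J (s n) /\<^sub>R s n) (J (s n) /\<^sub>R s n) \<le> f 1) sequentially"
    using topological_tendstoD[OF sl S] by eventually_elim (use bound' s01 in auto)
  ultimately have "g c0 (x 0) w w \<le> f 1" by (rule tendsto_upperbound) simp
  then show ?thesis by (simp add: f_def J0)
qed

end

section \<open>Sections of expanding maps\<close>

text \<open>The injective differential has a linear left inverse, which is what the inverse function
  theorem asks for.\<close>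

lemma C1_locally_injective:
  fixes f :: "'e::euclidean_space \<Rightarrow> 'e"
  assumes W: "open W" "u \<in> W" and f: "C1_on f W" and inj: "\<And>w. frechet_derivative f (at u) w = 0 \<Longrightarrow> w = 0"
  obtains N where "open N" "u \<in> N" "N \<subseteq> W" "inj_on f N"
proof -
  define F' where "F' = (\<lambda>x. Blinfun (frechet_derivative f (at x)))"
  have F': "blinfun_apply (F' x) = frechet_derivative f (at x)" if "x \<in> W" for x
    unfolding F'_def using C1_on_has_derivative[OF f that] has_derivative_bounded_linear
    by (intro bounded_linear_Blinfun_apply) blast
  have der: "(f has_derivative blinfun_apply (F' x)) (at x)" if "x \<in> W" for x
    using C1_on_has_derivative[OF f that] F'[OF that] by simp
  have cont: "continuous_on W F'"
  proof (rule continuous_on_blinfun_componentwise)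
    fix i :: 'e
    show "continuous_on W (\<lambda>x. F' x i)" using f F' by (simp add: C1_on_def cong: continuous_on_cong)
  qed
  have "linear (frechet_derivative f (at u))" using f W(2) by (rule C1_on_linear)
  then obtain g where g: "linear g" "g \<circ> frechet_derivative f (at u) = id"
    using linear_injective_left_inverse linear_injective_0 inj by blast
  have inv: "Blinfun g o\<^sub>L F' u = id_blinfun"
    using g F'[OF W(2)] by (intro blinfun_eqI) (simp add: bounded_linear_Blinfun_apply linear_linear pointfree_idE)
  show thesis
  proof (rule inverse_function_theorem[OF W(1) der cont W(2) inv])
    fix U' V k k' assume "open U'" "U' \<subseteq> W" "u \<in> U'" "homeomorphism U' V f k"
    then show thesis
      using that[of U'] inj_on_inverseI[of U' k f] homeomorphism_apply1 by blast
  qed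
qed

text \<open>Otherwise distinct points with equal images approach \<open>K\<close>. Subsequential
  limits have equal images, so they coincide by injectivity on \<open>K\<close>, and local
  injectivity at the common limit is violated.\<close>

lemma inj_near_compact:
  fixes F :: "'b::metric_space \<Rightarrow> 'c::t2_space"
  assumes W: "open W" "K \<subseteq> W" and K: "compact K" and cont: "continuous_on W F" and inj: "inj_on F K"
    and loc: "\<And>x. x \<in> K \<Longrightarrow> \<exists>N. open N \<and> x \<in> N \<and> inj_on F N"
  obtains V where "open V" "K \<subseteq> V" "V \<subseteq> W" "inj_on F V"
proof -
  define V where "V = (\<lambda>n. W \<inter> (\<Union>k\<in>K. ball k (inverse (real (Suc n)))))"
  have V: "open (V n)" "K \<subseteq> V n" "V n \<subseteq> W" for n using W by (auto simp: V_def)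
  have "\<exists>n. inj_on F (V n)"
  proof (rule ccontr)
    assume "\<not> ?thesis"
    then have "\<forall>n. \<exists>x y. x \<in> V n \<and> y \<in> V n \<and> F x = F y \<and> x \<noteq> y" unfolding inj_on_def by blast
    then obtain x y where xy: "\<And>n. x n \<in> V n" "\<And>n. y n \<in> V n" "\<And>n. F (x n) = F (y n)" "\<And>n. x n \<noteq> y n" by metis
    have near: "\<exists>a. \<forall>n. a n \<in> K \<and> dist (a n) (z n) < inverse (real (Suc n))" if "\<And>n. z n \<in> V n" for z
      using that by (intro choice) (auto simp: V_def)
    obtain a b where a: "\<And>n. a n \<in> K" "\<And>n. dist (a n) (x n) < inverse (real (Suc n))"
      and b: "\<And>n. b n \<in> K" "\<And>n. dist (b n) (y n) < inverse (real (Suc n))"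
      using near[OF xy(1)] near[OF xy(2)] by metis
    obtain a' r where r: "a' \<in> K" "strict_mono r" "(a \<circ> r) \<longlonglongrightarrow> a'"
      using K a(1) unfolding compact_def by metis
    obtain b' q where q: "b' \<in> K" "strict_mono q" "((b \<circ> r) \<circ> q) \<longlonglongrightarrow> b'"
      using K b(1) unfolding compact_def by (metis comp_apply)
    define m where "m = r \<circ> q"
    have m: "strict_mono m" using r q strict_mono_o by (simp add: m_def)
    have am: "(\<lambda>n. a (m n)) \<longlonglongrightarrow> a'"
      using LIMSEQ_subseq_LIMSEQ[OF r(3) q(2)] by (simp add: m_def comp_def)
    have bm: "(\<lambda>n. b (m n)) \<longlonglongrightarrow> b'" using q(3) by (simp add: m_def comp_def)
    have inv0: "(\<lambda>n. inverse (real (Suc (m n)))) \<longlonglongrightarrow> 0"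
      using LIMSEQ_subseq_LIMSEQ[OF LIMSEQ_inverse_real_of_nat m] by (simp add: comp_def)
    have shift: "(\<lambda>n. z (m n)) \<longlonglongrightarrow> c'"
      if "(\<lambda>n. c (m n)) \<longlonglongrightarrow> c'" "\<And>n. dist (c n) (z n) < inverse (real (Suc n))" for z c c'
    proof -
      have "(\<lambda>n. dist (z (m n)) c') \<longlonglongrightarrow> 0"
      proof (rule tendsto_sandwich[OF _ _ tendsto_const])
        show "\<forall>\<^sub>F n in sequentially. dist (z (m n)) c' \<le> inverse (real (Suc (m n))) + dist (c (m n)) c'"
        proof (rule always_eventually, rule allI)
          fix n
          have "dist (z (m n)) c' \<le> dist (c (m n)) (z (m n)) + dist (c (m n)) c'"
            using dist_triangle[of "z (m n)" c' "c (m n)"] by (simp add: dist_commute)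
          then show "dist (z (m n)) c' \<le> inverse (real (Suc (m n))) + dist (c (m n)) c'"
            using that(2)[of "m n"] by linarith
        qed
        show "(\<lambda>n. inverse (real (Suc (m n))) + dist (c (m n)) c') \<longlonglongrightarrow> 0"
          using tendsto_add[OF inv0 tendsto_dist[OF that(1) tendsto_const[of c']]] by simp
      qed simp
      then show ?thesis by (rule tendsto_dist_iff[THEN iffD2])
    qed
    have xm: "(\<lambda>n. x (m n)) \<longlonglongrightarrow> a'" by (rule shift[OF am a(2)])
    have ym: "(\<lambda>n. y (m n)) \<longlonglongrightarrow> b'" by (rule shift[OF bm b(2)])
    have Fc: "(\<lambda>n. F (z (m n))) \<longlonglongrightarrow> F c" if "(\<lambda>n. z (m n)) \<longlonglongrightarrow> c" "c \<in> K" "\<And>n. z n \<in> V n" for z c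
      by (rule continuous_on_tendsto_compose[OF cont that(1) subsetD[OF W(2) that(2)] always_eventually])
         (use subsetD[OF V(3) that(3)] in blast)
    have "F a' = F b'"
      using LIMSEQ_unique[OF Fc[OF xm r(1) xy(1)]] Fc[OF ym q(1) xy(2)] xy(3) by simp
    then have ab: "a' = b'" using inj r(1) q(1) by (auto simp: inj_on_def)
    obtain N where N: "open N" "a' \<in> N" "inj_on F N" using loc[OF r(1)] by blast
    have "eventually (\<lambda>n. x (m n) \<in> N \<and> y (m n) \<in> N) sequentially"
      using topological_tendstoD[OF xm N(1,2)] topological_tendstoD[OF ym N(1) N(2)[unfolded ab]]
      by eventually_elim simp
    then obtain n where "x (m n) \<in> N" "y (m n) \<in> N" using eventually_happens'[OF sequentially_bot] by blast
    then show False using N(3) xy(3,4) by (auto simp: inj_on_def)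
  qed
  then obtain n where "inj_on F (V n)" by blast
  then show thesis by (rule that[OF V])
qed

text \<open>The set of agreement is open by local injectivity of \<open>F\<close> and closed because
  the target of the lifts is Hausdorff.\<close>

lemma lift_unique:
  fixes F :: "'e::t2_space \<Rightarrow> 'c" and s s' :: "'b::topological_space \<Rightarrow> 'e"
  assumes T: "connected T" and s: "continuous_on T s" "continuous_on T s'"
    and loc: "\<And>y. y \<in> T \<Longrightarrow> \<exists>N. open N \<and> s y \<in> N \<and> inj_on F N"
    and eq: "\<And>y. y \<in> T \<Longrightarrow> F (s y) = F (s' y)" and a: "a \<in> T" "s a = s' a" and y: "y \<in> T"
  shows "s y = s' y"
proof (rule connected_induction_simple[OF T a(1) y, of "\<lambda>y. s y = s' y"])
  fix b assume b: "b \<in> T"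
  show "\<exists>O'. openin (top_of_set T) O' \<and> b \<in> O' \<and> (\<forall>x\<in>O'. \<forall>y\<in>O'. s x = s' x \<longrightarrow> s y = s' y)"
  proof (cases "s b = s' b")
    case True
    obtain N where N: "open N" "s b \<in> N" "inj_on F N" using loc[OF b] by blast
    have "openin (top_of_set T) ((T \<inter> s -` N) \<inter> (T \<inter> s' -` N))"
      by (rule openin_Int[OF continuous_openin_preimage_gen[OF s(1) N(1)] continuous_openin_preimage_gen[OF s(2) N(1)]])
    moreover have "s y = s' y" if "y \<in> (T \<inter> s -` N) \<inter> (T \<inter> s' -` N)" for y
      using that eq[of y] N(3) by (auto simp: inj_on_def)
    ultimately show ?thesis using b N True by (intro exI[of _ "(T \<inter> s -` N) \<inter> (T \<inter> s' -` N)"]) auto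
  next
    case False
    from hausdorff[OF this]
    obtain N N' where N: "open N" "open N'" "s b \<in> N" "s' b \<in> N'" "N \<inter> N' = {}" by (elim exE conjE)
    have "openin (top_of_set T) ((T \<inter> s -` N) \<inter> (T \<inter> s' -` N'))"
      by (rule openin_Int[OF continuous_openin_preimage_gen[OF s(1) N(1)] continuous_openin_preimage_gen[OF s(2) N(2)]])
    moreover have "s y \<noteq> s' y" if "y \<in> (T \<inter> s -` N) \<inter> (T \<inter> s' -` N')" for y
      using that N(5) by auto
    ultimately show ?thesis using b N by (intro exI[of _ "(T \<inter> s -` N) \<inter> (T \<inter> s' -` N')"]) auto
  qed
qed (rule a(2))

text \<open>Models the exponential map read in a chart. The bound \<open>C\<close> controls the
  inverse differential, and \<open>closed\<close> prevents sections over smaller balls from running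
  to the boundary of \<open>W\<close>.\<close>

locale expanding_map =
  fixes f :: "'e::euclidean_space \<Rightarrow> 'e" and W :: "'e set" and u0 :: 'e and C R :: real
  assumes W: "open W" "u0 \<in> W" and f: "C1_on f W" and C: "C > 0" and R: "R > 0"
    and expanding: "\<And>u w. u \<in> W \<Longrightarrow> f u \<in> ball (f u0) R \<Longrightarrow> norm w \<le> C * norm (frechet_derivative f (at u) w)"
    and closed: "\<And>r. r < R \<Longrightarrow> closed {u\<in>W. f u \<in> cball (f u0) r}"
begin

definition section_on :: "'e set \<Rightarrow> ('e \<Rightarrow> 'e) \<Rightarrow> bool" where
  "section_on B s \<longleftrightarrow> continuous_on B s \<and> s (f u0) = u0 \<and> (\<forall>y\<in>B. s y \<in> W \<and> f (s y) = y)"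

lemma locally_injective:
  assumes "u \<in> W" "f u \<in> ball (f u0) R"
  obtains N where "open N" "u \<in> N" "N \<subseteq> W" "inj_on f N"
proof -
  have "w = 0" if "frechet_derivative f (at u) w = 0" for w
    using expanding[OF assms, of w] that by simp
  from C1_locally_injective[OF W(1) assms(1) f this] show thesis using that by blast
qed

text \<open>The section is locally inverse to \<open>f\<close>, so its differential is bounded by
  the expansion constant; the mean value inequality applies because a ball is convex.\<close>

lemma section_lipschitz:
  assumes s: "section_on (ball (f u0) r) s" "r \<le> R" and yz: "y \<in> ball (f u0) r" "z \<in> ball (f u0) r"
  shows "norm (s y - s z) \<le> C * norm (y - z)"
proof -
  have "\<exists>g'. (s has_derivative g') (at y) \<and> onorm g' \<le> C" if y: "y \<in> ball (f u0) r" for y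
  proof -
    have sy: "s y \<in> W" "f (s y) = y" and cont: "continuous_on (ball (f u0) r) s" using s y by (auto simp: section_on_def)
    have yR: "f (s y) \<in> ball (f u0) R" using sy(2) y s(2) by auto
    let ?D = "frechet_derivative f (at (s y))"
    note lin = C1_on_linear[OF f sy(1)]
    have "x = 0" if "?D x = 0" for x using expanding[OF sy(1) yR, of x] that by simp
    then have "inj ?D" using linear_injective_0[OF lin] by blast
    then obtain g' where g': "linear g'" "\<And>x. g' (?D x) = x" "\<And>x. ?D (g' x) = x"
      using linear_injective_isomorphism[OF lin] by blast
    have "(s has_derivative g') (at y)"
      by (rule has_derivative_inverse_basic[where g=s and y=y, OF C1_on_has_derivative[OF f sy(1)] _ _ _ open_ball y])
         (use g' s cont y in \<open>auto simp: linear_linear section_on_def continuous_on_eq_continuous_at\<close>)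
    moreover have "onorm g' \<le> C"
      by (rule onorm_le) (use expanding[OF sy(1) yR] g'(3) in metis)
    ultimately show ?thesis by blast
  qed
  then obtain s' where "\<And>y. y \<in> ball (f u0) r \<Longrightarrow> (s has_derivative s' y) (at y)" "\<And>y. y \<in> ball (f u0) r \<Longrightarrow> onorm (s' y) \<le> C"
    by metis
  then show ?thesis
    by (intro differentiable_bound[of "ball (f u0) r" s s' C y z]) (use yz in \<open>auto intro: has_derivative_at_withinI\<close>)
qed

text \<open>A Lipschitz section extends continuously to the closed ball; by \<open>closed\<close>
  its limit values stay in \<open>W\<close>.\<close>

lemma section_closure:
  assumes r: "0 < r" "r < R" and s: "section_on (ball (f u0) r) s"
  obtains s' where "section_on (cball (f u0) r) s'"
proof -
  let ?B = "ball (f u0) r"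
  have cl: "closure ?B = cball (f u0) r" using r by simp
  have "uniformly_continuous_on ?B s"
    unfolding uniformly_continuous_on_def
  proof (intro allI impI)
    fix e :: real assume e: "e > 0"
    have "dist (s x') (s x) < e" if "x \<in> ?B" "x' \<in> ?B" "dist x' x < e / C" for x x'
      using section_lipschitz[OF s _ that(2,1)] r(2) that(3) C by (simp add: dist_norm field_simps)
    then show "\<exists>d>0. \<forall>x\<in>?B. \<forall>x'\<in>?B. dist x' x < d \<longrightarrow> dist (s x') (s x) < e"
      using e C by (intro exI[of _ "e / C"]) auto
  qed
  then obtain s' where s': "uniformly_continuous_on (closure ?B) s'" "\<And>x. x \<in> ?B \<Longrightarrow> s x = s' x"
    by (rule uniformly_continuous_on_extension_on_closure) blast
  have cont: "continuous_on (cball (f u0) r) s'"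
    using uniformly_continuous_imp_continuous[OF s'(1)] cl by simp
  let ?K = "{u\<in>W. f u \<in> cball (f u0) r}"
  have sB: "s' y \<in> ?K" "f (s' y) = y" if "y \<in> ?B" for y
  proof -
    have "s y \<in> W" "f (s y) = y" using s that by (auto simp: section_on_def)
    then show "s' y \<in> ?K" "f (s' y) = y" using that s'(2)[OF that] by auto
  qed
  have in_K: "s' y \<in> ?K \<and> f (s' y) = y" if y: "y \<in> cball (f u0) r" for y
  proof -
    obtain z where z: "\<And>n. z n \<in> ?B" "z \<longlonglongrightarrow> y" using y cl closure_sequential by metis
    have sz: "(\<lambda>n. s' (z n)) \<longlonglongrightarrow> s' y"
      by (rule continuous_on_tendsto_compose[OF cont z(2) y]) (use z(1) in \<open>auto intro!: always_eventually less_imp_le\<close>)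
    then have K: "s' y \<in> ?K"
      by (intro closed_sequentially[OF closed[OF r(2)] sB(1)[OF z(1)] sz])
    have "(\<lambda>n. f (s' (z n))) \<longlonglongrightarrow> f (s' y)"
      by (rule continuous_on_tendsto_compose[OF C1_on_continuous[OF f] sz]) (use K sB(1)[OF z(1)] in auto)
    then have "f (s' y) = y" using z(2) sB(2)[OF z(1)] LIMSEQ_unique by simp
    then show ?thesis using K by blast
  qed
  have "s' (f u0) = u0" using s s'(2)[of "f u0"] r by (simp add: section_on_def)
  then have "section_on (cball (f u0) r) s'" unfolding section_on_def using cont in_K by blast
  then show thesis by (rule that)
qed

text \<open>The map \<open>f\<close> is injective near the compact image of the section, so
  invariance of domain gives an inverse on an open set that contains the closed ball together with a
  neighbourhood of some width \<open>e\<close>.\<close>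

lemma section_extend:
  assumes r: "0 \<le> r" "r < R" and s: "section_on (cball (f u0) r) s"
  obtains r' s' where "r' > r" "r' < R" "section_on (cball (f u0) r') s'"
proof -
  let ?B = "cball (f u0) r"
  have S: "continuous_on ?B s" "s (f u0) = u0" "\<And>y. y \<in> ?B \<Longrightarrow> s y \<in> W" "\<And>y. y \<in> ?B \<Longrightarrow> f (s y) = y"
    using s by (auto simp: section_on_def)
  have inR: "f (s y) \<in> ball (f u0) R" if "y \<in> ?B" for y using S(4)[OF that] that r by auto
  have "s ` ?B \<subseteq> W" using S(3) by blast
  moreover have "compact (s ` ?B)" by (rule compact_continuous_image[OF S(1) compact_cball])
  moreover have "inj_on f (s ` ?B)" by (rule inj_on_inverseI[of _ s]) (use S(4) in auto)
  moreover have "\<exists>N. open N \<and> x \<in> N \<and> inj_on f N" if x: "x \<in> s ` ?B" for x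
  proof -
    obtain y where y: "y \<in> ?B" "x = s y" using x by blast
    obtain N where "open N" "s y \<in> N" "N \<subseteq> W" "inj_on f N" by (rule locally_injective[OF S(3)[OF y(1)] inR[OF y(1)]])
    then show ?thesis using y by blast
  qed
  ultimately obtain V where V: "open V" "s ` ?B \<subseteq> V" "V \<subseteq> W" "inj_on f V"
    by (rule inj_near_compact[OF W(1) _ _ C1_on_continuous[OF f]])
  have cV: "continuous_on V f" using C1_on_continuous[OF f] V(3) continuous_on_subset by blast
  obtain k where k: "homeomorphism V (f ` V) f k"
    by (rule invariance_of_domain_homeomorphism[OF V(1) cV order_refl V(4)])
  have o: "open (f ` V)" by (rule invariance_of_domain[OF cV V(1) V(4)])
  have "?B \<subseteq> f ` V" using S(4) V(2) by (metis (no_types, lifting) image_iff image_subset_iff subsetI)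
  then obtain e where e: "e > 0" "(\<Union>x\<in>?B. ball x e) \<subseteq> f ` V"
    using compact_subset_open_imp_ball_epsilon_subset[OF compact_cball o] by metis
  \<comment> \<open>Lies above \<open>r\<close>, but below both \<open>r + e\<close> and
    \<open>R\<close>.\<close>
  define r' where "r' = min (r + e / 2) ((r + R) / 2)"
  have "r' \<le> r + e / 2" "r' \<le> (r + R) / 2" unfolding r'_def by (rule min.cobounded1, rule min.cobounded2)
  moreover have "r' > r" using e r by (simp add: r'_def)
  ultimately have r': "r' > r" "r' < R" "r' < r + e" using e(1) r by simp_all
  have sub: "cball (f u0) r' \<subseteq> f ` V"
  proof
    fix y assume y: "y \<in> cball (f u0) r'"
    show "y \<in> f ` V"
    proof (cases "y \<in> ?B")
      case True
      then show ?thesis using e by force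
    next
      case False
      define d where "d = dist (f u0) y"
      have d: "d > r" "d \<le> r'" using False y by (auto simp: d_def)
      \<comment> \<open>The radial projection of \<open>y\<close> to the sphere of radius
        \<open>r\<close>, at distance \<open>d - r < e\<close> from \<open>y\<close>.\<close>
      define x where "x = f u0 + (r / d) *\<^sub>R (y - f u0)"
      have d0: "d > 0" using d r by linarith
      have "dist (f u0) x = \<bar>r / d\<bar> * d" by (simp add: x_def dist_norm d_def norm_minus_commute)
      then have "dist (f u0) x = r" using d0 r by simp
      moreover have "dist x y = d - r"
      proof -
        have "x - y = (r / d - 1) *\<^sub>R (y - f u0)" by (simp add: x_def algebra_simps)
        then have "dist x y = \<bar>r / d - 1\<bar> * d" by (simp add: dist_norm d_def norm_minus_commute)
        also have "\<bar>r / d - 1\<bar> = 1 - r / d" using d r by simp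
        finally show ?thesis using d0 by (simp add: left_diff_distrib)
      qed
      ultimately have "x \<in> ?B" "y \<in> ball x e" using d r' by auto
      then show ?thesis using e(2) by blast
    qed
  qed
  have "k (f u0) = u0"
    using homeomorphism_apply1[OF k, of u0] S(2) V(2) r by (metis centre_in_cball image_subset_iff)
  then have "section_on (cball (f u0) r') k"
    unfolding section_on_def
    using k sub V(3) continuous_on_subset homeomorphism_apply2[OF k] homeomorphism_image2[OF k]
    by (metis (no_types, lifting) homeomorphism_cont2 image_subset_iff subsetD)
  then show thesis using that r' by blast
qed

lemma section_unique:
  assumes B: "connected B" "f u0 \<in> B" "B \<subseteq> ball (f u0) R" and s: "section_on B s" "section_on B s'" and y: "y \<in> B"
  shows "s y = s' y"
proof (rule lift_unique[OF B(1), of s s' f "f u0"])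
  fix z assume z: "z \<in> B"
  then have "s z \<in> W" "f (s z) \<in> ball (f u0) R" using s(1) B(3) by (auto simp: section_on_def)
  then show "\<exists>N. open N \<and> s z \<in> N \<and> inj_on f N" using locally_injective by metis
qed (use s B y in \<open>auto simp: section_on_def\<close>)

text \<open>Continuation in the radius: the supremum \<open>\<rho>\<close> of the radii with a
  section is positive by \<open>section_extend\<close>, and it is \<open>R\<close> since otherwise
  the section would extend to the closed ball and beyond.\<close>

proposition section_exists:
  obtains s where "section_on (ball (f u0) R) s"
proof -
  define T where "T = {r. 0 \<le> r \<and> r < R \<and> (\<exists>s. section_on (cball (f u0) r) s)}"
  have T0: "0 \<in> T"
    unfolding T_def using R W by (auto simp: section_on_def intro!: exI[of _ "\<lambda>_. u0"])
  have bdd: "bdd_above T" by (auto simp: T_def bdd_above_def intro: less_imp_le)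
  define \<rho> where "\<rho> = Sup T"
  obtain t where t: "section_on (cball (f u0) 0) t" using T0 by (auto simp: T_def)
  obtain \<rho>1 t' where "\<rho>1 > 0" "\<rho>1 < R" "section_on (cball (f u0) \<rho>1) t'"
    by (rule section_extend[OF order_refl R t])
  then have "\<rho>1 \<in> T" "\<rho>1 > 0" by (auto simp: T_def)
  then have \<rho>: "\<rho> > 0" "\<rho> \<le> R"
    using cSup_upper[OF _ bdd] T0 by (force simp: \<rho>_def, auto simp: \<rho>_def T_def intro!: cSup_least)
  have ex: "\<exists>s. section_on (cball (f u0) r) s" if r: "0 \<le> r" "r < \<rho>" for r
  proof -
    obtain r1 where r1: "r1 \<in> T" "r < r1" using less_cSupD[of T r] T0 r unfolding \<rho>_def by blast
    then obtain s where "section_on (cball (f u0) r1) s" by (auto simp: T_def)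
    then have "section_on (cball (f u0) r) s"
      using r1(2) by (auto simp: section_on_def elim: continuous_on_subset)
    then show ?thesis by blast
  qed
  then obtain \<sigma> where \<sigma>: "\<And>r. 0 \<le> r \<Longrightarrow> r < \<rho> \<Longrightarrow> section_on (cball (f u0) r) (\<sigma> r)" by metis
  \<comment> \<open>Each point takes its value from the section on the closed ball whose sphere
    passes through it; uniqueness reconciles these sections.\<close>
  define s where "s = (\<lambda>y. \<sigma> (dist (f u0) y) y)"
  have eq: "s y = \<sigma> r y" if "0 \<le> r" "r < \<rho>" "y \<in> cball (f u0) r" for r y
    unfolding s_def
  proof (rule section_unique[of "cball (f u0) (dist (f u0) y)" "\<sigma> (dist (f u0) y)" "\<sigma> r" y])
    show "section_on (cball (f u0) (dist (f u0) y)) (\<sigma> r)"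
      using \<sigma>[OF that(1,2)] that(3) by (auto simp: section_on_def elim: continuous_on_subset)
    show "section_on (cball (f u0) (dist (f u0) y)) (\<sigma> (dist (f u0) y))" using \<sigma> that by auto
    show "cball (f u0) (dist (f u0) y) \<subseteq> ball (f u0) R" using that \<rho> by auto
  qed auto
  have "section_on (ball (f u0) \<rho>) s"
    unfolding section_on_def
  proof (intro conjI ballI)
    show "continuous_on (ball (f u0) \<rho>) s"
      unfolding continuous_on_eq_continuous_at[OF open_ball]
    proof
      fix y assume y: "y \<in> ball (f u0) \<rho>"
      define r where "r = (dist (f u0) y + \<rho>) / 2"
      have r: "0 \<le> r" "r < \<rho>" "dist (f u0) y < r" using y zero_le_dist[of "f u0" y] by (simp_all add: r_def del: zero_le_dist)
      have "continuous_on (ball (f u0) r) (\<sigma> r)"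
        using \<sigma>[OF r(1,2)] by (auto simp: section_on_def elim: continuous_on_subset)
      then have "isCont (\<sigma> r) y" using r(3) by (simp add: continuous_on_eq_continuous_at)
      moreover have "\<forall>\<^sub>F z in nhds y. \<sigma> r z = s z"
        using eq[OF r(1,2)] r(3) by (auto simp: eventually_nhds intro!: exI[of _ "ball (f u0) r"])
      ultimately show "isCont s y" using isCont_cong by blast
    qed
    show "s (f u0) = u0" using eq[of 0 "f u0"] \<sigma>[of 0] \<rho> by (auto simp: section_on_def)
    fix y assume "y \<in> ball (f u0) \<rho>"
    then show "s y \<in> W" "f (s y) = y"
      using \<sigma>[of "dist (f u0) y"] by (auto simp: section_on_def s_def)
  qed
  moreover have "\<rho> = R"
  proof (rule ccontr)
    assume "\<rho> \<noteq> R"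
    then have "\<rho> < R" using \<rho> by simp
    then obtain s' where s': "section_on (cball (f u0) \<rho>) s'"
      using section_closure[OF \<rho>(1)] \<open>section_on (ball (f u0) \<rho>) s\<close> by blast
    obtain r' s'' where "r' > \<rho>" "r' < R" "section_on (cball (f u0) r') s''"
      by (rule section_extend[OF less_imp_le[OF \<rho>(1)] \<open>\<rho> < R\<close> s'])
    then have "r' \<in> T" using \<rho> by (auto simp: T_def)
    then have "r' \<le> \<rho>" unfolding \<rho>_def by (rule cSup_upper[OF _ bdd])
    then show False using \<open>r' > \<rho>\<close> by simp
  qed
  ultimately show thesis using that by simp
qed

end

section \<open>Covering maps and simple connectedness\<close>

text \<open>Lifting through \<open>F\<close> is reduced to the library's theory of covering spaces, which requires a
  normed base space, by pulling \<open>F\<close> back along the map to be lifted.\<close>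

lemma lift_through_uniform_sections:
  fixes F :: "'e::euclidean_space \<Rightarrow> 'c::metric_space" and h :: "'b::real_normed_vector \<Rightarrow> 'c"
  assumes F: "continuous_on UNIV F" "surj F"
    and loc: "\<And>u. \<exists>N. open N \<and> u \<in> N \<and> inj_on F N"
    and sections: "\<And>q. \<exists>U. open U \<and> q \<in> U \<and>
      (\<forall>u. F u \<in> U \<longrightarrow> (\<exists>s. continuous_on U s \<and> s (F u) = u \<and> (\<forall>x\<in>U. F (s x) = x)))"
    and Q: "convex Q" "z0 \<in> Q" and h: "continuous_on Q h" "h z0 = F u0"
  obtains k where "continuous_on Q k" "\<And>z. z \<in> Q \<Longrightarrow> F (k z) = h z" "k z0 = u0"
proof -
  \<comment> \<open>The fibre product of \<open>F\<close> and \<open>h\<close>; the second component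
    of a continuous section of \<open>fst\<close> on it is a lift of \<open>h\<close>.\<close>
  define P where "P = {(z, v). z \<in> Q \<and> F v = h z}"
  have cov: "covering_space P fst Q"
  proof
    show "continuous_on P fst" by (intro continuous_intros)
    show "fst ` P = Q"
    proof
      show "Q \<subseteq> fst ` P"
      proof
        fix z assume "z \<in> Q"
        moreover obtain v where "F v = h z" using F(2) by (metis surjD)
        ultimately have "(z, v) \<in> P" by (simp add: P_def)
        then show "z \<in> fst ` P" by force
      qed
    qed (auto simp: P_def)
    fix z assume z: "z \<in> Q"
    obtain U where U: "open U" "h z \<in> U"
      and sec: "\<And>u. F u \<in> U \<Longrightarrow> \<exists>s. continuous_on U s \<and> s (F u) = u \<and> (\<forall>x\<in>U. F (s x) = x)"
      using sections[of "h z"] by blast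
    have "openin (top_of_set Q) (Q \<inter> h -` U)" using h(1) U(1) by (rule continuous_openin_preimage_gen)
    then have "\<exists>r>0. ball z r \<inter> Q \<subseteq> Q \<inter> h -` U"
      using z U(2) unfolding openin_contains_ball by blast
    then obtain r where r: "r > 0" "Q \<inter> ball z r \<subseteq> Q \<inter> h -` U" by blast
    define T where "T = Q \<inter> ball z r"
    have T: "openin (top_of_set Q) T" "z \<in> T" "connected T" "T \<subseteq> Q" "\<And>y. y \<in> T \<Longrightarrow> h y \<in> U"
      using z r Q(1) by (auto simp: T_def openin_open_Int intro!: convex_connected convex_Int)
    have hT: "continuous_on T h" using h(1) T(4) continuous_on_subset by blast
    define I where "I = {w. F w = h z}"
    have "\<forall>w\<in>I. \<exists>s. continuous_on U s \<and> s (h z) = w \<and> (\<forall>x\<in>U. F (s x) = x)"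
    proof
      fix w assume "w \<in> I"
      then have w: "F w = h z" by (simp add: I_def)
      show "\<exists>s. continuous_on U s \<and> s (h z) = w \<and> (\<forall>x\<in>U. F (s x) = x)"
        using sec[of w] U(2) unfolding w by blast
    qed
    from bchoice[OF this] obtain s where s: "\<And>w. w \<in> I \<Longrightarrow> continuous_on U (s w)" "\<And>w. w \<in> I \<Longrightarrow> s w (h z) = w"
      "\<And>w x. w \<in> I \<Longrightarrow> x \<in> U \<Longrightarrow> F (s w x) = x" by blast
    have sh: "continuous_on T (\<lambda>y. s w (h y))" if "w \<in> I" for w
      by (rule continuous_on_compose2[OF s(1)[OF that] hT]) (use T(5) in auto)
    \<comment> \<open>The sheets over \<open>T\<close>, indexed by the preimages \<open>w\<close> of
      \<open>h z\<close>, are the graphs of the lifts \<open>s w \<circ> h\<close>.\<close>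
    define G where "G = (\<lambda>w. (\<lambda>y. (y, s w (h y))) ` T)"
    have uniq: "s w (h y) = t y" if "w \<in> I" "continuous_on T t" "\<And>y. y \<in> T \<Longrightarrow> F (t y) = h y" "b \<in> T" "s w (h b) = t b" "y \<in> T"
      for w t b y
      by (rule lift_unique[OF T(3) sh[OF that(1)] that(2) loc _ that(4,5,6)]) (use s(3)[OF that(1)] T(5) that(3) in auto)
    show "\<exists>T. z \<in> T \<and> openin (top_of_set Q) T \<and> (\<exists>v. \<Union> v = P \<inter> fst -` T \<and> (\<forall>u\<in>v. openin (top_of_set P) u) \<and>
        pairwise disjnt v \<and> (\<forall>u\<in>v. \<exists>q. homeomorphism u T fst q))"
    proof (intro exI[of _ T] exI[of _ "G ` I"] conjI ballI)
      show "\<Union> (G ` I) = P \<inter> fst -` T"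
      proof
        show "\<Union> (G ` I) \<subseteq> P \<inter> fst -` T" using s(3) T by (auto simp: G_def P_def)
        show "P \<inter> fst -` T \<subseteq> \<Union> (G ` I)"
        proof
          fix p assume p: "p \<in> P \<inter> fst -` T"
          obtain y v where yv: "p = (y, v)" "y \<in> T" "F v = h y" using p by (auto simp: P_def)
          obtain t where t: "continuous_on U t" "t (h y) = v" "\<And>x. x \<in> U \<Longrightarrow> F (t x) = x"
            using sec[of v] T(5)[OF yv(2)] yv(3) by metis
          have w: "t (h z) \<in> I" using t(3) U(2) by (simp add: I_def)
          have "s (t (h z)) (h y) = t (h y)"
          proof (rule uniq[OF w _ _ T(2) _ yv(2)])
            show "continuous_on T (\<lambda>y. t (h y))" by (rule continuous_on_compose2[OF t(1) hT]) (use T(5) in auto)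
          qed (use t(3) T(5) s(2)[OF w] in auto)
          then have "p \<in> G (t (h z))" using yv t(2) by (auto simp: G_def)
          then show "p \<in> \<Union> (G ` I)" using w by blast
        qed
      qed
    next
      fix u assume "u \<in> G ` I"
      then obtain w where w: "w \<in> I" "u = G w" by blast
      show "\<exists>q. homeomorphism u T fst q"
        unfolding w(2) G_def
        by (intro exI[of _ "\<lambda>y. (y, s w (h y))"])
           (auto simp: homeomorphism_def image_image intro!: continuous_intros sh[OF w(1)])
      show "openin (top_of_set P) u"
      proof (subst openin_subopen, rule ballI)
        fix p assume "p \<in> u"
        then obtain y where y: "y \<in> T" "p = (y, s w (h y))" using w by (auto simp: G_def)
        obtain N where N: "open N" "s w (h y) \<in> N" "inj_on F N" using loc by blast
        have "openin (top_of_set T) (T \<inter> (\<lambda>y. s w (h y)) -` N)"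
          by (rule continuous_openin_preimage_gen[OF sh[OF w(1)] N(1)])
        then have "openin (top_of_set Q) (T \<inter> (\<lambda>y. s w (h y)) -` N)" using T(1) openin_trans by blast
        then obtain O' where O': "open O'" "T \<inter> (\<lambda>y. s w (h y)) -` N = Q \<inter> O'" by (auto simp: openin_open)
        have "P \<inter> (O' \<times> N) \<subseteq> u"
        proof
          fix q assume q: "q \<in> P \<inter> (O' \<times> N)"
          obtain y' v where yv: "q = (y', v)" "y' \<in> Q" "y' \<in> O'" "v \<in> N" "F v = h y'" using q by (auto simp: P_def)
          have y'': "y' \<in> T" "s w (h y') \<in> N" using O'(2) yv by blast+
          have "F (s w (h y')) = F v" using s(3)[OF w(1) T(5)[OF y''(1)]] yv by simp
          then have "s w (h y') = v" using N(3) y''(2) yv(4) by (auto simp: inj_on_def)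
          then show "q \<in> u" using y''(1) yv w by (auto simp: G_def)
        qed
        moreover have "openin (top_of_set P) (P \<inter> (O' \<times> N))" using O' N by (simp add: openin_open_Int open_Times)
        moreover have "p \<in> P \<inter> (O' \<times> N)"
          using y N O' T(4,5) s(3)[OF w(1)] by (auto simp: P_def)
        ultimately show "\<exists>Ta. openin (top_of_set P) Ta \<and> p \<in> Ta \<and> Ta \<subseteq> u" by blast
      qed
    next
      show "pairwise disjnt (G ` I)"
        unfolding pairwise_def
      proof (intro ballI impI)
        fix u u' assume "u \<in> G ` I" "u' \<in> G ` I" and ne: "u \<noteq> u'"
        then obtain w w' where w: "w \<in> I" "u = G w" "w' \<in> I" "u' = G w'" by blast
        show "disjnt u u'"
        proof (rule ccontr)
          assume "\<not> disjnt u u'"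
          then obtain b where b: "b \<in> T" "s w (h b) = s w' (h b)" using w by (auto simp: disjnt_def G_def)
          have "s w (h y) = s w' (h y)" if "y \<in> T" for y
            by (rule uniq[OF w(1) sh[OF w(3)] _ b that]) (use s(3)[OF w(3)] T(5) in auto)
          then show False using ne w by (auto simp: G_def)
        qed
      qed
    qed (use T in auto)
  qed
  obtain k where k: "continuous_on Q k" "k \<in> Q \<rightarrow> P" "k z0 = (z0, u0)" "\<And>y. y \<in> Q \<Longrightarrow> fst (k y) = y"
    by (rule covering_space_lift_strong[OF cov, of "(z0, u0)" z0 Q id])
       (use Q h in \<open>auto simp: P_def convex_imp_simply_connected convex_imp_locally_path_connected\<close>)
  show thesis
  proof (rule that[of "\<lambda>z. snd (k z)"])
    show "continuous_on Q (\<lambda>z. snd (k z))" using k(1) by (intro continuous_intros)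
    show "F (snd (k z)) = h z" if "z \<in> Q" for z
      using k(2,4) that by (force simp: P_def Pi_def)
  qed (simp add: k(3))
qed

text \<open>Points with the same image are the ends of a segment that \<open>F\<close> maps to a
  loop. The contraction of the loop is a free homotopy, so its base point moves, and the lifted
  square is examined on all four edges. One edge is the segment, the opposite one is constant, and
  the remaining two lift the same path and share an end point, hence also the other.\<close>

lemma uniform_sections_inj:
  fixes F :: "'e::euclidean_space \<Rightarrow> 'c::metric_space"
  assumes F: "continuous_on UNIV F" "surj F"
    and loc: "\<And>u. \<exists>N. open N \<and> u \<in> N \<and> inj_on F N"
    and sections: "\<And>q. \<exists>U. open U \<and> q \<in> U \<and>
      (\<forall>u. F u \<in> U \<longrightarrow> (\<exists>s. continuous_on U s \<and> s (F u) = u \<and> (\<forall>x\<in>U. F (s x) = x)))"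
    and sc: "simply_connected (UNIV :: 'c set)"
  shows "inj F"
proof (rule injI)
  fix u v assume uv: "F u = F v"
  define \<sigma> where "\<sigma> = (\<lambda>t::real. F (u + t *\<^sub>R (v - u)))"
  have cs: "continuous_on S \<sigma>" for S
    unfolding \<sigma>_def by (rule continuous_on_compose2[OF F(1)]) (auto intro!: continuous_intros)
  have "homotopic_loops UNIV \<sigma> (\<lambda>_. F u)"
    using sc cs uv unfolding simply_connected_def
    by (auto simp: path_def pathstart_def pathfinish_def \<sigma>_def)
  then obtain h where h: "continuous_on ({0..1::real} \<times> {0..1::real}) h" "\<And>x. x \<in> {0..1} \<Longrightarrow> h (0, x) = \<sigma> x"
    "\<And>x. x \<in> {0..1} \<Longrightarrow> h (1, x) = F u" "\<And>t. t \<in> {0..1} \<Longrightarrow> h (t, 1) = h (t, 0)"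
    unfolding homotopic_loops by (auto simp: pathfinish_def pathstart_def)
  have "convex ({0..1::real} \<times> {0..1::real})" by (intro convex_Times) auto
  then obtain k where k: "continuous_on ({0..1} \<times> {0..1}) k" "\<And>z. z \<in> {0..1} \<times> {0..1} \<Longrightarrow> F (k z) = h z" "k (0, 0) = u"
    using lift_through_uniform_sections[OF F loc sections _ _ h(1), of "(0,0)" u] h(2)[of 0] by (auto simp: \<sigma>_def)
  have kc: "continuous_on {0..1} (\<lambda>x. k (a x, b x))" if "continuous_on {0..1} a" "continuous_on {0..1} b"
    "\<And>x. x \<in> {0..1} \<Longrightarrow> a x \<in> {0..1} \<and> b x \<in> {0..1}" for a b :: "real \<Rightarrow> real"
    by (rule continuous_on_compose2[OF k(1) continuous_on_Pair[OF that(1,2)]]) (use that(3) in blast)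
  note ci = continuous_on_id and cc = continuous_on_const
  have k0: "continuous_on {0..1} (\<lambda>x. k (0, x))" and k1: "continuous_on {0..1} (\<lambda>x. k (1, x))"
    and k0': "continuous_on {0..1} (\<lambda>x. k (x, 0))" and k1': "continuous_on {0..1} (\<lambda>x. k (x, 1))"
    using kc[OF cc ci, of 0] kc[OF cc ci, of 1] kc[OF ci cc, of 0] kc[OF ci cc, of 1] by auto
  have seg: "continuous_on {0..1::real} (\<lambda>t. u + t *\<^sub>R (v - u))" by (intro continuous_intros)
  have "k (0, 1) = u + 1 *\<^sub>R (v - u)"
    by (rule lift_unique[where s="\<lambda>x. k (0, x)" and s'="\<lambda>t. u + t *\<^sub>R (v - u)" and y=1, OF connected_Icc k0 seg loc, of 0])
       (use k(2,3) h(2) in \<open>auto simp: \<sigma>_def\<close>)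
  moreover have one: "k (1, 1) = k (1, 0)"
    by (rule lift_unique[where s="\<lambda>x. k (1, x)" and s'="\<lambda>_. k (1, 0)" and y=1, OF connected_Icc k1 cc loc, of 0])
       (use k(2) h(3) in auto)
  have "k (0, 1) = k (0, 0)"
    by (rule lift_unique[where s="\<lambda>x. k (x, 1)" and s'="\<lambda>x. k (x, 0)" and y=0, OF connected_Icc k1' k0' loc, of 1])
       (use k(2) h(4) one in auto)
  ultimately show "u = v" using k(3) by simp
qed

section \<open>The theorem of Cartan and Hadamard\<close>

text \<open>Simple connectedness is formulated through free homotopy of loops; for two constant
  loops, the track of the base point is a path.\<close>

lemma simply_connected_imp_connected:
  assumes "simply_connected (UNIV :: 'c::topological_space set)"
  shows "connected (UNIV :: 'c set)"
proof (rule path_connected_imp_connected, unfold path_connected_def, intro ballI)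
  fix x y :: 'c
  have "homotopic_loops UNIV (\<lambda>_. x) (\<lambda>_. y)"
    using assms by (simp add: simply_connected_def path_def pathstart_def pathfinish_def continuous_on_const)
  then obtain h :: "real \<times> real \<Rightarrow> 'c" where h: "continuous_on ({0..1} \<times> {0..1}) h" "h (0, 0) = x" "h (1, 0) = y"
    unfolding homotopic_loops by auto
  have "continuous_on {0..1} (\<lambda>s. h (s, 0))"
    by (rule continuous_on_compose2[OF h(1) continuous_on_Pair[OF continuous_on_id continuous_on_const]]) auto
  then show "\<exists>g. path g \<and> path_image g \<subseteq> UNIV \<and> pathstart g = x \<and> pathfinish g = y"
    using h(2,3) by (intro exI[of _ "\<lambda>s. h (s, 0)"]) (simp add: path_def pathstart_def pathfinish_def)
qed

lemma continuous_on_locally: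
  assumes "\<And>t. t \<in> S \<Longrightarrow> \<exists>N. open N \<and> t \<in> N \<and> continuous_on (S \<inter> N) f"
  shows "continuous_on S f"
  unfolding continuous_on_topological
proof (intro ballI allI impI)
  fix t B assume t: "t \<in> S" and B: "open B" "f t \<in> B"
  obtain N where N: "open N" "t \<in> N" "continuous_on (S \<inter> N) f" using assms[OF t] by blast
  have "t \<in> S \<inter> N" using t N by blast
  from N(3)[unfolded continuous_on_topological, rule_format, OF this B]
  obtain M where M: "open M" "t \<in> M" "\<forall>y\<in>S \<inter> N. y \<in> M \<longrightarrow> f y \<in> B" by blast
  then show "\<exists>M. open M \<and> t \<in> M \<and> (\<forall>y\<in>S. y \<in> M \<longrightarrow> f y \<in> B)"
    using N by (intro exI[of _ "N \<inter> M"]) auto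
qed

lemma C1_on_locally:
  assumes S: "open S" and loc: "\<And>x. x \<in> S \<Longrightarrow> \<exists>N. open N \<and> x \<in> N \<and> C1_on f N"
  shows "C1_on f S"
  unfolding C1_on_def
proof (intro conjI ballI allI)
  show "f differentiable at x" if "x \<in> S" for x using loc[OF that] by (auto simp: C1_on_def)
  show "continuous_on S (\<lambda>x. frechet_derivative f (at x) v)" for v
    using loc by (intro continuous_on_locally) (metis C1_on_def continuous_on_subset inf_le2)
qed

text \<open>Induction on the number of break points inside the interval, which is split at one of
  them.\<close>

lemma integrable_on_pieces:
  fixes f :: "real \<Rightarrow> real"
  assumes "finite F" and "\<And>a b. l \<le> a \<Longrightarrow> a < b \<Longrightarrow> b \<le> r \<Longrightarrow> {a<..<b} \<inter> F = {} \<Longrightarrow> f integrable_on {a..b}"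
  shows "f integrable_on {l..r}"
  using assms(2)
proof (induction "card (F \<inter> {l<..<r})" arbitrary: l r rule: less_induct)
  case less
  show ?case
  proof (cases "l < r")
    case False
    then show ?thesis by (cases "l = r") (use integrable_on_refl[of f r] in \<open>auto simp del: integrable_on_refl\<close>)
  next
    case lr: True
    show ?thesis
    proof (cases "F \<inter> {l<..<r} = {}")
      case True
      then show ?thesis using less.prems[of l r] lr by (simp add: Int_commute)
    next
      case False
      then obtain m where m: "m \<in> F" "l < m" "m < r" by auto
      have "card (F \<inter> {l<..<m}) < card (F \<inter> {l<..<r})" "card (F \<inter> {m<..<r}) < card (F \<inter> {l<..<r})"
        using assms(1) m by (intro psubset_card_mono; force)+
      then have "f integrable_on {l..m}" "f integrable_on {m..r}"
        using less.hyps less.prems m by (auto simp: less_imp_le)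
      then show ?thesis using Henstock_Kurzweil_Integration.integrable_combine[OF less_imp_le[OF m(2)] less_imp_le[OF m(3)]] by blast
    qed
  qed
qed

context riemannian_metric begin

text \<open>The function \<open>speed\<close> uses two-sided derivatives, which may fail to exist at
  the ends of a piece. The function \<open>w\<close> uses derivatives within the piece; it is
  continuous and differs from \<open>speed\<close> at the two ends at most.\<close>

lemma speed_integrable_piece:
  assumes ab: "a < b" and \<sigma>: "C1_curve_on {a..b} \<sigma>"
  shows "speed \<sigma> integrable_on {a..b}"
proof -
  define w where "w = (\<lambda>t. let c = (SOME c. c \<in> A \<and> \<sigma> t \<in> chart_dom c);
      v = vector_derivative (chart_coord c \<circ> \<sigma>) (at t within {a..b}) in sqrt (g c (chart_coord c (\<sigma> t)) v v))"
  have cont\<sigma>: "continuous_on {a..b} \<sigma>" using \<sigma> by (simp add: C1_curve_on_def)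
  have wc: "w t = sqrt (g c (chart_coord c (\<sigma> t)) v v)"
    if c: "c \<in> A" "\<sigma> t \<in> chart_dom c" and t: "t \<in> {a..b}"
      and d: "((chart_coord c \<circ> \<sigma>) has_vector_derivative v) (at t within {a..b})" for c t v
  proof -
    define c1 where "c1 = (SOME c. c \<in> A \<and> \<sigma> t \<in> chart_dom c)"
    have c1: "c1 \<in> A" "\<sigma> t \<in> chart_dom c1"
      using someI[of "\<lambda>c. c \<in> A \<and> \<sigma> t \<in> chart_dom c" c] c by (auto simp: c1_def)
    let ?x = "chart_coord c (\<sigma> t)"
    have x: "?x \<in> overlap c c1" using c c1 by (auto simp: overlap_def)
    have "((chart_coord c1 \<circ> \<sigma>) has_vector_derivative Dtrans c c1 ?x v) (at t within {a..b})"
      using curve_change_chart[OF c(1) c1(1), of \<sigma> t "{a..b}" v] c c1 cont\<sigma> t d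
      by (simp add: continuous_on_eq_continuous_within)
    then have "vector_derivative (chart_coord c1 \<circ> \<sigma>) (at t within {a..b}) = Dtrans c c1 ?x v"
      by (rule vector_derivative_within_closed_interval[OF ab t])
    then show ?thesis
      unfolding w_def Let_def c1_def[symmetric]
      by (simp add: metric_transition[OF c(1) c1(1) x] transition_coord[OF c])
  qed
  have "continuous_on {a..b} w"
  proof (rule continuous_on_locally)
    fix t assume t: "t \<in> {a..b}"
    obtain c where c: "c \<in> A" "\<sigma> t \<in> chart_dom c" by (rule chart_exists)
    interpret M: C1_inner "chart_img c" "g c" using C1_metric[OF c(1)] .
    have "openin (top_of_set {a..b}) ({a..b} \<inter> \<sigma> -` chart_dom c)"
      by (rule continuous_openin_preimage_gen[OF cont\<sigma> chart_dom_open[OF c(1)]])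
    then obtain N where N: "open N" "{a..b} \<inter> \<sigma> -` chart_dom c = {a..b} \<inter> N" by (auto simp: openin_open)
    let ?T = "{t \<in> {a..b}. \<sigma> t \<in> chart_dom c}"
    have T: "{a..b} \<inter> N = ?T" using N(2) by blast
    obtain D where D: "continuous_on ?T D"
      "\<And>t. t \<in> {a..b} \<Longrightarrow> \<sigma> t \<in> chart_dom c \<Longrightarrow> ((chart_coord c \<circ> \<sigma>) has_vector_derivative D t) (at t within {a..b})"
      using \<sigma> c(1) unfolding C1_curve_on_def by blast
    have "continuous_on ?T \<sigma>" by (rule continuous_on_subset[OF cont\<sigma>]) blast
    then have "continuous_on ?T (\<lambda>t. chart_coord c (\<sigma> t))"
      by (rule continuous_on_compose2[OF continuous_chart_coord[OF c(1)]]) auto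
    then have "continuous_on ?T (\<lambda>t. sqrt (g c (chart_coord c (\<sigma> t)) (D t) (D t)))"
      by (intro continuous_on_real_sqrt M.continuous_joint D(1) image_subsetI) (assumption, erule CollectE, elim conjE, rule chart_coord_in)
    then have "continuous_on ?T w"
    proof (rule continuous_on_eq)
      fix t assume "t \<in> ?T"
      then show "sqrt (g c (chart_coord c (\<sigma> t)) (D t) (D t)) = w t"
        using wc[OF c(1) _ _ D(2), of t] by simp
    qed
    then show "\<exists>N. open N \<and> t \<in> N \<and> continuous_on ({a..b} \<inter> N) w"
      using N t c(2) T by (intro exI[of _ N]) auto
  qed
  then have "w integrable_on {a..b}" by (rule integrable_continuous_real)
  then show ?thesis
  proof (rule integrable_spike_finite[of "{a, b}", rotated 2])
    fix t assume "t \<in> {a..b} - {a, b}"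
    then have "at t within {a..b} = at t" by (intro at_within_Icc_at) auto
    then show "speed \<sigma> t = w t" by (simp add: speed_def w_def)
  qed simp
qed

text \<open>A nonintegrable speed would give the default value \<open>0\<close> for
  \<open>curve_length\<close>, and lengths could not be bounded below.\<close>

lemma speed_integrable: "piecewise_C1_curve \<sigma> \<Longrightarrow> speed \<sigma> integrable_on {0..1}"
proof -
  assume "piecewise_C1_curve \<sigma>"
  then obtain F where F: "finite F"
    "\<And>a b. 0 \<le> a \<Longrightarrow> a < b \<Longrightarrow> b \<le> 1 \<Longrightarrow> {a<..<b} \<inter> F = {} \<Longrightarrow> C1_curve_on {a..b} \<sigma>"
    unfolding piecewise_C1_curve_def by blast
  show ?thesis by (rule integrable_on_pieces[OF F(1)]) (rule speed_integrable_piece[OF _ F(2)])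
qed

end

section \<open>Bijectivity of the exponential map\<close>

context exp_family begin

definition E :: "'e \<Rightarrow> 'a" where "E u = \<gamma> u 1"

abbreviation Q :: "'e \<Rightarrow> 'e \<Rightarrow> real" where "Q \<equiv> g c0 (chart_coord c0 p)"

lemma base_img: "chart_coord c0 p \<in> chart_img c0"
  using c0 by (simp add: chart_coord_in)

lemma Q_bilinear: "bilinear Q" and Q_sym: "Q v w = Q w v" and Q_pos: "v \<noteq> 0 \<Longrightarrow> Q v v > 0" and Q_nonneg: "Q v v \<ge> 0"
  using metric_bilinear metric_sym metric_pos metric_nonneg base_img c0 by auto

lemma E_chart:
  assumes c: "c \<in> A"
  shows "open (E -` chart_dom c)" "C1_on (chart_coord c \<circ> E) (E -` chart_dom c)"
proof -
  have loc: "\<exists>N. open N \<and> u \<in> N \<and> N \<subseteq> E -` chart_dom c \<and> C1_on (chart_coord c \<circ> E) N" if u: "u \<in> E -` chart_dom c" for u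
  proof -
    have "good c u 1" using good_all[of 1 c u] u c by (auto simp: E_def)
    then obtain N where N: "open N" "u \<in> N" "\<forall>u\<in>N. \<gamma> u 1 \<in> chart_dom c" "C1_on (\<lambda>u. st c u 1) N" by (auto simp: good_def)
    have "C1_on (\<lambda>u. fst (st c u 1)) N"
    proof (rule C1_onI)
      show "((\<lambda>u. fst (st c u 1)) has_derivative (\<lambda>w. fst (frechet_derivative (\<lambda>u. st c u 1) (at u) w))) (at u)" if "u \<in> N" for u
        by (rule has_derivative_fst[OF C1_on_has_derivative[OF N(4) that]])
      show "continuous_on N (\<lambda>u. fst (frechet_derivative (\<lambda>u. st c u 1) (at u) w))" for w
        using N(4) by (intro continuous_on_fst) (simp add: C1_on_def)
    qed
    then have "C1_on (chart_coord c \<circ> E) N" by (simp add: st_def E_def comp_def)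
    then show ?thesis using N by (auto simp: E_def)
  qed
  show "open (E -` chart_dom c)" by (subst open_subopen) (use loc in blast)
  then show "C1_on (chart_coord c \<circ> E) (E -` chart_dom c)" by (rule C1_on_locally) (use loc in blast)
qed

lemma E_continuous: "continuous_on UNIV E"
proof (rule continuous_on_locally)
  fix u
  obtain c where c: "c \<in> A" "E u \<in> chart_dom c" by (rule chart_exists)
  have "continuous_on (E -` chart_dom c) (\<lambda>u. chart_inv c ((chart_coord c \<circ> E) u))"
    by (rule continuous_on_compose2[OF continuous_chart_inv[OF c(1)] C1_on_continuous[OF E_chart(2)[OF c(1)]]])
       (auto simp: chart_coord_in)
  then have "continuous_on (E -` chart_dom c) E"
    by (rule continuous_on_eq) (simp add: chart_inv_coord[OF c(1)])
  then show "\<exists>N. open N \<and> u \<in> N \<and> continuous_on (UNIV \<inter> N) E" using E_chart(1)[OF c(1)] c(2) by auto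
qed

lemma E_expanding:
  assumes c: "c \<in> A" "E u \<in> chart_dom c"
  shows "Q w w \<le> g c (chart_coord c (E u)) (frechet_derivative (chart_coord c \<circ> E) (at u) w) (frechet_derivative (chart_coord c \<circ> E) (at u) w)"
proof -
  have "((chart_coord c \<circ> E) has_derivative frechet_derivative (chart_coord c \<circ> E) (at u)) (at u)"
    by (rule C1_on_has_derivative[OF E_chart(2)[OF c(1)]]) (use c in simp)
  from dnorm_chart[OF c(1) E_chart(1)[OF c(1)] _ _ this] c(2) exp_expanding[of w u]
  show ?thesis by (simp add: E_def[abs_def])
qed

lemma E_derivative_injective:
  assumes c: "c \<in> A" "E u \<in> chart_dom c" and "frechet_derivative (chart_coord c \<circ> E) (at u) w = 0"
  shows "w = 0"
  using E_expanding[OF c, of w] Q_pos[of w] bilinear_lzero[OF metric_bilinear[OF c(1) chart_coord_in[OF c(2)]]] assms(3)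
  by fastforce

lemma E_locally_injective: "\<exists>N. open N \<and> u \<in> N \<and> inj_on E N"
proof -
  obtain c where c: "c \<in> A" "E u \<in> chart_dom c" by (rule chart_exists)
  obtain N where N: "open N" "u \<in> N" "N \<subseteq> E -` chart_dom c" "inj_on (chart_coord c \<circ> E) N"
    by (rule C1_locally_injective[OF E_chart(1)[OF c(1)] _ E_chart(2)[OF c(1)] E_derivative_injective[OF c]]) (use c in auto)
  have "inj_on E N" using N(4) by (rule inj_on_imageI2)
  then show ?thesis using N by blast
qed

lemma E_sections:
  "\<exists>U. open U \<and> q \<in> U \<and> (\<forall>u. E u \<in> U \<longrightarrow> (\<exists>s. continuous_on U s \<and> s (E u) = u \<and> (\<forall>x\<in>U. E (s x) = x)))"
proof -
  obtain c where c: "c \<in> A" "q \<in> chart_dom c" by (rule chart_exists)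
  interpret M: C1_inner "chart_img c" "g c" using C1_metric[OF c(1)] .
  interpret M0: C1_inner "chart_img c0" "g c0" using C1_metric[OF c0(1)] .
  define y where "y = chart_coord c q"
  from open_contains_cball[THEN iffD1, OF M.U, rule_format, OF chart_coord_in[OF c(2)]]
  obtain R' where R': "R' > 0" "cball y R' \<subseteq> chart_img c" unfolding y_def by (elim exE conjE)
  \<comment> \<open>With a third of the radius, the ball of radius \<open>2 * R\<close> around any
    point of \<open>ball y R\<close> contains \<open>ball y R\<close> and stays inside
    \<open>cball y R'\<close>; thus one \<open>U\<close> serves every preimage
    \<open>u\<close>.\<close>
  define R where "R = R' / 3"
  have R: "R > 0" using R' by (simp add: R_def)
  obtain m' M where M: "m' > 0" "M > 0" "\<And>x v. x \<in> cball y R' \<Longrightarrow> m' * (norm v)\<^sup>2 \<le> g c x v v \<and> g c x v v \<le> M * (norm v)\<^sup>2"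
    using M.norm_equiv[OF compact_cball R'(2)] by metis
  have "{chart_coord c0 p} \<subseteq> chart_img c0" using base_img by simp
  then obtain m M' where m: "m > 0" "M' > 0" "\<And>x v. x \<in> {chart_coord c0 p} \<Longrightarrow> m * (norm v)\<^sup>2 \<le> g c0 x v v \<and> g c0 x v v \<le> M' * (norm v)\<^sup>2"
    using M0.norm_equiv[OF compact_sing] by metis
  \<comment> \<open>Converts the expansion in the Riemannian metrics into one for Euclidean norms:
    \<open>m\<close> is the lower constant at the base point and \<open>M\<close> the upper constant
    on the coordinate ball.\<close>
  define C where "C = sqrt (M / m)"
  have C: "C > 0" using M m by (simp add: C_def)
  define f where "f = chart_coord c \<circ> E"
  define U where "U = chart_dom c \<inter> chart_coord c -` ball y R"
  have U: "open U" "q \<in> U"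
    unfolding U_def
    using continuous_open_preimage[OF continuous_chart_coord[OF c(1)] chart_dom_open[OF c(1)] open_ball] c(2) R
    by (auto simp: y_def)
  have sec: "\<exists>s. continuous_on U s \<and> s (E u) = u \<and> (\<forall>x\<in>U. E (s x) = x)" if u: "E u \<in> U" for u
  proof -
    have fu: "f u \<in> ball y R" "E u \<in> chart_dom c" using u by (auto simp: U_def f_def)
    have sub: "ball (f u) (2 * R) \<subseteq> cball y R'"
    proof
      fix x assume "x \<in> ball (f u) (2 * R)"
      then show "x \<in> cball y R'" using fu(1) dist_triangle[of y x "f u"] by (simp add: R_def)
    qed
    interpret X: expanding_map f "E -` chart_dom c" u C "2 * R"
    proof
      show "open (E -` chart_dom c)" "C1_on f (E -` chart_dom c)"
        using E_chart[OF c(1)] by (simp_all add: f_def)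
      fix v w assume v: "v \<in> E -` chart_dom c" "f v \<in> ball (f u) (2 * R)"
      let ?D = "frechet_derivative f (at v) w"
      have "m * (norm w)\<^sup>2 \<le> Q w w" using m(3) by simp
      also have "\<dots> \<le> g c (f v) ?D ?D" using E_expanding[OF c(1), of v w] v by (simp add: f_def)
      also have "\<dots> \<le> M * (norm ?D)\<^sup>2" using M(3) v(2) sub by blast
      finally have "(norm w)\<^sup>2 \<le> (C * norm ?D)\<^sup>2"
        using m(1) M(2) by (simp add: C_def power_mult_distrib field_simps)
      then show "norm w \<le> C * norm ?D" by (rule power2_le_imp_le) (use C in simp)
    next
      fix r assume r: "r < 2 * R"
      have sub': "cball (f u) r \<subseteq> chart_img c" using r sub R'(2) by (force simp: subset_iff)
      \<comment> \<open>Closedness in the whole tangent space: the set is the preimage under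
        \<open>E\<close> of a compact subset of the manifold.\<close>
      have "compact (chart_inv c ` cball (f u) r)"
        by (rule compact_continuous_image[OF continuous_on_subset[OF continuous_chart_inv[OF c(1)] sub'] compact_cball])
      then have "closed (E -` (chart_inv c ` cball (f u) r))"
        using E_continuous continuous_closed_vimage compact_imp_closed by (metis continuous_on_eq_continuous_within UNIV_I)
      moreover have "E -` (chart_inv c ` cball (f u) r) = {v \<in> E -` chart_dom c. f v \<in> cball (f u) r}"
      proof (intro set_eqI iffI)
        fix v assume "v \<in> E -` (chart_inv c ` cball (f u) r)"
        then obtain z where z: "z \<in> cball (f u) r" "E v = chart_inv c z" by blast
        then have "z \<in> chart_img c" using sub' by blast
        then show "v \<in> {v \<in> E -` chart_dom c. f v \<in> cball (f u) r}"
          using z chart_inv_in[OF c(1)] chart_coord_inv[OF c(1)] by (simp add: f_def)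
      next
        fix v assume "v \<in> {v \<in> E -` chart_dom c. f v \<in> cball (f u) r}"
        then show "v \<in> E -` (chart_inv c ` cball (f u) r)"
          using chart_inv_coord[OF c(1), of "E v"] by (auto simp: f_def image_iff intro!: bexI[of _ "chart_coord c (E v)"])
      qed
      ultimately show "closed {v \<in> E -` chart_dom c. f v \<in> cball (f u) r}" by simp
    qed (use fu R C in auto)
    obtain s where s: "X.section_on (ball (f u) (2 * R)) s" by (rule X.section_exists)
    note s = s[unfolded X.section_on_def]
    have sub2: "ball y R \<subseteq> ball (f u) (2 * R)"
    proof
      fix x assume "x \<in> ball y R"
      then show "x \<in> ball (f u) (2 * R)" using fu(1) dist_triangle[of "f u" x y] by (simp add: dist_commute)
    qed
    have cU: "continuous_on U (chart_coord c)"
      using continuous_chart_coord[OF c(1)] by (rule continuous_on_subset) (auto simp: U_def)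
    have "continuous_on U (\<lambda>x. s (chart_coord c x))"
      by (rule continuous_on_compose2[of "ball (f u) (2 * R)", OF _ cU]) (use s sub2 in \<open>auto simp: U_def\<close>)
    moreover have "s (chart_coord c (E u)) = u" using s unfolding f_def comp_def by blast
    moreover have "E (s (chart_coord c x)) = x" if x: "x \<in> U" for x
    proof -
      have xd: "x \<in> chart_dom c" "chart_coord c x \<in> ball (f u) (2 * R)" using x sub2 by (auto simp: U_def)
      then have "E (s (chart_coord c x)) \<in> chart_dom c" "chart_coord c (E (s (chart_coord c x))) = chart_coord c x"
        using s unfolding f_def comp_def by blast+
      then show ?thesis using xd(1) chart_inv_coord[OF c(1)] by metis
    qed
    ultimately show ?thesis by blast
  qed
  show ?thesis by (intro exI[of _ U] conjI U allI impI sec)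
qed

text \<open>Every point has a neighbourhood inside the range or disjoint from it, since a single
  preimage over \<open>U\<close> yields a section over all of \<open>U\<close>; connectedness
  concludes.\<close>

lemma E_surj: "surj E"
proof -
  have cl: "\<exists>U. open U \<and> q \<in> U \<and> (U \<subseteq> range E \<or> U \<inter> range E = {})" for q
  proof -
    obtain U where U: "open U" "q \<in> U" "\<And>u. E u \<in> U \<Longrightarrow> \<exists>s. continuous_on U s \<and> s (E u) = u \<and> (\<forall>x\<in>U. E (s x) = x)"
      using E_sections[of q] by blast
    have "U \<subseteq> range E" if "E u \<in> U" for u using U(3)[OF that] by (metis rangeI subsetI)
    then show ?thesis using U by blast
  qed
  have "open (range E)"
  proof (rule open_subopen[THEN iffD2], rule ballI)
    fix q assume "q \<in> range E"
    then show "\<exists>T. open T \<and> q \<in> T \<and> T \<subseteq> range E" using cl[of q] by (elim exE conjE disjE) auto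
  qed
  moreover have "open (- range E)"
  proof (rule open_subopen[THEN iffD2], rule ballI)
    fix q assume "q \<in> - range E"
    then show "\<exists>T. open T \<and> q \<in> T \<and> T \<subseteq> - range E" using cl[of q] by (elim exE conjE disjE) auto
  qed
  ultimately show ?thesis
    using connectedD[OF simply_connected_imp_connected[OF simply_connected], of "range E" "- range E"] by auto
qed

lemma E_inj: "inj E"
  by (rule uniform_sections_inj[OF E_continuous E_surj E_locally_injective E_sections simply_connected])

section \<open>The nonexpanding inverse of the exponential map\<close>

definition L :: "'a \<Rightarrow> 'e" where "L = inv E"

lemma E_L: "E (L x) = x" and L_E: "L (E u) = u"
  using E_surj E_inj by (simp_all add: L_def surj_f_inv_f)

lemma L_continuous: "continuous_on UNIV L"
proof (rule continuous_on_locally)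
  fix q
  obtain U where U: "open U" "q \<in> U" "\<And>u. E u \<in> U \<Longrightarrow> \<exists>s. continuous_on U s \<and> s (E u) = u \<and> (\<forall>x\<in>U. E (s x) = x)"
    using E_sections[of q] by blast
  obtain s where s: "continuous_on U s" "\<forall>x\<in>U. E (s x) = x" using U(3)[of "L q"] U(2) by (auto simp: E_L)
  have "continuous_on U L" by (rule continuous_on_eq[OF s(1)]) (metis s(2) L_E)
  then show "\<exists>N. open N \<and> q \<in> N \<and> continuous_on (UNIV \<inter> N) L" using U by auto
qed

text \<open>The differential of \<open>L\<close> inverts that of \<open>E\<close>, which does not
  decrease lengths.\<close>

lemma L_curve:
  assumes c: "c \<in> A" "\<sigma> t \<in> chart_dom c" and cont: "isCont \<sigma> t" and d: "((chart_coord c \<circ> \<sigma>) has_vector_derivative v) (at t)"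
  obtains l where "((L \<circ> \<sigma>) has_vector_derivative l) (at t)" "Q l l \<le> (speed \<sigma> t)\<^sup>2"
proof -
  define f where "f = chart_coord c \<circ> E"
  let ?k = "L \<circ> chart_inv c" and ?y = "chart_coord c (\<sigma> t)"
  have y: "?y \<in> chart_img c" using c by (simp add: chart_coord_in)
  have ky: "?k ?y = L (\<sigma> t)" by (simp add: chart_inv_coord[OF c])
  have dom: "L (\<sigma> t) \<in> E -` chart_dom c" using c by (simp add: E_L)
  let ?D = "frechet_derivative f (at (L (\<sigma> t)))"
  have df: "(f has_derivative ?D) (at (L (\<sigma> t)))"
    unfolding f_def by (rule C1_on_has_derivative[OF E_chart(2)[OF c(1)] dom])
  note lin = has_derivative_linear[OF df]
  have "w = 0" if "?D w = 0" for w
    using E_derivative_injective[OF c(1), of "L (\<sigma> t)" w] c(2) that by (simp add: E_L f_def)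
  then have "inj ?D" using linear_injective_0[OF lin] by blast
  then obtain k' where k': "linear k'" "\<And>x. k' (?D x) = x" "\<And>x. ?D (k' x) = x"
    using linear_injective_isomorphism[OF lin] by blast
  have contk: "continuous_on (chart_img c) ?k"
    by (rule continuous_on_compose[OF continuous_chart_inv[OF c(1)] continuous_on_subset[OF L_continuous]]) simp
  have dk: "(?k has_derivative k') (at ?y)"
  proof (rule has_derivative_inverse_basic[where f=f and f'="?D" and T="chart_img c"])
    show "(f has_derivative ?D) (at (?k ?y))" unfolding ky by (rule df)
    show "isCont ?k ?y" using contk y chart_img_open[OF c(1)] continuous_on_eq_continuous_at by blast
    show "f (?k z) = z" if "z \<in> chart_img c" for z using that by (simp add: f_def E_L chart_coord_inv[OF c(1)])
  qed (use k' y chart_img_open[OF c(1)] in \<open>auto simp: linear_linear\<close>)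
  have "((?k \<circ> (chart_coord c \<circ> \<sigma>)) has_vector_derivative k' v) (at t)"
    using diff_chain_at[OF d[unfolded has_vector_derivative_def], of ?k k'] dk linear_cmul[OF k'(1)]
    by (simp add: has_vector_derivative_def comp_def)
  moreover obtain S where S: "open S" "t \<in> S" "\<And>s. s \<in> S \<Longrightarrow> \<sigma> s \<in> chart_dom c"
    using cont[unfolded continuous_at_open, rule_format, OF conjI[OF chart_dom_open[OF c(1)] c(2)]] by blast
  ultimately have "((L \<circ> \<sigma>) has_vector_derivative k' v) (at t)"
    using has_vector_derivative_transform_within_open[of "?k \<circ> (chart_coord c \<circ> \<sigma>)" "k' v" t S "L \<circ> \<sigma>"]
    by (simp add: chart_inv_coord[OF c(1)])
  moreover have "Q (k' v) (k' v) \<le> (speed \<sigma> t)\<^sup>2"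
    using E_expanding[OF c(1), of "L (\<sigma> t)" "k' v"] c(2) k'(3) metric_nonneg[OF c(1) y]
    unfolding speed_chart[OF c cont d] by (simp add: E_L f_def)
  ultimately show thesis by (rule that)
qed

text \<open>The linear functional \<open>Q z\<close> acts as a calibration: the derivative of
  \<open>Q z (L (\<sigma> t))\<close> is at most \<open>sqrt (Q z z) * speed \<sigma> t\<close>,
  while its integral is \<open>Q z z\<close>.\<close>

lemma curve_length_lower:
  assumes \<sigma>: "piecewise_C1_curve \<sigma>"
  defines "z \<equiv> L (\<sigma> 1) - L (\<sigma> 0)"
  shows "sqrt (Q z z) \<le> curve_length \<sigma>"
proof -
  obtain F where F: "finite F" "\<And>a b. 0 \<le> a \<Longrightarrow> a < b \<Longrightarrow> b \<le> 1 \<Longrightarrow> {a<..<b} \<inter> F = {} \<Longrightarrow> C1_curve_on {a..b} \<sigma>"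
    and cont: "continuous_on {0..1} \<sigma>" using \<sigma> unfolding piecewise_C1_curve_def by blast
  have ex: "\<exists>l. ((L \<circ> \<sigma>) has_vector_derivative l) (at t) \<and> Q l l \<le> (speed \<sigma> t)\<^sup>2" if t: "t \<in> {0<..<1} - F" for t
  proof -
    have "open ({0<..<1} - F)" using F(1) by (intro open_Diff finite_imp_closed) auto
    then obtain e where e: "e > 0" "cball t e \<subseteq> {0<..<1} - F" using t open_contains_cball by metis
    have eq: "{t - e..t + e} = cball t e" by (simp add: cball_eq_atLeastAtMost)
    have "{t - e..t + e} \<subseteq> {0<..<1}" using e(2) unfolding eq by blast
    moreover have "t - e \<in> {t - e..t + e}" "t + e \<in> {t - e..t + e}" using e(1) by simp_all
    ultimately have "t - e \<in> {0<..<1}" "t + e \<in> {0<..<1}" by blast+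
    then have b: "0 \<le> t - e" "t + e \<le> 1" by auto
    have "{t - e<..<t + e} \<subseteq> cball t e" unfolding eq[symmetric] by auto
    then have "{t - e<..<t + e} \<inter> F = {}" using e(2) by blast
    then have C: "C1_curve_on {t - e..t + e} \<sigma>" using F(2) b e(1) by simp
    obtain c where c: "c \<in> A" "\<sigma> t \<in> chart_dom c" by (rule chart_exists)
    have te: "t \<in> {t - e..t + e}" using e(1) by simp
    have at: "at t within {t - e..t + e} = at t" by (rule at_within_Icc_at) (use e in auto)
    obtain D where D: "((chart_coord c \<circ> \<sigma>) has_vector_derivative D t) (at t within {t - e..t + e})"
      using C c te unfolding C1_curve_on_def by blast
    have "isCont \<sigma> t"
      using C te at unfolding C1_curve_on_def continuous_on_eq_continuous_within by metis
    then show ?thesis using L_curve[OF c _ D[unfolded at]] by metis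
  qed
  then obtain l where l: "\<And>t. t \<in> {0<..<1} - F \<Longrightarrow> ((L \<circ> \<sigma>) has_vector_derivative l t) (at t)"
    "\<And>t. t \<in> {0<..<1} - F \<Longrightarrow> Q (l t) (l t) \<le> (speed \<sigma> t)\<^sup>2" by metis
  define S where "S = F \<union> {0, 1}"
  define \<phi> where "\<phi> = (\<lambda>t. Q z (L (\<sigma> t)))"
  \<comment> \<open>Finitely many exceptional points in \<open>{0..1}\<close> do not affect the
    integral; the value \<open>0\<close> there keeps the bound \<open>le\<close> valid
    everywhere.\<close>
  define \<phi>' where "\<phi>' = (\<lambda>t. if t \<in> {0<..<1} - F then Q z (l t) else 0)"
  have blin: "bounded_linear (Q z)" using Q_bilinear by (simp add: bilinear_def linear_linear)
  have int': "(\<phi>' has_integral (\<phi> 1 - \<phi> 0)) {0..1}"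
  proof (rule fundamental_theorem_of_calculus_interior_strong[OF F(1)])
    show "(\<phi> has_vector_derivative \<phi>' t) (at t)" if "t \<in> {0<..<1} - F" for t
      using bounded_linear.has_vector_derivative[OF blin l(1)[OF that]] that by (simp add: \<phi>_def \<phi>'_def)
    show "continuous_on {0..1} \<phi>"
      unfolding \<phi>_def
      by (intro bounded_linear.continuous_on[OF blin] continuous_on_compose2[OF L_continuous cont]) auto
  qed simp
  have int: "((\<lambda>t. sqrt (Q z z) * speed \<sigma> t) has_integral sqrt (Q z z) * curve_length \<sigma>) {0..1}"
    unfolding curve_length_def using speed_integrable[OF \<sigma>] by (intro has_integral_mult_right integrable_integral)
  have le: "\<phi>' t \<le> sqrt (Q z z) * speed \<sigma> t" for t
  proof (cases "t \<in> {0<..<1} - F")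
    case True
    have "(Q z (l t))\<^sup>2 \<le> Q z z * Q (l t) (l t)" by (rule bilinear_Cauchy_Schwarz[OF Q_bilinear Q_sym Q_pos])
    also have "\<dots> \<le> Q z z * (speed \<sigma> t)\<^sup>2" using l(2)[OF True] Q_nonneg by (rule mult_left_mono)
    also have "\<dots> = (sqrt (Q z z) * speed \<sigma> t)\<^sup>2" using Q_nonneg by (simp add: power_mult_distrib)
    finally have "Q z (l t) \<le> sqrt (Q z z) * speed \<sigma> t"
      by (rule power2_le_imp_le) (use speed_nonneg Q_nonneg in simp)
    then show ?thesis using True by (simp add: \<phi>'_def)
  next
    case False
    then show ?thesis using speed_nonneg Q_nonneg unfolding \<phi>'_def by (simp only: if_False) simp
  qed
  have "\<phi> 1 - \<phi> 0 \<le> sqrt (Q z z) * curve_length \<sigma>" by (rule has_integral_le[OF int' int le])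
  moreover have "\<phi> 1 - \<phi> 0 = sqrt (Q z z) * sqrt (Q z z)"
    using Q_nonneg[of z] bilinear_rsub[OF Q_bilinear, of z "L (\<sigma> 1)" "L (\<sigma> 0)"] by (simp add: \<phi>_def z_def)
  ultimately have "sqrt (Q z z) * sqrt (Q z z) \<le> sqrt (Q z z) * curve_length \<sigma>" by simp
  then have "sqrt (Q z z) \<le> curve_length \<sigma>" if "sqrt (Q z z) > 0"
    unfolding mult_le_cancel_left_pos[OF that] .
  then show ?thesis
    using curve_length_nonneg[of \<sigma>] Q_nonneg[of z] by (cases "sqrt (Q z z) > 0") linarith+
qed

lemma E_joined: "\<exists>\<sigma>. piecewise_C1_curve \<sigma> \<and> \<sigma> 0 = p \<and> \<sigma> 1 = x"
proof -
  obtain e where e: "e > 0" "geod_on (\<gamma> (L x)) {-e<..<1 + e}" using family by blast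
  have "piecewise_C1_curve (\<gamma> (L x))" by (rule geod_piecewise_C1[OF _ _ e(2)]) (use e(1) in auto)
  then show ?thesis using init(1) E_L[of x] by (auto simp: E_def)
qed

lemma speed_initial: "speed (\<gamma> u) 0 = sqrt (Q u u)"
proof -
  obtain S where S: "open S" "0 \<in> S" "geod_in c0 (\<gamma> u) S"
    using geod_near[of 0 c0 u] c0 init(1) by auto
  show ?thesis using speed_geod_in[OF c0(1) S(1,3,2)] by (simp add: init)
qed

lemma geodesic_speed:
  assumes "s \<in> {0..1}" "t \<in> {0..1}"
  shows "dist (\<gamma> u s) (\<gamma> u t) \<le> \<bar>t - s\<bar> * sqrt (Q u u)" "speed (\<gamma> u) t = sqrt (Q u u)"
proof -
  obtain e where e: "e > 0" "geod_on (\<gamma> u) {-e<..<1 + e}" using family by blast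
  have i: "s \<in> {-e<..<1 + e}" "t \<in> {-e<..<1 + e}" "0 \<in> {-e<..<1 + e}" using assms e(1) by auto
  show sp: "speed (\<gamma> u) t = sqrt (Q u u)"
    using speed_constant[OF _ _ e(2) i(2,3)] speed_initial by simp
  have "speed (\<gamma> u) s = sqrt (Q u u)"
    using speed_constant[OF _ _ e(2) i(1,3)] speed_initial by simp
  then show "dist (\<gamma> u s) (\<gamma> u t) \<le> \<bar>t - s\<bar> * sqrt (Q u u)"
    using geod_dist_le[OF _ _ i(1,2) e(2)] by simp
qed

end

context hadamard_space begin

lemma exp_family_exists:
  obtains c0 \<gamma> where "exp_family A g c0 p \<gamma>"
proof -
  obtain c0 where c0: "c0 \<in> A" "p \<in> chart_dom c0" by (rule chart_exists)
  have "\<exists>\<gamma>. (\<exists>e>0. geod_on \<gamma> {-e<..<1 + e}) \<and> \<gamma> 0 = p \<and> vel c0 \<gamma> 0 = u" for u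
  proof -
    obtain e \<gamma> where "e > 0" "geod_on \<gamma> {-e<..<1 + e}" "\<gamma> 0 = chart_inv c0 (chart_coord c0 p)" "vel c0 \<gamma> 0 = u"
      by (rule geodesically_complete[OF c0(1) chart_coord_in[OF c0(2)]])
    then show ?thesis using chart_inv_coord[OF c0] by auto
  qed
  then obtain \<gamma> where "\<And>u. (\<exists>e>0. geod_on (\<gamma> u) {-e<..<1 + e}) \<and> \<gamma> u 0 = p \<and> vel c0 (\<gamma> u) 0 = u" by metis
  then have "exp_family A g c0 p \<gamma>" using c0 by unfold_locales auto
  then show thesis by (rule that)
qed

text \<open>Surjectivity of the exponential map at \<open>x\<close> guarantees that some admissible
  curve joins the points, so that the infimum in \<open>riemannian_dist\<close> is not taken over
  the empty set.\<close>

lemma dist_ge: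
  assumes "\<And>\<sigma>. piecewise_C1_curve \<sigma> \<Longrightarrow> \<sigma> 0 = x \<Longrightarrow> \<sigma> 1 = y \<Longrightarrow> d \<le> curve_length \<sigma>"
  shows "d \<le> dist x y"
proof -
  obtain c0 \<gamma> where "exp_family A g c0 x \<gamma>" by (rule exp_family_exists)
  then have "{\<sigma>. piecewise_C1_curve \<sigma> \<and> \<sigma> 0 = x \<and> \<sigma> 1 = y} \<noteq> {}" using exp_family.E_joined by blast
  then show ?thesis
    unfolding dist_riemannian riemannian_dist_def using assms by (intro cINF_greatest) auto
qed

end

context exp_family begin

lemma L_dist: "Q (L x - L y) (L x - L y) \<le> (dist x y)\<^sup>2"
proof -
  have "sqrt (Q (L x - L y) (L x - L y)) \<le> dist y x"
    by (rule dist_ge) (use curve_length_lower in auto)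
  then have "(sqrt (Q (L x - L y) (L x - L y)))\<^sup>2 \<le> (dist y x)\<^sup>2" using Q_nonneg by (intro power_mono) auto
  then show ?thesis using Q_nonneg by (simp add: dist_commute)
qed

lemma E_0: "E 0 = p" and L_base: "L p = 0"
proof -
  have "dist (\<gamma> 0 0) (\<gamma> 0 1) \<le> 0"
    using geodesic_speed(1)[of 0 1 0] bilinear_lzero[OF Q_bilinear] by simp
  then show "E 0 = p" by (simp add: E_def init)
  then show "L p = 0" using L_E by metis
qed

text \<open>The radial geodesic has length \<open>sqrt (Q (L x) (L x))\<close>, and
  \<open>L_dist\<close> shows that the distance is not smaller.\<close>

lemma dist_radial: "(dist p x)\<^sup>2 = Q (L x) (L x)"
proof (rule antisym)
  have "dist (\<gamma> (L x) 0) (\<gamma> (L x) 1) \<le> sqrt (Q (L x) (L x))" using geodesic_speed(1)[of 0 1 "L x"] by simp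
  then have "dist p x \<le> sqrt (Q (L x) (L x))" using E_L[of x] by (simp add: E_def init)
  then have "(dist p x)\<^sup>2 \<le> (sqrt (Q (L x) (L x)))\<^sup>2" by (intro power_mono) auto
  then show "(dist p x)\<^sup>2 \<le> Q (L x) (L x)" using Q_nonneg by simp
  show "Q (L x) (L x) \<le> (dist p x)\<^sup>2" using L_dist[of x p] by (simp add: L_base dist_commute)
qed

lemma L_geodesic:
  assumes J: "open J" "convex J" "{0..1} \<subseteq> J" and \<sigma>: "geod_on \<sigma> J" "\<sigma> 0 = p" "vel c0 \<sigma> 0 = u"
  shows "L (\<sigma> 1) = u"
  using geodesic_determined[OF J \<sigma>, of 1] L_E[of u] by (simp add: E_def)

text \<open>The closed ball is the image under \<open>E\<close> of a solid ellipsoid in the tangent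
  space.\<close>

lemma compact_cball_base: "compact (cball p r)"
proof (cases "r \<ge> 0")
  case True
  interpret M0: C1_inner "chart_img c0" "g c0" using C1_metric[OF c0(1)] .
  have "{chart_coord c0 p} \<subseteq> chart_img c0" using base_img by simp
  then obtain m M' where m: "m > 0" "M' > 0" "\<And>x v. x \<in> {chart_coord c0 p} \<Longrightarrow> m * (norm v)\<^sup>2 \<le> g c0 x v v \<and> g c0 x v v \<le> M' * (norm v)\<^sup>2"
    using M0.norm_equiv[OF compact_sing] by metis
  let ?B = "{u. Q u u \<le> r\<^sup>2}"
  have "u \<in> cball 0 (sqrt (r\<^sup>2 / m))" if "u \<in> ?B" for u
  proof -
    have "m * (norm u)\<^sup>2 \<le> r\<^sup>2" using m(3)[of "chart_coord c0 p" u] that by simp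
    then have "(norm u)\<^sup>2 \<le> r\<^sup>2 / m" using m(1) by (simp add: field_simps)
    then show ?thesis by (simp add: real_le_rsqrt)
  qed
  then have "bounded ?B" by (meson bounded_cball bounded_subset subsetI)
  moreover have "closed ?B"
  proof (rule closed_Collect_le)
    show "continuous_on UNIV (\<lambda>u. Q u u)"
      by (rule M0.continuous_joint[of UNIV "\<lambda>_. chart_coord c0 p"]) (use base_img in \<open>auto intro!: continuous_intros\<close>)
  qed (rule continuous_on_const)
  ultimately have "compact (E ` ?B)"
    by (intro compact_continuous_image continuous_on_subset[OF E_continuous]) (auto simp: compact_eq_bounded_closed)
  moreover have "E ` ?B = cball p r"
  proof (intro set_eqI iffI)
    fix x assume "x \<in> E ` ?B"
    then have "(dist p x)\<^sup>2 \<le> r\<^sup>2" using dist_radial L_E by auto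
    then show "x \<in> cball p r" using True by (simp add: power2_le_iff_abs_le)
  next
    fix x assume "x \<in> cball p r"
    then have "Q (L x) (L x) \<le> r\<^sup>2" using dist_radial[of x] by (metis mem_cball power_mono zero_le_dist)
    then show "x \<in> E ` ?B" using E_L[of x] by (intro image_eqI[of _ _ "L x"]) auto
  qed
  ultimately show ?thesis by simp
qed simp

end

text \<open>\<open>CAT(0)\<close> in the form of the Bruhat--Tits inequality.\<close>

definition cat0_geodesic :: "(real \<Rightarrow> 'a::metric_space) \<Rightarrow> 'a \<Rightarrow> 'a \<Rightarrow> bool" where
  "cat0_geodesic c x y \<longleftrightarrow> c 0 = x \<and> c 1 = y \<and>
     (\<forall>s\<in>{0..1}. \<forall>t\<in>{0..1}. dist (c s) (c t) = \<bar>t - s\<bar> * dist x y) \<and>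
     (\<forall>t\<in>{0..1}. \<forall>z. (dist z (c t))\<^sup>2 \<le> (1 - t) * (dist z x)\<^sup>2 + t * (dist z y)\<^sup>2 - t * (1 - t) * (dist x y)\<^sup>2)"

theorem (in hadamard_space) hadamard_proper: "compact (cball (x::'a) r)"
proof -
  obtain c0 \<gamma> where "exp_family A g c0 x \<gamma>" by (rule exp_family_exists)
  then show ?thesis by (rule exp_family.compact_cball_base)
qed

text \<open>In the tangent space at \<open>c t\<close> the points \<open>x\<close> and
  \<open>y\<close> lie on one line, at \<open>- t\<close> and \<open>1 - t\<close> times the
  velocity \<open>w\<close>. Stewart's identity holds there exactly; by \<open>dist_radial\<close>
  the distance from \<open>c t\<close> is preserved, and \<open>L_dist\<close> bounds the two others
  in the right direction.\<close>

theorem (in hadamard_space) hadamard_cat0: "\<exists>c. cat0_geodesic c (x::'a) y"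
proof -
  obtain c0 \<gamma> where "exp_family A g c0 x \<gamma>" by (rule exp_family_exists)
  then interpret X: exp_family A g c0 x \<gamma> .
  define v where "v = X.L y"
  define c where "c = \<gamma> v"
  have c01: "c 0 = x" "c 1 = y" using X.init(1) X.E_L[of y] by (simp_all add: c_def v_def X.E_def)
  have dxy: "dist x y = sqrt (X.Q v v)"
    using X.dist_radial[of y] by (metis real_sqrt_abs2 power2_eq_square real_sqrt_unique v_def zero_le_dist)
  have le: "dist (c s) (c t) \<le> \<bar>t - s\<bar> * dist x y" if "s \<in> {0..1}" "t \<in> {0..1}" for s t
    using X.geodesic_speed(1)[OF that, of v] by (simp add: dxy c_def)
  \<comment> \<open>The upper bounds for the three pieces of \<open>c\<close> add up to
    \<open>dist x y\<close>, so the triangle inequality forces equality for the middle one.\<close>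
  have dist_le: "dist (c s) (c t) = (t - s) * dist x y" if st: "s \<in> {0..1}" "t \<in> {0..1}" "s \<le> t" for s t
  proof (rule antisym)
    show "dist (c s) (c t) \<le> (t - s) * dist x y" using le[OF st(1,2)] st(3) by simp
    have "dist x y \<le> dist x (c s) + dist (c s) (c t) + dist (c t) y"
      using dist_triangle[of x y "c s"] dist_triangle[of "c s" y "c t"] by linarith
    also have "dist x (c s) \<le> s * dist x y" using le[of 0 s] st c01 by simp
    also have "dist (c t) y \<le> (1 - t) * dist x y" using le[of t 1] st c01 by simp
    finally show "(t - s) * dist x y \<le> dist (c s) (c t)" by (simp add: algebra_simps)
  qed
  have dist_eq: "dist (c s) (c t) = \<bar>t - s\<bar> * dist x y" if st: "s \<in> {0..1}" "t \<in> {0..1}" for s t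
    using dist_le[OF st] dist_le[OF st(2,1)] by (cases "s \<le> t") (auto simp: dist_commute)
  have cn: "(dist z (c t))\<^sup>2 \<le> (1 - t) * (dist z x)\<^sup>2 + t * (dist z y)\<^sup>2 - t * (1 - t) * (dist x y)\<^sup>2"
    if t: "t \<in> {0..1}" for t z
  proof -
    obtain c1 \<gamma>1 where "exp_family A g c1 (c t) \<gamma>1" by (rule exp_family_exists)
    then interpret Y: exp_family A g c1 "c t" \<gamma>1 .
    define w where "w = vel c1 c t"
    obtain e where e: "e > 0" "geod_on c {-e<..<1 + e}" using X.family[of v] by (auto simp: c_def)
    have t': "t \<in> {-e<..<1 + e}" using t e(1) by auto
    obtain S where S: "open S" "t \<in> S" "geod_in c1 c S"
      by (rule X.geod_near[OF t Y.c0[unfolded c_def], folded c_def])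
    \<comment> \<open>The same geodesic, restarted at \<open>c t\<close> and run with factor
      \<open>a\<close>, reaches \<open>c (a + t)\<close> at time \<open>1\<close>.\<close>
    have Lend: "Y.L (c (a + t)) = a *\<^sub>R w" if a: "a + t \<in> {0..1}" for a
    proof -
      let ?J = "(\<lambda>s. a * s + t) -` {-e<..<1 + e}" and ?\<sigma> = "\<lambda>s. c (a * s + t)"
      have "open ?J" by (intro open_vimage continuous_intros)
      moreover have "convex ?J"
      proof (rule convexI)
        fix x y u v :: real assume xy: "x \<in> ?J" "y \<in> ?J" and uv: "0 \<le> u" "0 \<le> v" "u + v = 1"
        have "u * (a * x + t) + v * (a * y + t) = a * (u * x + v * y) + (u + v) * t" by (simp add: algebra_simps)
        then have "a * (u * x + v * y) + t = u * (a * x + t) + v * (a * y + t)" using uv(3) by simp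
        then show "u *\<^sub>R x + v *\<^sub>R y \<in> ?J"
          using convexD[OF convex_real_interval(8) xy[unfolded vimage_eq] uv] by simp
      qed
      moreover have "{0..1} \<subseteq> ?J"
      proof
        fix s :: real assume s: "s \<in> {0..1}"
        have "a * s + t = (1 - s) * t + s * (a + t)" by (simp add: algebra_simps)
        moreover have "(1 - s) * t + s * (a + t) \<in> {0..1}"
          using convexD[OF convex_real_interval(5)[of 0 1] t a, of "1 - s" s] s by simp
        ultimately show "s \<in> ?J" using e(1) by auto
      qed
      moreover have "geod_on ?\<sigma> ?J" by (rule geod_on_affine[OF e(2)]) (use \<open>open ?J\<close> in auto)
      moreover have "?\<sigma> 0 = c t" by simp
      moreover have "vel c1 ?\<sigma> 0 = a *\<^sub>R w"
        using vel_affine[where c=c1 and \<gamma>=c and a=a and s=0 and b=t] geod_inD(2)[OF S(3,2)] by (simp add: w_def)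
      ultimately have "Y.L (?\<sigma> 1) = a *\<^sub>R w" by (rule Y.L_geodesic)
      then show ?thesis by simp
    qed
    have Lx: "Y.L x = (- t) *\<^sub>R w" and Ly: "Y.L y = (1 - t) *\<^sub>R w"
      using Lend[of "-t"] Lend[of "1 - t"] c01 by simp_all
    have "speed c t = sqrt (Y.Q w w)" using speed_geod_in[OF Y.c0(1) S(1,3,2)] by (simp add: w_def)
    moreover have "speed c t = dist x y" using X.geodesic_speed(2)[of 0 t v] t by (simp add: dxy c_def)
    ultimately have Qw: "Y.Q w w = (dist x y)\<^sup>2" using Y.Q_nonneg by (metis real_sqrt_pow2)
    note b = Y.Q_bilinear
    let ?z = "Y.L z"
    have Q_line: "Y.Q (?z - k *\<^sub>R w) (?z - k *\<^sub>R w) = Y.Q ?z ?z - 2 * k * Y.Q ?z w + k\<^sup>2 * Y.Q w w" for k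
      using Y.Q_sym[of w ?z]
      by (simp add: bilinear_lsub[OF b] bilinear_rsub[OF b] bilinear_lmul[OF b] bilinear_rmul[OF b] power2_eq_square algebra_simps)
    have 1: "Y.Q ?z ?z + 2 * t * Y.Q ?z w + t\<^sup>2 * Y.Q w w \<le> (dist z x)\<^sup>2"
      using Y.L_dist[of z x] by (simp only: Lx Q_line) simp
    have 2: "Y.Q ?z ?z - 2 * (1 - t) * Y.Q ?z w + (1 - t)\<^sup>2 * Y.Q w w \<le> (dist z y)\<^sup>2"
      using Y.L_dist[of z y] by (simp only: Ly Q_line)
    have "(dist z (c t))\<^sup>2 = Y.Q ?z ?z" using Y.dist_radial[of z] by (simp add: dist_commute)
    also have "\<dots> = (1 - t) * (Y.Q ?z ?z + 2 * t * Y.Q ?z w + t\<^sup>2 * Y.Q w w)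
        + t * (Y.Q ?z ?z - 2 * (1 - t) * Y.Q ?z w + (1 - t)\<^sup>2 * Y.Q w w) - t * (1 - t) * Y.Q w w"
      by (simp add: algebra_simps power2_eq_square)
    also have "\<dots> \<le> (1 - t) * (dist z x)\<^sup>2 + t * (dist z y)\<^sup>2 - t * (1 - t) * Y.Q w w"
      using 1 2 t by (intro diff_right_mono add_mono mult_left_mono) auto
    finally show ?thesis by (simp add: Qw)
  qed
  show ?thesis unfolding cat0_geodesic_def using c01 dist_eq cn by blast
qed

section \<open>Rays and Busemann functions\<close>

text \<open>Makes one theory of Busemann functions applicable both to \<open>dist\<close> on the
  space and to \<open>quotient_dist\<close> on orbits.\<close>

locale pseudometric_on =
  fixes M :: "'p set" and d :: "'p \<Rightarrow> 'p \<Rightarrow> real"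
  assumes d_sym: "x \<in> M \<Longrightarrow> y \<in> M \<Longrightarrow> d x y = d y x"
    and d_triangle: "x \<in> M \<Longrightarrow> y \<in> M \<Longrightarrow> z \<in> M \<Longrightarrow> d x z \<le> d x y + d y z"

text \<open>The Busemann function normalized to vanish at the origin of the ray. As \<open>t - d (\<alpha> t) y\<close> is
  nondecreasing in \<open>t\<close>, the limit is a supremum.\<close>

definition busemann0 :: "('p \<Rightarrow> 'p \<Rightarrow> real) \<Rightarrow> (real \<Rightarrow> 'p) \<Rightarrow> 'p \<Rightarrow> real" where
  "busemann0 d \<alpha> y = (SUP t\<in>{0..}. t - d (\<alpha> t) y)"

lemma (in pseudometric_on) rayD:
  assumes "is_ray M d \<alpha>" "0 \<le> s" "0 \<le> t"
  shows "\<alpha> t \<in> M" "d (\<alpha> t) (\<alpha> s) = \<bar>t - s\<bar>"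
  using assms by (simp_all add: is_ray_def)

context pseudometric_on begin

lemma busemann0_mono:
  assumes \<alpha>: "is_ray M d \<alpha>" and y: "y \<in> M" and st: "0 \<le> s" "s \<le> t"
  shows "s - d (\<alpha> s) y \<le> t - d (\<alpha> t) y"
  using d_triangle[of "\<alpha> t" "\<alpha> s" y] rayD[OF \<alpha>, of s t] rayD[OF \<alpha>, of s s] st y by simp

lemma busemann0_bounded:
  assumes \<alpha>: "is_ray M d \<alpha>" and y: "y \<in> M" and t: "0 \<le> t"
  shows "t - d (\<alpha> t) y \<le> d y (\<alpha> 0)"
  using d_triangle[of "\<alpha> t" y "\<alpha> 0"] rayD[OF \<alpha>, of 0 t] rayD[OF \<alpha>, of 0 0] t y by simp

lemma busemann0_ge:
  assumes \<alpha>: "is_ray M d \<alpha>" and y: "y \<in> M" and t: "0 \<le> t"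
  shows "t - d (\<alpha> t) y \<le> busemann0 d \<alpha> y"
  unfolding busemann0_def
  by (rule cSUP_upper) (use t busemann0_bounded[OF \<alpha> y] in \<open>auto intro!: bdd_aboveI2\<close>)

lemma busemann0_le:
  assumes "\<And>t. 0 \<le> t \<Longrightarrow> t - d (\<alpha> t) y \<le> c"
  shows "busemann0 d \<alpha> y \<le> c"
  unfolding busemann0_def by (rule cSUP_least) (use assms in auto)

lemma busemann0_gtE:
  assumes "c < busemann0 d \<alpha> y"
  obtains t where "0 \<le> t" "c < t - d (\<alpha> t) y"
  using busemann0_le[of \<alpha> y c] assms by (meson not_le)

lemma busemann0_tendsto:
  assumes \<alpha>: "is_ray M d \<alpha>" and y: "y \<in> M"
  shows "((\<lambda>t. t - d (\<alpha> t) y) \<longlongrightarrow> busemann0 d \<alpha> y) at_top"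
proof (rule order_tendstoI)
  fix c assume "c < busemann0 d \<alpha> y"
  then obtain t where t: "0 \<le> t" "c < t - d (\<alpha> t) y" by (rule busemann0_gtE)
  show "\<forall>\<^sub>F s in at_top. c < s - d (\<alpha> s) y"
    using eventually_ge_at_top[of t]
  proof eventually_elim
    case (elim s)
    then show ?case using busemann0_mono[OF \<alpha> y t(1)] t(2) by fastforce
  qed
next
  fix c assume c: "busemann0 d \<alpha> y < c"
  show "\<forall>\<^sub>F s in at_top. s - d (\<alpha> s) y < c"
    using eventually_ge_at_top[of "0::real"] 
  proof eventually_elim
    case (elim s)
    then show ?case using busemann0_ge[OF \<alpha> y, of s] c by simp
  qed
qed

lemma busemann0_on_ray:
  assumes \<alpha>: "is_ray M d \<alpha>" and t: "0 \<le> t"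
  shows "busemann0 d \<alpha> (\<alpha> t) = t"
proof (rule antisym)
  show "busemann0 d \<alpha> (\<alpha> t) \<le> t" by (rule busemann0_le) (use rayD(2)[OF \<alpha> t] in auto)
  show "t \<le> busemann0 d \<alpha> (\<alpha> t)" using busemann0_ge[OF \<alpha> rayD(1)[OF \<alpha> t t] t] rayD(2)[OF \<alpha> t t] by simp
qed

lemma busemann0_lipschitz:
  assumes \<alpha>: "is_ray M d \<alpha>" and xy: "x \<in> M" "y \<in> M"
  shows "busemann0 d \<alpha> y \<le> busemann0 d \<alpha> x + d x y"
proof (rule busemann0_le)
  fix t :: real assume t: "0 \<le> t"
  show "t - d (\<alpha> t) y \<le> busemann0 d \<alpha> x + d x y"
    using busemann0_ge[OF \<alpha> xy(1) t] d_triangle[of "\<alpha> t" y x] d_sym[of x y] rayD(1)[OF \<alpha> t t] xy by simp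
qed

lemma busemann_tendsto:
  assumes \<alpha>: "is_ray M d \<alpha>" and xy: "x \<in> M" "y \<in> M"
  shows "((\<lambda>t. d x (\<alpha> t) - d (\<alpha> t) y) \<longlongrightarrow> busemann0 d \<alpha> y - busemann0 d \<alpha> x) at_top"
proof (rule Lim_transform_eventually[OF tendsto_diff[OF busemann0_tendsto[OF \<alpha> xy(2)] busemann0_tendsto[OF \<alpha> xy(1)]]])
  show "\<forall>\<^sub>F t in at_top. t - d (\<alpha> t) y - (t - d (\<alpha> t) x) = d x (\<alpha> t) - d (\<alpha> t) y"
    using eventually_ge_at_top[of "0::real"]
  proof eventually_elim
    case (elim t)
    then show ?case using d_sym[of x "\<alpha> t"] rayD(1)[OF \<alpha>, of t t] xy by simp
  qed
qed

lemma busemann_eq: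
  assumes "is_ray M d \<alpha>" "x \<in> M" "y \<in> M"
  shows "busemann d \<alpha> x y = busemann0 d \<alpha> y - busemann0 d \<alpha> x"
  unfolding busemann_def by (rule tendsto_Lim[OF trivial_limit_at_top_linorder busemann_tendsto[OF assms]])

end

interpretation dist: pseudometric_on UNIV "dist :: 'a::metric_space \<Rightarrow> 'a \<Rightarrow> real"
  by unfold_locales (simp_all add: dist_commute dist_triangle)

section \<open>Proper CAT(0) spaces\<close>

locale proper_cat0 =
  fixes geodesic :: "'a::metric_space \<Rightarrow> 'a \<Rightarrow> real \<Rightarrow> 'a"
  assumes cat0: "cat0_geodesic (geodesic x y) x y"
    and proper: "compact (cball (x::'a) r)"
begin

lemma geodesic_ends [simp]: "geodesic x y 0 = x" "geodesic x y 1 = y"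
  using cat0[of x y] by (simp_all add: cat0_geodesic_def)

lemma geodesic_dist:
  assumes "0 \<le> s" "s \<le> 1" "0 \<le> t" "t \<le> 1"
  shows "dist (geodesic x y s) (geodesic x y t) = \<bar>t - s\<bar> * dist x y"
  using cat0[of x y] assms by (simp add: cat0_geodesic_def)

lemma geodesic_dist_ends:
  assumes "0 \<le> t" "t \<le> 1"
  shows "dist x (geodesic x y t) = t * dist x y" "dist (geodesic x y t) y = (1 - t) * dist x y"
  using geodesic_dist[of 0 t x y] geodesic_dist[of t 1 x y] assms by simp_all

lemma bruhat_tits:
  assumes "0 \<le> t" "t \<le> 1"
  shows "(dist z (geodesic x y t))\<^sup>2 \<le> (1 - t) * (dist z x)\<^sup>2 + t * (dist z y)\<^sup>2 - t * (1 - t) * (dist x y)\<^sup>2"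
  using cat0[of x y] assms by (simp add: cat0_geodesic_def)

text \<open>For such a point \<open>m\<close> the right side of the Bruhat-Tits inequality with
  \<open>z = m\<close> vanishes.\<close>

lemma geodesic_unique:
  assumes t: "0 \<le> t" "t \<le> 1" and m: "dist x m = t * dist x y" "dist m y = (1 - t) * dist x y"
  shows "m = geodesic x y t"
proof -
  have "(dist m (geodesic x y t))\<^sup>2 \<le> (1 - t) * (dist m x)\<^sup>2 + t * (dist m y)\<^sup>2 - t * (1 - t) * (dist x y)\<^sup>2"
    by (rule bruhat_tits[OF t])
  also have "\<dots> = 0" unfolding dist_commute[of m x] m by (simp add: power2_eq_square algebra_simps)
  finally show ?thesis by simp
qed

lemma geodesic_reverse:
  assumes "0 \<le> t" "t \<le> 1"
  shows "geodesic x y t = geodesic y x (1 - t)"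
  using assms geodesic_dist_ends[OF assms, of x y] by (intro geodesic_unique) (simp_all add: dist_commute)

text \<open>The Bruhat-Tits inequality twice: for \<open>y\<close> and a point of
  \<open>[p, x]\<close>, then for that point and a point of \<open>[p, y]\<close>. In the Euclidean
  plane both are equalities.\<close>

lemma hinge:
  assumes s: "0 \<le> s" "s \<le> 1"
  shows "dist (geodesic p x s) (geodesic p y s) \<le> s * dist x y"
proof -
  let ?X = "geodesic p x s"
  have 1: "(dist y ?X)\<^sup>2 \<le> (1 - s) * (dist y p)\<^sup>2 + s * (dist y x)\<^sup>2 - s * (1 - s) * (dist p x)\<^sup>2"
    by (rule bruhat_tits[OF s])
  have "(dist ?X (geodesic p y s))\<^sup>2 \<le> (1 - s) * (dist ?X p)\<^sup>2 + s * (dist ?X y)\<^sup>2 - s * (1 - s) * (dist p y)\<^sup>2"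
    by (rule bruhat_tits[OF s])
  also have "\<dots> \<le> (1 - s) * (dist ?X p)\<^sup>2 + s * ((1 - s) * (dist y p)\<^sup>2 + s * (dist y x)\<^sup>2 - s * (1 - s) * (dist p x)\<^sup>2)
      - s * (1 - s) * (dist p y)\<^sup>2"
    using mult_left_mono[OF 1 s(1)] by (simp add: dist_commute)
  also have "\<dots> = (s * dist x y)\<^sup>2"
    using geodesic_dist_ends(1)[OF s, of p x]
    by (simp add: dist_commute[of ?X p] dist_commute[of y] power2_eq_square algebra_simps)
  finally show ?thesis by (rule power2_le_imp_le) (use s in simp)
qed

text \<open>The Bruhat-Tits inequality is applied to \<open>y\<close> and \<open>q\<close> at the
  midpoint of the diagonal \<open>[x, p]\<close>, and the other diagonal is bounded by the path
  through that midpoint.\<close>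

lemma quadrilateral:
  "(dist (x::'a) p)\<^sup>2 + (dist y q)\<^sup>2 \<le> (dist x y)\<^sup>2 + (dist y p)\<^sup>2 + (dist p q)\<^sup>2 + (dist q x)\<^sup>2"
proof -
  let ?m = "geodesic x p (1/2)"
  have m: "(dist z ?m)\<^sup>2 \<le> (dist z x)\<^sup>2 / 2 + (dist z p)\<^sup>2 / 2 - (dist x p)\<^sup>2 / 4" for z
    using bruhat_tits[of "1/2" z x p] by simp
  have "(dist y q)\<^sup>2 \<le> (dist y ?m + dist q ?m)\<^sup>2"
    by (intro power_mono) (use dist_triangle2 in auto)
  also have "\<dots> \<le> 2 * (dist y ?m)\<^sup>2 + 2 * (dist q ?m)\<^sup>2"
    using sum_squares_bound[of "dist y ?m" "dist q ?m"] by (simp add: power2_sum)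
  finally show ?thesis using m[of y] m[of q] by (simp add: dist_commute)
qed

text \<open>By the quadrilateral inequality the differences of squared distances for \<open>\<alpha>\<close> and \<open>\<beta>\<close> differ by a
  bounded amount; division by \<open>2 t\<close> turns them into Busemann functions.\<close>

lemma asymptotic_busemann_le:
  assumes \<alpha>: "ray (\<alpha> :: real \<Rightarrow> 'a)" and \<beta>: "ray \<beta>" and as: "asymptotic \<alpha> \<beta>"
  shows "busemann0 dist \<alpha> y - busemann0 dist \<alpha> x \<le> busemann0 dist \<beta> y - busemann0 dist \<beta> x"
proof -
  obtain C where C: "\<And>t. 0 \<le> t \<Longrightarrow> dist (\<alpha> t) (\<beta> t) \<le> C" using as by (auto simp: asymptotic_def)
  have lim: "((\<lambda>t. ((dist x (\<gamma> t))\<^sup>2 - (dist y (\<gamma> t))\<^sup>2) / t) \<longlongrightarrow> (busemann0 dist \<gamma> y - busemann0 dist \<gamma> x) * 2) at_top"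
    if \<gamma>: "ray \<gamma>" for \<gamma>
  proof -
    \<comment> \<open>In the difference of squares the sum of the distances is
      \<open>2 * t - ?u t\<close>, and \<open>?u\<close> converges, so after division by
      \<open>t\<close> it contributes the factor \<open>2\<close>.\<close>
    let ?u = "\<lambda>t. (t - dist (\<gamma> t) x) + (t - dist (\<gamma> t) y)"
    have "((\<lambda>t. ?u t * inverse t) \<longlongrightarrow> (busemann0 dist \<gamma> x + busemann0 dist \<gamma> y) * 0) at_top"
      by (intro tendsto_mult tendsto_add dist.busemann0_tendsto[OF \<gamma>] tendsto_inverse_0_at_top filterlim_ident) auto
    then have "((\<lambda>t. (dist x (\<gamma> t) - dist (\<gamma> t) y) * (2 - ?u t * inverse t)) \<longlongrightarrow> (busemann0 dist \<gamma> y - busemann0 dist \<gamma> x) * (2 - 0)) at_top"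
      by (intro tendsto_mult tendsto_diff tendsto_const dist.busemann_tendsto[OF \<gamma>]) auto
    then have "((\<lambda>t. (dist x (\<gamma> t) - dist (\<gamma> t) y) * (2 - ?u t * inverse t)) \<longlongrightarrow> (busemann0 dist \<gamma> y - busemann0 dist \<gamma> x) * 2) at_top"
      by simp
    then show ?thesis
    proof (rule Lim_transform_eventually)
      show "\<forall>\<^sub>F t in at_top. (dist x (\<gamma> t) - dist (\<gamma> t) y) * (2 - ?u t * inverse t) = ((dist x (\<gamma> t))\<^sup>2 - (dist y (\<gamma> t))\<^sup>2) / t"
        using eventually_gt_at_top[of "0::real"]
        by eventually_elim (simp add: dist_commute field_simps power2_eq_square)
    qed
  qed
  have "((\<lambda>t. ((dist x y)\<^sup>2 + C\<^sup>2) * inverse t) \<longlongrightarrow> ((dist x y)\<^sup>2 + C\<^sup>2) * 0) at_top"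
    by (intro tendsto_mult tendsto_const tendsto_inverse_0_at_top filterlim_ident)
  moreover have "((\<lambda>t. ((dist x (\<alpha> t))\<^sup>2 - (dist y (\<alpha> t))\<^sup>2) / t - ((dist x (\<beta> t))\<^sup>2 - (dist y (\<beta> t))\<^sup>2) / t)
      \<longlongrightarrow> (busemann0 dist \<alpha> y - busemann0 dist \<alpha> x) * 2 - (busemann0 dist \<beta> y - busemann0 dist \<beta> x) * 2) at_top"
    by (rule tendsto_diff[OF lim[OF \<alpha>] lim[OF \<beta>]])
  moreover have "\<forall>\<^sub>F t in at_top. ((dist x (\<alpha> t))\<^sup>2 - (dist y (\<alpha> t))\<^sup>2) / t - ((dist x (\<beta> t))\<^sup>2 - (dist y (\<beta> t))\<^sup>2) / t
      \<le> ((dist x y)\<^sup>2 + C\<^sup>2) * inverse t"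
    using eventually_gt_at_top[of "0::real"]
  proof eventually_elim
    case (elim t)
    have "(dist (\<alpha> t) (\<beta> t))\<^sup>2 \<le> C\<^sup>2" using C[of t] elim by (intro power_mono) auto
    then have "(dist x (\<alpha> t))\<^sup>2 - (dist y (\<alpha> t))\<^sup>2 - ((dist x (\<beta> t))\<^sup>2 - (dist y (\<beta> t))\<^sup>2) \<le> (dist x y)\<^sup>2 + C\<^sup>2"
      using quadrilateral[of x "\<alpha> t" y "\<beta> t"] by (simp add: dist_commute)
    then have "((dist x (\<alpha> t))\<^sup>2 - (dist y (\<alpha> t))\<^sup>2 - ((dist x (\<beta> t))\<^sup>2 - (dist y (\<beta> t))\<^sup>2)) / t \<le> ((dist x y)\<^sup>2 + C\<^sup>2) / t"
      using elim by (intro divide_right_mono) auto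
    then show ?case by (simp only: diff_divide_distrib divide_inverse left_diff_distrib)
  qed
  ultimately have "(busemann0 dist \<alpha> y - busemann0 dist \<alpha> x) * 2 - (busemann0 dist \<beta> y - busemann0 dist \<beta> x) * 2 \<le> ((dist x y)\<^sup>2 + C\<^sup>2) * 0"
    by (rule tendsto_le[OF trivial_limit_at_top_linorder])
  then show ?thesis by simp
qed

lemma asymptotic_sym: "asymptotic \<alpha> \<beta> \<Longrightarrow> asymptotic \<beta> (\<alpha> :: real \<Rightarrow> 'a)"
  by (simp add: asymptotic_def dist_commute)

lemma asymptotic_busemann:
  assumes "ray (\<alpha> :: real \<Rightarrow> 'a)" "ray \<beta>" "asymptotic \<alpha> \<beta>"
  shows "busemann0 dist \<alpha> y - busemann0 dist \<alpha> x = busemann0 dist \<beta> y - busemann0 dist \<beta> x"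
  using asymptotic_busemann_le[OF assms] asymptotic_busemann_le[OF assms(2,1) asymptotic_sym[OF assms(3)]] by (rule antisym)

text \<open>The representative picked by \<open>SOME\<close> is asymptotic to
  \<open>\<alpha>\<close>, and increments of Busemann functions agree for asymptotic rays.\<close>

lemma busemann_at_infinity:
  assumes \<alpha>: "ray (\<alpha> :: real \<Rightarrow> 'a)"
  shows "busemann_at (point_at_infinity \<alpha>) x y = busemann0 dist \<alpha> y - busemann0 dist \<alpha> x"
proof -
  have "\<alpha> \<in> point_at_infinity \<alpha>" using \<alpha> by (auto simp: point_at_infinity_def asymptotic_def)
  then have "(SOME \<beta>. \<beta> \<in> point_at_infinity \<alpha>) \<in> point_at_infinity \<alpha>" by (rule someI[of "\<lambda>\<beta>. \<beta> \<in> point_at_infinity \<alpha>"])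
  then have s: "ray (SOME \<beta>. \<beta> \<in> point_at_infinity \<alpha>)" "asymptotic \<alpha> (SOME \<beta>. \<beta> \<in> point_at_infinity \<alpha>)"
    by (simp_all add: point_at_infinity_def)
  show ?thesis
    using asymptotic_busemann[OF \<alpha> s] dist.busemann_eq[OF s(1)] by (simp add: busemann_at_def)
qed

lemma ray_geodesic:
  assumes \<beta>: "ray (\<beta> :: real \<Rightarrow> 'a)" and r: "0 \<le> r" "r \<le> n" "0 < n"
  shows "\<beta> r = geodesic (\<beta> 0) (\<beta> n) (r / n)"
proof (rule geodesic_unique)
  show "dist (\<beta> 0) (\<beta> r) = r / n * dist (\<beta> 0) (\<beta> n)"
    using dist.rayD(2)[OF \<beta>, of 0 r] dist.rayD(2)[OF \<beta>, of 0 n] r by (simp add: dist_commute)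
  have d: "dist (\<beta> r) (\<beta> n) = n - r" "dist (\<beta> 0) (\<beta> n) = n"
    using dist.rayD(2)[OF \<beta>, of n r] dist.rayD(2)[OF \<beta>, of n 0] r by simp_all
  show "dist (\<beta> r) (\<beta> n) = (1 - r / n) * dist (\<beta> 0) (\<beta> n)" unfolding d using r by (simp add: field_simps)
qed (use r in auto)

lemma rays_convex:
  assumes \<beta>: "ray (\<beta> :: real \<Rightarrow> 'a)" and \<eta>: "ray \<eta>" and o: "\<beta> 0 = \<eta> 0" and r: "0 \<le> r" "r \<le> n" "0 < n"
  shows "dist (\<beta> r) (\<eta> r) \<le> r / n * dist (\<beta> n) (\<eta> n)"
  using hinge[of "r / n" "\<eta> 0" "\<beta> n" "\<eta> n"] ray_geodesic[OF \<beta> r] ray_geodesic[OF \<eta> r] o r by simp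

text \<open>By convexity the distance at \<open>r\<close> is at most \<open>r / n\<close> times a
  bounded quantity, for every large \<open>n\<close>.\<close>

lemma asymptotic_ray_unique:
  assumes \<beta>: "ray (\<beta> :: real \<Rightarrow> 'a)" and \<eta>: "ray \<eta>" and o: "\<beta> 0 = \<eta> 0" and as: "asymptotic \<beta> \<eta>" and r: "0 \<le> r"
  shows "\<beta> r = \<eta> r"
proof -
  obtain C where C: "\<And>t. 0 \<le> t \<Longrightarrow> dist (\<beta> t) (\<eta> t) \<le> C" using as by (auto simp: asymptotic_def)
  have "((\<lambda>n. r * C * inverse n) \<longlongrightarrow> r * C * 0) at_top"
    by (intro tendsto_mult tendsto_const tendsto_inverse_0_at_top filterlim_ident)
  moreover have "\<forall>\<^sub>F n in at_top. dist (\<beta> r) (\<eta> r) \<le> r * C * inverse n"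
    using eventually_gt_at_top[of r]
  proof eventually_elim
    case (elim n)
    have "dist (\<beta> r) (\<eta> r) \<le> r / n * dist (\<beta> n) (\<eta> n)" by (rule rays_convex[OF \<beta> \<eta> o]) (use elim r in auto)
    also have "\<dots> \<le> r / n * C" by (rule mult_left_mono) (use C elim r in auto)
    finally show ?case by (simp add: field_simps)
  qed
  ultimately have "dist (\<beta> r) (\<eta> r) \<le> r * C * 0"
    by (intro tendsto_le[OF trivial_limit_at_top_linorder _ tendsto_const])
  then show ?thesis by simp
qed

lemma Cauchy_convergent_UNIV:
  fixes X :: "nat \<Rightarrow> 'a"
  assumes "Cauchy X"
  shows "convergent X"
proof -
  have "bounded (range X)" using assms by (rule cauchy_imp_bounded)
  then obtain x r where "range X \<subseteq> cball x r" by (metis bounded_subset_cball)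
  moreover have "complete (cball x r)" by (rule compact_imp_complete[OF proper])
  ultimately show ?thesis using assms unfolding complete_def convergent_def by blast
qed

text \<open>The ray is the limit of the geodesics from \<open>o1\<close> to \<open>\<alpha> n\<close>.\<close>

lemma ray_from:
  assumes \<alpha>: "ray (\<alpha> :: real \<Rightarrow> 'a)"
  obtains \<eta> where "ray \<eta>" "\<eta> 0 = o1" "asymptotic \<alpha> \<eta>"
proof -
  define D where "D = dist o1 (\<alpha> 0)"
  define l where "l = (\<lambda>n::nat. dist o1 (\<alpha> (real n)))"
  define P where "P = (\<lambda>r n. geodesic o1 (\<alpha> (real n)) (r / l n))"
  have D: "D \<ge> 0" by (simp add: D_def)
  have ray_dist: "dist (\<alpha> (real n)) (\<alpha> (real m)) = \<bar>real n - real m\<bar>" for n m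
    using dist.rayD(2)[OF \<alpha>, of "real m" "real n"] by simp
  have l: "real n - D \<le> l n" "l n \<le> real n + D" for n
    using dist_triangle[of "\<alpha> (real n)" "\<alpha> 0" o1] dist_triangle[of o1 "\<alpha> (real n)" "\<alpha> 0"] ray_dist[of n 0]
    by (simp_all add: l_def D_def dist_commute)
  have P_dist: "dist (P r n) (P s n) = \<bar>r - s\<bar>" if "0 \<le> r" "r \<le> l n" "0 \<le> s" "s \<le> l n" "0 < l n" for r s n
  proof -
    have "dist (P r n) (P s n) = \<bar>s / l n - r / l n\<bar> * l n"
      unfolding P_def l_def[symmetric] by (subst geodesic_dist) (use that in \<open>auto simp: l_def\<close>)
    also have "\<dots> = \<bar>(s / l n - r / l n) * l n\<bar>" using that(5) by (simp add: abs_mult)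
    also have "(s / l n - r / l n) * l n = s - r" using that(5) by (simp add: field_simps)
    finally show ?thesis by (simp add: abs_minus_commute)
  qed
  \<comment> \<open>The point \<open>q\<close> of \<open>[o1, \<alpha> m]\<close> at distance \<open>l n\<close> from \<open>o1\<close> is within \<open>2 sqrt (D l n)\<close> of \<open>\<alpha> n\<close>,
    which is sublinear in \<open>l n\<close>.\<close>
  have close: "dist (P r n) (P r m) \<le> 2 * r * sqrt (D / l n)"
    if nm: "l n \<le> l m" and n: "2 * D \<le> l n" "0 < l n" and r: "0 \<le> r" "r \<le> l n" for n m r
  proof -
    define s where "s = l n / l m"
    define q where "q = geodesic o1 (\<alpha> (real m)) s"
    define k where "k = \<bar>real n - real m\<bar>"
    define h where "h = l m - l n"
    have s: "0 \<le> s" "s \<le> 1" using nm n by (auto simp: s_def)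
    have lm: "l m > 0" using nm n by simp
    have h0: "0 \<le> h" using nm by (simp add: h_def)
    have "l m \<le> l n + k"
      using dist_triangle[of o1 "\<alpha> (real m)" "\<alpha> (real n)"] ray_dist[of n m] by (simp add: l_def k_def)
    then have hk: "h \<le> k" by (simp add: h_def)
    have kh: "k \<le> h + 2 * D" using l[of n] l[of m] nm by (simp add: k_def h_def)
    have "(dist (\<alpha> (real n)) q)\<^sup>2 \<le> (1 - s) * (l n)\<^sup>2 + s * k\<^sup>2 - s * (1 - s) * (l m)\<^sup>2"
      using bruhat_tits[OF s, of "\<alpha> (real n)" o1 "\<alpha> (real m)"] ray_dist[of n m] by (simp add: q_def l_def k_def dist_commute)
    also have "\<dots> = s * (k\<^sup>2 - h\<^sup>2)"
    proof -
      have "l n = s * l m" using lm by (simp add: s_def)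
      then show ?thesis unfolding h_def by (simp add: power2_eq_square algebra_simps)
    qed
    also have "\<dots> = s * ((k - h) * (k + h))" by (simp add: power2_eq_square algebra_simps)
    \<comment> \<open>Both \<open>k\<close> and \<open>h\<close> measure the progress from
      \<open>\<alpha> n\<close> to \<open>\<alpha> m\<close>, along the ray and in distance from
      \<open>o1\<close>; by the triangle inequality they differ by at most
      \<open>2 * D\<close>.\<close>
    also have "\<dots> \<le> s * ((2 * D) * (2 * l m))"
    proof (intro mult_left_mono mult_mono)
      show "k + h \<le> 2 * l m" using kh n(1) D by (simp add: h_def)
    qed (use s hk kh h0 D in auto)
    also have "\<dots> = 4 * D * l n" using lm by (simp add: s_def)
    finally have "dist (\<alpha> (real n)) q \<le> sqrt (4 * D * l n)" by (rule real_le_rsqrt)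
    then have d: "dist (\<alpha> (real n)) q \<le> 2 * sqrt (D * l n)" by (simp add: real_sqrt_mult)
    have oq: "dist o1 q = l n"
      using geodesic_dist_ends(1)[OF s, of o1 "\<alpha> (real m)"] lm unfolding q_def l_def by (simp add: s_def l_def)
    have q: "P (l n) m = q" by (simp add: P_def q_def s_def)
    have "P r m = geodesic o1 q (r / l n)"
    proof (rule geodesic_unique)
      have P0: "P 0 m = o1" by (simp add: P_def)
      show "dist o1 (P r m) = r / l n * dist o1 q"
        using P_dist[of 0 m r] r nm lm n(2) unfolding P0 oq by simp
      show "dist (P r m) q = (1 - r / l n) * dist o1 q"
      proof -
        have d: "dist (P r m) q = l n - r" using P_dist[of r m "l n"] r nm lm n(2) unfolding q by simp
        show ?thesis unfolding d oq using n(2) by (simp add: field_simps)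
      qed
    qed (use r n in auto)
    then have "dist (P r n) (P r m) \<le> r / l n * dist (\<alpha> (real n)) q"
      using hinge[of "r / l n" o1 "\<alpha> (real n)" q] r n by (simp add: P_def)
    also have "\<dots> \<le> r / l n * (2 * sqrt (D * l n))" using d r n by (intro mult_left_mono) auto
    also have "D * l n = (D / l n) * (l n)\<^sup>2" using n(2) by (simp add: power2_eq_square)
    also have "r / l n * (2 * sqrt (D / l n * (l n)\<^sup>2)) = 2 * r * sqrt (D / l n)"
      using n(2) by (simp only: real_sqrt_mult real_sqrt_abs) simp
    finally show ?thesis .
  qed
  have "\<exists>L. P r \<longlonglongrightarrow> L" if r: "0 \<le> r" for r
  proof -
    have "Cauchy (P r)"
    proof (rule metric_CauchyI)
      fix e :: real assume e: "0 < e"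
      \<comment> \<open>Since \<open>l n \<ge> n - D\<close>, this ensures
        \<open>l n \<ge> 2 * D\<close>, \<open>l n \<ge> r\<close> and
        \<open>(2 * r + 1) * sqrt (D / l n) < e\<close> for \<open>n \<ge> N\<close>; with
        \<open>2 * r + 1\<close> in place of \<open>2 * r\<close> the division is possible also for
        \<open>r = 0\<close>.\<close>
      obtain N :: nat where N: "real N > r + 3 * D + 1 + D * (2 * r + 1)\<^sup>2 / e\<^sup>2" using reals_Archimedean2 by blast
      have cl: "dist (P r n) (P r m) < e" if nm: "n \<ge> N" "l n \<le> l m" for n m
      proof -
        have q0: "0 \<le> D * (2 * r + 1)\<^sup>2 / e\<^sup>2" using D by simp
        have ln: "r + 2 * D + 1 + D * (2 * r + 1)\<^sup>2 / e\<^sup>2 < l n" using l(1)[of n] N nm(1) by linarith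
        then have ln': "2 * D \<le> l n" "0 < l n" "r \<le> l n" "D * (2 * r + 1)\<^sup>2 / e\<^sup>2 < l n" using q0 r D by linarith+
        have "D * (2 * r + 1)\<^sup>2 < l n * e\<^sup>2" using ln'(4) e by (simp add: field_simps)
        then have "D / l n < (e / (2 * r + 1))\<^sup>2" using ln'(2) r by (simp add: field_simps power_divide)
        then have "sqrt (D / l n) < e / (2 * r + 1)" using e r by (intro real_less_lsqrt) auto
        then have "(2 * r + 1) * sqrt (D / l n) < e" using r by (simp add: field_simps)
        moreover have "0 \<le> sqrt (D / l n)" using D ln'(2) by (intro real_sqrt_ge_zero divide_nonneg_pos)
        ultimately have "2 * r * sqrt (D / l n) < e" by (simp only: distrib_right)
        then show ?thesis using close[OF nm(2) ln'(1,2) r ln'(3)] by simp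
      qed
      have "dist (P r m) (P r n) < e" if "m \<ge> N" "n \<ge> N" for m n
        using cl[OF that(1), of n] cl[OF that(2), of m] by (cases "l m \<le> l n") (auto simp: dist_commute)
      then show "\<exists>M. \<forall>m\<ge>M. \<forall>n\<ge>M. dist (P r m) (P r n) < e" by blast
    qed
    then show ?thesis using Cauchy_convergent_UNIV unfolding convergent_def by blast
  qed
  then obtain \<eta> where \<eta>: "\<And>r. 0 \<le> r \<Longrightarrow> P r \<longlonglongrightarrow> \<eta> r" by metis
  have large: "\<forall>\<^sub>F n in sequentially. r < l n \<and> r < real n" for r
  proof -
    obtain N :: nat where "real N > r + D" using reals_Archimedean2 by blast
    then show ?thesis using l(1) D by (intro eventually_sequentiallyI[of N]) (smt (verit) of_nat_le_iff)
  qed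
  have ray: "ray \<eta>"
    unfolding is_ray_def
  proof (intro conjI allI impI)
    fix s t :: real assume st: "0 \<le> s" "0 \<le> t"
    have "(\<lambda>n. dist (P t n) (P s n)) \<longlonglongrightarrow> dist (\<eta> t) (\<eta> s)" by (intro tendsto_dist \<eta> st)
    moreover have "(\<lambda>n. dist (P t n) (P s n)) \<longlonglongrightarrow> \<bar>t - s\<bar>"
      by (rule tendsto_eventually, rule eventually_mono[OF large[of "max s t"]], rule P_dist) (use st in auto)
    ultimately show "dist (\<eta> t) (\<eta> s) = \<bar>t - s\<bar>" by (rule LIMSEQ_unique)
  qed simp
  have "P 0 \<longlonglongrightarrow> o1" by (simp add: P_def)
  then have "\<eta> 0 = o1" using \<eta>[of 0] LIMSEQ_unique by blast
  have "dist (\<alpha> r) (\<eta> r) \<le> 2 * D" if r: "0 \<le> r" for r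
  proof -
    have "(\<lambda>n. dist (\<alpha> r) (P r n)) \<longlonglongrightarrow> dist (\<alpha> r) (\<eta> r)" by (intro tendsto_dist tendsto_const \<eta> r)
    moreover have "\<forall>\<^sub>F n in sequentially. dist (\<alpha> r) (P r n) \<le> 2 * D"
      using large[of r]
    proof eventually_elim
      case (elim n)
      \<comment> \<open>Comparison from the common end \<open>\<alpha> n\<close>: proportional
        points on the segments to \<open>\<alpha> 0\<close> and to \<open>o1\<close> are at distance
        at most \<open>D\<close>, and passing from the proportional to the arc length parameter
        costs at most another \<open>D\<close>.\<close>
      let ?s = "r / real n"
      have s: "0 \<le> ?s" "?s \<le> 1" using elim r by auto
      have ln: "0 < l n" and n: "0 < real n" using elim r by auto
      have "\<alpha> r = geodesic (\<alpha> 0) (\<alpha> (real n)) ?s" by (rule ray_geodesic[OF \<alpha> r]) (use elim r in auto)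
      then have "\<alpha> r = geodesic (\<alpha> (real n)) (\<alpha> 0) (1 - ?s)" using geodesic_reverse[OF s] by simp
      moreover have "P (l n * ?s) n = geodesic (\<alpha> (real n)) o1 (1 - ?s)"
        using geodesic_reverse[OF s, of o1 "\<alpha> (real n)"] ln by (simp add: P_def)
      ultimately have "dist (\<alpha> r) (P (l n * ?s) n) \<le> (1 - ?s) * D"
        using hinge[of "1 - ?s" "\<alpha> (real n)" "\<alpha> 0" o1] s by (simp add: D_def dist_commute)
      also have "\<dots> \<le> D" using s D by (simp add: mult_left_le_one_le)
      finally have 1: "dist (\<alpha> r) (P (l n * ?s) n) \<le> D" .
      have "dist (P (l n * ?s) n) (P r n) = \<bar>l n * ?s - r\<bar>"
        by (rule P_dist) (use s ln elim r mult_left_mono[of ?s 1 "l n"] in auto)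
      also have "l n * ?s - r = (l n - real n) * ?s" using n by (simp add: field_simps)
      also have "\<bar>\<dots>\<bar> \<le> D * 1" unfolding abs_mult by (rule mult_mono) (use s l[of n] D in auto)
      finally show ?case using 1 dist_triangle[of "\<alpha> r" "P r n" "P (l n * ?s) n"] by simp
    qed
    ultimately show ?thesis by (rule tendsto_upperbound) simp
  qed
  then have "asymptotic \<alpha> \<eta>" unfolding asymptotic_def by blast
  then show thesis using that ray \<open>\<eta> 0 = o1\<close> by blast
qed

end

section \<open>Regular quotients\<close>

lemma isometry_inv:
  assumes "isometry f"
  shows "inv f (f x) = x" "f (inv f x) = x" "inv (inv f) = f"
proof -
  have "inj f" using assms by (metis injI isometry_def dist_eq_0_iff)
  moreover have "surj f" using assms by (simp add: isometry_def)
  ultimately show "inv f (f x) = x" "f (inv f x) = x" "inv (inv f) = f"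
    by (simp_all add: surj_f_inv_f inv_inv_eq bij_def)
qed

lemma isometry_dist: "isometry f \<Longrightarrow> dist (f x) (f y) = dist x y"
  by (simp add: isometry_def)

lemma isometry_ray: "isometry f \<Longrightarrow> ray (f \<circ> \<alpha>) \<longleftrightarrow> ray \<alpha>"
  by (simp add: is_ray_def isometry_dist)

lemma isometry_asymptotic: "isometry f \<Longrightarrow> asymptotic (f \<circ> \<alpha>) (f \<circ> \<beta>) \<longleftrightarrow> asymptotic \<alpha> \<beta>"
  by (simp add: asymptotic_def isometry_dist)

lemma isometry_busemann: "isometry f \<Longrightarrow> busemann0 dist (f \<circ> \<alpha>) (f x) = busemann0 dist \<alpha> x"
  by (simp add: busemann0_def isometry_dist)

lemma boundary_action_point_at_infinity:
  assumes f: "isometry f"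
  shows "boundary_action f (point_at_infinity \<alpha>) = point_at_infinity (f \<circ> \<alpha>)"
proof
  show "boundary_action f (point_at_infinity \<alpha>) \<subseteq> point_at_infinity (f \<circ> \<alpha>)"
    using f by (auto simp: boundary_action_def point_at_infinity_def isometry_ray isometry_asymptotic)
  show "point_at_infinity (f \<circ> \<alpha>) \<subseteq> boundary_action f (point_at_infinity \<alpha>)"
  proof
    fix \<beta> assume \<beta>: "\<beta> \<in> point_at_infinity (f \<circ> \<alpha>)"
    have eq: "\<beta> = f \<circ> (inv f \<circ> \<beta>)" using isometry_inv(2)[OF f] by (simp add: fun_eq_iff)
    have "ray (f \<circ> (inv f \<circ> \<beta>))" "asymptotic (f \<circ> \<alpha>) (f \<circ> (inv f \<circ> \<beta>))"
      using \<beta> unfolding eq[symmetric] point_at_infinity_def by simp_all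
    then have "inv f \<circ> \<beta> \<in> point_at_infinity \<alpha>"
      by (simp add: point_at_infinity_def isometry_ray[OF f] isometry_asymptotic[OF f])
    then show "\<beta> \<in> boundary_action f (point_at_infinity \<alpha>)" unfolding boundary_action_def by (rule rev_image_eqI) (rule eq)
  qed
qed

text \<open>Finite intersections and unions of subbasic sets preserve the condition, by induction on
  the generation of open sets.\<close>

lemma limitin_topology_generated_by:
  assumes l: "l \<in> \<Union>\<S>" and ev: "\<And>U. U \<in> \<S> \<Longrightarrow> l \<in> U \<Longrightarrow> eventually (\<lambda>x. f x \<in> U) F"
  shows "limitin (topology_generated_by \<S>) f l F"
  unfolding limitin_def
proof (intro conjI allI impI)
  show "l \<in> topspace (topology_generated_by \<S>)" using l by simp
  fix U assume "openin (topology_generated_by \<S>) U \<and> l \<in> U"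
  then have "generate_topology_on \<S> U" "l \<in> U" by (simp_all add: openin_topology_generated_by_iff)
  then show "eventually (\<lambda>x. f x \<in> U) F"
  proof (induction rule: generate_topology_on.induct)
    case (Int a b)
    then show ?case by (auto intro: eventually_conj)
  next
    case (UN K)
    then obtain k where k: "k \<in> K" "l \<in> k" by blast
    show ?case using UN.IH[OF k] by (rule eventually_mono) (use k(1) in blast)
  qed (use ev in auto)
qed

text \<open>A repeated pigeonhole argument over finite nets, one index after the other. As a basic
  neighbourhood in the pointwise topology constrains finitely many points only, this takes the place
  of the theorem of Arzela and Ascoli.\<close>

lemma infinite_subset_close:
  fixes y :: "'i \<Rightarrow> 'b \<Rightarrow> 'a::metric_space"
  assumes "finite Y" "infinite S" "\<epsilon> > 0" and K: "\<And>i. i \<in> Y \<Longrightarrow> compact (K i) \<and> y i ` S \<subseteq> K i"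
  shows "\<exists>S'\<subseteq>S. infinite S' \<and> (\<forall>i\<in>Y. \<forall>a\<in>S'. \<forall>b\<in>S'. dist (y i a) (y i b) < \<epsilon>)"
  using assms(1) K
proof (induction Y)
  case empty
  show ?case using assms(2) by blast
next
  case (insert i Y)
  then obtain S' where S': "S' \<subseteq> S" "infinite S'" "\<forall>i\<in>Y. \<forall>a\<in>S'. \<forall>b\<in>S'. dist (y i a) (y i b) < \<epsilon>" by blast
  have "K i \<subseteq> (\<Union>x\<in>K i. ball x (\<epsilon> / 2))" using assms(3) by auto
  then obtain k where k: "finite k" "K i \<subseteq> (\<Union>x\<in>k. ball x (\<epsilon> / 2))"
    using compactE_image[of "K i" "K i" "\<lambda>x. ball x (\<epsilon> / 2)"] insert.prems[of i] by (metis insertI1 open_ball)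
  have "S' \<subseteq> (\<Union>z\<in>k. {a \<in> S'. y i a \<in> ball z (\<epsilon> / 2)})" using insert.prems[of i] S'(1) k(2) by blast
  then obtain z where z: "infinite {a \<in> S'. y i a \<in> ball z (\<epsilon> / 2)}"
    using S'(2) k(1) finite_subset by (metis (no_types, lifting) finite_UN)
  have "dist (y i a) (y i b) < \<epsilon>" if "y i a \<in> ball z (\<epsilon> / 2)" "y i b \<in> ball z (\<epsilon> / 2)" for a b
    using that dist_triangle_half_r[of z "y i a" \<epsilon> "y i b"] by simp
  then show ?case using z S' by (intro exI[of _ "{a \<in> S'. y i a \<in> ball z (\<epsilon> / 2)}"]) auto
qed

lemma uniform_balls:
  fixes X :: "'a::metric_space \<Rightarrow> 'a set"
  assumes "finite Y" "\<And>y. y \<in> Y \<Longrightarrow> open (X y) \<and> y \<in> X y"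
  shows "\<exists>\<epsilon>>0. \<forall>y\<in>Y. ball y \<epsilon> \<subseteq> X y"
  using assms
proof (induction Y)
  case empty
  show ?case by (intro exI[of _ 1]) simp
next
  case (insert y Y)
  then obtain \<epsilon> where \<epsilon>: "\<epsilon> > 0" "\<forall>y\<in>Y. ball y \<epsilon> \<subseteq> X y" by blast
  obtain \<delta> where \<delta>: "\<delta> > 0" "ball y \<delta> \<subseteq> X y" using insert.prems[of y] open_contains_ball by blast
  have "ball z (min \<epsilon> \<delta>) = ball z \<epsilon> \<inter> ball z \<delta>" for z by auto
  then have "\<forall>z\<in>insert y Y. ball z (min \<epsilon> \<delta>) \<subseteq> X z" using \<epsilon>(2) \<delta>(2) by blast
  then show ?case using \<epsilon>(1) \<delta>(1) by (intro exI[of _ "min \<epsilon> \<delta>"]) simp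
qed

locale regular_quotient = proper_cat0 geodesic
  for geodesic :: "'a::metric_space \<Rightarrow> 'a \<Rightarrow> real \<Rightarrow> 'a" +
  fixes G :: "('a \<Rightarrow> 'a) set"
  assumes regular: "regular_group G"
begin

lemma G_isometry: "f \<in> G \<Longrightarrow> isometry f" and G_id: "id \<in> G"
  and G_comp: "f \<in> G \<Longrightarrow> h \<in> G \<Longrightarrow> f \<circ> h \<in> G" and G_inv: "f \<in> G \<Longrightarrow> inv f \<in> G"
  using regular by (auto simp: regular_group_def isometry_group_def)

lemmas G_dist = isometry_dist[OF G_isometry]
lemmas G_inv_simps = isometry_inv[OF G_isometry]

text \<open>Discreteness isolates \<open>id\<close> by conditions at finitely many points.
  Properness confines the images of these points, so among infinitely many elements of bounded
  displacement two, \<open>f\<close> and \<open>h\<close>, are so close there that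
  \<open>inv f \<circ> h\<close> satisfies the conditions.\<close>

lemma finite_small_displacement: "finite {f \<in> G. dist x (f x) \<le> c}"
proof (rule ccontr)
  let ?S = "{f \<in> G. dist x (f x) \<le> c}"
  assume inf: "infinite ?S"
  have "discrete G" using regular by (simp add: regular_group_def)
  then obtain T where T: "open T" "T \<inter> G = {id}" using G_id by (auto simp: discrete_def isolated_in_def)
  then have "openin (product_topology (\<lambda>_. euclidean) UNIV) T" "id \<in> T" by (auto simp: open_fun_def)
  from product_topology_open_contains_basis[OF this]
  have "\<exists>X. id \<in> (\<Pi>\<^sub>E i\<in>UNIV. X i) \<and> (\<forall>i. open (X i)) \<and> finite {i. X i \<noteq> UNIV} \<and> (\<Pi>\<^sub>E i\<in>UNIV. X i) \<subseteq> T"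
    by (simp only: open_openin topspace_euclidean)
  then obtain X :: "'a \<Rightarrow> 'a set" where X:
    "id \<in> (\<Pi>\<^sub>E i\<in>UNIV. X i)" "\<And>i. open (X i)" "finite {i. X i \<noteq> UNIV}" "(\<Pi>\<^sub>E i\<in>UNIV. X i) \<subseteq> T" by blast
  have "i \<in> X i" for i using X(1) by (auto simp: PiE_def Pi_def)
  then obtain \<epsilon> where \<epsilon>: "\<epsilon> > 0" "\<forall>y\<in>{i. X i \<noteq> UNIV}. ball y \<epsilon> \<subseteq> X y"
    using uniform_balls[OF X(3)] X(2) by blast
  have im: "compact (cball y (2 * dist x y + c)) \<and> (\<lambda>f. f y) ` ?S \<subseteq> cball y (2 * dist x y + c)" for y
  proof (intro conjI proper image_subsetI)
    fix f assume "f \<in> ?S"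
    then have "f \<in> G" "dist x (f x) \<le> c" by auto
    then show "f y \<in> cball y (2 * dist x y + c)"
      using dist_triangle[of y "f y" x] dist_triangle[of x "f y" "f x"] G_dist[of f x y] by (simp add: dist_commute)
  qed
  obtain S' where S': "S' \<subseteq> ?S" "infinite S'" "\<forall>y\<in>{i. X i \<noteq> UNIV}. \<forall>f\<in>S'. \<forall>h\<in>S'. dist (f y) (h y) < \<epsilon>"
    using infinite_subset_close[OF X(3) inf \<epsilon>(1), where y="\<lambda>y f. f y", OF im] by blast
  obtain f where f: "f \<in> S'" using S'(2) by (metis ex_in_conv finite.emptyI)
  obtain h where h: "h \<in> S'" "h \<noteq> f" using S'(2) by (metis finite.emptyI finite_insert finite_subset insertCI subsetI)
  have fh: "f \<in> G" "h \<in> G" using f h S'(1) by auto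
  let ?k = "inv f \<circ> h"
  have "?k i \<in> X i" for i
  proof (cases "X i = UNIV")
    case False
    then have "dist (f i) (h i) < \<epsilon>" using S'(3) f h by blast
    then have "dist i (?k i) < \<epsilon>"
      using G_dist[OF fh(1), of i "?k i"] by (simp add: G_inv_simps[OF fh(1)])
    then have "?k i \<in> ball i \<epsilon>" by simp
    moreover have "ball i \<epsilon> \<subseteq> X i" using \<epsilon>(2) False by blast
    ultimately show ?thesis by (rule rev_subsetD)
  qed simp
  then have "?k \<in> T" using X(4) by (auto simp: PiE_def Pi_def)
  then have k: "?k = id" using T(2) G_comp[OF G_inv[OF fh(1)] fh(2)] by blast
  have "h z = f z" for z using fun_cong[OF k, of z] G_inv_simps(2)[OF fh(1), of "h z"] by simp
  then show False using h(2) by (simp add: fun_eq_iff)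
qed

text \<open>The powers of an element fixing \<open>x\<close> have displacement \<open>0\<close>
  there, so two of them coincide and the element has finite order.\<close>

lemma free_action:
  assumes f: "f \<in> G" "f x = x"
  shows "f = id"
proof -
  have pw: "f ^^ n \<in> G" "(f ^^ n) x = x" for n by (induction n) (use f G_id G_comp in auto)
  have "range (\<lambda>n. f ^^ n) \<subseteq> {h \<in> G. dist x (h x) \<le> 0}" using pw by auto
  then have "finite (range (\<lambda>n. f ^^ n))" using finite_small_displacement finite_subset by blast
  then have "\<not> inj (\<lambda>n. f ^^ n)" using finite_imageD infinite_UNIV_nat by blast
  then have "\<exists>i j. i < j \<and> f ^^ i = f ^^ j" by (metis injI linorder_neqE_nat)
  then obtain i j where ij: "i < j" "f ^^ i = f ^^ j" by blast
  have "(f ^^ (j - i)) z = z" for z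
  proof -
    have "(f ^^ i) z = (f ^^ i) ((f ^^ (j - i)) z)"
      using ij by (metis comp_apply funpow_add le_add_diff_inverse less_imp_le)
    then have "dist ((f ^^ i) z) ((f ^^ i) ((f ^^ (j - i)) z)) = 0" by simp
    then show ?thesis using G_dist[OF pw(1)[of i]] by simp
  qed
  then have "f ^^ (j - i) = id" by (simp add: fun_eq_iff)
  then show ?thesis using regular f(1) ij(1) by (metis regular_group_def torsion_free_def zero_less_diff)
qed

lemma displacement_gap: "\<exists>\<epsilon>>0. \<forall>f\<in>G. f \<noteq> id \<longrightarrow> \<epsilon> \<le> dist x (f x)"
proof -
  let ?F = "{f \<in> G. dist x (f x) \<le> 1} - {id}"
  \<comment> \<open>The entry \<open>1\<close> accounts for the elements of displacement greater
    than \<open>1\<close> and makes the set nonempty.\<close>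
  let ?D = "insert 1 ((\<lambda>f. dist x (f x)) ` ?F)"
  have fin: "finite ?D" using finite_small_displacement[of x 1] by simp
  have "0 < Min ?D" using fin free_action by (subst Min_gr_iff) (auto, metis free_action)
  moreover have "Min ?D \<le> dist x (f x)" if "f \<in> G" "f \<noteq> id" for f
  proof (cases "dist x (f x) \<le> 1")
    case True
    then show ?thesis using fin that by (intro Min_le) auto
  next
    case False
    then show ?thesis using Min_le[OF fin, of 1] by simp
  qed
  ultimately show ?thesis by blast
qed

lemma orbit_self: "x \<in> orbit G x"
  using G_id by (auto simp: orbit_def intro!: exI[of _ id])

lemma orbit_move: "f \<in> G \<Longrightarrow> orbit G (f x) = orbit G x"
proof (intro set_eqI iffI)
  fix z assume f: "f \<in> G"
  show "z \<in> orbit G x" if "z \<in> orbit G (f x)"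
    using that G_comp[OF _ f] by (auto simp: orbit_def) (metis comp_apply)
  show "z \<in> orbit G (f x)" if z: "z \<in> orbit G x"
  proof -
    obtain h where h: "h \<in> G" "z = h x" using z by (auto simp: orbit_def)
    have "z = (h \<circ> inv f) (f x)" using h(2) by (simp add: G_inv_simps[OF f])
    then show ?thesis using G_comp[OF h(1) G_inv[OF f]] unfolding orbit_def by blast
  qed
qed

lemma setdist_orbit_le: "f \<in> G \<Longrightarrow> setdist (orbit G x) (orbit G y) \<le> dist x (f y)"
  using setdist_le_dist[OF orbit_self[of x] orbit_self[of "f y"]] by (simp add: orbit_move)

text \<open>Since the group acts by isometries, one of the two points may be held fixed.\<close>

lemma setdist_orbit_ge:
  assumes "\<And>f. f \<in> G \<Longrightarrow> c \<le> dist x (f y)"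
  shows "c \<le> setdist (orbit G x) (orbit G y)"
proof (rule le_setdistI)
  show "orbit G x \<noteq> {}" "orbit G y \<noteq> {}" using orbit_self by blast+
  fix u v assume "u \<in> orbit G x" "v \<in> orbit G y"
  then obtain f h where fh: "f \<in> G" "h \<in> G" "u = f x" "v = h y" by (auto simp: orbit_def)
  have "dist u v = dist x ((inv f \<circ> h) y)"
    using G_dist[OF fh(1), of x "(inv f \<circ> h) y"] fh(3,4) by (simp add: G_inv_simps[OF fh(1)])
  then show "c \<le> dist u v" using assms[OF G_comp[OF G_inv[OF fh(1)] fh(2)]] by simp
qed

lemma setdist_orbit_lessE:
  assumes "setdist (orbit G x) (orbit G y) < c"
  obtains f where "f \<in> G" "dist x (f y) < c"
  using setdist_orbit_ge[of c x y] assms by (meson not_le)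

sublocale quotient: pseudometric_on "quotient_space G" quotient_dist
proof
  show "setdist X Y = setdist Y X" for X Y :: "'a set" by (rule setdist_sym)
  fix X Y Z assume "X \<in> quotient_space G" "Y \<in> quotient_space G" "Z \<in> quotient_space G"
  then obtain x y z where xyz: "X = orbit G x" "Y = orbit G y" "Z = orbit G z" by (auto simp: quotient_space_def)
  show "setdist X Z \<le> setdist X Y + setdist Y Z"
  proof (rule field_le_epsilon)
    fix e :: real assume e: "0 < e"
    obtain f where f: "f \<in> G" "dist x (f y) < setdist X Y + e / 2"
      using setdist_orbit_lessE[of x y "setdist X Y + e / 2"] e by (auto simp: xyz)
    obtain h where h: "h \<in> G" "dist y (h z) < setdist Y Z + e / 2"
      using setdist_orbit_lessE[of y z "setdist Y Z + e / 2"] e by (auto simp: xyz)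
    have "setdist X Z \<le> dist x (f (h z))" using setdist_orbit_le[OF G_comp[OF f(1) h(1)], of x z] by (simp add: xyz)
    also have "\<dots> \<le> dist x (f y) + dist y (h z)" using dist_triangle[of x "f (h z)" "f y"] G_dist[OF f(1)] by simp
    finally show "setdist X Z \<le> setdist X Y + setdist Y Z + e" using f(2) h(2) by simp
  qed
qed

text \<open>Distances along the lift are at least the orbit distances. Conversely, near each time
  the orbit distance is realized by the identity, as other elements displace the point by at least
  \<open>\<epsilon>\<close>; bisection turns the local upper bound into a global one.\<close>

lemma lift_is_ray:
  assumes \<alpha>: "is_ray (quotient_space G) quotient_dist \<alpha>" and lift: "is_lift G \<alpha>' \<alpha>"
  shows "ray \<alpha>'"
proof -
  have cont: "continuous_on {0..} \<alpha>'" and orb: "\<And>t. 0 \<le> t \<Longrightarrow> orbit G (\<alpha>' t) = \<alpha> t"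
    using lift by (auto simp: is_lift_def)
  have sd: "setdist (orbit G (\<alpha>' s)) (orbit G (\<alpha>' t)) = \<bar>s - t\<bar>" if "0 \<le> s" "0 \<le> t" for s t
    using quotient.rayD(2)[OF \<alpha> that(2,1)] that by (simp add: orb)
  have lower: "\<bar>s - t\<bar> \<le> dist (\<alpha>' s) (\<alpha>' t)" if "0 \<le> s" "0 \<le> t" for s t
    using setdist_orbit_le[OF G_id, of "\<alpha>' s" "\<alpha>' t"] sd[OF that] by simp
  have upper: "dist (\<alpha>' s) (\<alpha>' t) \<le> t - s" if st: "0 \<le> s" "s \<le> t" for s t
  proof -
    have trans: "0 \<le> a \<longrightarrow> dist (\<alpha>' a) (\<alpha>' c) \<le> c - a"
      if "0 \<le> a \<longrightarrow> dist (\<alpha>' a) (\<alpha>' b) \<le> b - a" "0 \<le> b \<longrightarrow> dist (\<alpha>' b) (\<alpha>' c) \<le> c - b" "a \<le> b" "b \<le> c" for a b c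
      using that dist_triangle[of "\<alpha>' a" "\<alpha>' c" "\<alpha>' b"] by auto
    have local: "\<exists>d>0. \<forall>a b. a \<le> u \<and> u \<le> b \<and> b - a < d \<longrightarrow> 0 \<le> a \<longrightarrow> dist (\<alpha>' a) (\<alpha>' b) \<le> b - a"
      if u: "s \<le> u" "u \<le> t" for u
    proof -
      obtain \<epsilon> where \<epsilon>: "\<epsilon> > 0" "\<And>f. f \<in> G \<Longrightarrow> f \<noteq> id \<Longrightarrow> \<epsilon> \<le> dist (\<alpha>' u) (f (\<alpha>' u))"
        using displacement_gap[of "\<alpha>' u"] by blast
      \<comment> \<open>When \<open>\<alpha>' a\<close> and \<open>\<alpha>' b\<close> are within
        \<open>\<epsilon> / 4\<close> of \<open>\<alpha>' u\<close>, a nontrivial \<open>f\<close>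
        puts \<open>f (\<alpha>' b)\<close> farther than \<open>\<epsilon> / 2\<close> from
        \<open>\<alpha>' a\<close>, while \<open>\<alpha>' b\<close> itself is closer than
        that.\<close>
      obtain d where d: "d > 0" "\<And>v. 0 \<le> v \<Longrightarrow> dist v u < d \<Longrightarrow> dist (\<alpha>' v) (\<alpha>' u) < \<epsilon> / 4"
        using cont[unfolded continuous_on_iff, rule_format, of u "\<epsilon> / 4"] \<epsilon>(1) st u by auto
      have "dist (\<alpha>' a) (\<alpha>' b) \<le> b - a" if ab: "0 \<le> a" "a \<le> u" "u \<le> b" "b - a < d" for a b
      proof -
        have near: "dist (\<alpha>' a) (\<alpha>' u) < \<epsilon> / 4" "dist (\<alpha>' b) (\<alpha>' u) < \<epsilon> / 4"
          using d(2)[of a] d(2)[of b] ab by (simp_all add: dist_real_def)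
        have "dist (\<alpha>' a) (\<alpha>' b) \<le> setdist (orbit G (\<alpha>' a)) (orbit G (\<alpha>' b))"
        proof (rule setdist_orbit_ge)
          fix f assume f: "f \<in> G"
          show "dist (\<alpha>' a) (\<alpha>' b) \<le> dist (\<alpha>' a) (f (\<alpha>' b))"
          proof (cases "f = id")
            case False
            have "\<epsilon> \<le> dist (\<alpha>' u) (f (\<alpha>' u))" by (rule \<epsilon>(2)[OF f False])
            also have "\<dots> \<le> dist (\<alpha>' a) (\<alpha>' u) + dist (\<alpha>' a) (f (\<alpha>' b)) + dist (\<alpha>' b) (\<alpha>' u)"
              using dist_triangle[of "\<alpha>' u" "f (\<alpha>' u)" "\<alpha>' a"] dist_triangle[of "\<alpha>' a" "f (\<alpha>' u)" "f (\<alpha>' b)"]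
                G_dist[OF f, of "\<alpha>' b" "\<alpha>' u"] by (simp add: dist_commute)
            finally show ?thesis using near dist_triangle2[of "\<alpha>' a" "\<alpha>' b" "\<alpha>' u"] by linarith
          qed simp
        qed
        then show ?thesis using sd[of a b] ab by simp
      qed
      then show ?thesis using d(1) by blast
    qed
    show ?thesis
      using Bolzano[OF st(2), of "\<lambda>a b. 0 \<le> a \<longrightarrow> dist (\<alpha>' a) (\<alpha>' b) \<le> b - a", OF trans local] st(1) by simp
  qed
  have "dist (\<alpha>' t) (\<alpha>' s) = \<bar>t - s\<bar>" if "0 \<le> s" "0 \<le> t" for s t
    using lower[OF that(2,1)] upper[of s t] upper[of t s] that by (cases "s \<le> t") (auto simp: dist_commute)
  then show ?thesis by (simp add: is_ray_def)
qed

end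

section \<open>Busemann functions of the quotient and the two implications\<close>

locale lifted_ray = regular_quotient geodesic G
  for geodesic :: "'a::metric_space \<Rightarrow> 'a \<Rightarrow> real \<Rightarrow> 'a" and G +
  fixes \<alpha> :: "real \<Rightarrow> 'a set" and \<alpha>' :: "real \<Rightarrow> 'a"
  assumes is_ray: "is_ray (quotient_space G) quotient_dist \<alpha>" and is_lift: "is_lift G \<alpha>' \<alpha>"
begin

lemma ray: "ray \<alpha>'"
  by (rule lift_is_ray[OF is_ray is_lift])

lemma orbit_ray: "0 \<le> t \<Longrightarrow> orbit G (\<alpha>' t) = \<alpha> t"
  using is_lift by (simp add: is_lift_def)

text \<open>Together with \<open>busemann_quotient_gtE\<close> this makes the quotient function the
  supremum over an orbit, in the form of an upper bound and of approximation from below.\<close>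

lemma busemann_quotient_ge: "f \<in> G \<Longrightarrow> busemann0 dist \<alpha>' (f x) \<le> busemann0 quotient_dist \<alpha> (orbit G x)"
proof (rule dist.busemann0_le)
  fix t :: real assume "f \<in> G" "0 \<le> t"
  moreover have "t - setdist (\<alpha> t) (orbit G x) \<le> busemann0 quotient_dist \<alpha> (orbit G x)"
    using \<open>0 \<le> t\<close> by (intro quotient.busemann0_ge[OF is_ray]) (auto simp: quotient_space_def)
  ultimately show "t - dist (\<alpha>' t) (f x) \<le> busemann0 quotient_dist \<alpha> (orbit G x)"
    using setdist_orbit_le[of f "\<alpha>' t" x] by (simp add: orbit_ray)
qed

lemma busemann_quotient_gtE:
  assumes "c < busemann0 quotient_dist \<alpha> (orbit G x)"
  obtains f where "f \<in> G" "c < busemann0 dist \<alpha>' (f x)"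
proof -
  obtain t where t: "0 \<le> t" "c < t - setdist (\<alpha> t) (orbit G x)" using quotient.busemann0_gtE[OF assms] by blast
  then obtain f where f: "f \<in> G" "dist (\<alpha>' t) (f x) < t - c"
    using setdist_orbit_lessE[of "\<alpha>' t" x "t - c"] by (auto simp: orbit_ray)
  have "c < busemann0 dist \<alpha>' (f x)" using dist.busemann0_ge[OF ray _ t(1), of "f x"] f(2) by simp
  then show thesis using that f(1) by blast
qed

lemma busemann_origin: "busemann0 dist \<alpha>' (\<alpha>' 0) = 0" "busemann0 quotient_dist \<alpha> (orbit G (\<alpha>' 0)) = 0"
  using dist.busemann0_on_ray[OF ray, of 0] quotient.busemann0_on_ray[OF is_ray, of 0] by (simp_all add: orbit_ray)

lemma horoball_eq: "horoball (point_at_infinity \<alpha>') (\<alpha>' 0) = {y. 0 \<le> busemann0 dist \<alpha>' y}"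
  by (simp add: horoball_def busemann_at_infinity[OF ray] busemann_origin)

text \<open>The Busemann function is 1-Lipschitz and nonnegative on the horoball. The horoball
  contains the origin; for an empty set \<open>infdist\<close> would be \<open>0\<close> by
  default.\<close>

lemma infdist_horoball_ge: "- busemann0 dist \<alpha>' z \<le> infdist z (horoball (point_at_infinity \<alpha>') (\<alpha>' 0))"
proof -
  have "\<alpha>' 0 \<in> {y. 0 \<le> busemann0 dist \<alpha>' y}" by (simp add: busemann_origin)
  then have ne: "{y. 0 \<le> busemann0 dist \<alpha>' y} \<noteq> {}" by blast
  show ?thesis
    unfolding horoball_eq infdist_notempty[OF ne]
  proof (rule cINF_greatest[OF ne])
    fix h assume "h \<in> {y. 0 \<le> busemann0 dist \<alpha>' y}"
    then show "- busemann0 dist \<alpha>' z \<le> dist z h" using dist.busemann0_lipschitz[OF ray, of z h] by simp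
  qed
qed

text \<open>Moving \<open>z\<close> along the segment to \<open>\<alpha>' t\<close> until its
  distance from \<open>\<alpha>' t\<close> is at most \<open>t\<close> makes the Busemann function
  nonnegative; for suitable \<open>t\<close> the distance travelled is less than
  \<open>e\<close>.\<close>

lemma infdist_horoball_le:
  assumes e: "0 < e" "- e < busemann0 dist \<alpha>' z"
  shows "infdist z (horoball (point_at_infinity \<alpha>') (\<alpha>' 0)) \<le> e"
proof -
  obtain t where t: "0 \<le> t" "- e < t - dist (\<alpha>' t) z" by (rule dist.busemann0_gtE[OF e(2)])
  let ?l = "dist z (\<alpha>' t)"
  obtain h where h: "0 \<le> t - dist (\<alpha>' t) h" "dist z h \<le> e"
  proof (cases "?l \<le> t")
    case True
    then show thesis using that[of z] e by (simp add: dist_commute)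
  next
    case False
    let ?s = "(?l - t) / ?l"
    have l: "?l > 0" using False t by linarith
    have s: "0 \<le> ?s" "?s \<le> 1" using False t(1) l by auto
    have "dist z (geodesic z (\<alpha>' t) ?s) = ?l - t" "dist (geodesic z (\<alpha>' t) ?s) (\<alpha>' t) = t"
      using geodesic_dist_ends[OF s, of z "\<alpha>' t"] l by (auto simp: diff_divide_distrib algebra_simps)
    then show thesis using that[of "geodesic z (\<alpha>' t) ?s"] t(2) by (simp add: dist_commute)
  qed
  have "0 \<le> busemann0 dist \<alpha>' h" using dist.busemann0_ge[OF ray _ t(1), of h] h(1) by simp
  then have "infdist z (horoball (point_at_infinity \<alpha>') (\<alpha>' 0)) \<le> dist z h"
    unfolding horoball_eq by (intro infdist_le) simp
  then show ?thesis using h(2) by simp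
qed

text \<open>At a finite time the expression for the Busemann function of \<open>\<beta>'\<close>
  involves a single point of the ray, which the cone topology approximates by a point of a translate
  of \<open>\<alpha>'^+\<close>; monotonicity in time then passes to the Busemann function of the
  translated ray. Its normalization at the origin is controlled by the horoball.\<close>

lemma busemann_le_of_limit:
  assumes \<beta>: "lifted_ray geodesic G \<beta> \<beta>'" and o: "\<beta>' 0 = \<alpha>' 0" and gs: "\<And>n. gs n \<in> G"
    and lim: "limitin (cone_topology (\<alpha>' 0)) (\<lambda>n. boundary_action (gs n) (point_at_infinity \<alpha>')) (point_at_infinity \<beta>') sequentially"
    and hor: "(\<lambda>n. infdist (inv (gs n) (\<alpha>' 0)) (horoball (point_at_infinity \<alpha>') (\<alpha>' 0))) \<longlonglongrightarrow> 0"
  shows "busemann0 quotient_dist \<beta> (orbit G y) \<le> busemann0 quotient_dist \<alpha> (orbit G y)"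
proof -
  interpret \<beta>: lifted_ray geodesic G \<beta> \<beta>' by (rule \<beta>)
  have upstairs: "busemann0 dist \<beta>' z \<le> busemann0 quotient_dist \<alpha> (orbit G z)" (is "_ \<le> ?c") for z
  proof (rule dist.busemann0_le, rule field_le_epsilon)
    fix t e :: real assume t: "0 \<le> t" and e: "0 < e"
    \<comment> \<open>\<open>t + 1\<close> because \<open>cone_topology\<close> only has positive radii\<close>
    let ?U = "{\<xi> \<in> visual_boundary. \<exists>\<eta>\<in>\<xi>. \<eta> 0 = \<alpha>' 0 \<and> dist (\<eta> (t + 1)) (\<beta>' (t + 1)) < e / 2}"
    have "openin (cone_topology (\<alpha>' 0)) ?U"
      unfolding cone_topology_def
      by (rule topology_generated_by_Basis, rule CollectI, rule exI[of _ \<beta>'], rule exI[of _ "t + 1"], rule exI[of _ "e / 2"])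
        (use \<beta>.ray o e t in simp)
    moreover have "point_at_infinity \<beta>' \<in> ?U"
      using \<beta>.ray o e by (auto simp: visual_boundary_def point_at_infinity_def asymptotic_def intro!: bexI[of _ \<beta>'])
    ultimately have "\<forall>\<^sub>F n in sequentially. boundary_action (gs n) (point_at_infinity \<alpha>') \<in> ?U"
      using lim unfolding limitin_def by blast
    moreover have "\<forall>\<^sub>F n in sequentially. infdist (inv (gs n) (\<alpha>' 0)) (horoball (point_at_infinity \<alpha>') (\<alpha>' 0)) < e / 2"
      by (rule order_tendstoD(2)[OF hor]) (use e in simp)
    ultimately have "\<forall>\<^sub>F n in sequentially. boundary_action (gs n) (point_at_infinity \<alpha>') \<in> ?U \<and>
        infdist (inv (gs n) (\<alpha>' 0)) (horoball (point_at_infinity \<alpha>') (\<alpha>' 0)) < e / 2" by (rule eventually_conj)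
    then obtain n where n: "boundary_action (gs n) (point_at_infinity \<alpha>') \<in> ?U"
      "infdist (inv (gs n) (\<alpha>' 0)) (horoball (point_at_infinity \<alpha>') (\<alpha>' 0)) < e / 2"
      using eventually_happens'[OF sequentially_bot] by blast
    note I = G_isometry[OF gs[of n]]
    \<comment> \<open>A representative of the class of \<open>\<alpha>'\<close> whose translate by
      \<open>gs n\<close> issues from the common origin.\<close>
    obtain \<zeta> where \<zeta>: "ray \<zeta>" "asymptotic \<alpha>' \<zeta>" "gs n (\<zeta> 0) = \<alpha>' 0" "dist (gs n (\<zeta> (t + 1))) (\<beta>' (t + 1)) < e / 2"
      using n(1) by (auto simp: boundary_action_def point_at_infinity_def)
    let ?h = "inv (gs n)"
    have \<zeta>0: "\<zeta> 0 = ?h (\<alpha>' 0)" using isometry_inv(1)[OF I, of "\<zeta> 0"] \<zeta>(3) by simp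
    have "t - dist (\<beta>' t) z \<le> t + 1 - dist (\<beta>' (t + 1)) z" by (rule dist.busemann0_mono[OF \<beta>.ray _ t]) auto
    also have "\<dots> \<le> t + 1 - dist (gs n (\<zeta> (t + 1))) z + e / 2"
      using dist_triangle[of "gs n (\<zeta> (t + 1))" z "\<beta>' (t + 1)"] \<zeta>(4) by simp
    also have "dist (gs n (\<zeta> (t + 1))) z = dist (\<zeta> (t + 1)) (?h z)"
      using isometry_dist[OF I, of "\<zeta> (t + 1)" "?h z"] by (simp add: isometry_inv[OF I])
    also have "t + 1 - dist (\<zeta> (t + 1)) (?h z) \<le> busemann0 dist \<zeta> (?h z)"
      using dist.busemann0_ge[OF \<zeta>(1), of "?h z" "t + 1"] t by simp
    also have "busemann0 dist \<zeta> (?h z) = busemann0 dist \<alpha>' (?h z) - busemann0 dist \<alpha>' (?h (\<alpha>' 0))"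
      using asymptotic_busemann[OF ray \<zeta>(1,2), of "?h z" "?h (\<alpha>' 0)"] dist.busemann0_on_ray[OF \<zeta>(1), of 0] by (simp add: \<zeta>0)
    finally have "t - dist (\<beta>' t) z \<le> busemann0 dist \<alpha>' (?h z) - busemann0 dist \<alpha>' (?h (\<alpha>' 0)) + e / 2" by simp
    moreover have "- busemann0 dist \<alpha>' (?h (\<alpha>' 0)) < e / 2" using infdist_horoball_ge[of "?h (\<alpha>' 0)"] n(2) by simp
    moreover have "busemann0 dist \<alpha>' (?h z) \<le> ?c" by (rule busemann_quotient_ge[OF G_inv[OF gs]])
    ultimately show "t - dist (\<beta>' t) z \<le> ?c + e" by linarith
  qed
  \<comment> \<open>The left side is a supremum over the orbit of \<open>y\<close>, and
    \<open>upstairs\<close> applies to each point of the orbit with the same right side.\<close>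
  show ?thesis
  proof (rule ccontr)
    assume "\<not> ?thesis"
    then obtain f where f: "f \<in> G" "busemann0 quotient_dist \<alpha> (orbit G y) < busemann0 dist \<beta>' (f y)"
      using \<beta>.busemann_quotient_gtE[of "busemann0 quotient_dist \<alpha> (orbit G y)" y] by (auto simp: not_le)
    then show False using upstairs[of "f y"] by (simp add: orbit_move)
  qed
qed

lemma limit_of_busemann_le:
  assumes \<beta>: "lifted_ray geodesic G \<beta> \<beta>'" and o: "\<beta>' 0 = \<alpha>' 0"
    and le: "\<And>y. busemann0 quotient_dist \<beta> (orbit G y) \<le> busemann0 quotient_dist \<alpha> (orbit G y)"
  obtains gs where "\<And>n. gs n \<in> G"
    "limitin (cone_topology (\<alpha>' 0)) (\<lambda>n. boundary_action (gs n) (point_at_infinity \<alpha>')) (point_at_infinity \<beta>') sequentially"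
    "(\<lambda>n. infdist (inv (gs n) (\<alpha>' 0)) (horoball (point_at_infinity \<alpha>') (\<alpha>' 0))) \<longlonglongrightarrow> 0"
proof -
  interpret \<beta>: lifted_ray geodesic G \<beta> \<beta>' by (rule \<beta>)
  \<comment> \<open>Shifted by one so that \<open>1 / N n\<close> is at most
    \<open>1\<close>.\<close>
  define N where "N = (\<lambda>n::nat. real n + 1)"
  have N: "1 \<le> N n" for n by (simp add: N_def)
  have "\<exists>k\<in>G. N n - 1 / N n < busemann0 dist \<alpha>' (k (\<beta>' (N n)))" for n
  proof -
    have "0 < 1 / N n" using N[of n] by simp
    moreover have "busemann0 quotient_dist \<beta> (orbit G (\<beta>' (N n))) = N n"
      using quotient.busemann0_on_ray[OF \<beta>.is_ray, of "N n"] \<beta>.orbit_ray[of "N n"] N[of n] by simp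
    ultimately have "N n - 1 / N n < busemann0 quotient_dist \<alpha> (orbit G (\<beta>' (N n)))" using le[of "\<beta>' (N n)"] by linarith
    then show ?thesis using busemann_quotient_gtE by blast
  qed
  then obtain k where k: "\<And>n. k n \<in> G" "\<And>n. N n - 1 / N n < busemann0 dist \<alpha>' (k n (\<beta>' (N n)))" by metis
  \<comment> \<open>Inverses are taken because the horoball condition concerns
    \<open>inv (gs n)\<close>, and it is \<open>k n\<close> that almost maximizes the Busemann
    function of \<open>\<alpha>'\<close>.\<close>
  define gs where "gs = (\<lambda>n. inv (k n))"
  have gs: "gs n \<in> G" "inv (gs n) = k n" for n using k(1) by (simp_all add: gs_def G_inv G_inv_simps)
  \<comment> \<open>From the image of \<open>\<beta>' (N n)\<close> to that of the origin the
    Busemann function drops by at most their distance \<open>N n\<close>. The upper bound holds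
    because the quotient function vanishes at the origin.\<close>
  have b0: "- (1 / N n) < busemann0 dist \<alpha>' (k n (\<alpha>' 0))" "busemann0 dist \<alpha>' (k n (\<alpha>' 0)) \<le> 0" for n
  proof -
    have "dist (k n (\<alpha>' 0)) (k n (\<beta>' (N n))) = N n"
      using G_dist[OF k(1)] dist.rayD(2)[OF \<beta>.ray, of "N n" 0] N[of n] o by simp
    then show "- (1 / N n) < busemann0 dist \<alpha>' (k n (\<alpha>' 0))"
      using dist.busemann0_lipschitz[OF ray, of "k n (\<alpha>' 0)" "k n (\<beta>' (N n))"] k(2)[of n] by simp
    show "busemann0 dist \<alpha>' (k n (\<alpha>' 0)) \<le> 0" using busemann_quotient_ge[OF k(1)[of n], of "\<alpha>' 0"] busemann_origin by simp
  qed
  have invN: "(\<lambda>n. 1 / N n) \<longlonglongrightarrow> 0" unfolding N_def using LIMSEQ_inverse_real_of_nat by (simp add: inverse_eq_divide add.commute)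
  have hor: "(\<lambda>n. infdist (inv (gs n) (\<alpha>' 0)) (horoball (point_at_infinity \<alpha>') (\<alpha>' 0))) \<longlonglongrightarrow> 0"
  proof (rule tendsto_sandwich[OF _ _ tendsto_const invN])
    show "\<forall>\<^sub>F n in sequentially. infdist (inv (gs n) (\<alpha>' 0)) (horoball (point_at_infinity \<alpha>') (\<alpha>' 0)) \<le> 1 / N n"
    proof (intro always_eventually allI)
      fix n
      have "0 < 1 / N n" using N[of n] by simp
      then show "infdist (inv (gs n) (\<alpha>' 0)) (horoball (point_at_infinity \<alpha>') (\<alpha>' 0)) \<le> 1 / N n"
        unfolding gs(2) using b0(1) by (rule infdist_horoball_le)
    qed
  qed (simp add: infdist_nonneg)
  have "\<exists>\<zeta>. ray \<zeta> \<and> \<zeta> 0 = k n (\<alpha>' 0) \<and> asymptotic \<alpha>' \<zeta>" for n using ray_from[OF ray, of "k n (\<alpha>' 0)"] by metis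
  then obtain \<zeta> where \<zeta>: "\<And>n. ray (\<zeta> n)" "\<And>n. \<zeta> n 0 = k n (\<alpha>' 0)" "\<And>n. asymptotic \<alpha>' (\<zeta> n)" by metis
  define \<eta> where "\<eta> = (\<lambda>n. gs n \<circ> \<zeta> n)"
  have \<eta>: "ray (\<eta> n)" "\<eta> n 0 = \<alpha>' 0" "\<eta> n \<in> boundary_action (gs n) (point_at_infinity \<alpha>')" for n
    using \<zeta> isometry_ray[OF G_isometry[OF gs(1)]] G_inv_simps(1)[OF k(1)]
    by (auto simp: \<eta>_def boundary_action_def point_at_infinity_def) (simp add: gs_def)
  \<comment> \<open>Being almost maximal at \<open>\<beta>' (N n)\<close>, the Busemann function of \<open>\<eta> n\<close> forces \<open>\<eta> n\<close> to stay close to \<open>\<beta>'\<close>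
    up to the parameter \<open>N n\<close>.\<close>
  have far: "dist (\<beta>' (N n)) (\<eta> n (N n)) \<le> 3" for n
  proof -
    let ?N = "N n" and ?x = "\<beta>' (N n)"
    have gx: "gs n (k n ?x) = ?x" using G_inv_simps(1)[OF k(1)] by (simp add: gs_def)
    have "busemann0 dist (\<eta> n) ?x = busemann0 dist (\<zeta> n) (k n ?x)"
      using isometry_busemann[OF G_isometry[OF gs(1)], of n "\<zeta> n" "k n ?x"] by (simp add: \<eta>_def gx)
    also have "\<dots> = busemann0 dist \<alpha>' (k n ?x) - busemann0 dist \<alpha>' (k n (\<alpha>' 0))"
      using asymptotic_busemann[OF ray \<zeta>(1)[of n] \<zeta>(3)[of n], of "k n ?x" "k n (\<alpha>' 0)"] dist.busemann0_on_ray[OF \<zeta>(1)[of n], of 0] by (simp add: \<zeta>(2))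
    finally have "?N - 1 / ?N < busemann0 dist (\<eta> n) ?x" using k(2)[of n] b0(2)[of n] by simp
    then obtain t0 where t0: "0 \<le> t0" "?N - 1 / ?N < t0 - dist (\<eta> n t0) ?x" by (rule dist.busemann0_gtE)
    \<comment> \<open>By monotonicity any later time may be used; beyond \<open>N n\<close> the
      point \<open>\<eta> n (N n)\<close> lies on the segment from the origin to
      \<open>\<eta> n t\<close>.\<close>
    define t where "t = max t0 (?N + 1)"
    have t: "?N < t" "t0 \<le> t" by (simp_all add: t_def)
    have "t0 - dist (\<eta> n t0) ?x \<le> t - dist (\<eta> n t) ?x" by (rule dist.busemann0_mono[OF \<eta>(1) UNIV_I t0(1) t(2)])
    then have dt: "dist ?x (\<eta> n t) \<le> t - ?N + 1 / ?N" using t0(2) by (simp add: dist_commute)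
    let ?s = "?N / t"
    have s: "0 \<le> ?s" "?s \<le> 1" using N[of n] t by auto
    have "\<eta> n ?N = geodesic (\<alpha>' 0) (\<eta> n t) ?s"
      using ray_geodesic[OF \<eta>(1)[of n], of ?N t] \<eta>(2)[of n] N[of n] t by simp
    then have "(dist ?x (\<eta> n ?N))\<^sup>2 \<le> (1 - ?s) * (dist ?x (\<alpha>' 0))\<^sup>2 + ?s * (dist ?x (\<eta> n t))\<^sup>2 - ?s * (1 - ?s) * (dist (\<alpha>' 0) (\<eta> n t))\<^sup>2"
      using bruhat_tits[OF s, of ?x "\<alpha>' 0" "\<eta> n t"] by simp
    also have "dist ?x (\<alpha>' 0) = ?N" using dist.rayD(2)[OF \<beta>.ray, of 0 ?N] N[of n] o by simp
    also have "dist (\<alpha>' 0) (\<eta> n t) = t" using dist.rayD(2)[OF \<eta>(1)[of n], of 0 t] \<eta>(2)[of n] N[of n] t by (simp add: dist_commute)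
    also have "(1 - ?s) * ?N\<^sup>2 + ?s * (dist ?x (\<eta> n t))\<^sup>2 - ?s * (1 - ?s) * t\<^sup>2
        \<le> (1 - ?s) * ?N\<^sup>2 + ?s * (t - ?N + 1 / ?N)\<^sup>2 - ?s * (1 - ?s) * t\<^sup>2"
      using s dt by (intro diff_right_mono add_left_mono mult_left_mono power_mono) auto
    \<comment> \<open>The leading terms cancel by Stewart's identity for the degenerate triangle
      with sides \<open>?N\<close>, \<open>t - ?N\<close> and \<open>t\<close>; what remains comes
      from the error \<open>1 / ?N\<close>.\<close>
    also have "\<dots> = 2 * (t - ?N) / t + 1 / (?N * t)"
      using N[of n] t by (simp add: field_simps power2_eq_square)
    also have "\<dots> \<le> 2 + 1"
    proof (rule add_mono)
      show "2 * (t - ?N) / t \<le> 2" using N[of n] t by (simp add: field_simps)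
      have "1 * 1 \<le> ?N * t" by (rule mult_mono) (use N[of n] t in auto)
      then show "1 / (?N * t) \<le> 1" by (simp add: divide_le_eq)
    qed
    finally have "(dist ?x (\<eta> n ?N))\<^sup>2 \<le> 3\<^sup>2" by simp
    then show ?thesis by (rule power2_le_imp_le) simp
  qed
  have conv: "(\<lambda>n. \<eta> n r) \<longlonglongrightarrow> \<beta>' r" if r: "0 < r" for r
  proof (rule tendsto_dist_iff[THEN iffD2], rule tendsto_sandwich[OF _ _ tendsto_const])
    show "(\<lambda>n. 3 * r * (1 / N n)) \<longlonglongrightarrow> 0" using tendsto_mult_left[OF invN, of "3 * r"] by simp
    obtain M :: nat where M: "r \<le> real M" using real_arch_simple by blast
    have "dist (\<eta> n r) (\<beta>' r) \<le> 3 * r * (1 / N n)" if "M \<le> n" for n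
    proof -
      have rn: "r \<le> N n" using M that by (simp add: N_def)
      have "dist (\<beta>' r) (\<eta> n r) \<le> r / N n * dist (\<beta>' (N n)) (\<eta> n (N n))"
        by (rule rays_convex[OF \<beta>.ray \<eta>(1)]) (use \<eta>(2) o r rn N[of n] in auto)
      also have "\<dots> \<le> r / N n * 3" by (rule mult_left_mono[OF far]) (use r N[of n] in simp)
      finally show ?thesis by (simp add: dist_commute mult.commute)
    qed
    then show "\<forall>\<^sub>F n in sequentially. dist (\<eta> n r) (\<beta>' r) \<le> 3 * r * (1 / N n)" by (rule eventually_sequentiallyI)
  qed simp
  have "limitin (cone_topology (\<alpha>' 0)) (\<lambda>n. boundary_action (gs n) (point_at_infinity \<alpha>')) (point_at_infinity \<beta>') sequentially"
    unfolding cone_topology_def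
  proof (rule limitin_topology_generated_by)
    let ?\<S> = "{{\<xi> \<in> visual_boundary. \<exists>\<beta>\<in>\<xi>. \<beta> 0 = \<alpha>' 0 \<and> dist (\<beta> r) (\<alpha> r) < \<epsilon>} |\<alpha> r \<epsilon>. ray \<alpha> \<and> \<alpha> 0 = \<alpha>' 0 \<and> r > 0 \<and> \<epsilon> > 0}"
    have "\<beta>' \<in> point_at_infinity \<beta>'" "point_at_infinity \<beta>' \<in> visual_boundary"
      using \<beta>.ray by (auto simp: visual_boundary_def point_at_infinity_def asymptotic_def)
    then have "point_at_infinity \<beta>' \<in> {\<xi> \<in> visual_boundary. \<exists>\<beta>\<in>\<xi>. \<beta> 0 = \<alpha>' 0 \<and> dist (\<beta> 1) (\<beta>' 1) < 1}"
      using o by (auto intro!: bexI[of _ \<beta>'])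
    moreover have "{\<xi> \<in> visual_boundary. \<exists>\<beta>\<in>\<xi>. \<beta> 0 = \<alpha>' 0 \<and> dist (\<beta> 1) (\<beta>' 1) < 1} \<in> ?\<S>"
      using \<beta>.ray o by (intro CollectI exI[of _ \<beta>'] exI[of _ 1]) simp
    ultimately show "point_at_infinity \<beta>' \<in> \<Union> ?\<S>" by (rule UnionI[rotated])
    fix U assume "U \<in> ?\<S>" and in_U: "point_at_infinity \<beta>' \<in> U"
    then obtain a r \<epsilon> where U: "U = {\<xi> \<in> visual_boundary. \<exists>\<beta>\<in>\<xi>. \<beta> 0 = \<alpha>' 0 \<and> dist (\<beta> r) (a r) < \<epsilon>}" and r: "0 < r" by blast
    obtain b where b: "ray b" "asymptotic \<beta>' b" "b 0 = \<alpha>' 0" "dist (b r) (a r) < \<epsilon>"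
      using in_U by (auto simp: U point_at_infinity_def)
    \<comment> \<open>A subbasic set may be centred at any ray \<open>a\<close>. That it contains
      the class of \<open>\<beta>'\<close> is witnessed by some ray \<open>b\<close>, which must
      agree with \<open>\<beta>'\<close>.\<close>
    have "\<beta>' r = b r" by (rule asymptotic_ray_unique[OF \<beta>.ray b(1) _ b(2)]) (use b(3) o r in auto)
    then have "dist (\<beta>' r) (a r) < \<epsilon>" using b(4) by simp
    then have ev: "\<forall>\<^sub>F n in sequentially. dist (\<eta> n r) (a r) < \<epsilon>"
      by (rule order_tendstoD(2)[OF tendsto_dist[OF conv[OF r] tendsto_const]])
    have "boundary_action (gs n) (point_at_infinity \<alpha>') \<in> visual_boundary" for n
      using boundary_action_point_at_infinity[OF G_isometry[OF gs(1)[of n]]] isometry_ray[OF G_isometry[OF gs(1)[of n]]] ray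
      by (auto simp: visual_boundary_def)
    then show "\<forall>\<^sub>F n in sequentially. boundary_action (gs n) (point_at_infinity \<alpha>') \<in> U"
      unfolding U by (intro eventually_mono[OF ev]) (use \<eta>(2,3) in blast)
  qed
  then show thesis by (rule that[OF gs(1) _ hor])
qed

end

theorem mainTheorem3:
  fixes A :: "('a::metric_space, 'e::euclidean_space) chart set"
    and g :: "('a, 'e) chart \<Rightarrow> 'e \<Rightarrow> 'e \<Rightarrow> 'e \<Rightarrow> real"
    and G :: "('a \<Rightarrow> 'a) set"
    and \<alpha> \<beta> :: "real \<Rightarrow> 'a set"
    and \<alpha>' \<beta>' :: "real \<Rightarrow> 'a"
    and o' :: 'a
  assumes "hadamard_space A g"
    and "regular_group G"
    and "is_ray (quotient_space G) quotient_dist \<alpha>"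
    and "is_ray (quotient_space G) quotient_dist \<beta>"
    and "\<alpha> 0 = \<beta> 0"
    and "is_lift G \<alpha>' \<alpha>" and "\<alpha>' 0 = o'"
    and "is_lift G \<beta>' \<beta>" and "\<beta>' 0 = o'"
  shows "(\<forall>x\<in>quotient_space G. \<forall>y\<in>quotient_space G.
            busemann quotient_dist \<alpha> x y = busemann quotient_dist \<beta> x y) \<longleftrightarrow>
         (\<exists>gs hs :: nat \<Rightarrow> 'a \<Rightarrow> 'a. (\<forall>n. gs n \<in> G) \<and> (\<forall>n. hs n \<in> G) \<and>
            limitin (cone_topology o') (\<lambda>n. boundary_action (gs n) (point_at_infinity \<alpha>'))
              (point_at_infinity \<beta>') sequentially \<and>
            (\<lambda>n. infdist (inv (gs n) o') (horoball (point_at_infinity \<alpha>') o'))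
              \<longlonglongrightarrow> 0 \<and>
            limitin (cone_topology o') (\<lambda>n. boundary_action (hs n) (point_at_infinity \<beta>'))
              (point_at_infinity \<alpha>') sequentially \<and>
            (\<lambda>n. infdist (inv (hs n) o') (horoball (point_at_infinity \<beta>') o'))
              \<longlonglongrightarrow> 0)"
proof -
  interpret H: hadamard_space A g by fact
  obtain geodesic where "\<And>x y :: 'a. cat0_geodesic (geodesic x y) x y" using H.hadamard_cat0 by metis
  then have cat0: "proper_cat0 geodesic" using H.hadamard_proper by unfold_locales auto
  have a: "lifted_ray geodesic G \<alpha> \<alpha>'" and b: "lifted_ray geodesic G \<beta> \<beta>'"
    using cat0 assms by (simp_all add: lifted_ray_def lifted_ray_axioms_def regular_quotient_def regular_quotient_axioms_def)
  interpret a: lifted_ray geodesic G \<alpha> \<alpha>' by (rule a)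
  interpret b: lifted_ray geodesic G \<beta> \<beta>' by (rule b)
  let ?B = "\<lambda>\<gamma> y. busemann0 quotient_dist \<gamma> (orbit G y)"
  have o: "\<beta>' 0 = \<alpha>' 0" "\<alpha>' 0 = \<beta>' 0" using assms by simp_all
  \<comment> \<open>A Busemann function of two variables is the increment of the normalized one;
    since both rays start at the same point of the quotient, equality of the increments is equality
    of the normalized functions.\<close>
  have eq: "(\<forall>x\<in>quotient_space G. \<forall>y\<in>quotient_space G. busemann quotient_dist \<alpha> x y = busemann quotient_dist \<beta> x y)
      \<longleftrightarrow> (\<forall>y. ?B \<alpha> y = ?B \<beta> y)" (is "?l \<longleftrightarrow> ?r")
  proof
    assume ?r
    then show ?l
      by (auto simp: quotient_space_def a.quotient.busemann_eq[OF a.is_ray] a.quotient.busemann_eq[OF b.is_ray])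
  next
    assume l: ?l
    show ?r
    proof
      fix y
      have q: "orbit G x \<in> quotient_space G" for x by (simp add: quotient_space_def)
      have "busemann quotient_dist \<alpha> (orbit G (\<alpha>' 0)) (orbit G y) = busemann quotient_dist \<beta> (orbit G (\<alpha>' 0)) (orbit G y)"
        using l q by blast
      then show "?B \<alpha> y = ?B \<beta> y"
        using a.busemann_origin(2) b.busemann_origin(2) unfolding o(1)
        by (simp add: a.quotient.busemann_eq[OF a.is_ray q q] a.quotient.busemann_eq[OF b.is_ray q q])
    qed
  qed
  show ?thesis
    unfolding eq
  proof
    assume r: "\<forall>y. ?B \<alpha> y = ?B \<beta> y"
    obtain gs where gs: "\<And>n. gs n \<in> G"
      "limitin (cone_topology (\<alpha>' 0)) (\<lambda>n. boundary_action (gs n) (point_at_infinity \<alpha>')) (point_at_infinity \<beta>') sequentially"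
      "(\<lambda>n. infdist (inv (gs n) (\<alpha>' 0)) (horoball (point_at_infinity \<alpha>') (\<alpha>' 0))) \<longlonglongrightarrow> 0"
      by (rule a.limit_of_busemann_le[OF b o(1)]) (use r in auto)
    obtain hs where hs: "\<And>n. hs n \<in> G"
      "limitin (cone_topology (\<beta>' 0)) (\<lambda>n. boundary_action (hs n) (point_at_infinity \<beta>')) (point_at_infinity \<alpha>') sequentially"
      "(\<lambda>n. infdist (inv (hs n) (\<beta>' 0)) (horoball (point_at_infinity \<beta>') (\<beta>' 0))) \<longlonglongrightarrow> 0"
      by (rule b.limit_of_busemann_le[OF a o(2)]) (use r in auto)
    show "\<exists>gs hs :: nat \<Rightarrow> 'a \<Rightarrow> 'a. (\<forall>n. gs n \<in> G) \<and> (\<forall>n. hs n \<in> G) \<and>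
            limitin (cone_topology o') (\<lambda>n. boundary_action (gs n) (point_at_infinity \<alpha>'))
              (point_at_infinity \<beta>') sequentially \<and>
            (\<lambda>n. infdist (inv (gs n) o') (horoball (point_at_infinity \<alpha>') o'))
              \<longlonglongrightarrow> 0 \<and>
            limitin (cone_topology o') (\<lambda>n. boundary_action (hs n) (point_at_infinity \<beta>'))
              (point_at_infinity \<alpha>') sequentially \<and>
            (\<lambda>n. infdist (inv (hs n) o') (horoball (point_at_infinity \<beta>') o'))
              \<longlonglongrightarrow> 0"
      by (intro exI[of _ gs] exI[of _ hs] conjI allI gs(1) hs(1)) (use gs(2,3) hs(2,3) assms(7,9) in simp_all)
  next
    assume "\<exists>gs hs :: nat \<Rightarrow> 'a \<Rightarrow> 'a. (\<forall>n. gs n \<in> G) \<and> (\<forall>n. hs n \<in> G) \<and>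
            limitin (cone_topology o') (\<lambda>n. boundary_action (gs n) (point_at_infinity \<alpha>'))
              (point_at_infinity \<beta>') sequentially \<and>
            (\<lambda>n. infdist (inv (gs n) o') (horoball (point_at_infinity \<alpha>') o'))
              \<longlonglongrightarrow> 0 \<and>
            limitin (cone_topology o') (\<lambda>n. boundary_action (hs n) (point_at_infinity \<beta>'))
              (point_at_infinity \<alpha>') sequentially \<and>
            (\<lambda>n. infdist (inv (hs n) o') (horoball (point_at_infinity \<beta>') o'))
              \<longlonglongrightarrow> 0"
    then obtain gs hs where gs: "\<forall>n. gs n \<in> G"
      "limitin (cone_topology (\<alpha>' 0)) (\<lambda>n. boundary_action (gs n) (point_at_infinity \<alpha>')) (point_at_infinity \<beta>') sequentially"
      "(\<lambda>n. infdist (inv (gs n) (\<alpha>' 0)) (horoball (point_at_infinity \<alpha>') (\<alpha>' 0))) \<longlonglongrightarrow> 0"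
      and hs: "\<forall>n. hs n \<in> G"
      "limitin (cone_topology (\<beta>' 0)) (\<lambda>n. boundary_action (hs n) (point_at_infinity \<beta>')) (point_at_infinity \<alpha>') sequentially"
      "(\<lambda>n. infdist (inv (hs n) (\<beta>' 0)) (horoball (point_at_infinity \<beta>') (\<beta>' 0))) \<longlonglongrightarrow> 0"
      unfolding assms(7,9) by (elim exE conjE)
    show "\<forall>y. ?B \<alpha> y = ?B \<beta> y"
      using a.busemann_le_of_limit[OF b o(1) gs[rule_format]] b.busemann_le_of_limit[OF a o(2) hs[rule_format]] by (intro allI antisym)
  qed
qed

end
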